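(* Let $\Lambda$ be a row-finite $k$-graph with no sources. Then the assignment $(T,\gamma)\mapsto I_{T,\gamma}$ is a bijection from $\bigcup_{T\in\operatorname{MT}(\Lambda)}\big(\{T\}\times\widehat{\operatorname{Per}(\Lambda T)}\big)$ to the set of primitive ideals of $C^*(\Lambda)$.
   Context: Conventions: $\mathbb{N}$ contains $0$; "homomorphism" between $C^*$-algebras means $*$-homomorphism; "ideal" means closed two-sided ideal; a primitive ideal is the kernel of a (nonzero) irreducible representation. A $k$-graph is a countable small category $\Lambda$ (identified with its set of morphisms) with a functor $d:\Lambda\to\mathbb{N}^k$ satisfying the factorisation property: if $d(\lambda)=p+q$ then there are unique $\mu,\nu\in\Lambda$ with $d(\mu)=p$, $d(\nu)=q$, $\lambda=\mu\nu$. Write $\Lambda^n=d^{-1}(n)$; $r(\lambda)$, $s(\lambda)$ are the codomain and domain of $\lambda$. $\Lambda^0$ is the set of identity morphisms, identified with the objects (vertices). For $v,w\in\Lambda^0$, $v\Lambda w=\{\lambda: r(\lambda)=v,s(\lambda)=w\}$, $v\Lambda^n=\{\lambda\in\Lambda^n:r(\lambda)=v\}$, and similarly $\Lambda w$, $v\Lambda$. $\Lambda$ is row-finite with no sources if $0<|v\Lambda^n|<\infty$ for all $v\in\Lambda^0$, $n\in\mathbb{N}^k$. $C^*(\Lambda)$ is the universal $C^*$-algebra generated by elements $\{s_\lambda:\lambda\in\Lambda\}$ such that: the $s_v$, $v\in\Lambda^0$, are mutually orthogonal projections; $s_\mu s_\nu=s_{\mu\nu}$ if $s(\mu)=r(\nu)$;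 $s_\lambda^*s_\lambda=s_{s(\lambda)}$; and $s_v=\sum_{\lambda\in v\Lambda^n}s_\lambda s_\lambda^*$ for all $v\in\Lambda^0,n\in\mathbb{N}^k$. Infinite paths: $\Omega_k=\{(m,n)\in\mathbb{N}^k\times\mathbb{N}^k:m\le n\}$ is a $k$-graph with $r(m,n)=m$, $s(m,n)=n$, $(m,n)(n,p)=(m,p)$, $d(m,n)=n-m$. $\Lambda^\infty$ is the set of degree-preserving functors $x:\Omega_k\to\Lambda$; $x(n):=x(n,n)$, $\sigma^p(x)(m,n)=x(m+p,n+p)$, and for $\lambda\in\Lambda$ with $s(\lambda)=x(0)$, $\lambda x$ is the unique infinite path with $(\lambda x)(0,d(\lambda))=\lambda$ and $\sigma^{d(\lambda)}(\lambda x)=x$. Write $v\Lambda^\infty=\{x:x(0)=v\}$. Maximal tails: a nonempty $T\subseteq\Lambda^0$ is a maximal tail if (a) for all $v_1,v_2\in T$ there is $w\in T$ with $v_1\Lambda w\neq\emptyset\neq v_2\Lambda w$; (b) for all $v\in T$ and $1\le i\le k$ there is $\lambda\in v\Lambda^{e_i}$ with $s(\lambda)\in T$; (c) if $w\in T$, $v\in\Lambda^0$ and $v\Lambda w\ne\emptyset$ then $v\in T$. $\operatorname{MT}(\Lambda)$ is the set of maximal tails. For a maximal tail $T$, $\Lambda T=\{\lambda\in\Lambda:s(\lambda)\in T\}$ is a row-finite $k$-graph with no sources, with vertex set $T$, which is a maximal tail of $\Lambda T$. Periodicity: for a row-finite $k$-graph $\Sigma$ with no sources such that $\Sigma^0$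 is a maximal tail, put $\mu\sim\nu$ iff $s(\mu)=s(\nu)$ and $\mu x=\nu x$ for all $x\in s(\mu)\Sigma^\infty$, and $\operatorname{Per}(\Sigma)=\{d(\mu)-d(\nu):\mu,\nu\in\Sigma,\mu\sim\nu\}$, which is a subgroup of $\mathbb{Z}^k$. $\widehat{\operatorname{Per}(\Lambda T)}$ is the group of characters $\operatorname{Per}(\Lambda T)\to\mathbb{T}$. The ideals $I_{T,\gamma}$: an infinite path $x\in(\Lambda T)^\infty$ is cofinal in $T$ if for each $v\in T$ there is $n\in\mathbb{N}^k$ with $v\Lambda x(n)\ne\emptyset$. For $x\in\Lambda^\infty$ let $[x]=\{\lambda\sigma^m(x):m\in\mathbb{N}^k,\lambda\in\Lambda x(m)\}$. For $z\in\mathbb{T}^k$, let $\pi_{[x],z}:C^*(\Lambda)\to\mathcal{B}(\ell^2([x]))$ be the representation with $\pi_{[x],z}(s_\lambda)\xi_y=z^{d(\lambda)}\xi_{\lambda y}$ if $y(0)=s(\lambda)$ and $0$ otherwise, where $\{\xi_y:y\in[x]\}$ is the canonical orthonormal basis and $z^n=\prod_i z_i^{n_i}$. Given a maximal tail $T$ and a character $\gamma$ of $\operatorname{Per}(\Lambda T)$, define $I_{T,\gamma}:=\ker\pi_{[x],z}$ for any $x\in(\Lambda T)^\infty$ cofinal in $T$ and any $z\in\mathbb{T}^k$ with $z^g=\gamma(g)$ for all $g\in\operatorname{Per}(\Lambda T)$; such $x$ and $z$ exist, and this kernel does not depend on the choices of $x$ and $z$. *)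

theory Defs
  imports "HOL-Analysis.Analysis" "HOL-Library.Poly_Mapping" "HOL-Algebra.Module"
begin

section \<open>\<open>C\<^sup>*\<close>-algebras\<close>

definition complex_ring :: "complex ring" where
  "complex_ring = \<lparr>carrier = UNIV, mult = (*), one = 1, zero = 0, add = (+)\<rparr>"

text \<open>Algebras need not be unital: the record field \<^term>\<open>one\<close>, inherited from HOL-Algebra,
  is never constrained.\<close>

record 'a star_algebra = "(complex, 'a) module" +
  star :: "'a \<Rightarrow> 'a"

record 'a cstar_algebra = "'a star_algebra" +
  cnorm :: "'a \<Rightarrow> real"

locale star_algebra = Module.module complex_ring A
  for A :: "('a, 'm) star_algebra_scheme" (structure) +
  assumes mult_closed [simp, intro]:
      "\<lbrakk>x \<in> carrier A; y \<in> carrier A\<rbrakk> \<Longrightarrow> x \<otimes> y \<in> carrier A"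
    and mult_assoc:
      "\<lbrakk>x \<in> carrier A; y \<in> carrier A; z \<in> carrier A\<rbrakk> \<Longrightarrow> (x \<otimes> y) \<otimes> z = x \<otimes> (y \<otimes> z)"
    and mult_l_distr:
      "\<lbrakk>x \<in> carrier A; y \<in> carrier A; z \<in> carrier A\<rbrakk> \<Longrightarrow> (x \<oplus> y) \<otimes> z = x \<otimes> z \<oplus> y \<otimes> z"
    and mult_r_distr:
      "\<lbrakk>x \<in> carrier A; y \<in> carrier A; z \<in> carrier A\<rbrakk> \<Longrightarrow> z \<otimes> (x \<oplus> y) = z \<otimes> x \<oplus> z \<otimes> y"
    and smult_mult_left:
      "\<lbrakk>x \<in> carrier A; y \<in> carrier A\<rbrakk> \<Longrightarrow> (c \<odot> x) \<otimes> y = c \<odot> (x \<otimes> y)"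
    and smult_mult_right:
      "\<lbrakk>x \<in> carrier A; y \<in> carrier A\<rbrakk> \<Longrightarrow> x \<otimes> (c \<odot> y) = c \<odot> (x \<otimes> y)"
    and star_closed [simp, intro]: "x \<in> carrier A \<Longrightarrow> star A x \<in> carrier A"
    and star_star [simp]: "x \<in> carrier A \<Longrightarrow> star A (star A x) = x"
    and star_add:
      "\<lbrakk>x \<in> carrier A; y \<in> carrier A\<rbrakk> \<Longrightarrow> star A (x \<oplus> y) = star A x \<oplus> star A y"
    and star_smult: "x \<in> carrier A \<Longrightarrow> star A (c \<odot> x) = cnj c \<odot> star A x"
    and star_mult:
      "\<lbrakk>x \<in> carrier A; y \<in> carrier A\<rbrakk> \<Longrightarrow> star A (x \<otimes> y) = star A y \<otimes> star A x"

definition cstar_seminorm :: "('a, 'm) star_algebra_scheme \<Rightarrow> ('a \<Rightarrow> real) \<Rightarrow> bool" where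
  "cstar_seminorm A p \<longleftrightarrow>
     (\<forall>x\<in>carrier A. 0 \<le> p x) \<and>
     (\<forall>x\<in>carrier A. \<forall>y\<in>carrier A. p (x \<oplus>\<^bsub>A\<^esub> y) \<le> p x + p y) \<and>
     (\<forall>c. \<forall>x\<in>carrier A. p (c \<odot>\<^bsub>A\<^esub> x) = cmod c * p x) \<and>
     (\<forall>x\<in>carrier A. \<forall>y\<in>carrier A. p (x \<otimes>\<^bsub>A\<^esub> y) \<le> p x * p y) \<and>
     (\<forall>x\<in>carrier A. p (star A x \<otimes>\<^bsub>A\<^esub> x) = (p x)\<^sup>2)"

definition norm_Cauchy :: "('a, 'm) ring_scheme \<Rightarrow> ('a \<Rightarrow> real) \<Rightarrow> (nat \<Rightarrow> 'a) \<Rightarrow> bool" where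
  "norm_Cauchy V N X \<longleftrightarrow> (\<forall>e>0. \<exists>M. \<forall>m\<ge>M. \<forall>n\<ge>M. N (X m \<ominus>\<^bsub>V\<^esub> X n) < e)"

definition norm_tendsto :: "('a, 'm) ring_scheme \<Rightarrow> ('a \<Rightarrow> real) \<Rightarrow> (nat \<Rightarrow> 'a) \<Rightarrow> 'a \<Rightarrow> bool" where
  "norm_tendsto V N X l \<longleftrightarrow> (\<lambda>n. N (X n \<ominus>\<^bsub>V\<^esub> l)) \<longlonglongrightarrow> 0"

definition norm_complete :: "('a, 'm) ring_scheme \<Rightarrow> ('a \<Rightarrow> real) \<Rightarrow> bool" where
  "norm_complete V N \<longleftrightarrow>
     (\<forall>X. (\<forall>n. X n \<in> carrier V) \<and> norm_Cauchy V N X \<longrightarrow> (\<exists>l\<in>carrier V. norm_tendsto V N X l))"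

definition norm_closed :: "('a, 'm) ring_scheme \<Rightarrow> ('a \<Rightarrow> real) \<Rightarrow> 'a set \<Rightarrow> bool" where
  "norm_closed V N W \<longleftrightarrow>
     W \<subseteq> carrier V \<and>
     (\<forall>X l. (\<forall>n. X n \<in> W) \<and> l \<in> carrier V \<and> norm_tendsto V N X l \<longrightarrow> l \<in> W)"

locale cstar_algebra = star_algebra A for A :: "('a, 'm) cstar_algebra_scheme" (structure) +
  assumes cstar_norm: "cstar_seminorm A (cnorm A)"
    and cnorm_eq_0: "\<lbrakk>x \<in> carrier A; cnorm A x = 0\<rbrakk> \<Longrightarrow> x = \<zero>"
    and complete: "norm_complete A (cnorm A)"

definition star_hom ::
  "('a, 'm) star_algebra_scheme \<Rightarrow> ('b, 'n) star_algebra_scheme \<Rightarrow> ('a \<Rightarrow> 'b) \<Rightarrow> bool" where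
  "star_hom A B \<phi> \<longleftrightarrow>
     \<phi> \<in> carrier A \<rightarrow> carrier B \<and>
     (\<forall>x\<in>carrier A. \<forall>y\<in>carrier A. \<phi> (x \<oplus>\<^bsub>A\<^esub> y) = \<phi> x \<oplus>\<^bsub>B\<^esub> \<phi> y) \<and>
     (\<forall>c. \<forall>x\<in>carrier A. \<phi> (c \<odot>\<^bsub>A\<^esub> x) = c \<odot>\<^bsub>B\<^esub> \<phi> x) \<and>
     (\<forall>x\<in>carrier A. \<forall>y\<in>carrier A. \<phi> (x \<otimes>\<^bsub>A\<^esub> y) = \<phi> x \<otimes>\<^bsub>B\<^esub> \<phi> y) \<and>
     (\<forall>x\<in>carrier A. \<phi> (star A x) = star B (\<phi> x))"

subsection \<open>Hausdorff completion with respect to a \<open>C\<^sup>*\<close>-seminorm\<close>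

definition Cauchy_seqs :: "('a, 'm) star_algebra_scheme \<Rightarrow> ('a \<Rightarrow> real) \<Rightarrow> (nat \<Rightarrow> 'a) set" where
  "Cauchy_seqs A p = {X. (\<forall>n. X n \<in> carrier A) \<and> norm_Cauchy A p X}"

definition Cauchy_class ::
  "('a, 'm) star_algebra_scheme \<Rightarrow> ('a \<Rightarrow> real) \<Rightarrow> (nat \<Rightarrow> 'a) \<Rightarrow> (nat \<Rightarrow> 'a) set" where
  "Cauchy_class A p X = {Y \<in> Cauchy_seqs A p. (\<lambda>n. p (X n \<ominus>\<^bsub>A\<^esub> Y n)) \<longlonglongrightarrow> 0}"

definition class_rep :: "(nat \<Rightarrow> 'a) set \<Rightarrow> nat \<Rightarrow> 'a" where
  "class_rep U = (SOME X. X \<in> U)"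

definition cstar_completion ::
  "('a, 'm) star_algebra_scheme \<Rightarrow> ('a \<Rightarrow> real) \<Rightarrow> (nat \<Rightarrow> 'a) set cstar_algebra" where
  "cstar_completion A p =
     \<lparr>carrier = Cauchy_class A p ` Cauchy_seqs A p,
      mult = (\<lambda>U V. Cauchy_class A p (\<lambda>n. class_rep U n \<otimes>\<^bsub>A\<^esub> class_rep V n)),
      one = undefined,
      zero = Cauchy_class A p (\<lambda>n. \<zero>\<^bsub>A\<^esub>),
      add = (\<lambda>U V. Cauchy_class A p (\<lambda>n. class_rep U n \<oplus>\<^bsub>A\<^esub> class_rep V n)),
      smult = (\<lambda>c U. Cauchy_class A p (\<lambda>n. c \<odot>\<^bsub>A\<^esub> class_rep U n)),
      star = (\<lambda>U. Cauchy_class A p (\<lambda>n. star A (class_rep U n))),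
      cnorm = (\<lambda>U. lim (\<lambda>n. p (class_rep U n)))\<rparr>"

subsection \<open>Free \<open>*\<close>-algebras\<close>

text \<open>The letter \<open>(g, False)\<close> stands for the generator \<open>g\<close> and \<open>(g, True)\<close> for its adjoint. The
  free \<open>*\<close>-algebra on a set of generators consists of the elements of the monoid algebra of
  words that are supported on nonempty words, so it has no unit.\<close>

datatype 'g star_word = Star_Word (letters: "('g \<times> bool) list")

instantiation star_word :: (type) monoid_add
begin

definition "0 = Star_Word []"

definition "u + v = Star_Word (letters u @ letters v)"

instance
  by standard (simp_all add: zero_star_word_def plus_star_word_def)

end

definition word_star :: "'g star_word \<Rightarrow> 'g star_word" where
  "word_star u = Star_Word (rev (map (\<lambda>(g, b). (g, \<not> b)) (letters u)))"

lemma word_star_word_star [simp]: "word_star (word_star u) = u"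
  by (cases u) (simp add: word_star_def rev_map comp_def case_prod_unfold)

lift_definition free_star :: "('g star_word \<Rightarrow>\<^sub>0 complex) \<Rightarrow> ('g star_word \<Rightarrow>\<^sub>0 complex)"
  is "\<lambda>f u. cnj (f (word_star u))"
proof -
  fix f :: "'g star_word \<Rightarrow> complex"
  assume "finite {u. f u \<noteq> 0}"
  then have "finite (word_star ` {u. f u \<noteq> 0})" by (rule finite_imageI)
  moreover have "{u. cnj (f (word_star u)) \<noteq> 0} \<subseteq> word_star ` {u. f u \<noteq> 0}"
    by (auto simp: image_iff) (metis word_star_word_star)
  ultimately show "finite {u. cnj (f (word_star u)) \<noteq> 0}" by (rule finite_subset[rotated])
qed

definition free_star_algebra :: "'g set \<Rightarrow> ('g star_word \<Rightarrow>\<^sub>0 complex) star_algebra" where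
  "free_star_algebra G =
     \<lparr>carrier = {f. \<forall>u\<in>Poly_Mapping.keys f. letters u \<noteq> [] \<and> fst ` set (letters u) \<subseteq> G},
      mult = (*), one = undefined, zero = 0, add = (+),
      smult = (\<lambda>c. Poly_Mapping.map ((*) c)),
      star = free_star\<rparr>"

definition free_gen :: "'g \<Rightarrow> ('g star_word \<Rightarrow>\<^sub>0 complex)" where
  "free_gen g = Poly_Mapping.single (Star_Word [(g, False)]) 1"


section \<open>Hilbert spaces, representations and primitive ideals\<close>

text \<open>The ring structure that \<open>module\<close> records carry is not used for Hilbert spaces.\<close>

record 'h hilbert = "(complex, 'h) module" +
  hinner :: "'h \<Rightarrow> 'h \<Rightarrow> complex"

definition hnorm :: "('h, 'm) hilbert_scheme \<Rightarrow> 'h \<Rightarrow> real" where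
  "hnorm H v = sqrt (Re (hinner H v v))"

locale hilbert_space = Module.module complex_ring H
  for H :: "('h, 'm) hilbert_scheme" (structure) +
  assumes hinner_cnj: "\<lbrakk>v \<in> carrier H; w \<in> carrier H\<rbrakk> \<Longrightarrow> hinner H w v = cnj (hinner H v w)"
    and hinner_add_left: "\<lbrakk>u \<in> carrier H; v \<in> carrier H; w \<in> carrier H\<rbrakk> \<Longrightarrow>
      hinner H (u \<oplus> v) w = hinner H u w + hinner H v w"
    and hinner_smult_left: "\<lbrakk>v \<in> carrier H; w \<in> carrier H\<rbrakk> \<Longrightarrow>
      hinner H (c \<odot> v) w = c * hinner H v w"
    and hinner_nonneg: "v \<in> carrier H \<Longrightarrow> 0 \<le> Re (hinner H v v)"
    and hinner_eq_0: "\<lbrakk>v \<in> carrier H; hinner H v v = 0\<rbrakk> \<Longrightarrow> v = \<zero>"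
    and complete: "norm_complete H (hnorm H)"

definition bounded_operator :: "('h, 'm) hilbert_scheme \<Rightarrow> ('h \<Rightarrow> 'h) \<Rightarrow> bool" where
  "bounded_operator H S \<longleftrightarrow>
     S \<in> carrier H \<rightarrow> carrier H \<and>
     (\<forall>v\<in>carrier H. \<forall>w\<in>carrier H. S (v \<oplus>\<^bsub>H\<^esub> w) = S v \<oplus>\<^bsub>H\<^esub> S w) \<and>
     (\<forall>c. \<forall>v\<in>carrier H. S (c \<odot>\<^bsub>H\<^esub> v) = c \<odot>\<^bsub>H\<^esub> S v) \<and>
     (\<exists>C. \<forall>v\<in>carrier H. hnorm H (S v) \<le> C * hnorm H v)"

definition hilbert_rep ::
  "('a, 'm) star_algebra_scheme \<Rightarrow> ('h, 'n) hilbert_scheme \<Rightarrow> ('a \<Rightarrow> 'h \<Rightarrow> 'h) \<Rightarrow> bool" where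
  "hilbert_rep A H \<pi> \<longleftrightarrow>
     (\<forall>a\<in>carrier A. bounded_operator H (\<pi> a)) \<and>
     (\<forall>a\<in>carrier A. \<forall>b\<in>carrier A. \<forall>v\<in>carrier H. \<pi> (a \<oplus>\<^bsub>A\<^esub> b) v = \<pi> a v \<oplus>\<^bsub>H\<^esub> \<pi> b v) \<and>
     (\<forall>c. \<forall>a\<in>carrier A. \<forall>v\<in>carrier H. \<pi> (c \<odot>\<^bsub>A\<^esub> a) v = c \<odot>\<^bsub>H\<^esub> \<pi> a v) \<and>
     (\<forall>a\<in>carrier A. \<forall>b\<in>carrier A. \<forall>v\<in>carrier H. \<pi> (a \<otimes>\<^bsub>A\<^esub> b) v = \<pi> a (\<pi> b v)) \<and>
     (\<forall>a\<in>carrier A. \<forall>v\<in>carrier H. \<forall>w\<in>carrier H.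
        hinner H (\<pi> a v) w = hinner H v (\<pi> (star A a) w))"

definition rep_kernel ::
  "('a, 'm) star_algebra_scheme \<Rightarrow> ('h, 'n) hilbert_scheme \<Rightarrow> ('a \<Rightarrow> 'h \<Rightarrow> 'h) \<Rightarrow> 'a set" where
  "rep_kernel A H \<pi> = {a \<in> carrier A. \<forall>v\<in>carrier H. \<pi> a v = \<zero>\<^bsub>H\<^esub>}"

definition irreducible_rep ::
  "('a, 'm) star_algebra_scheme \<Rightarrow> ('h, 'n) hilbert_scheme \<Rightarrow> ('a \<Rightarrow> 'h \<Rightarrow> 'h) \<Rightarrow> bool" where
  "irreducible_rep A H \<pi> \<longleftrightarrow>
     hilbert_rep A H \<pi> \<and>
     (\<exists>a\<in>carrier A. \<exists>v\<in>carrier H. \<pi> a v \<noteq> \<zero>\<^bsub>H\<^esub>) \<and>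
     (\<forall>W. submodule W complex_ring H \<and> norm_closed H (hnorm H) W \<and>
          (\<forall>a\<in>carrier A. \<forall>w\<in>W. \<pi> a w \<in> W) \<longrightarrow> W = {\<zero>\<^bsub>H\<^esub>} \<or> W = carrier H)"

text \<open>The definition quantifies over Hilbert spaces with carrier in the type \<open>'a \<Rightarrow> complex\<close>.
  The kernel of an irreducible representation on a Hilbert space of any other type is still
  primitive in this sense: see \<open>rep_kernel_primitive\<close> below.\<close>

definition primitive_ideals :: "('a, 'm) star_algebra_scheme \<Rightarrow> 'a set set" where
  "primitive_ideals A =
     {rep_kernel A H \<pi> | (H :: ('a \<Rightarrow> complex) hilbert) \<pi>. hilbert_space H \<and> irreducible_rep A H \<pi>}"

definition ell2 :: "'i set \<Rightarrow> ('i \<Rightarrow> complex) hilbert" where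
  "ell2 X =
     \<lparr>carrier = {f. (\<forall>i. i \<notin> X \<longrightarrow> f i = 0) \<and> (\<lambda>i. (cmod (f i))\<^sup>2) summable_on X},
      mult = undefined, one = undefined,
      zero = (\<lambda>i. 0), add = (\<lambda>f g i. f i + g i), smult = (\<lambda>c f i. c * f i),
      hinner = (\<lambda>f g. \<Sum>\<^sub>\<infinity>i\<in>X. f i * cnj (g i))\<rparr>"

definition ket :: "'i \<Rightarrow> 'i \<Rightarrow> complex" where
  "ket i = (\<lambda>j. if j = i then 1 else 0)"


section \<open>Higher-rank graphs\<close>

text \<open>A small category is given by its set of morphisms, objects being identified with their
  identity morphisms; \<open>cmp \<Lambda> \<mu> \<nu>\<close> is \<open>\<mu>\<nu>\<close>, defined when \<open>src \<Lambda> \<mu> = rng \<Lambda> \<nu>\<close>.\<close>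

record ('e, 'k) kgraph =
  mor :: "'e set"
  rng :: "'e \<Rightarrow> 'e"
  src :: "'e \<Rightarrow> 'e"
  cmp :: "'e \<Rightarrow> 'e \<Rightarrow> 'e"
  deg :: "'e \<Rightarrow> nat ^ 'k"

definition verts :: "('e, 'k::finite) kgraph \<Rightarrow> 'e set" where
  "verts \<Lambda> = {v \<in> mor \<Lambda>. src \<Lambda> v = v}"

locale kgraph =
  fixes \<Lambda> :: "('e, 'k::finite) kgraph"
  assumes countable_mor: "countable (mor \<Lambda>)"
    and rng_closed: "\<kappa> \<in> mor \<Lambda> \<Longrightarrow> rng \<Lambda> \<kappa> \<in> mor \<Lambda>"
    and src_closed: "\<kappa> \<in> mor \<Lambda> \<Longrightarrow> src \<Lambda> \<kappa> \<in> mor \<Lambda>"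
    and rng_src_rng: "\<kappa> \<in> mor \<Lambda> \<Longrightarrow> rng \<Lambda> (rng \<Lambda> \<kappa>) = rng \<Lambda> \<kappa> \<and> src \<Lambda> (rng \<Lambda> \<kappa>) = rng \<Lambda> \<kappa>"
    and rng_src_src: "\<kappa> \<in> mor \<Lambda> \<Longrightarrow> rng \<Lambda> (src \<Lambda> \<kappa>) = src \<Lambda> \<kappa> \<and> src \<Lambda> (src \<Lambda> \<kappa>) = src \<Lambda> \<kappa>"
    and cmp_closed: "\<lbrakk>\<mu> \<in> mor \<Lambda>; \<nu> \<in> mor \<Lambda>; src \<Lambda> \<mu> = rng \<Lambda> \<nu>\<rbrakk> \<Longrightarrow> cmp \<Lambda> \<mu> \<nu> \<in> mor \<Lambda>"
    and rng_cmp: "\<lbrakk>\<mu> \<in> mor \<Lambda>; \<nu> \<in> mor \<Lambda>; src \<Lambda> \<mu> = rng \<Lambda> \<nu>\<rbrakk> \<Longrightarrow> rng \<Lambda> (cmp \<Lambda> \<mu> \<nu>) = rng \<Lambda> \<mu>"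
    and src_cmp: "\<lbrakk>\<mu> \<in> mor \<Lambda>; \<nu> \<in> mor \<Lambda>; src \<Lambda> \<mu> = rng \<Lambda> \<nu>\<rbrakk> \<Longrightarrow> src \<Lambda> (cmp \<Lambda> \<mu> \<nu>) = src \<Lambda> \<nu>"
    and cmp_assoc:
      "\<lbrakk>\<kappa> \<in> mor \<Lambda>; \<mu> \<in> mor \<Lambda>; \<nu> \<in> mor \<Lambda>; src \<Lambda> \<kappa> = rng \<Lambda> \<mu>; src \<Lambda> \<mu> = rng \<Lambda> \<nu>\<rbrakk> \<Longrightarrow>
       cmp \<Lambda> (cmp \<Lambda> \<kappa> \<mu>) \<nu> = cmp \<Lambda> \<kappa> (cmp \<Lambda> \<mu> \<nu>)"
    and cmp_rng_left: "\<kappa> \<in> mor \<Lambda> \<Longrightarrow> cmp \<Lambda> (rng \<Lambda> \<kappa>) \<kappa> = \<kappa>"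
    and cmp_src_right: "\<kappa> \<in> mor \<Lambda> \<Longrightarrow> cmp \<Lambda> \<kappa> (src \<Lambda> \<kappa>) = \<kappa>"
    and deg_vert: "v \<in> verts \<Lambda> \<Longrightarrow> deg \<Lambda> v = 0"
    and deg_cmp:
      "\<lbrakk>\<mu> \<in> mor \<Lambda>; \<nu> \<in> mor \<Lambda>; src \<Lambda> \<mu> = rng \<Lambda> \<nu>\<rbrakk> \<Longrightarrow> deg \<Lambda> (cmp \<Lambda> \<mu> \<nu>) = deg \<Lambda> \<mu> + deg \<Lambda> \<nu>"
    and factorisation: "\<lbrakk>\<kappa> \<in> mor \<Lambda>; deg \<Lambda> \<kappa> = p + q\<rbrakk> \<Longrightarrow>
       \<exists>!(\<mu>, \<nu>). \<mu> \<in> mor \<Lambda> \<and> \<nu> \<in> mor \<Lambda> \<and> deg \<Lambda> \<mu> = p \<and> deg \<Lambda> \<nu> = q \<and>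
                src \<Lambda> \<mu> = rng \<Lambda> \<nu> \<and> \<kappa> = cmp \<Lambda> \<mu> \<nu>"

definition row_finite_no_sources :: "('e, 'k::finite) kgraph \<Rightarrow> bool" where
  "row_finite_no_sources \<Lambda> \<longleftrightarrow>
     (\<forall>v\<in>verts \<Lambda>. \<forall>n. finite {\<kappa> \<in> mor \<Lambda>. rng \<Lambda> \<kappa> = v \<and> deg \<Lambda> \<kappa> = n} \<and>
                      {\<kappa> \<in> mor \<Lambda>. rng \<Lambda> \<kappa> = v \<and> deg \<Lambda> \<kappa> = n} \<noteq> {})"

text \<open>\<open>connected_to \<Lambda> v w\<close> means \<open>v\<Lambda>w \<noteq> \<emptyset>\<close>.\<close>

definition connected_to :: "('e, 'k::finite) kgraph \<Rightarrow> 'e \<Rightarrow> 'e \<Rightarrow> bool" where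
  "connected_to \<Lambda> v w \<longleftrightarrow> (\<exists>\<kappa>\<in>mor \<Lambda>. rng \<Lambda> \<kappa> = v \<and> src \<Lambda> \<kappa> = w)"

subsection \<open>Infinite paths\<close>

text \<open>The functor \<open>x : \<Omega>\<^sub>k \<rightarrow> \<Lambda>\<close> is a function on the pairs \<open>(m, n)\<close> with \<open>m \<le> n\<close> (componentwise),
  extended by \<^term>\<open>undefined\<close>; \<open>x (n, n)\<close> is the vertex \<open>x(n)\<close>.\<close>

type_synonym ('e, 'k) inf_path = "(nat ^ 'k) \<times> (nat ^ 'k) \<Rightarrow> 'e"

definition inf_paths :: "('e, 'k::finite) kgraph \<Rightarrow> ('e, 'k) inf_path set" where
  "inf_paths \<Lambda> =
     {x \<in> extensional {(m, n). m \<le> n}.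
        (\<forall>m n. m \<le> n \<longrightarrow> x (m, n) \<in> mor \<Lambda> \<and> deg \<Lambda> (x (m, n)) = n - m \<and>
           rng \<Lambda> (x (m, n)) = x (m, m) \<and> src \<Lambda> (x (m, n)) = x (n, n)) \<and>
        (\<forall>m n p. m \<le> n \<and> n \<le> p \<longrightarrow> cmp \<Lambda> (x (m, n)) (x (n, p)) = x (m, p))}"

definition shift :: "nat ^ 'k::finite \<Rightarrow> ('e, 'k) inf_path \<Rightarrow> ('e, 'k) inf_path" where
  "shift p x = (\<lambda>(m, n)\<in>{(m, n). m \<le> n}. x (m + p, n + p))"

definition prepend :: "('e, 'k::finite) kgraph \<Rightarrow> 'e \<Rightarrow> ('e, 'k) inf_path \<Rightarrow> ('e, 'k) inf_path" where
  "prepend \<Lambda> \<kappa> x =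
     (THE y. y \<in> inf_paths \<Lambda> \<and> y (0, deg \<Lambda> \<kappa>) = \<kappa> \<and> shift (deg \<Lambda> \<kappa>) y = x)"

definition shift_tail_class ::
  "('e, 'k::finite) kgraph \<Rightarrow> ('e, 'k) inf_path \<Rightarrow> ('e, 'k) inf_path set" where
  "shift_tail_class \<Lambda> x =
     {prepend \<Lambda> \<kappa> (shift m x) | m \<kappa>. \<kappa> \<in> mor \<Lambda> \<and> src \<Lambda> \<kappa> = x (m, m)}"

subsection \<open>Maximal tails and periodicity\<close>

definition maximal_tails :: "('e, 'k::finite) kgraph \<Rightarrow> 'e set set" where
  "maximal_tails \<Lambda> =
     {T. T \<noteq> {} \<and> T \<subseteq> verts \<Lambda> \<and>
        (\<forall>v1\<in>T. \<forall>v2\<in>T. \<exists>w\<in>T. connected_to \<Lambda> v1 w \<and> connected_to \<Lambda> v2 w) \<and>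
        (\<forall>v\<in>T. \<forall>i. \<exists>\<kappa>\<in>mor \<Lambda>. rng \<Lambda> \<kappa> = v \<and> deg \<Lambda> \<kappa> = axis i 1 \<and> src \<Lambda> \<kappa> \<in> T) \<and>
        (\<forall>w\<in>T. \<forall>v\<in>verts \<Lambda>. connected_to \<Lambda> v w \<longrightarrow> v \<in> T)}"

text \<open>The \<open>k\<close>-graph \<open>\<Lambda>T\<close>.\<close>

definition tail_subgraph :: "('e, 'k::finite) kgraph \<Rightarrow> 'e set \<Rightarrow> ('e, 'k) kgraph" where
  "tail_subgraph \<Lambda> T = \<Lambda>\<lparr>mor := {\<kappa> \<in> mor \<Lambda>. src \<Lambda> \<kappa> \<in> T}\<rparr>"

definition path_equiv :: "('e, 'k::finite) kgraph \<Rightarrow> 'e \<Rightarrow> 'e \<Rightarrow> bool" where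
  "path_equiv \<Sigma> \<mu> \<nu> \<longleftrightarrow>
     src \<Sigma> \<mu> = src \<Sigma> \<nu> \<and>
     (\<forall>x\<in>inf_paths \<Sigma>. x (0, 0) = src \<Sigma> \<mu> \<longrightarrow> prepend \<Sigma> \<mu> x = prepend \<Sigma> \<nu> x)"

definition Per :: "('e, 'k::finite) kgraph \<Rightarrow> (int ^ 'k) set" where
  "Per \<Sigma> = {(\<chi> i. int (deg \<Sigma> \<mu> $ i) - int (deg \<Sigma> \<nu> $ i)) | \<mu> \<nu>.
              \<mu> \<in> mor \<Sigma> \<and> \<nu> \<in> mor \<Sigma> \<and> path_equiv \<Sigma> \<mu> \<nu>}"

text \<open>Characters are extended by \<^term>\<open>undefined\<close> outside the group, so that distinct functions
  are distinct characters.\<close>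

definition characters :: "('g::ab_group_add) set \<Rightarrow> ('g \<Rightarrow> complex) set" where
  "characters P =
     {\<gamma> \<in> P \<rightarrow>\<^sub>E {z. cmod z = 1}. \<forall>g\<in>P. \<forall>h\<in>P. \<gamma> (g + h) = \<gamma> g * \<gamma> h}"

definition cofinal_in :: "('e, 'k::finite) kgraph \<Rightarrow> 'e set \<Rightarrow> ('e, 'k) inf_path \<Rightarrow> bool" where
  "cofinal_in \<Lambda> T x \<longleftrightarrow> (\<forall>v\<in>T. \<exists>n. connected_to \<Lambda> v (x (n, n)))"


section \<open>The \<open>C\<^sup>*\<close>-algebra of a higher-rank graph\<close>

text \<open>The Cuntz--Krieger relations for \<open>t\<close> up to the equality notion \<open>E\<close>: equality itself for
  families in a \<open>C\<^sup>*\<close>-algebra, and equality modulo a seminorm in the construction of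
  \<open>C\<^sup>*(\<Lambda>)\<close>.\<close>

definition CK_relations :: "('e, 'k::finite) kgraph \<Rightarrow> ('a, 'm) star_algebra_scheme \<Rightarrow>
    ('a \<Rightarrow> 'a \<Rightarrow> bool) \<Rightarrow> ('e \<Rightarrow> 'a) \<Rightarrow> bool" where
  "CK_relations \<Lambda> A E t \<longleftrightarrow>
     (\<forall>v\<in>verts \<Lambda>. E (star A (t v)) (t v) \<and> E (t v \<otimes>\<^bsub>A\<^esub> t v) (t v)) \<and>
     (\<forall>v\<in>verts \<Lambda>. \<forall>w\<in>verts \<Lambda>. v \<noteq> w \<longrightarrow> E (t v \<otimes>\<^bsub>A\<^esub> t w) \<zero>\<^bsub>A\<^esub>) \<and>
     (\<forall>\<mu>\<in>mor \<Lambda>. \<forall>\<nu>\<in>mor \<Lambda>. src \<Lambda> \<mu> = rng \<Lambda> \<nu> \<longrightarrow> E (t \<mu> \<otimes>\<^bsub>A\<^esub> t \<nu>) (t (cmp \<Lambda> \<mu> \<nu>))) \<and>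
     (\<forall>\<kappa>\<in>mor \<Lambda>. E (star A (t \<kappa>) \<otimes>\<^bsub>A\<^esub> t \<kappa>) (t (src \<Lambda> \<kappa>))) \<and>
     (\<forall>v\<in>verts \<Lambda>. \<forall>n.
        E (t v) (\<Oplus>\<^bsub>A\<^esub>\<kappa>\<in>{\<kappa> \<in> mor \<Lambda>. rng \<Lambda> \<kappa> = v \<and> deg \<Lambda> \<kappa> = n}. t \<kappa> \<otimes>\<^bsub>A\<^esub> star A (t \<kappa>)))"

definition CK_family ::
  "('e, 'k::finite) kgraph \<Rightarrow> ('a, 'm) star_algebra_scheme \<Rightarrow> ('e \<Rightarrow> 'a) \<Rightarrow> bool" where
  "CK_family \<Lambda> A t \<longleftrightarrow> t \<in> mor \<Lambda> \<rightarrow> carrier A \<and> CK_relations \<Lambda> A (=) t"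

definition CK_seminorms :: "('e, 'k::finite) kgraph \<Rightarrow> (('e star_word \<Rightarrow>\<^sub>0 complex) \<Rightarrow> real) set" where
  "CK_seminorms \<Lambda> =
     (let F = free_star_algebra (mor \<Lambda>)
      in {p. cstar_seminorm F p \<and> CK_relations \<Lambda> F (\<lambda>a b. p (a \<ominus>\<^bsub>F\<^esub> b) = 0) free_gen})"

definition CK_norm :: "('e, 'k::finite) kgraph \<Rightarrow> ('e star_word \<Rightarrow>\<^sub>0 complex) \<Rightarrow> real" where
  "CK_norm \<Lambda> f = (SUP p\<in>CK_seminorms \<Lambda>. p f)"

text \<open>The universal \<open>C\<^sup>*\<close>-algebra: the completion of the free \<open>*\<close>-algebra on \<open>\<Lambda>\<close> in the largest
  \<open>C\<^sup>*\<close>-seminorm compatible with the Cuntz--Krieger relations. Its universal property, with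
  respect to \<open>C\<^sup>*\<close>-algebras of arbitrary type, is \<open>kgraph_cstar_universal\<close> below.\<close>

definition kgraph_cstar ::
  "('e, 'k::finite) kgraph \<Rightarrow> (nat \<Rightarrow> 'e star_word \<Rightarrow>\<^sub>0 complex) set cstar_algebra" where
  "kgraph_cstar \<Lambda> = cstar_completion (free_star_algebra (mor \<Lambda>)) (CK_norm \<Lambda>)"

definition kgraph_gen ::
  "('e, 'k::finite) kgraph \<Rightarrow> 'e \<Rightarrow> (nat \<Rightarrow> 'e star_word \<Rightarrow>\<^sub>0 complex) set" where
  "kgraph_gen \<Lambda> \<kappa> = Cauchy_class (free_star_algebra (mor \<Lambda>)) (CK_norm \<Lambda>) (\<lambda>n. free_gen \<kappa>)"

subsection \<open>The ideals \<open>I\<^bsub>T,\<gamma>\<^esub>\<close>\<close>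

definition is_path_rep :: "('e, 'k::finite) kgraph \<Rightarrow> ('e, 'k) inf_path set \<Rightarrow> complex ^ 'k \<Rightarrow>
    ((nat \<Rightarrow> 'e star_word \<Rightarrow>\<^sub>0 complex) set \<Rightarrow>
     (('e, 'k) inf_path \<Rightarrow> complex) \<Rightarrow> (('e, 'k) inf_path \<Rightarrow> complex)) \<Rightarrow> bool" where
  "is_path_rep \<Lambda> X z \<pi> \<longleftrightarrow>
     hilbert_rep (kgraph_cstar \<Lambda>) (ell2 X) \<pi> \<and>
     (\<forall>\<kappa>\<in>mor \<Lambda>. \<forall>y\<in>X. \<pi> (kgraph_gen \<Lambda> \<kappa>) (ket y) =
        (if y (0, 0) = src \<Lambda> \<kappa>
         then (\<Prod>i\<in>UNIV. (z $ i) ^ (deg \<Lambda> \<kappa> $ i)) \<odot>\<^bsub>ell2 X\<^esub> ket (prepend \<Lambda> \<kappa> y)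
         else \<zero>\<^bsub>ell2 X\<^esub>))"

definition tail_ideal :: "('e, 'k::finite) kgraph \<Rightarrow> 'e set \<Rightarrow> (int ^ 'k \<Rightarrow> complex) \<Rightarrow>
    (nat \<Rightarrow> 'e star_word \<Rightarrow>\<^sub>0 complex) set set" where
  "tail_ideal \<Lambda> T \<gamma> =
     (THE J. \<exists>x z \<pi>. x \<in> inf_paths (tail_subgraph \<Lambda> T) \<and> cofinal_in \<Lambda> T x \<and>
        (\<forall>i. cmod (z $ i) = 1) \<and>
        (\<forall>g\<in>Per (tail_subgraph \<Lambda> T). (\<Prod>i\<in>UNIV. (z $ i) powi (g $ i)) = \<gamma> g) \<and>
        is_path_rep \<Lambda> (shift_tail_class \<Lambda> x) z \<pi> \<and>
        J = rep_kernel (kgraph_cstar \<Lambda>) (ell2 (shift_tail_class \<Lambda> x)) \<pi>)"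


section \<open>Properties of the definitions\<close>

subsection \<open>Completions\<close>

lemma complex_ring_simps [simp]:
  "carrier complex_ring = UNIV" "mult complex_ring = (*)" "one complex_ring = 1"
  "zero complex_ring = 0" "add complex_ring = (+)"
  by (simp_all add: complex_ring_def)

lemma cring_complex_ring: "cring complex_ring"
proof (rule cringI)
  show "abelian_group complex_ring"
  proof (rule abelian_groupI)
    fix x :: complex
    show "\<exists>y\<in>carrier complex_ring. y \<oplus>\<^bsub>complex_ring\<^esub> x = \<zero>\<^bsub>complex_ring\<^esub>"
      by (rule bexI[of _ "- x"]) simp_all
  qed (simp_all add: add_ac)
  show "comm_monoid complex_ring"
    by (rule comm_monoidI) (simp_all add: mult_ac)
qed (simp_all add: algebra_simps)

lemma complex_moduleI:
  assumes "\<And>x y. \<lbrakk>x \<in> carrier M; y \<in> carrier M\<rbrakk> \<Longrightarrow> x \<oplus>\<^bsub>M\<^esub> y \<in> carrier M"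
    and "\<zero>\<^bsub>M\<^esub> \<in> carrier M"
    and "\<And>x y z. \<lbrakk>x \<in> carrier M; y \<in> carrier M; z \<in> carrier M\<rbrakk> \<Longrightarrow>
      (x \<oplus>\<^bsub>M\<^esub> y) \<oplus>\<^bsub>M\<^esub> z = x \<oplus>\<^bsub>M\<^esub> (y \<oplus>\<^bsub>M\<^esub> z)"
    and "\<And>x y. \<lbrakk>x \<in> carrier M; y \<in> carrier M\<rbrakk> \<Longrightarrow> x \<oplus>\<^bsub>M\<^esub> y = y \<oplus>\<^bsub>M\<^esub> x"
    and "\<And>x. x \<in> carrier M \<Longrightarrow> \<zero>\<^bsub>M\<^esub> \<oplus>\<^bsub>M\<^esub> x = x"
    and "\<And>x. x \<in> carrier M \<Longrightarrow> ((-1) \<odot>\<^bsub>M\<^esub> x) \<oplus>\<^bsub>M\<^esub> x = \<zero>\<^bsub>M\<^esub>"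
    and "\<And>c x. x \<in> carrier M \<Longrightarrow> c \<odot>\<^bsub>M\<^esub> x \<in> carrier M"
    and "\<And>c d x. x \<in> carrier M \<Longrightarrow> (c + d) \<odot>\<^bsub>M\<^esub> x = c \<odot>\<^bsub>M\<^esub> x \<oplus>\<^bsub>M\<^esub> d \<odot>\<^bsub>M\<^esub> x"
    and "\<And>c x y. \<lbrakk>x \<in> carrier M; y \<in> carrier M\<rbrakk> \<Longrightarrow>
      c \<odot>\<^bsub>M\<^esub> (x \<oplus>\<^bsub>M\<^esub> y) = c \<odot>\<^bsub>M\<^esub> x \<oplus>\<^bsub>M\<^esub> c \<odot>\<^bsub>M\<^esub> y"
    and "\<And>c d x. x \<in> carrier M \<Longrightarrow> (c * d) \<odot>\<^bsub>M\<^esub> x = c \<odot>\<^bsub>M\<^esub> (d \<odot>\<^bsub>M\<^esub> x)"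
    and "\<And>x. x \<in> carrier M \<Longrightarrow> 1 \<odot>\<^bsub>M\<^esub> x = x"
  shows "Module.module complex_ring M"
proof (rule moduleI)
  show "cring complex_ring" by (rule cring_complex_ring)
  show "abelian_group M"
  proof (rule abelian_groupI)
    fix x assume "x \<in> carrier M"
    then show "\<exists>y\<in>carrier M. y \<oplus>\<^bsub>M\<^esub> x = \<zero>\<^bsub>M\<^esub>"
      using assms(6,7) by (intro bexI[of _ "(-1) \<odot>\<^bsub>M\<^esub> x"])
  qed (fact assms)+
qed (simp_all add: assms)

locale complex_module = Module.module complex_ring A
  for A :: "(complex, 'a, 'm) module_scheme" (structure)
begin

lemma complex_smult_closed [simp]: "x \<in> carrier A \<Longrightarrow> c \<odot> x \<in> carrier A"
  using smult_closed[of c x] by simp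

lemma minus_conv: "x \<in> carrier A \<Longrightarrow> \<ominus> x = (-1) \<odot> x"
proof -
  assume x: "x \<in> carrier A"
  have "(-1) \<odot> x \<oplus> x = ((-1) + 1) \<odot> x"
    using x smult_l_distr[of "-1" 1 x] smult_one[of x] by simp
  also have "\<dots> = \<zero>" using x smult_l_null by simp
  finally show ?thesis using x by (simp add: M.minus_equality)
qed

lemma complex_smult_distr:
  "\<lbrakk>x \<in> carrier A; y \<in> carrier A\<rbrakk> \<Longrightarrow> c \<odot> (x \<oplus> y) = c \<odot> x \<oplus> c \<odot> y"
  "x \<in> carrier A \<Longrightarrow> (c + d) \<odot> x = c \<odot> x \<oplus> d \<odot> x"
  "x \<in> carrier A \<Longrightarrow> (c * d) \<odot> x = c \<odot> (d \<odot> x)"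
  "x \<in> carrier A \<Longrightarrow> 1 \<odot> x = x"
  "x \<in> carrier A \<Longrightarrow> 0 \<odot> x = \<zero>"
  "c \<odot> \<zero> = \<zero>"
  using smult_l_distr[of c d x] smult_assoc1[of c d x] smult_one smult_l_null[of x]
    smult_r_null[of c]
  by (auto simp: smult_r_distr)

lemma smult_minus: "\<lbrakk>x \<in> carrier A; y \<in> carrier A\<rbrakk> \<Longrightarrow> c \<odot> (x \<ominus> y) = c \<odot> x \<ominus> c \<odot> y"
  by (simp add: M.minus_eq minus_conv complex_smult_distr flip: complex_smult_distr(3))

lemma minus_eq_zero_iff:
  assumes "x \<in> carrier A" "y \<in> carrier A"
  shows "x \<ominus> y = \<zero> \<longleftrightarrow> x = y"
proof
  have "x = (x \<ominus> y) \<oplus> y" using assms by (simp add: M.minus_eq M.a_assoc M.l_neg)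
  moreover assume "x \<ominus> y = \<zero>"
  ultimately show "x = y" using assms by simp
qed (use assms in \<open>simp add: M.minus_eq M.r_neg\<close>)

end

sublocale star_algebra \<subseteq> complex_module A ..

sublocale hilbert_space \<subseteq> complex_module H ..

context star_algebra
begin

lemma mult_minus_left:
  "\<lbrakk>x \<in> carrier A; y \<in> carrier A; z \<in> carrier A\<rbrakk> \<Longrightarrow> (x \<ominus> y) \<otimes> z = x \<otimes> z \<ominus> y \<otimes> z"
  by (simp add: M.minus_eq minus_conv mult_l_distr smult_mult_left)

lemma mult_minus_right:
  "\<lbrakk>x \<in> carrier A; y \<in> carrier A; z \<in> carrier A\<rbrakk> \<Longrightarrow> z \<otimes> (x \<ominus> y) = z \<otimes> x \<ominus> z \<otimes> y"
  by (simp add: M.minus_eq minus_conv mult_r_distr smult_mult_right)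

lemma star_minus:
  "\<lbrakk>x \<in> carrier A; y \<in> carrier A\<rbrakk> \<Longrightarrow> star A (x \<ominus> y) = star A x \<ominus> star A y"
  by (simp add: M.minus_eq minus_conv star_add star_smult)

lemma star_zero [simp]: "star A \<zero> = \<zero>"
  using star_smult[of \<zero> 0] by (simp add: complex_smult_distr)

lemma mult_zero [simp]: "x \<in> carrier A \<Longrightarrow> x \<otimes> \<zero> = \<zero>" "x \<in> carrier A \<Longrightarrow> \<zero> \<otimes> x = \<zero>"
  using smult_mult_left[of \<zero> x 0] smult_mult_right[of x \<zero> 0] by (simp_all add: complex_smult_distr)

end

locale cstar_seminormed = star_algebra A for A :: "('a, 'm) star_algebra_scheme" (structure) +
  fixes p :: "'a \<Rightarrow> real"
  assumes seminorm: "cstar_seminorm A p"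
begin

lemma p_nonneg [simp]: "x \<in> carrier A \<Longrightarrow> 0 \<le> p x"
  and p_add: "\<lbrakk>x \<in> carrier A; y \<in> carrier A\<rbrakk> \<Longrightarrow> p (x \<oplus> y) \<le> p x + p y"
  and p_smult: "x \<in> carrier A \<Longrightarrow> p (c \<odot> x) = cmod c * p x"
  and p_mult: "\<lbrakk>x \<in> carrier A; y \<in> carrier A\<rbrakk> \<Longrightarrow> p (x \<otimes> y) \<le> p x * p y"
  and p_star_mult: "x \<in> carrier A \<Longrightarrow> p (star A x \<otimes> x) = (p x)\<^sup>2"
  using seminorm by (auto simp: cstar_seminorm_def)

lemma p_zero [simp]: "p \<zero> = 0"
  using p_smult[of \<zero> 0] by (simp add: complex_smult_distr)

lemma p_minus_commute: "\<lbrakk>x \<in> carrier A; y \<in> carrier A\<rbrakk> \<Longrightarrow> p (x \<ominus> y) = p (y \<ominus> x)"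
proof -
  assume xy: "x \<in> carrier A" "y \<in> carrier A"
  have "x \<ominus> y = (-1) \<odot> (y \<ominus> x)"
    using xy by (simp flip: minus_conv add: M.minus_minus M.minus_eq M.minus_add M.a_comm)
  then show ?thesis using xy p_smult[of "y \<ominus> x" "-1"] by simp
qed

lemma p_triangle:
  assumes "x \<in> carrier A" "y \<in> carrier A" "z \<in> carrier A"
  shows "p (x \<ominus> z) \<le> p (x \<ominus> y) + p (y \<ominus> z)"
proof -
  have "x \<ominus> z = (x \<ominus> y) \<oplus> (y \<ominus> z)"
    using assms by (simp add: M.minus_eq M.a_assoc M.r_neg1)
  then show ?thesis using assms p_add[of "x \<ominus> y" "y \<ominus> z"] by simp
qed

lemma diff_zero [simp]: "x \<in> carrier A \<Longrightarrow> x \<ominus> \<zero> = x"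
  by (simp add: M.minus_eq minus_conv complex_smult_distr)

lemma zero_diff [simp]: "x \<in> carrier A \<Longrightarrow> p (\<zero> \<ominus> x) = p x"
  using p_minus_commute[of \<zero> x] by simp

lemma p_minus: "\<lbrakk>x \<in> carrier A; y \<in> carrier A\<rbrakk> \<Longrightarrow> p (x \<ominus> y) \<le> p x + p y"
  using p_triangle[of x \<zero> y] by simp

lemma p_reverse: "\<lbrakk>x \<in> carrier A; y \<in> carrier A\<rbrakk> \<Longrightarrow> \<bar>p x - p y\<bar> \<le> p (x \<ominus> y)"
  using p_triangle[of x y \<zero>] p_triangle[of y x \<zero>] p_minus_commute[of x y] by simp

lemma p_star [simp]: "x \<in> carrier A \<Longrightarrow> p (star A x) = p x"
proof -
  have *: "p x \<le> p (star A x)" if x: "x \<in> carrier A" for x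
  proof (cases "p x = 0")
    case False
    have "(p x)\<^sup>2 \<le> p (star A x) * p x"
      using p_star_mult[of x] p_mult[of "star A x" x] x by simp
    then show ?thesis using False p_nonneg[OF x] by (simp add: power2_eq_square)
  qed (use x in simp)
  assume x: "x \<in> carrier A"
  show ?thesis using *[OF x] *[of "star A x"] x by simp
qed

lemma p_add_diff:
  assumes "x \<in> carrier A" "y \<in> carrier A" "x' \<in> carrier A" "y' \<in> carrier A"
  shows "p ((x \<oplus> y) \<ominus> (x' \<oplus> y')) \<le> p (x \<ominus> x') + p (y \<ominus> y')"
proof -
  have "(x \<oplus> y) \<ominus> (x' \<oplus> y') = (x \<ominus> x') \<oplus> (y \<ominus> y')"
    using assms by (simp add: M.minus_eq M.minus_add M.a_ac)
  then show ?thesis using assms p_add[of "x \<ominus> x'" "y \<ominus> y'"] by simp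
qed

lemma p_mult_diff:
  assumes "x \<in> carrier A" "y \<in> carrier A" "x' \<in> carrier A" "y' \<in> carrier A"
  shows "p (x \<otimes> y \<ominus> x' \<otimes> y') \<le> p x * p (y \<ominus> y') + p (x \<ominus> x') * p y'"
proof -
  have "p (x \<otimes> y \<ominus> x' \<otimes> y') \<le> p (x \<otimes> y \<ominus> x \<otimes> y') + p (x \<otimes> y' \<ominus> x' \<otimes> y')"
    using assms by (intro p_triangle) auto
  also have "\<dots> = p (x \<otimes> (y \<ominus> y')) + p ((x \<ominus> x') \<otimes> y')"
    using assms by (simp add: mult_minus_left mult_minus_right)
  also have "\<dots> \<le> p x * p (y \<ominus> y') + p (x \<ominus> x') * p y'"
    using assms by (intro add_mono p_mult) auto
  finally show ?thesis .
qed

lemma p_smult_diff: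
  "\<lbrakk>x \<in> carrier A; y \<in> carrier A\<rbrakk> \<Longrightarrow> p (c \<odot> x \<ominus> c \<odot> y) = cmod c * p (x \<ominus> y)"
  by (simp add: smult_minus[symmetric] p_smult)

lemma p_star_diff:
  "\<lbrakk>x \<in> carrier A; y \<in> carrier A\<rbrakk> \<Longrightarrow> p (star A x \<ominus> star A y) = p (x \<ominus> y)"
  by (simp add: star_minus[symmetric])

subsection \<open>Cauchy sequences\<close>

abbreviation CS where "CS \<equiv> Cauchy_seqs A p"
abbreviation cls where "cls \<equiv> Cauchy_class A p"

lemma CS_carrier [simp]: "X \<in> CS \<Longrightarrow> X n \<in> carrier A"
  by (simp add: Cauchy_seqs_def)

lemma CS_ge: "\<lbrakk>X \<in> CS; e > 0\<rbrakk> \<Longrightarrow> \<exists>M. \<forall>m\<ge>M. \<forall>n\<ge>M. p (X m \<ominus> X n) < e"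
  unfolding Cauchy_seqs_def norm_Cauchy_def mem_Collect_eq by (drule conjunct2) (erule allE, erule mp)

lemma CSI:
  assumes "\<And>n. X n \<in> carrier A"
    and "\<And>e. e > 0 \<Longrightarrow> \<exists>M. \<forall>m\<ge>M. \<forall>n\<ge>M. p (X m \<ominus> X n) < e"
  shows "X \<in> CS"
  unfolding Cauchy_seqs_def norm_Cauchy_def
proof (intro CollectI conjI allI impI)
  show "X n \<in> carrier A" for n by (rule assms(1))
  show "\<exists>M. \<forall>m\<ge>M. \<forall>n\<ge>M. p (X m \<ominus> X n) < e" if "e > 0" for e
    using that by (rule assms(2))
qed

lemma CS_const [simp]: "x \<in> carrier A \<Longrightarrow> (\<lambda>n. x) \<in> CS"
  unfolding Cauchy_seqs_def norm_Cauchy_def by (auto simp: M.minus_eq M.r_neg)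

lemma CS_convergent: "X \<in> CS \<Longrightarrow> convergent (\<lambda>n. p (X n))"
proof -
  assume X: "X \<in> CS"
  have "Cauchy (\<lambda>n. p (X n))"
  proof (rule metric_CauchyI)
    fix e :: real assume "e > 0"
    then obtain M where M: "\<forall>m\<ge>M. \<forall>n\<ge>M. p (X m \<ominus> X n) < e" using CS_ge[OF X] by blast
    have "dist (p (X m)) (p (X n)) < e" if "m \<ge> M" "n \<ge> M" for m n
      using p_reverse[of "X m" "X n"] M that X by (fastforce simp: dist_real_def)
    then show "\<exists>M. \<forall>m\<ge>M. \<forall>n\<ge>M. dist (p (X m)) (p (X n)) < e" by blast
  qed
  then show ?thesis by (simp add: Cauchy_convergent_iff)
qed

lemma CS_bounded: "X \<in> CS \<Longrightarrow> \<exists>K>0. \<forall>n. p (X n) \<le> K"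
  using convergent_imp_Bseq[OF CS_convergent, of X] by (auto simp: Bseq_def)

lemma CS_add [simp]: "\<lbrakk>X \<in> CS; Y \<in> CS\<rbrakk> \<Longrightarrow> (\<lambda>n. X n \<oplus> Y n) \<in> CS"
proof (rule CSI)
  fix e :: real assume X: "X \<in> CS" and Y: "Y \<in> CS" and "e > 0"
  then obtain M N where M: "\<forall>m\<ge>M. \<forall>n\<ge>M. p (X m \<ominus> X n) < e/2"
    and N: "\<forall>m\<ge>N. \<forall>n\<ge>N. p (Y m \<ominus> Y n) < e/2"
    using CS_ge[of X "e/2"] CS_ge[of Y "e/2"] by (metis half_gt_zero)
  show "\<exists>M. \<forall>m\<ge>M. \<forall>n\<ge>M. p ((X m \<oplus> Y m) \<ominus> (X n \<oplus> Y n)) < e"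
  proof (intro exI[of _ "max M N"] allI impI)
    fix m n assume "max M N \<le> m" "max M N \<le> n"
    then have "p (X m \<ominus> X n) < e/2" "p (Y m \<ominus> Y n) < e/2" using M N by auto
    then show "p ((X m \<oplus> Y m) \<ominus> (X n \<oplus> Y n)) < e"
      using p_add_diff[of "X m" "Y m" "X n" "Y n"] X Y by fastforce
  qed
qed simp

lemma CS_smult [simp]: "X \<in> CS \<Longrightarrow> (\<lambda>n. c \<odot> X n) \<in> CS"
proof (rule CSI)
  fix e :: real assume X: "X \<in> CS" and "e > 0"
  then have "e / (cmod c + 1) > 0" by (simp add: add_nonneg_pos)
  from CS_ge[OF X this] obtain M where
    M: "\<forall>m\<ge>M. \<forall>n\<ge>M. p (X m \<ominus> X n) < e / (cmod c + 1)" by blast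
  show "\<exists>M. \<forall>m\<ge>M. \<forall>n\<ge>M. p (c \<odot> X m \<ominus> c \<odot> X n) < e"
  proof (intro exI[of _ M] allI impI)
    fix m n assume mn: "M \<le> m" "M \<le> n"
    have "p (c \<odot> X m \<ominus> c \<odot> X n) \<le> (cmod c + 1) * p (X m \<ominus> X n)"
      using X by (simp add: p_smult_diff mult_right_mono)
    also have "\<dots> < (cmod c + 1) * (e / (cmod c + 1))"
      using M mn by (intro mult_strict_left_mono) (auto intro: add_nonneg_pos)
    also have "\<dots> = e" by (simp add: add_nonneg_eq_0_iff)
    finally show "p (c \<odot> X m \<ominus> c \<odot> X n) < e" .
  qed
qed simp

lemma CS_star [simp]: "X \<in> CS \<Longrightarrow> (\<lambda>n. star A (X n)) \<in> CS"
  by (rule CSI) (auto simp: p_star_diff intro: CS_ge)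

lemma CS_mult [simp]: "\<lbrakk>X \<in> CS; Y \<in> CS\<rbrakk> \<Longrightarrow> (\<lambda>n. X n \<otimes> Y n) \<in> CS"
proof (rule CSI)
  fix e :: real assume X: "X \<in> CS" and Y: "Y \<in> CS" and e: "e > 0"
  obtain K where K: "K > 0" "\<And>n. p (X n) \<le> K" using CS_bounded[OF X] by blast
  obtain L where L: "L > 0" "\<And>n. p (Y n) \<le> L" using CS_bounded[OF Y] by blast
  obtain M where M: "\<forall>m\<ge>M. \<forall>n\<ge>M. p (X m \<ominus> X n) < e/(2*L)"
    using CS_ge[OF X, of "e/(2*L)"] e L by auto
  obtain N where N: "\<forall>m\<ge>N. \<forall>n\<ge>N. p (Y m \<ominus> Y n) < e/(2*K)"
    using CS_ge[OF Y, of "e/(2*K)"] e K by auto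
  show "\<exists>M. \<forall>m\<ge>M. \<forall>n\<ge>M. p (X m \<otimes> Y m \<ominus> X n \<otimes> Y n) < e"
  proof (intro exI[of _ "max M N"] allI impI)
    fix m n assume "max M N \<le> m" "max M N \<le> n"
    then have d: "p (X m \<ominus> X n) < e/(2*L)" "p (Y m \<ominus> Y n) < e/(2*K)" using M N by auto
    have "p (X m \<otimes> Y m \<ominus> X n \<otimes> Y n) \<le> p (X m) * p (Y m \<ominus> Y n) + p (X m \<ominus> X n) * p (Y n)"
      using X Y by (intro p_mult_diff) auto
    also have "\<dots> \<le> K * p (Y m \<ominus> Y n) + p (X m \<ominus> X n) * L"
      using X Y K L by (intro add_mono mult_mono) auto
    also have "\<dots> < K * (e/(2*K)) + (e/(2*L)) * L"
      using d K L by (intro add_strict_mono mult_strict_left_mono mult_strict_right_mono) auto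
    also have "\<dots> = e" using K L by simp
    finally show "p (X m \<otimes> Y m \<ominus> X n \<otimes> Y n) < e" .
  qed
qed simp

definition null :: "(nat \<Rightarrow> 'a) \<Rightarrow> (nat \<Rightarrow> 'a) \<Rightarrow> bool" where
  "null X Y \<longleftrightarrow> (\<lambda>n. p (X n \<ominus> Y n)) \<longlonglongrightarrow> 0"

lemma null_refl: "X \<in> CS \<Longrightarrow> null X X"
  by (simp add: null_def M.minus_eq M.r_neg)

lemma null_sym: "\<lbrakk>X \<in> CS; Y \<in> CS; null X Y\<rbrakk> \<Longrightarrow> null Y X"
  by (simp add: null_def p_minus_commute)

lemma null_le:
  assumes "f \<longlonglongrightarrow> 0" "\<And>n. X n \<in> carrier A" "\<And>n. Y n \<in> carrier A" "\<And>n. p (X n \<ominus> Y n) \<le> f n"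
  shows "null X Y"
  unfolding null_def
  by (rule tendsto_sandwich[OF _ _ tendsto_const assms(1)]) (use assms in auto)

lemma null_trans: "\<lbrakk>X \<in> CS; Y \<in> CS; Z \<in> CS; null X Y; null Y Z\<rbrakk> \<Longrightarrow> null X Z"
  using tendsto_add[of "\<lambda>n. p (X n \<ominus> Y n)" 0 sequentially "\<lambda>n. p (Y n \<ominus> Z n)" 0]
  by (intro null_le[where f = "\<lambda>n. p (X n \<ominus> Y n) + p (Y n \<ominus> Z n)"]) (auto simp: null_def intro: p_triangle)

lemma cls_def': "cls X = {Y \<in> CS. null X Y}"
  by (simp add: Cauchy_class_def null_def)

lemma cls_eq_iff: "\<lbrakk>X \<in> CS; Y \<in> CS\<rbrakk> \<Longrightarrow> cls X = cls Y \<longleftrightarrow> null X Y"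
  unfolding cls_def' by (auto intro: null_refl null_sym null_trans)

lemma rep_cls: "X \<in> CS \<Longrightarrow> class_rep (cls X) \<in> CS \<and> null X (class_rep (cls X))"
  using someI[of "\<lambda>Y. Y \<in> cls X" X] null_refl by (simp add: class_rep_def cls_def')

lemma null_add: "\<lbrakk>X \<in> CS; Y \<in> CS; X' \<in> CS; Y' \<in> CS; null X X'; null Y Y'\<rbrakk> \<Longrightarrow>
    null (\<lambda>n. X n \<oplus> Y n) (\<lambda>n. X' n \<oplus> Y' n)"
  using tendsto_add[of "\<lambda>n. p (X n \<ominus> X' n)" 0 sequentially "\<lambda>n. p (Y n \<ominus> Y' n)" 0]
  by (intro null_le[where f = "\<lambda>n. p (X n \<ominus> X' n) + p (Y n \<ominus> Y' n)"]) (auto simp: null_def intro: p_add_diff)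

lemma null_smult: "\<lbrakk>X \<in> CS; X' \<in> CS; null X X'\<rbrakk> \<Longrightarrow> null (\<lambda>n. c \<odot> X n) (\<lambda>n. c \<odot> X' n)"
  using tendsto_mult_right_zero[of "\<lambda>n. p (X n \<ominus> X' n)" sequentially "cmod c"]
  by (simp add: null_def p_smult_diff)

lemma null_star: "\<lbrakk>X \<in> CS; X' \<in> CS; null X X'\<rbrakk> \<Longrightarrow> null (\<lambda>n. star A (X n)) (\<lambda>n. star A (X' n))"
  by (simp add: null_def p_star_diff)

lemma null_mult:
  assumes "X \<in> CS" "Y \<in> CS" "X' \<in> CS" "Y' \<in> CS" "null X X'" "null Y Y'"
  shows "null (\<lambda>n. X n \<otimes> Y n) (\<lambda>n. X' n \<otimes> Y' n)"
proof -
  obtain a where a: "(\<lambda>n. p (X n)) \<longlonglongrightarrow> a"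
    using CS_convergent[OF assms(1)] by (auto simp: convergent_def)
  obtain b where b: "(\<lambda>n. p (Y' n)) \<longlonglongrightarrow> b"
    using CS_convergent[OF assms(4)] by (auto simp: convergent_def)
  have "(\<lambda>n. p (X n) * p (Y n \<ominus> Y' n) + p (X n \<ominus> X' n) * p (Y' n)) \<longlonglongrightarrow> a * 0 + 0 * b"
    using assms a b unfolding null_def by (intro tendsto_intros)
  then show ?thesis
    using assms by (intro null_le[OF _ _ _ p_mult_diff]) auto
qed

lemma null_lim:
  assumes "X \<in> CS" "Y \<in> CS" "null X Y"
  shows "lim (\<lambda>n. p (X n)) = lim (\<lambda>n. p (Y n))"
proof -
  have "(\<lambda>n. p (X n) - p (Y n)) \<longlonglongrightarrow> 0"
    by (rule Lim_null_comparison[of _ "\<lambda>n. p (X n \<ominus> Y n)"])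
      (use assms in \<open>auto simp: null_def intro!: always_eventually p_reverse\<close>)
  moreover have Y: "(\<lambda>n. p (Y n)) \<longlonglongrightarrow> lim (\<lambda>n. p (Y n))"
    using CS_convergent[OF assms(2)] by (simp add: convergent_LIMSEQ_iff)
  ultimately have "(\<lambda>n. p (X n) - p (Y n) + p (Y n)) \<longlonglongrightarrow> 0 + lim (\<lambda>n. p (Y n))"
    by (rule tendsto_add)
  then show ?thesis by (simp add: limI)
qed

abbreviation "C \<equiv> cstar_completion A p"

lemma C_sel:
  "carrier C = cls ` CS"
  "zero C = cls (\<lambda>n. \<zero>)"
  by (simp_all add: cstar_completion_def)

lemma cls_closed [simp]: "X \<in> CS \<Longrightarrow> cls X \<in> carrier C"
  by (simp add: C_sel)

lemma C_add: "\<lbrakk>X \<in> CS; Y \<in> CS\<rbrakk> \<Longrightarrow> cls X \<oplus>\<^bsub>C\<^esub> cls Y = cls (\<lambda>n. X n \<oplus> Y n)"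
  using rep_cls[of X] rep_cls[of Y]
  by (auto simp: cstar_completion_def cls_eq_iff intro!: null_add intro: null_sym)

lemma C_mult: "\<lbrakk>X \<in> CS; Y \<in> CS\<rbrakk> \<Longrightarrow> cls X \<otimes>\<^bsub>C\<^esub> cls Y = cls (\<lambda>n. X n \<otimes> Y n)"
  using rep_cls[of X] rep_cls[of Y]
  by (auto simp: cstar_completion_def cls_eq_iff intro!: null_mult intro: null_sym)

lemma C_smult: "X \<in> CS \<Longrightarrow> c \<odot>\<^bsub>C\<^esub> cls X = cls (\<lambda>n. c \<odot> X n)"
  using rep_cls[of X]
  by (auto simp: cstar_completion_def cls_eq_iff intro!: null_smult intro: null_sym)

lemma C_star: "X \<in> CS \<Longrightarrow> star C (cls X) = cls (\<lambda>n. star A (X n))"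
  using rep_cls[of X]
  by (auto simp: cstar_completion_def cls_eq_iff intro!: null_star intro: null_sym)

lemma C_norm: "X \<in> CS \<Longrightarrow> cnorm C (cls X) = lim (\<lambda>n. p (X n))"
  using rep_cls[of X] null_lim[of X "class_rep (cls X)"] by (simp add: cstar_completion_def)

lemma C_norm_tendsto: "X \<in> CS \<Longrightarrow> (\<lambda>n. p (X n)) \<longlonglongrightarrow> cnorm C (cls X)"
  using CS_convergent[of X] by (simp add: C_norm convergent_LIMSEQ_iff)

lemma C_cases:
  assumes "U \<in> carrier C"
  obtains X where "X \<in> CS" "U = cls X"
  using assms by (auto simp: C_sel)

lemma C_star_algebra: "star_algebra C"
proof (rule star_algebra.intro)
  show "Module.module complex_ring C"
  proof (rule complex_moduleI)
    fix x assume "x \<in> carrier C"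
    then obtain X where X: "X \<in> CS" "x = cls X" by (rule C_cases)
    have "(-1) \<odot> X n \<oplus> X n = \<zero>" for n
      using X by (simp add: minus_conv[symmetric] M.l_neg)
    then show "(-1) \<odot>\<^bsub>C\<^esub> x \<oplus>\<^bsub>C\<^esub> x = \<zero>\<^bsub>C\<^esub>"
      using X by (simp add: C_add C_smult C_sel)
  next
    fix x y assume "x \<in> carrier C" "y \<in> carrier C"
    then show "x \<oplus>\<^bsub>C\<^esub> y = y \<oplus>\<^bsub>C\<^esub> x"
      by (elim C_cases) (simp add: C_add M.a_comm)
  qed (auto elim!: C_cases simp: C_add C_smult C_sel(2) complex_smult_distr M.a_assoc)
  show "star_algebra_axioms C"
    by unfold_locales (auto elim!: C_cases simp: C_add C_smult C_mult C_star
        mult_assoc mult_l_distr mult_r_distr smult_mult_left smult_mult_right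
        star_add star_mult star_smult)
qed

lemma C_seminorm: "cstar_seminorm C (cnorm C)"
  unfolding cstar_seminorm_def
proof (intro conjI ballI allI)
  fix x assume "x \<in> carrier C"
  then obtain X where X: "X \<in> CS" "x = cls X" by (rule C_cases)
  note X' = C_norm_tendsto[OF X(1)]
  show "0 \<le> cnorm C x"
    using LIMSEQ_le_const[OF X', of 0] X by auto
  show "cnorm C (c \<odot>\<^bsub>C\<^esub> x) = cmod c * cnorm C x" for c
  proof (rule LIMSEQ_unique)
    show "(\<lambda>n. p (c \<odot> X n)) \<longlonglongrightarrow> cnorm C (c \<odot>\<^bsub>C\<^esub> x)"
      using C_norm_tendsto[of "\<lambda>n. c \<odot> X n"] X by (simp add: C_smult)
    show "(\<lambda>n. p (c \<odot> X n)) \<longlonglongrightarrow> cmod c * cnorm C x"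
      using tendsto_mult_left[OF X', of "cmod c"] X by (simp add: p_smult)
  qed
  show "cnorm C (star C x \<otimes>\<^bsub>C\<^esub> x) = (cnorm C x)\<^sup>2"
  proof (rule LIMSEQ_unique)
    show "(\<lambda>n. p (star A (X n) \<otimes> X n)) \<longlonglongrightarrow> cnorm C (star C x \<otimes>\<^bsub>C\<^esub> x)"
      using C_norm_tendsto[of "\<lambda>n. star A (X n) \<otimes> X n"] X by (simp add: C_star C_mult)
    show "(\<lambda>n. p (star A (X n) \<otimes> X n)) \<longlonglongrightarrow> (cnorm C x)\<^sup>2"
      using tendsto_power[OF X', of 2] X by (simp add: p_star_mult)
  qed
  fix y assume "y \<in> carrier C"
  then obtain Y where Y: "Y \<in> CS" "y = cls Y" by (rule C_cases)
  note Y' = C_norm_tendsto[OF Y(1)]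
  show "cnorm C (x \<oplus>\<^bsub>C\<^esub> y) \<le> cnorm C x + cnorm C y"
  proof (rule LIMSEQ_le)
    show "(\<lambda>n. p (X n \<oplus> Y n)) \<longlonglongrightarrow> cnorm C (x \<oplus>\<^bsub>C\<^esub> y)"
      using C_norm_tendsto[of "\<lambda>n. X n \<oplus> Y n"] X Y by (simp add: C_add)
    show "(\<lambda>n. p (X n) + p (Y n)) \<longlonglongrightarrow> cnorm C x + cnorm C y"
      using tendsto_add[OF X' Y'] X Y by simp
  qed (use X Y in \<open>auto intro!: exI[of _ 0] p_add\<close>)
  show "cnorm C (x \<otimes>\<^bsub>C\<^esub> y) \<le> cnorm C x * cnorm C y"
  proof (rule LIMSEQ_le)
    show "(\<lambda>n. p (X n \<otimes> Y n)) \<longlonglongrightarrow> cnorm C (x \<otimes>\<^bsub>C\<^esub> y)"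
      using C_norm_tendsto[of "\<lambda>n. X n \<otimes> Y n"] X Y by (simp add: C_mult)
    show "(\<lambda>n. p (X n) * p (Y n)) \<longlonglongrightarrow> cnorm C x * cnorm C y"
      using tendsto_mult[OF X' Y'] X Y by simp
  qed (use X Y in \<open>auto intro!: exI[of _ 0] p_mult\<close>)
qed

lemma C_norm_0: "\<lbrakk>x \<in> carrier C; cnorm C x = 0\<rbrakk> \<Longrightarrow> x = \<zero>\<^bsub>C\<^esub>"
proof -
  assume "x \<in> carrier C" and 0: "cnorm C x = 0"
  then obtain X where X: "X \<in> CS" "x = cls X" by (elim C_cases)
  have "null X (\<lambda>n. \<zero>)"
    using C_norm_tendsto[OF X(1)] 0 X by (simp add: null_def)
  then show ?thesis using X by (simp add: C_sel(2) cls_eq_iff)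
qed

interpretation C: cstar_seminormed C "cnorm C"
  by (intro cstar_seminormed.intro C_star_algebra cstar_seminormed_axioms.intro C_seminorm)

lemma C_minus: "\<lbrakk>X \<in> CS; Y \<in> CS\<rbrakk> \<Longrightarrow> cls X \<ominus>\<^bsub>C\<^esub> cls Y = cls (\<lambda>n. X n \<ominus> Y n)"
  by (simp add: C.M.minus_eq C.minus_conv M.minus_eq minus_conv C_smult C_add)

lemma CS_minus [simp]: "\<lbrakk>X \<in> CS; Y \<in> CS\<rbrakk> \<Longrightarrow> (\<lambda>n. X n \<ominus> Y n) \<in> CS"
  by (simp add: M.minus_eq minus_conv)

lemma C_norm_const: "x \<in> carrier A \<Longrightarrow> cnorm C (cls (\<lambda>n. x)) = p x"
  using LIMSEQ_unique[OF C_norm_tendsto tendsto_const] by simp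

lemma C_const_tendsto:
  assumes X: "X \<in> CS"
  shows "norm_tendsto C (cnorm C) (\<lambda>n. cls (\<lambda>_. X n)) (cls X)"
  unfolding norm_tendsto_def
proof (rule LIMSEQ_I)
  fix e :: real assume e: "e > 0"
  obtain M where M: "\<forall>m\<ge>M. \<forall>n\<ge>M. p (X m \<ominus> X n) < e/2" using CS_ge[OF X, of "e/2"] e by auto
  have "norm (cnorm C (cls (\<lambda>_. X n) \<ominus>\<^bsub>C\<^esub> cls X) - 0) < e" if n: "n \<ge> M" for n
  proof -
    have "(\<lambda>m. p (X n \<ominus> X m)) \<longlonglongrightarrow> cnorm C (cls (\<lambda>_. X n) \<ominus>\<^bsub>C\<^esub> cls X)"
      using C_norm_tendsto[of "\<lambda>m. X n \<ominus> X m"] CS_minus[of "\<lambda>_. X n" X] X by (simp add: C_minus)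
    then have "cnorm C (cls (\<lambda>_. X n) \<ominus>\<^bsub>C\<^esub> cls X) \<le> e/2"
      by (rule LIMSEQ_le_const2) (use M n in \<open>auto intro!: exI[of _ M] less_imp_le\<close>)
    then show ?thesis using e X by simp
  qed
  then show "\<exists>M. \<forall>n\<ge>M. norm (cnorm C (cls (\<lambda>_. X n) \<ominus>\<^bsub>C\<^esub> cls X) - 0) < e" by blast
qed

lemma C_dense:
  assumes U: "U \<in> carrier C" and e: "e > 0"
  shows "\<exists>a\<in>carrier A. cnorm C (cls (\<lambda>_. a) \<ominus>\<^bsub>C\<^esub> U) < e"
proof -
  obtain X where X: "X \<in> CS" "U = cls X" using U by (rule C_cases)
  have "\<forall>\<^sub>F n in sequentially. cnorm C (cls (\<lambda>_. X n) \<ominus>\<^bsub>C\<^esub> cls X) < e"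
    using order_tendstoD(2)[OF C_const_tendsto[OF X(1), unfolded norm_tendsto_def] e] .
  then obtain n where "cnorm C (cls (\<lambda>_. X n) \<ominus>\<^bsub>C\<^esub> cls X) < e"
    using eventually_happens'[OF sequentially_bot] by blast
  then show ?thesis using X by (auto intro!: bexI[of _ "X n"])
qed

lemma C_complete: "norm_complete C (cnorm C)"
  unfolding norm_complete_def
proof (intro allI impI, elim conjE)
  fix U :: "nat \<Rightarrow> (nat \<Rightarrow> 'a) set"
  assume U: "\<forall>n. U n \<in> carrier C" and "norm_Cauchy C (cnorm C) U"
  then have UC: "U \<in> C.CS" unfolding Cauchy_seqs_def mem_Collect_eq by (rule conjI)
  have "\<exists>a\<in>carrier A. cnorm C (cls (\<lambda>_. a) \<ominus>\<^bsub>C\<^esub> U n) < inverse (real (Suc n))" for n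
    using C_dense[of "U n" "inverse (real (Suc n))"] U by simp
  then obtain a where a: "\<And>n. a n \<in> carrier A"
    "\<And>n. cnorm C (cls (\<lambda>_. a n) \<ominus>\<^bsub>C\<^esub> U n) < inverse (real (Suc n))" by metis
  define V where "V = (\<lambda>n. cls (\<lambda>_. a n))"
  have V: "V n \<in> carrier C" for n using a by (simp add: V_def)
  have V_less: "cnorm C (V n \<ominus>\<^bsub>C\<^esub> U n) \<le> inverse (real (Suc n))" for n
    using a(2)[of n] unfolding V_def by (rule less_imp_le)
  have V_ge: "0 \<le> cnorm C (V n \<ominus>\<^bsub>C\<^esub> U n)" for n
    using V[of n] U by simp
  have VU: "(\<lambda>n. cnorm C (V n \<ominus>\<^bsub>C\<^esub> U n)) \<longlonglongrightarrow> 0"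
    by (rule tendsto_sandwich[OF always_eventually always_eventually tendsto_const
          LIMSEQ_inverse_real_of_nat]) (use V_less V_ge in blast)+
  have aCS: "a \<in> CS"
  proof (rule CSI)
    fix e :: real assume e: "e > 0"
    obtain M where M: "\<forall>m\<ge>M. \<forall>n\<ge>M. cnorm C (U m \<ominus>\<^bsub>C\<^esub> U n) < e/3"
      using C.CS_ge[OF UC, of "e/3"] e by auto
    have "\<forall>\<^sub>F n in sequentially. cnorm C (V n \<ominus>\<^bsub>C\<^esub> U n) < e/3"
      using order_tendstoD(2)[OF VU, of "e/3"] e by simp
    then obtain N where N: "\<And>n. n \<ge> N \<Longrightarrow> cnorm C (V n \<ominus>\<^bsub>C\<^esub> U n) < e/3"
      by (auto simp: eventually_sequentially)
    show "\<exists>M. \<forall>m\<ge>M. \<forall>n\<ge>M. p (a m \<ominus> a n) < e"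
    proof (intro exI[of _ "max M N"] allI impI)
      fix m n assume mn: "max M N \<le> m" "max M N \<le> n"
      have "p (a m \<ominus> a n) = cnorm C (V m \<ominus>\<^bsub>C\<^esub> V n)"
        using a by (simp add: V_def C_minus C_norm_const)
      also have "\<dots> \<le> cnorm C (V m \<ominus>\<^bsub>C\<^esub> U m) + cnorm C (U m \<ominus>\<^bsub>C\<^esub> V n)"
        using U V by (intro C.p_triangle) auto
      also have "cnorm C (U m \<ominus>\<^bsub>C\<^esub> V n) \<le> cnorm C (U m \<ominus>\<^bsub>C\<^esub> U n) + cnorm C (V n \<ominus>\<^bsub>C\<^esub> U n)"
        using U V C.p_triangle[of "U m" "U n" "V n"] C.p_minus_commute[of "U n" "V n"] by simp
      finally show "p (a m \<ominus> a n) < e"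
        using N[of m] N[of n] M mn by fastforce
    qed
  qed (use a in simp)
  have "norm_tendsto C (cnorm C) U (cls a)"
    unfolding norm_tendsto_def
  proof (rule tendsto_sandwich[OF _ _ tendsto_const])
    have "(\<lambda>n. cnorm C (V n \<ominus>\<^bsub>C\<^esub> U n) + cnorm C (V n \<ominus>\<^bsub>C\<^esub> cls a)) \<longlonglongrightarrow> 0 + 0"
      using C_const_tendsto[OF aCS] VU unfolding V_def norm_tendsto_def by (intro tendsto_add)
    then show "(\<lambda>n. cnorm C (V n \<ominus>\<^bsub>C\<^esub> U n) + cnorm C (V n \<ominus>\<^bsub>C\<^esub> cls a)) \<longlonglongrightarrow> 0" by simp
    show "\<forall>\<^sub>F n in sequentially. cnorm C (U n \<ominus>\<^bsub>C\<^esub> cls a)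
        \<le> cnorm C (V n \<ominus>\<^bsub>C\<^esub> U n) + cnorm C (V n \<ominus>\<^bsub>C\<^esub> cls a)"
    proof (rule always_eventually, rule allI)
      fix n
      show "cnorm C (U n \<ominus>\<^bsub>C\<^esub> cls a) \<le> cnorm C (V n \<ominus>\<^bsub>C\<^esub> U n) + cnorm C (V n \<ominus>\<^bsub>C\<^esub> cls a)"
        using C.p_triangle[of "U n" "V n" "cls a"] C.p_minus_commute[of "U n" "V n"] U V aCS by simp
    qed
  qed (use U aCS in \<open>auto intro!: always_eventually\<close>)
  then show "\<exists>l\<in>carrier C. norm_tendsto C (cnorm C) U l" using aCS by auto
qed

theorem cstar_algebra_completion: "cstar_algebra C"
  by (intro cstar_algebra.intro cstar_algebra_axioms.intro C_star_algebra C_seminorm C_norm_0 C_complete)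

end

subsection \<open>Free \<open>*\<close>-algebras\<close>

lemma pm_sum:
  fixes f :: "'a \<Rightarrow>\<^sub>0 'b::comm_monoid_add"
  shows "f = (\<Sum>u\<in>Poly_Mapping.keys f. Poly_Mapping.single u (Poly_Mapping.lookup f u))"
  by (rule poly_mapping_eqI)
    (simp add: lookup_sum lookup_single when_def sum.delta in_keys_iff)

lemma pm_induct [consumes 1, case_names zero add]:
  fixes f :: "'a \<Rightarrow>\<^sub>0 'b::comm_monoid_add"
  assumes "Poly_Mapping.keys f \<subseteq> K" "P 0"
    and "\<And>u c g. \<lbrakk>u \<in> K; Poly_Mapping.keys g \<subseteq> K; P g\<rbrakk> \<Longrightarrow> P (Poly_Mapping.single u c + g)"
  shows "P f"
proof -
  have "P (\<Sum>u\<in>S. Poly_Mapping.single u (Poly_Mapping.lookup f u)) \<and>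
      Poly_Mapping.keys (\<Sum>u\<in>S. Poly_Mapping.single u (Poly_Mapping.lookup f u)) \<subseteq> K"
    if "finite S" "S \<subseteq> Poly_Mapping.keys f" for S
    using that
  proof (induction S)
    case (insert u S)
    let ?g = "\<Sum>u\<in>S. Poly_Mapping.single u (Poly_Mapping.lookup f u)"
    have *: "u \<in> K" "P ?g" "Poly_Mapping.keys ?g \<subseteq> K" using insert assms(1) by auto
    have "Poly_Mapping.keys (Poly_Mapping.single u (Poly_Mapping.lookup f u) + ?g) \<subseteq> K"
      by (rule order_trans[OF keys_add]) (use * in auto)
    then show ?case using insert(1,2) assms(3)[OF *(1,3,2)] by simp
  qed (simp add: assms(2))
  from this[of "Poly_Mapping.keys f"] show ?thesis using pm_sum[of f] by simp
qed

lemmas pm_induct' = pm_induct[OF subset_UNIV, case_names zero add]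

lemma lookup_scale [simp]:
  "Poly_Mapping.lookup (Poly_Mapping.map ((*) c) f) u = c * Poly_Mapping.lookup f u" for c :: complex
  by (simp add: Poly_Mapping.map.rep_eq when_def)

lemma keys_scale: "Poly_Mapping.keys (Poly_Mapping.map ((*) c) f) \<subseteq> Poly_Mapping.keys f" for c :: complex
  by (auto simp: in_keys_iff)

lemma scale_mult_left:
  "Poly_Mapping.map ((*) c) f * g = Poly_Mapping.map ((*) c) (f * g)" for c :: complex
  by (simp add: mult_map_scale_conv_mult mult.assoc)

lemma scale_single [simp]:
  "Poly_Mapping.map ((*) c) (Poly_Mapping.single u d) = Poly_Mapping.single u (c * d)" for c :: complex
  by (rule poly_mapping_eqI) (simp add: lookup_single when_def)

lemma scale_add:
  "Poly_Mapping.map ((*) c) (f + g) = Poly_Mapping.map ((*) c) f + Poly_Mapping.map ((*) c) g" for c :: complex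
  by (rule poly_mapping_eqI) (simp add: lookup_add algebra_simps)

lemma scale_zero [simp]: "Poly_Mapping.map ((*) c) 0 = 0" for c :: complex
  by (rule poly_mapping_eqI) simp

lemma single_scale_commute:
  "f * Poly_Mapping.single 0 c = Poly_Mapping.single 0 c * f" for c :: complex
  by (induction f rule: pm_induct') (simp_all add: algebra_simps mult_single)

lemma scale_mult_right:
  "f * Poly_Mapping.map ((*) c) g = Poly_Mapping.map ((*) c) (f * g)" for c :: complex
  by (simp add: mult_map_scale_conv_mult single_scale_commute flip: mult.assoc)

lemma lookup_free_star [simp]:
  "Poly_Mapping.lookup (free_star f) u = cnj (Poly_Mapping.lookup f (word_star u))"
  by transfer simp

lemma free_star_add: "free_star (f + g) = free_star f + free_star g"
  by (rule poly_mapping_eqI) (simp add: lookup_add)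

lemma free_star_single [simp]:
  "free_star (Poly_Mapping.single u c) = Poly_Mapping.single (word_star u) (cnj c)"
  by (rule poly_mapping_eqI) (auto simp: lookup_single when_def)

lemma free_star_zero [simp]: "free_star 0 = 0"
  by (rule poly_mapping_eqI) simp

lemma free_star_free_star [simp]: "free_star (free_star f) = f"
  by (rule poly_mapping_eqI) simp

lemma word_star_add: "word_star (u + v) = word_star v + word_star u"
  by (simp add: word_star_def plus_star_word_def)

lemma free_star_mult: "free_star (f * g) = free_star g * free_star f"
proof (induction f rule: pm_induct')
  case (add u c f)
  have "free_star (Poly_Mapping.single u c * g) = free_star g * free_star (Poly_Mapping.single u c)"
    by (induction g rule: pm_induct')
      (simp_all add: algebra_simps mult_single free_star_add word_star_add)
  then show ?case using add by (simp add: algebra_simps free_star_add)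
qed simp_all

definition words :: "'g set \<Rightarrow> 'g star_word set" where
  "words G = {u. letters u \<noteq> [] \<and> fst ` set (letters u) \<subseteq> G}"

lemma words_add: "\<lbrakk>u \<in> words G; v \<in> words G\<rbrakk> \<Longrightarrow> u + v \<in> words G"
  by (auto simp: words_def plus_star_word_def)

lemma words_star [simp]: "word_star u \<in> words G \<longleftrightarrow> u \<in> words G"
  by (force simp: words_def word_star_def image_iff)

lemma F_simps:
  "carrier (free_star_algebra G) = {f. Poly_Mapping.keys f \<subseteq> words G}"
  "mult (free_star_algebra G) = (*)"
  "zero (free_star_algebra G) = 0"
  "add (free_star_algebra G) = (+)"
  "smult (free_star_algebra G) = (\<lambda>c. Poly_Mapping.map ((*) c))"
  "star (free_star_algebra G) = free_star"
  by (auto simp: free_star_algebra_def words_def)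

lemma F_star_algebra: "star_algebra (free_star_algebra G)"
proof (rule star_algebra.intro)
  have add: "Poly_Mapping.keys (f + g) \<subseteq> words G"
    if "Poly_Mapping.keys f \<subseteq> words G" "Poly_Mapping.keys g \<subseteq> words G"
    for f g :: "'a star_word \<Rightarrow>\<^sub>0 complex"
    using keys_add[of f g] that by blast
  have mult: "Poly_Mapping.keys (f * g) \<subseteq> words G"
    if "Poly_Mapping.keys f \<subseteq> words G" "Poly_Mapping.keys g \<subseteq> words G"
    for f g :: "'a star_word \<Rightarrow>\<^sub>0 complex"
    using keys_mult[of f g] that by (auto dest!: subsetD intro!: words_add)
  have scale: "Poly_Mapping.keys (Poly_Mapping.map ((*) c) f) \<subseteq> words G"
    if "Poly_Mapping.keys f \<subseteq> words G" for c and f :: "'a star_word \<Rightarrow>\<^sub>0 complex"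
    using keys_scale[of c f] that by blast
  have star: "Poly_Mapping.keys (free_star f) \<subseteq> words G"
    if "Poly_Mapping.keys f \<subseteq> words G" for f :: "'a star_word \<Rightarrow>\<^sub>0 complex"
  proof
    fix u assume "u \<in> Poly_Mapping.keys (free_star f)"
    then have "word_star u \<in> Poly_Mapping.keys f" by (simp add: in_keys_iff)
    then show "u \<in> words G" using that words_star by blast
  qed
  show "Module.module complex_ring (free_star_algebra G)"
  proof (rule complex_moduleI)
    fix f assume "f \<in> carrier (free_star_algebra G)"
    show "(-1) \<odot>\<^bsub>free_star_algebra G\<^esub> f \<oplus>\<^bsub>free_star_algebra G\<^esub> f = \<zero>\<^bsub>free_star_algebra G\<^esub>"
      by (rule poly_mapping_eqI) (simp add: F_simps lookup_add)
  next
    fix c d and f assume "f \<in> carrier (free_star_algebra G)"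
    show "(c + d) \<odot>\<^bsub>free_star_algebra G\<^esub> f =
        c \<odot>\<^bsub>free_star_algebra G\<^esub> f \<oplus>\<^bsub>free_star_algebra G\<^esub> d \<odot>\<^bsub>free_star_algebra G\<^esub> f"
      "(c * d) \<odot>\<^bsub>free_star_algebra G\<^esub> f = c \<odot>\<^bsub>free_star_algebra G\<^esub> (d \<odot>\<^bsub>free_star_algebra G\<^esub> f)"
      "1 \<odot>\<^bsub>free_star_algebra G\<^esub> f = f"
      by (rule poly_mapping_eqI, simp add: F_simps lookup_add algebra_simps)+
  qed (simp_all add: F_simps add scale scale_add add_ac)
  show "star_algebra_axioms (free_star_algebra G)"
  proof
    fix c f assume "f \<in> carrier (free_star_algebra G)"
    show "star (free_star_algebra G) (c \<odot>\<^bsub>free_star_algebra G\<^esub> f) =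
        cnj c \<odot>\<^bsub>free_star_algebra G\<^esub> star (free_star_algebra G) f"
      by (rule poly_mapping_eqI) (simp add: F_simps)
  qed (simp_all add: F_simps mult star free_star_add free_star_mult scale_mult_left scale_mult_right
      algebra_simps)
qed

lemma free_gen_closed: "g \<in> G \<Longrightarrow> free_gen g \<in> carrier (free_star_algebra G)"
  by (simp add: F_simps free_gen_def words_def)

subsection \<open>Homomorphisms\<close>

lemma star_homD:
  assumes "star_hom A B \<phi>"
  shows "\<And>x. x \<in> carrier A \<Longrightarrow> \<phi> x \<in> carrier B"
    and "\<And>x y. \<lbrakk>x \<in> carrier A; y \<in> carrier A\<rbrakk> \<Longrightarrow> \<phi> (x \<oplus>\<^bsub>A\<^esub> y) = \<phi> x \<oplus>\<^bsub>B\<^esub> \<phi> y"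
    and "\<And>c x. x \<in> carrier A \<Longrightarrow> \<phi> (c \<odot>\<^bsub>A\<^esub> x) = c \<odot>\<^bsub>B\<^esub> \<phi> x"
    and "\<And>x y. \<lbrakk>x \<in> carrier A; y \<in> carrier A\<rbrakk> \<Longrightarrow> \<phi> (x \<otimes>\<^bsub>A\<^esub> y) = \<phi> x \<otimes>\<^bsub>B\<^esub> \<phi> y"
    and "\<And>x. x \<in> carrier A \<Longrightarrow> \<phi> (star A x) = star B (\<phi> x)"
  using assms by (auto simp: star_hom_def)

locale star_hom_pair = A: star_algebra A + B: star_algebra B
  for A :: "('a, 'm) star_algebra_scheme" and B :: "('b, 'n) star_algebra_scheme" +
  fixes \<phi> assumes hom: "star_hom A B \<phi>"
begin

lemmas hom_simps = star_homD[OF hom]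

lemma hom_zero: "\<phi> \<zero>\<^bsub>A\<^esub> = \<zero>\<^bsub>B\<^esub>"
  using hom_simps(3)[of "\<zero>\<^bsub>A\<^esub>" 0] hom_simps(1)[of "\<zero>\<^bsub>A\<^esub>"]
  by (simp add: A.complex_smult_distr B.complex_smult_distr)

lemma hom_minus: "\<lbrakk>x \<in> carrier A; y \<in> carrier A\<rbrakk> \<Longrightarrow> \<phi> (x \<ominus>\<^bsub>A\<^esub> y) = \<phi> x \<ominus>\<^bsub>B\<^esub> \<phi> y"
  by (simp add: A.M.minus_eq A.minus_conv B.M.minus_eq B.minus_conv hom_simps)

lemma hom_finsum:
  assumes "f \<in> S \<rightarrow> carrier A"
  shows "\<phi> (finsum A f S) = finsum B (\<lambda>i. \<phi> (f i)) S"
proof (cases "finite S")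
  case True
  then show ?thesis using assms
  proof (induction S)
    case (insert i S)
    then have "f \<in> S \<rightarrow> carrier A" "f i \<in> carrier A" by auto
    with insert show ?case
      by (simp add: A.M.finsum_insert B.M.finsum_insert hom_simps Pi_iff)
  qed (simp add: hom_zero)
qed (simp add: hom_zero A.M.finsum_infinite B.M.finsum_infinite)

lemma CK_relations_hom:
  assumes \<Lambda>: "kgraph \<Lambda>" and t: "t \<in> mor \<Lambda> \<rightarrow> carrier A"
  shows "CK_relations \<Lambda> A (\<lambda>a b. \<phi> a = \<phi> b) t \<longleftrightarrow> CK_relations \<Lambda> B (=) (\<lambda>\<mu>. \<phi> (t \<mu>))"
proof -
  have t': "t \<mu> \<in> carrier A" if "\<mu> \<in> mor \<Lambda>" for \<mu> using t that by auto
  have v: "t v \<in> carrier A" if "v \<in> verts \<Lambda>" for v using t' that by (auto simp: verts_def)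
  have fs: "\<phi> (\<Oplus>\<^bsub>A\<^esub>\<kappa>\<in>{\<kappa> \<in> mor \<Lambda>. rng \<Lambda> \<kappa> = v \<and> deg \<Lambda> \<kappa> = n}. t \<kappa> \<otimes>\<^bsub>A\<^esub> star A (t \<kappa>)) =
      (\<Oplus>\<^bsub>B\<^esub>\<kappa>\<in>{\<kappa> \<in> mor \<Lambda>. rng \<Lambda> \<kappa> = v \<and> deg \<Lambda> \<kappa> = n}. \<phi> (t \<kappa>) \<otimes>\<^bsub>B\<^esub> star B (\<phi> (t \<kappa>)))" for v n
    by (subst hom_finsum) (auto simp: t' hom_simps intro!: B.M.finsum_cong')
  show ?thesis
    unfolding CK_relations_def by (simp add: t' v hom_simps hom_zero fs)
qed

lemma seminorm_hom:
  assumes "cstar_seminorm B p"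
  shows "cstar_seminorm A (\<lambda>x. p (\<phi> x))"
  using assms unfolding cstar_seminorm_def by (simp add: hom_simps)

end

lemma (in cstar_seminormed) const_hom: "star_hom A C (\<lambda>a. cls (\<lambda>_. a))"
  by (simp add: star_hom_def C_add C_mult C_smult C_star)

lemma (in cstar_seminormed) const_eq_iff:
  "\<lbrakk>a \<in> carrier A; b \<in> carrier A\<rbrakk> \<Longrightarrow> cls (\<lambda>_. a) = cls (\<lambda>_. b) \<longleftrightarrow> p (a \<ominus> b) = 0"
  by (simp add: cls_eq_iff null_def LIMSEQ_const_iff)

subsection \<open>Evaluation of the free algebra\<close>

context star_algebra
begin

definition ev_letter :: "('g \<Rightarrow> 'a) \<Rightarrow> 'g \<times> bool \<Rightarrow> 'a" where
  "ev_letter t l = (if snd l then star A (t (fst l)) else t (fst l))"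

lemma smult_commute: "x \<in> carrier A \<Longrightarrow> c \<odot> (d \<odot> x) = d \<odot> (c \<odot> x)"
  by (simp add: mult.commute flip: complex_smult_distr(3))

fun ev_word :: "('g \<Rightarrow> 'a) \<Rightarrow> ('g \<times> bool) list \<Rightarrow> 'a" where
  "ev_word t [] = \<zero>"
| "ev_word t [l] = ev_letter t l"
| "ev_word t (l # m # w) = ev_letter t l \<otimes> ev_word t (m # w)"

definition ev :: "('g \<Rightarrow> 'a) \<Rightarrow> ('g star_word \<Rightarrow>\<^sub>0 complex) \<Rightarrow> 'a" where
  "ev t f = (\<Oplus>u\<in>Poly_Mapping.keys f. Poly_Mapping.lookup f u \<odot> ev_word t (letters u))"

context
  fixes G :: "'g set" and t :: "'g \<Rightarrow> 'a"
  assumes t: "t \<in> G \<rightarrow> carrier A"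
begin

lemma ev_letter_closed: "fst l \<in> G \<Longrightarrow> ev_letter t l \<in> carrier A"
  using t by (auto simp: ev_letter_def)

lemma ev_word_closed: "fst ` set w \<subseteq> G \<Longrightarrow> ev_word t w \<in> carrier A"
  by (induction w rule: induct_list012) (auto intro: ev_letter_closed)

lemma ev_word_Cons: "w \<noteq> [] \<Longrightarrow> ev_word t (l # w) = ev_letter t l \<otimes> ev_word t w"
  by (cases w) auto

lemma ev_word_append:
  "\<lbrakk>v \<noteq> []; w \<noteq> []; fst ` set v \<subseteq> G; fst ` set w \<subseteq> G\<rbrakk> \<Longrightarrow>
    ev_word t (v @ w) = ev_word t v \<otimes> ev_word t w"
proof (induction v)
  case (Cons l v)
  then show ?case
    by (cases "v = []") (simp_all add: ev_word_Cons mult_assoc ev_letter_closed ev_word_closed)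
qed simp

lemma ev_word_star:
  "fst ` set w \<subseteq> G \<Longrightarrow> ev_word t (rev (map (\<lambda>(g, b). (g, \<not> b)) w)) = star A (ev_word t w)"
proof (induction w)
  case (Cons l w)
  have l: "ev_letter t (case l of (g, b) \<Rightarrow> (g, \<not> b)) = star A (ev_letter t l)"
    using Cons t by (auto simp: ev_letter_def Pi_iff split: prod.splits)
  show ?case
  proof (cases "w = []")
    case False
    have "ev_word t (rev (map (\<lambda>(g, b). (g, \<not> b)) w) @ [case l of (g, b) \<Rightarrow> (g, \<not> b)]) =
        ev_word t (rev (map (\<lambda>(g, b). (g, \<not> b)) w)) \<otimes> ev_word t [case l of (g, b) \<Rightarrow> (g, \<not> b)]"
      using False Cons.prems by (intro ev_word_append) (auto split: prod.splits)
    then show ?thesis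
      using False Cons l by (simp add: ev_word_Cons star_mult ev_letter_closed ev_word_closed)
  qed (simp add: l)
qed simp

lemma ev_words_closed: "u \<in> words G \<Longrightarrow> ev_word t (letters u) \<in> carrier A"
  by (simp add: words_def ev_word_closed)

lemma ev_closed: "Poly_Mapping.keys f \<subseteq> words G \<Longrightarrow> ev t f \<in> carrier A"
  unfolding ev_def by (rule M.finsum_closed) (auto intro!: complex_smult_closed ev_words_closed)

lemma ev_superset:
  assumes "Poly_Mapping.keys f \<subseteq> S" "finite S" "S \<subseteq> words G"
  shows "ev t f = (\<Oplus>u\<in>S. Poly_Mapping.lookup f u \<odot> ev_word t (letters u))"
  unfolding ev_def
  by (rule M.add.finprod_mono_neutral_cong_left)
    (use assms in \<open>auto simp: in_keys_iff complex_smult_distr subset_iff ev_words_closed\<close>)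

lemma ev_add:
  assumes "Poly_Mapping.keys f \<subseteq> words G" "Poly_Mapping.keys g \<subseteq> words G"
  shows "ev t (f + g) = ev t f \<oplus> ev t g"
proof -
  let ?S = "Poly_Mapping.keys f \<union> Poly_Mapping.keys g"
  have S: "finite ?S" "?S \<subseteq> words G" using assms by auto
  have c: "\<And>u. u \<in> ?S \<Longrightarrow> ev_word t (letters u) \<in> carrier A"
    using S by (blast intro: ev_words_closed)
  have "ev t (f + g) = (\<Oplus>u\<in>?S. Poly_Mapping.lookup (f + g) u \<odot> ev_word t (letters u))"
    using keys_add[of f g] S by (intro ev_superset) auto
  also have "\<dots> = (\<Oplus>u\<in>?S. Poly_Mapping.lookup f u \<odot> ev_word t (letters u) \<oplus>
      Poly_Mapping.lookup g u \<odot> ev_word t (letters u))"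
    using c by (intro M.finsum_cong') (auto simp: lookup_add complex_smult_distr)
  also have "\<dots> = (\<Oplus>u\<in>?S. Poly_Mapping.lookup f u \<odot> ev_word t (letters u)) \<oplus>
      (\<Oplus>u\<in>?S. Poly_Mapping.lookup g u \<odot> ev_word t (letters u))"
    using c by (intro M.finsum_addf) auto
  also have "\<dots> = ev t f \<oplus> ev t g"
    using S by (simp add: ev_superset[where S = ?S])
  finally show ?thesis .
qed

lemma ev_single: "u \<in> words G \<Longrightarrow> ev t (Poly_Mapping.single u c) = c \<odot> ev_word t (letters u)"
  using ev_superset[of "Poly_Mapping.single u c" "{u}"] ev_words_closed[of u]
  by (simp add: M.finsum_insert)

lemma ev_zero: "ev t 0 = \<zero>"
  by (simp add: ev_def)

lemma keys_single_words: "u \<in> words G \<Longrightarrow> Poly_Mapping.keys (Poly_Mapping.single u (c :: complex)) \<subseteq> words G"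
  by simp

lemma ev_scale:
  assumes "Poly_Mapping.keys f \<subseteq> words G"
  shows "ev t (Poly_Mapping.map ((*) c) f) = c \<odot> ev t f"
  using assms
proof (induction f rule: pm_induct)
  case (add u d g)
  have "Poly_Mapping.keys (Poly_Mapping.map ((*) c) g) \<subseteq> words G"
    using keys_scale[of c g] add by blast
  then show ?case
    using add ev_words_closed[of u] ev_closed[of g]
    by (simp add: scale_add ev_add ev_single complex_smult_distr keys_single_words)
qed (simp add: ev_zero complex_smult_distr)

lemma ev_mult:
  assumes "Poly_Mapping.keys f \<subseteq> words G" "Poly_Mapping.keys g \<subseteq> words G"
  shows "ev t (f * g) = ev t f \<otimes> ev t g"
proof -
  interpret F: star_algebra "free_star_algebra G" by (rule F_star_algebra)
  have mult: "Poly_Mapping.keys (f * g) \<subseteq> words G"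
    if "Poly_Mapping.keys f \<subseteq> words G" "Poly_Mapping.keys g \<subseteq> words G"
    for f g :: "'g star_word \<Rightarrow>\<^sub>0 complex"
    using F.mult_closed[of f g] that by (simp add: F_simps)
  have 1: "ev t (Poly_Mapping.single u c * g) = ev t (Poly_Mapping.single u c) \<otimes> ev t g"
    if u: "u \<in> words G" and g: "Poly_Mapping.keys g \<subseteq> words G" for u c g
    using g
  proof (induction g rule: pm_induct)
    case (add v d g)
    have w: "ev_word t (letters (u + v)) = ev_word t (letters u) \<otimes> ev_word t (letters v)"
      using u add(1) by (auto simp: words_def plus_star_word_def intro!: ev_word_append)
    have "ev t (Poly_Mapping.single u c * (Poly_Mapping.single v d + g)) =
        ev t (Poly_Mapping.single (u + v) (c * d)) \<oplus> ev t (Poly_Mapping.single u c * g)"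
      using ev_add[OF keys_single_words[OF words_add[OF u add(1)]] mult[OF keys_single_words[OF u] add(2)],
          of "c * d" c]
      by (simp add: mult_single algebra_simps)
    then show ?case
      using u add ev_words_closed[of u] ev_words_closed[of v] ev_closed[of g]
        smult_commute[of "ev_word t (letters u) \<otimes> ev_word t (letters v)" c d]
      by (simp add: ev_single words_add w ev_add mult_r_distr smult_mult_left smult_mult_right
          complex_smult_distr keys_single_words)
  qed (use u in \<open>simp add: ev_zero ev_closed\<close>)
  show ?thesis using assms(1)
  proof (induction f rule: pm_induct)
    case (add u c f)
    have "ev t ((Poly_Mapping.single u c + f) * g) =
        ev t (Poly_Mapping.single u c * g) \<oplus> ev t (f * g)"
      using ev_add[OF mult[OF keys_single_words[OF add(1)] assms(2)] mult[OF add(2) assms(2)], of c]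
      by (simp add: algebra_simps)
    then show ?case
      using add assms(2) by (simp add: 1 ev_add mult_l_distr ev_closed)
  qed (use assms(2) in \<open>simp add: ev_zero ev_closed\<close>)
qed

lemma ev_star:
  assumes "Poly_Mapping.keys f \<subseteq> words G"
  shows "ev t (free_star f) = star A (ev t f)"
  using assms
proof (induction f rule: pm_induct)
  case (add u c f)
  interpret F: star_algebra "free_star_algebra G" by (rule F_star_algebra)
  have "Poly_Mapping.keys (free_star f) \<subseteq> words G"
    using F.star_closed[of f] add by (simp add: F_simps)
  moreover have "ev_word t (letters (word_star u)) = star A (ev_word t (letters u))"
    using add(1) by (simp add: word_star_def words_def ev_word_star)
  ultimately show ?case
    using add ev_words_closed[of u] ev_closed[of f]
    by (simp add: free_star_add ev_add ev_single star_add star_smult keys_single_words)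
qed (simp add: ev_zero)

lemma ev_hom: "star_hom (free_star_algebra G) A (ev t)"
  unfolding star_hom_def by (auto simp: F_simps ev_closed ev_add ev_scale ev_mult ev_star)

lemma ev_gen: "g \<in> G \<Longrightarrow> ev t (free_gen g) = t g"
  using t by (auto simp: free_gen_def ev_single words_def ev_letter_def complex_smult_distr Pi_iff)

end

end

subsection \<open>The universal seminorm\<close>

lemma (in kgraph) src_verts: "\<mu> \<in> mor \<Lambda> \<Longrightarrow> src \<Lambda> \<mu> \<in> verts \<Lambda>"
  using rng_src_src[of \<mu>] src_closed[of \<mu>] by (simp add: verts_def)

lemma CK_seminorms_iff:
  "p \<in> CK_seminorms \<Lambda> \<longleftrightarrow> cstar_seminorm (free_star_algebra (mor \<Lambda>)) p \<and>
     CK_relations \<Lambda> (free_star_algebra (mor \<Lambda>)) (\<lambda>a b. p (a \<ominus>\<^bsub>free_star_algebra (mor \<Lambda>)\<^esub> b) = 0) free_gen"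
  by (simp add: CK_seminorms_def Let_def)

context kgraph
begin

abbreviation "F \<equiv> free_star_algebra (mor \<Lambda>)"

lemma CK_seminorm_gen:
  assumes p: "p \<in> CK_seminorms \<Lambda>" and \<mu>: "\<mu> \<in> mor \<Lambda>"
  shows "p (free_gen \<mu>) \<le> 1"
proof -
  interpret cstar_seminormed F p
    using p by (intro cstar_seminormed.intro F_star_algebra cstar_seminormed_axioms.intro)
      (simp add: CK_seminorms_iff)
  have "CK_relations \<Lambda> F (\<lambda>a b. p (a \<ominus>\<^bsub>F\<^esub> b) = 0) free_gen"
    using p by (simp add: CK_seminorms_iff)
  note rel = this[unfolded CK_relations_def]
  have eq: "p a = p b" if "p (a \<ominus>\<^bsub>F\<^esub> b) = 0" "a \<in> carrier F" "b \<in> carrier F" for a b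
    using p_reverse[of a b] that by simp
  have v: "p (free_gen v) \<le> 1" if v: "v \<in> verts \<Lambda>" for v
  proof -
    let ?v = "free_gen v"
    have vc: "?v \<in> carrier F" using v by (simp add: verts_def free_gen_closed)
    have 0: "p (star F ?v \<ominus>\<^bsub>F\<^esub> ?v) = 0" "p (?v \<otimes>\<^bsub>F\<^esub> ?v \<ominus>\<^bsub>F\<^esub> ?v) = 0"
      using rel[THEN conjunct1, rule_format, OF v] by (rule conjunct1, rule conjunct2)
    have "p (star F ?v \<otimes>\<^bsub>F\<^esub> ?v \<ominus>\<^bsub>F\<^esub> ?v \<otimes>\<^bsub>F\<^esub> ?v) \<le> 0"
      using p_mult_diff[of "star F ?v" ?v ?v ?v] vc 0 p_minus_commute[of ?v ?v]
      by (simp add: M.minus_eq M.r_neg)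
    then have "(p ?v)\<^sup>2 = p (?v \<otimes>\<^bsub>F\<^esub> ?v)"
      using eq[of "star F ?v \<otimes>\<^bsub>F\<^esub> ?v" "?v \<otimes>\<^bsub>F\<^esub> ?v"] vc p_star_mult[of ?v]
      by (simp add: antisym)
    also have "\<dots> = p ?v" using eq[OF 0(2)] vc by simp
    finally show ?thesis by (cases "p ?v = 0") (auto simp: power2_eq_square)
  qed
  have \<mu>c: "free_gen \<mu> \<in> carrier F" "free_gen (src \<Lambda> \<mu>) \<in> carrier F"
    using \<mu> src_closed by (auto simp: free_gen_closed)
  have "p (star F (free_gen \<mu>) \<otimes>\<^bsub>F\<^esub> free_gen \<mu> \<ominus>\<^bsub>F\<^esub> free_gen (src \<Lambda> \<mu>)) = 0"
    using rel[THEN conjunct2, THEN conjunct2, THEN conjunct2, THEN conjunct1] \<mu> by (rule bspec)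
  from eq[OF this] have "(p (free_gen \<mu>))\<^sup>2 \<le> 1"
    using \<mu>c v[OF src_verts[OF \<mu>]] by (simp add: p_star_mult)
  then have "\<bar>p (free_gen \<mu>)\<bar> \<le> 1" by (simp only: abs_square_le_1)
  then show ?thesis by linarith
qed

definition ell1 :: "('e star_word \<Rightarrow>\<^sub>0 complex) \<Rightarrow> real" where
  "ell1 f = (\<Sum>u\<in>Poly_Mapping.keys f. cmod (Poly_Mapping.lookup f u))"

lemma CK_seminorm_le:
  assumes p: "p \<in> CK_seminorms \<Lambda>" and f: "f \<in> carrier F"
  shows "p f \<le> ell1 f"
proof -
  interpret cstar_seminormed F p
    using p by (intro cstar_seminormed.intro F_star_algebra cstar_seminormed_axioms.intro)
      (simp add: CK_seminorms_iff)
  have l: "p (Poly_Mapping.single (Star_Word [(\<mu>, b)]) 1) \<le> 1" if \<mu>: "\<mu> \<in> mor \<Lambda>" for \<mu> b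
  proof (cases b)
    case True
    have "Poly_Mapping.single (Star_Word [(\<mu>, b)]) 1 = star F (free_gen \<mu>)"
      using True by (simp add: F_simps free_gen_def word_star_def)
    then show ?thesis using CK_seminorm_gen[OF p \<mu>] p_star[of "free_gen \<mu>"] free_gen_closed[OF \<mu>] by simp
  next
    case False
    then show ?thesis using CK_seminorm_gen[OF p \<mu>] by (simp add: free_gen_def)
  qed
  have w: "p (Poly_Mapping.single (Star_Word w) 1) \<le> 1" if "w \<noteq> []" "fst ` set w \<subseteq> mor \<Lambda>" for w
    using that
  proof (induction w)
    case (Cons a w)
    obtain \<mu> b where a: "a = (\<mu>, b)" by (cases a)
    show ?case
    proof (cases "w = []")
      case False
      let ?a = "Poly_Mapping.single (Star_Word [a]) (1 :: complex)"
      let ?w = "Poly_Mapping.single (Star_Word w) (1 :: complex)"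
      have "Poly_Mapping.single (Star_Word (a # w)) 1 = ?a \<otimes>\<^bsub>F\<^esub> ?w"
        by (simp add: F_simps mult_single plus_star_word_def)
      moreover have c: "?a \<in> carrier F" "?w \<in> carrier F"
        using Cons.prems False by (auto simp: F_simps words_def)
      moreover have "p ?a * p ?w \<le> 1 * 1"
        using Cons False l[of \<mu> b] a c by (intro mult_mono) auto
      ultimately show ?thesis using p_mult[of ?a ?w] by simp
    qed (use a l Cons in auto)
  qed simp
  have s: "p (Poly_Mapping.single u c) \<le> cmod c" if "u \<in> words (mor \<Lambda>)" for u c
  proof -
    have "Poly_Mapping.single u c = c \<odot>\<^bsub>F\<^esub> Poly_Mapping.single u 1" by (simp add: F_simps)
    moreover have "Poly_Mapping.single u 1 \<in> carrier F" using that by (simp add: F_simps)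
    moreover have "p (Poly_Mapping.single u 1) \<le> 1"
      using that w[of "letters u"] by (simp add: words_def)
    ultimately show ?thesis by (simp add: p_smult mult_left_le)
  qed
  have "p (\<Sum>u\<in>S. Poly_Mapping.single u (Poly_Mapping.lookup f u)) \<le> (\<Sum>u\<in>S. cmod (Poly_Mapping.lookup f u)) \<and>
      (\<Sum>u\<in>S. Poly_Mapping.single u (Poly_Mapping.lookup f u)) \<in> carrier F"
    if "finite S" "S \<subseteq> Poly_Mapping.keys f" for S
    using that
  proof (induction S)
    case empty
    then show ?case using p_zero M.zero_closed by (simp add: F_simps)
  next
    case (insert u S)
    let ?u = "Poly_Mapping.single u (Poly_Mapping.lookup f u)"
    let ?g = "\<Sum>u\<in>S. Poly_Mapping.single u (Poly_Mapping.lookup f u)"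
    have u: "u \<in> words (mor \<Lambda>)" using insert f by (auto simp: F_simps)
    then have c: "?u \<in> carrier F" "?g \<in> carrier F" using insert by (auto simp: F_simps)
    have "p (?u \<oplus>\<^bsub>F\<^esub> ?g) \<le> p ?u + p ?g" using p_add c by blast
    moreover have "?u \<oplus>\<^bsub>F\<^esub> ?g \<in> carrier F" using c by (rule M.a_closed)
    ultimately show ?case
      using insert s[OF u, of "Poly_Mapping.lookup f u"] by (simp add: F_simps)
  qed
  from this[of "Poly_Mapping.keys f"] show ?thesis by (simp add: ell1_def flip: pm_sum)
qed

lemma zero_CK_seminorm: "(\<lambda>f. 0) \<in> CK_seminorms \<Lambda>"
  by (simp add: CK_seminorms_iff cstar_seminorm_def CK_relations_def)

lemma CK_bdd: "f \<in> carrier F \<Longrightarrow> bdd_above ((\<lambda>p. p f) ` CK_seminorms \<Lambda>)"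
  by (rule bdd_aboveI[of _ "ell1 f"]) (auto intro: CK_seminorm_le)

lemma CK_norm_ge: "\<lbrakk>p \<in> CK_seminorms \<Lambda>; f \<in> carrier F\<rbrakk> \<Longrightarrow> p f \<le> CK_norm \<Lambda> f"
  unfolding CK_norm_def by (rule cSUP_upper) (auto intro: CK_bdd)

lemma CK_norm_le:
  "(\<And>p. p \<in> CK_seminorms \<Lambda> \<Longrightarrow> p f \<le> c) \<Longrightarrow> CK_norm \<Lambda> f \<le> c"
  unfolding CK_norm_def by (rule cSUP_least) (use zero_CK_seminorm in auto)

lemma CK_norm_nonneg: "f \<in> carrier F \<Longrightarrow> 0 \<le> CK_norm \<Lambda> f"
  using CK_norm_ge[OF zero_CK_seminorm] .

lemma CK_norm_seminorm: "cstar_seminorm F (CK_norm \<Lambda>)"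
proof -
  interpret star_algebra F by (rule F_star_algebra)
  have sn: "cstar_seminormed F p" if "p \<in> CK_seminorms \<Lambda>" for p
    using that by (intro cstar_seminormed.intro F_star_algebra cstar_seminormed_axioms.intro)
      (simp add: CK_seminorms_iff)
  have smult_le: "CK_norm \<Lambda> (c \<odot>\<^bsub>F\<^esub> x) \<le> cmod c * CK_norm \<Lambda> x" if x: "x \<in> carrier F" for c x
  proof (rule CK_norm_le)
    fix p assume p: "p \<in> CK_seminorms \<Lambda>"
    show "p (c \<odot>\<^bsub>F\<^esub> x) \<le> cmod c * CK_norm \<Lambda> x"
      using cstar_seminormed.p_smult[OF sn[OF p] x, of c] CK_norm_ge[OF p x]
      by (simp add: mult_left_mono)
  qed
  show ?thesis
    unfolding cstar_seminorm_def
  proof (intro conjI ballI allI)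
    fix x assume x: "x \<in> carrier F"
    show "0 \<le> CK_norm \<Lambda> x" using CK_norm_nonneg[OF x] .
    show "CK_norm \<Lambda> (c \<odot>\<^bsub>F\<^esub> x) = cmod c * CK_norm \<Lambda> x" for c
    proof (cases "c = 0")
      case True
      then show ?thesis
        using smult_le[OF x, of c] CK_norm_nonneg[of "c \<odot>\<^bsub>F\<^esub> x"] x by simp
    next
      case False
      have "x = inverse c \<odot>\<^bsub>F\<^esub> (c \<odot>\<^bsub>F\<^esub> x)"
        using x False by (simp add: complex_smult_distr(4) flip: complex_smult_distr(3))
      then have "CK_norm \<Lambda> x \<le> cmod (inverse c) * CK_norm \<Lambda> (c \<odot>\<^bsub>F\<^esub> x)"
        using smult_le[of "c \<odot>\<^bsub>F\<^esub> x" "inverse c"] x by simp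
      then have "cmod c * CK_norm \<Lambda> x \<le> CK_norm \<Lambda> (c \<odot>\<^bsub>F\<^esub> x)"
        using False by (simp add: norm_divide field_simps)
      then show ?thesis using smult_le[OF x, of c] by simp
    qed
    show "CK_norm \<Lambda> (star F x \<otimes>\<^bsub>F\<^esub> x) = (CK_norm \<Lambda> x)\<^sup>2"
    proof (rule antisym)
      show "CK_norm \<Lambda> (star F x \<otimes>\<^bsub>F\<^esub> x) \<le> (CK_norm \<Lambda> x)\<^sup>2"
      proof (rule CK_norm_le)
        fix p assume p: "p \<in> CK_seminorms \<Lambda>"
        show "p (star F x \<otimes>\<^bsub>F\<^esub> x) \<le> (CK_norm \<Lambda> x)\<^sup>2"
          using cstar_seminormed.p_star_mult[OF sn[OF p] x] CK_norm_ge[OF p x]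
            cstar_seminormed.p_nonneg[OF sn[OF p] x] by (simp add: power_mono)
      qed
      have "CK_norm \<Lambda> x \<le> sqrt (CK_norm \<Lambda> (star F x \<otimes>\<^bsub>F\<^esub> x))"
      proof (rule CK_norm_le)
        fix p assume p: "p \<in> CK_seminorms \<Lambda>"
        show "p x \<le> sqrt (CK_norm \<Lambda> (star F x \<otimes>\<^bsub>F\<^esub> x))"
          using cstar_seminormed.p_star_mult[OF sn[OF p] x]
            CK_norm_ge[OF p, of "star F x \<otimes>\<^bsub>F\<^esub> x"] x by (simp add: real_le_rsqrt)
      qed
      then show "(CK_norm \<Lambda> x)\<^sup>2 \<le> CK_norm \<Lambda> (star F x \<otimes>\<^bsub>F\<^esub> x)"
        using CK_norm_nonneg[OF x] CK_norm_nonneg[of "star F x \<otimes>\<^bsub>F\<^esub> x"] x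
        by (simp add: sqrt_ge_absD)
    qed
    fix y assume y: "y \<in> carrier F"
    show "CK_norm \<Lambda> (x \<oplus>\<^bsub>F\<^esub> y) \<le> CK_norm \<Lambda> x + CK_norm \<Lambda> y"
    proof (rule CK_norm_le)
      fix p assume p: "p \<in> CK_seminorms \<Lambda>"
      show "p (x \<oplus>\<^bsub>F\<^esub> y) \<le> CK_norm \<Lambda> x + CK_norm \<Lambda> y"
        using cstar_seminormed.p_add[OF sn[OF p] x y] CK_norm_ge[OF p x] CK_norm_ge[OF p y] by linarith
    qed
    show "CK_norm \<Lambda> (x \<otimes>\<^bsub>F\<^esub> y) \<le> CK_norm \<Lambda> x * CK_norm \<Lambda> y"
    proof (rule CK_norm_le)
      fix p assume p: "p \<in> CK_seminorms \<Lambda>"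
      have "p x * p y \<le> CK_norm \<Lambda> x * CK_norm \<Lambda> y"
        using CK_norm_ge[OF p x] CK_norm_ge[OF p y] CK_norm_nonneg[OF x]
          cstar_seminormed.p_nonneg[OF sn[OF p] y] by (intro mult_mono) auto
      then show "p (x \<otimes>\<^bsub>F\<^esub> y) \<le> CK_norm \<Lambda> x * CK_norm \<Lambda> y"
        using cstar_seminormed.p_mult[OF sn[OF p] x y] by linarith
    qed
  qed
qed

lemma CK_norm_0_iff:
  "f \<in> carrier F \<Longrightarrow> CK_norm \<Lambda> f = 0 \<longleftrightarrow> (\<forall>p\<in>CK_seminorms \<Lambda>. p f = 0)"
proof
  assume f: "f \<in> carrier F" and 0: "CK_norm \<Lambda> f = 0"
  show "\<forall>p\<in>CK_seminorms \<Lambda>. p f = 0"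
  proof
    fix p assume p: "p \<in> CK_seminorms \<Lambda>"
    then have "0 \<le> p f" using f by (simp add: CK_seminorms_iff cstar_seminorm_def)
    then show "p f = 0" using CK_norm_ge[OF p f] 0 by simp
  qed
next
  assume f: "f \<in> carrier F" and "\<forall>p\<in>CK_seminorms \<Lambda>. p f = 0"
  then show "CK_norm \<Lambda> f = 0"
    using CK_norm_le[of f 0] CK_norm_nonneg[OF f] by fastforce
qed

lemma CK_norm_CK_seminorm: "CK_norm \<Lambda> \<in> CK_seminorms \<Lambda>"
  unfolding CK_seminorms_iff
proof
  show "cstar_seminorm F (CK_norm \<Lambda>)" by (rule CK_norm_seminorm)
  interpret star_algebra F by (rule F_star_algebra)
  have g: "free_gen \<mu> \<in> carrier F" if "\<mu> \<in> mor \<Lambda>" for \<mu> using that by (rule free_gen_closed)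
  have v: "free_gen v \<in> carrier F" if "v \<in> verts \<Lambda>" for v using that g by (simp add: verts_def)
  have s: "(\<Oplus>\<^bsub>F\<^esub>\<kappa>\<in>{\<kappa> \<in> mor \<Lambda>. rng \<Lambda> \<kappa> = v \<and> deg \<Lambda> \<kappa> = n}.
      free_gen \<kappa> \<otimes>\<^bsub>F\<^esub> star F (free_gen \<kappa>)) \<in> carrier F" for v n
    by (rule M.finsum_closed) (auto simp: g)
  have "CK_relations \<Lambda> F (\<lambda>a b. p (a \<ominus>\<^bsub>F\<^esub> b) = 0) free_gen" if "p \<in> CK_seminorms \<Lambda>" for p
    using that by (simp add: CK_seminorms_iff)
  then show "CK_relations \<Lambda> F (\<lambda>a b. CK_norm \<Lambda> (a \<ominus>\<^bsub>F\<^esub> b) = 0) free_gen"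
    unfolding CK_relations_def by (simp add: CK_norm_0_iff g v s src_closed cmp_closed)
qed

lemma CK_seminormed: "cstar_seminormed F (CK_norm \<Lambda>)"
  by (intro cstar_seminormed.intro F_star_algebra cstar_seminormed_axioms.intro CK_norm_seminorm)

theorem cstar_algebra_kgraph: "cstar_algebra (kgraph_cstar \<Lambda>)"
  unfolding kgraph_cstar_def by (rule cstar_seminormed.cstar_algebra_completion[OF CK_seminormed])

theorem CK_family_kgraph: "CK_family \<Lambda> (kgraph_cstar \<Lambda>) (kgraph_gen \<Lambda>)"
proof -
  interpret K: cstar_seminormed F "CK_norm \<Lambda>" by (rule CK_seminormed)
  interpret P: star_hom_pair F K.C "\<lambda>a. K.cls (\<lambda>_. a)"
    by (intro star_hom_pair.intro F_star_algebra K.C_star_algebra star_hom_pair_axioms.intro K.const_hom)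
  have g: "free_gen \<in> mor \<Lambda> \<rightarrow> carrier F" by (auto intro: free_gen_closed)
  have g': "free_gen \<mu> \<in> carrier F" if "\<mu> \<in> mor \<Lambda>" for \<mu> using that by (rule free_gen_closed)
  have v: "free_gen v \<in> carrier F" if "v \<in> verts \<Lambda>" for v using that g' by (simp add: verts_def)
  have s: "(\<Oplus>\<^bsub>F\<^esub>\<kappa>\<in>{\<kappa> \<in> mor \<Lambda>. rng \<Lambda> \<kappa> = v \<and> deg \<Lambda> \<kappa> = n}.
      free_gen \<kappa> \<otimes>\<^bsub>F\<^esub> star F (free_gen \<kappa>)) \<in> carrier F" for v n
    by (rule K.M.finsum_closed) (auto simp: g')
  have "CK_relations \<Lambda> F (\<lambda>a b. CK_norm \<Lambda> (a \<ominus>\<^bsub>F\<^esub> b) = 0) free_gen"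
    using CK_norm_CK_seminorm by (simp add: CK_seminorms_iff)
  then have "CK_relations \<Lambda> F (\<lambda>a b. K.cls (\<lambda>_. a) = K.cls (\<lambda>_. b)) free_gen"
    unfolding CK_relations_def by (simp add: K.const_eq_iff g' v s src_closed cmp_closed)
  moreover have "kgraph_gen \<Lambda> = (\<lambda>\<mu>. K.cls (\<lambda>_. free_gen \<mu>))"
    by (simp add: kgraph_gen_def fun_eq_iff)
  ultimately show ?thesis
    using P.CK_relations_hom[OF kgraph_axioms g] g'
    by (auto simp: CK_family_def kgraph_cstar_def)
qed

theorem kgraph_cstar_generated:
  assumes S: "norm_closed (kgraph_cstar \<Lambda>) (cnorm (kgraph_cstar \<Lambda>)) S" "\<zero>\<^bsub>kgraph_cstar \<Lambda>\<^esub> \<in> S"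
    and gen: "\<And>\<mu>. \<mu> \<in> mor \<Lambda> \<Longrightarrow> kgraph_gen \<Lambda> \<mu> \<in> S"
    and add: "\<And>a b. \<lbrakk>a \<in> S; b \<in> S\<rbrakk> \<Longrightarrow> a \<oplus>\<^bsub>kgraph_cstar \<Lambda>\<^esub> b \<in> S"
    and smult: "\<And>c a. a \<in> S \<Longrightarrow> c \<odot>\<^bsub>kgraph_cstar \<Lambda>\<^esub> a \<in> S"
    and mult: "\<And>a b. \<lbrakk>a \<in> S; b \<in> S\<rbrakk> \<Longrightarrow> a \<otimes>\<^bsub>kgraph_cstar \<Lambda>\<^esub> b \<in> S"
    and star: "\<And>a. a \<in> S \<Longrightarrow> star (kgraph_cstar \<Lambda>) a \<in> S"
  shows "S = carrier (kgraph_cstar \<Lambda>)"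
proof
  show "S \<subseteq> carrier (kgraph_cstar \<Lambda>)" using S by (simp add: norm_closed_def)
  interpret K: cstar_seminormed F "CK_norm \<Lambda>" by (rule CK_seminormed)
  let ?i = "\<lambda>a. K.cls (\<lambda>_. a)"
  note i = star_homD[OF K.const_hom, folded kgraph_cstar_def]
  have fg: "?i (free_gen \<mu>) \<in> S" if "\<mu> \<in> mor \<Lambda>" for \<mu>
    using gen[OF that] by (simp add: kgraph_gen_def)
  have l: "?i (Poly_Mapping.single (Star_Word [a]) 1) \<in> S" if "fst a \<in> mor \<Lambda>" for a
  proof (cases "snd a")
    case True
    then have "Poly_Mapping.single (Star_Word [a]) 1 = star F (free_gen (fst a))"
      by (cases a) (simp add: F_simps free_gen_def word_star_def)
    then show ?thesis
      using i(5)[of "free_gen (fst a)"] star[OF fg[OF that]] free_gen_closed[OF that] by simp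
  next
    case False
    then have "Poly_Mapping.single (Star_Word [a]) 1 = free_gen (fst a)"
      by (cases a) (simp add: free_gen_def)
    then show ?thesis using fg[OF that] by simp
  qed
  have w: "?i (Poly_Mapping.single (Star_Word w) 1) \<in> S" if "w \<noteq> []" "fst ` set w \<subseteq> mor \<Lambda>" for w
    using that
  proof (induction w)
    case (Cons a w)
    show ?case
    proof (cases "w = []")
      case False
      let ?a = "Poly_Mapping.single (Star_Word [a]) (1 :: complex)"
      let ?w = "Poly_Mapping.single (Star_Word w) (1 :: complex)"
      have "Poly_Mapping.single (Star_Word (a # w)) 1 = ?a \<otimes>\<^bsub>F\<^esub> ?w"
        by (simp add: F_simps mult_single plus_star_word_def)
      moreover have "?a \<in> carrier F" "?w \<in> carrier F"
        using Cons.prems False by (auto simp: F_simps words_def)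
      moreover have "?i ?a \<in> S" "?i ?w \<in> S" using Cons False l by auto
      ultimately show ?thesis using i(4)[of ?a ?w] mult by simp
    qed (use l Cons in auto)
  qed simp
  have f: "?i f \<in> S" if "Poly_Mapping.keys f \<subseteq> words (mor \<Lambda>)" for f
    using that
  proof (induction f rule: pm_induct)
    case zero
    show ?case using S(2) by (simp add: kgraph_cstar_def K.C_sel F_simps)
  next
    case (add u c g)
    let ?u = "Poly_Mapping.single u (1 :: complex)"
    have c: "?u \<in> carrier F" "g \<in> carrier F" using add by (simp_all add: F_simps)
    have "Poly_Mapping.single u c + g = c \<odot>\<^bsub>F\<^esub> ?u \<oplus>\<^bsub>F\<^esub> g" by (simp add: F_simps)
    moreover have "?i (c \<odot>\<^bsub>F\<^esub> ?u \<oplus>\<^bsub>F\<^esub> g) \<in> S"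
      using c i(2)[of "c \<odot>\<^bsub>F\<^esub> ?u" g] i(3)[of ?u c] add w[of "letters u"]
      by (auto simp: words_def intro!: assms(4) smult)
    ultimately show ?case by simp
  qed
  show "carrier (kgraph_cstar \<Lambda>) \<subseteq> S"
  proof
    fix U assume U: "U \<in> carrier (kgraph_cstar \<Lambda>)"
    then obtain X where X: "X \<in> K.CS" "U = K.cls X"
      unfolding kgraph_cstar_def by (rule K.C_cases)
    have XS: "?i (X n) \<in> S" for n
      using f[of "X n"] K.CS_carrier[OF X(1), of n] by (simp add: F_simps)
    have lim: "norm_tendsto (kgraph_cstar \<Lambda>) (cnorm (kgraph_cstar \<Lambda>)) (\<lambda>n. ?i (X n)) U"
      using K.C_const_tendsto[OF X(1)] X(2) by (simp add: kgraph_cstar_def)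
    show "U \<in> S"
      by (rule S(1)[unfolded norm_closed_def, THEN conjunct2, THEN spec, THEN spec, THEN mp,
            OF conjI[OF allI[OF XS] conjI[OF U lim]]])
  qed
qed

theorem kgraph_cstar_universal:
  fixes B :: "('b, 'n) cstar_algebra_scheme"
  assumes "cstar_algebra B" and t: "CK_family \<Lambda> B t"
  shows "\<exists>\<phi>. star_hom (kgraph_cstar \<Lambda>) B \<phi> \<and> (\<forall>\<mu>\<in>mor \<Lambda>. \<phi> (kgraph_gen \<Lambda> \<mu>) = t \<mu>)"
proof -
  interpret K: cstar_seminormed F "CK_norm \<Lambda>" by (rule CK_seminormed)
  interpret B: cstar_algebra B by fact
  interpret N: cstar_seminormed B "cnorm B"
    by (intro cstar_seminormed.intro cstar_seminormed_axioms.intro B.star_algebra_axioms B.cstar_norm)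
  have tc: "t \<in> mor \<Lambda> \<rightarrow> carrier B" using t by (simp add: CK_family_def)
  let ?e = "B.ev t"
  interpret P: star_hom_pair F B ?e
    by (intro star_hom_pair.intro F_star_algebra B.star_algebra_axioms star_hom_pair_axioms.intro
        B.ev_hom[OF tc])
  have e0: "cnorm B (?e a \<ominus>\<^bsub>B\<^esub> ?e b) = 0 \<longleftrightarrow> ?e a = ?e b" if "a \<in> carrier F" "b \<in> carrier F" for a b
  proof -
    have c: "?e a \<in> carrier B" "?e b \<in> carrier B" using that by (simp_all add: P.hom_simps)
    then have "cnorm B (?e a \<ominus>\<^bsub>B\<^esub> ?e b) = 0 \<longleftrightarrow> ?e a \<ominus>\<^bsub>B\<^esub> ?e b = \<zero>\<^bsub>B\<^esub>"
      using B.cnorm_eq_0[of "?e a \<ominus>\<^bsub>B\<^esub> ?e b"] N.p_zero by auto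
    then show ?thesis using B.minus_eq_zero_iff[OF c] by (rule trans)
  qed
  have g': "free_gen \<mu> \<in> carrier F" if "\<mu> \<in> mor \<Lambda>" for \<mu> using that by (rule free_gen_closed)
  have v: "free_gen v \<in> carrier F" if "v \<in> verts \<Lambda>" for v using that g' by (simp add: verts_def)
  have s: "(\<Oplus>\<^bsub>F\<^esub>\<kappa>\<in>{\<kappa> \<in> mor \<Lambda>. rng \<Lambda> \<kappa> = v \<and> deg \<Lambda> \<kappa> = n}.
      free_gen \<kappa> \<otimes>\<^bsub>F\<^esub> star F (free_gen \<kappa>)) \<in> carrier F" for v n
    by (rule K.M.finsum_closed) (auto simp: g')
  have gen: "?e (free_gen \<mu>) = t \<mu>" if "\<mu> \<in> mor \<Lambda>" for \<mu>
    using B.ev_gen[OF tc that] .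
  have "CK_relations \<Lambda> B (=) (\<lambda>\<mu>. ?e (free_gen \<mu>))"
  proof -
    have "(\<Oplus>\<^bsub>B\<^esub>\<kappa>\<in>{\<kappa> \<in> mor \<Lambda>. rng \<Lambda> \<kappa> = v \<and> deg \<Lambda> \<kappa> = n}.
        ?e (free_gen \<kappa>) \<otimes>\<^bsub>B\<^esub> star B (?e (free_gen \<kappa>))) =
      (\<Oplus>\<^bsub>B\<^esub>\<kappa>\<in>{\<kappa> \<in> mor \<Lambda>. rng \<Lambda> \<kappa> = v \<and> deg \<Lambda> \<kappa> = n}. t \<kappa> \<otimes>\<^bsub>B\<^esub> star B (t \<kappa>))" for v n
      using tc by (intro B.M.finsum_cong') (auto simp: gen)
    moreover have "?e (free_gen v) = t v" if "v \<in> verts \<Lambda>" for v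
      using that gen by (simp add: verts_def)
    ultimately show ?thesis
      using t by (simp add: CK_family_def CK_relations_def gen src_closed cmp_closed)
  qed
  then have "CK_relations \<Lambda> F (\<lambda>a b. ?e a = ?e b) free_gen"
    using P.CK_relations_hom[OF kgraph_axioms, of free_gen] g' by auto
  then have "CK_relations \<Lambda> F (\<lambda>a b. cnorm B (?e (a \<ominus>\<^bsub>F\<^esub> b)) = 0) free_gen"
    unfolding CK_relations_def by (simp add: P.hom_minus P.hom_zero e0 g' v s src_closed cmp_closed)
  then have p: "(\<lambda>a. cnorm B (?e a)) \<in> CK_seminorms \<Lambda>"
    using P.seminorm_hom[OF B.cstar_norm] by (simp add: CK_seminorms_iff)
  have le: "cnorm B (?e a \<ominus>\<^bsub>B\<^esub> ?e b) \<le> CK_norm \<Lambda> (a \<ominus>\<^bsub>F\<^esub> b)"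
    if "a \<in> carrier F" "b \<in> carrier F" for a b
    using CK_norm_ge[OF p, of "a \<ominus>\<^bsub>F\<^esub> b"] that by (simp add: P.hom_minus)
  have eCS: "(\<lambda>n. ?e (X n)) \<in> N.CS" if X: "X \<in> K.CS" for X
  proof (rule N.CSI)
    show "?e (X n) \<in> carrier B" for n using X by (intro P.hom_simps) simp
    fix e :: real assume "e > 0"
    then obtain M where M: "\<forall>m\<ge>M. \<forall>n\<ge>M. CK_norm \<Lambda> (X m \<ominus>\<^bsub>F\<^esub> X n) < e" using K.CS_ge[OF X] by blast
    show "\<exists>M. \<forall>m\<ge>M. \<forall>n\<ge>M. cnorm B (?e (X m) \<ominus>\<^bsub>B\<^esub> ?e (X n)) < e"
    proof (intro exI[of _ M] allI impI)
      fix m n assume "m \<ge> M" "n \<ge> M"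
      then have "CK_norm \<Lambda> (X m \<ominus>\<^bsub>F\<^esub> X n) < e" using M by blast
      then show "cnorm B (?e (X m) \<ominus>\<^bsub>B\<^esub> ?e (X n)) < e"
        using le[of "X m" "X n"] X by simp
    qed
  qed
  have enull: "N.null (\<lambda>n. ?e (X n)) (\<lambda>n. ?e (Y n))" if "X \<in> K.CS" "Y \<in> K.CS" "K.null X Y" for X Y
  proof (rule N.null_le)
    show "(\<lambda>n. CK_norm \<Lambda> (X n \<ominus>\<^bsub>F\<^esub> Y n)) \<longlonglongrightarrow> 0" using that(3) by (simp add: K.null_def)
  qed (use that le N.CS_carrier[OF eCS] in auto)
  define R where "R X b \<longleftrightarrow> b \<in> carrier B \<and> N.null (\<lambda>n. ?e (X n)) (\<lambda>_. b)" for X b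
  have ex: "\<exists>b. R X b" if X: "X \<in> K.CS" for X
  proof -
    have "(\<forall>n. ?e (X n) \<in> carrier B) \<and> norm_Cauchy B (cnorm B) (\<lambda>n. ?e (X n))"
      using eCS[OF X] unfolding Cauchy_seqs_def mem_Collect_eq .
    from B.complete[unfolded norm_complete_def, THEN spec, THEN mp, OF this]
    obtain b where "b \<in> carrier B" "norm_tendsto B (cnorm B) (\<lambda>n. ?e (X n)) b" by (rule bexE)
    then show ?thesis unfolding R_def N.null_def norm_tendsto_def by (intro exI[of _ b] conjI)
  qed
  have uniq: "b = b'" if X: "X \<in> K.CS" "Y \<in> K.CS" "K.cls X = K.cls Y" "R X b" "R Y b'" for X Y b b'
  proof -
    have b: "b \<in> carrier B" "b' \<in> carrier B" using X by (auto simp: R_def)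
    have "K.null X Y" using X by (simp add: K.cls_eq_iff)
    note n = enull[OF X(1,2) this]
    have nX: "N.null (\<lambda>n. ?e (X n)) (\<lambda>_. b)" and nY: "N.null (\<lambda>n. ?e (Y n)) (\<lambda>_. b')"
      by (rule conjunct2[OF X(4)[unfolded R_def]], rule conjunct2[OF X(5)[unfolded R_def]])
    note c = eCS[OF X(1)] eCS[OF X(2)] N.CS_const[OF b(1)] N.CS_const[OF b(2)]
    have "N.null (\<lambda>_. b) (\<lambda>_. b')"
      by (rule N.null_trans[OF c(3,2,4) N.null_trans[OF c(3,1,2) N.null_sym[OF c(1,3) nX] n] nY])
    then have "cnorm B (b \<ominus>\<^bsub>B\<^esub> b') = 0" unfolding N.null_def LIMSEQ_const_iff .
    then have "b \<ominus>\<^bsub>B\<^esub> b' = \<zero>\<^bsub>B\<^esub>" using b by (intro B.cnorm_eq_0) simp_all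
    then show ?thesis using B.minus_eq_zero_iff[OF b] by (rule iffD1[rotated])
  qed
  define \<phi> where "\<phi> U = (THE b. \<exists>X\<in>K.CS. U = K.cls X \<and> R X b)" for U
  have \<phi>: "\<phi> (K.cls X) = b" if "X \<in> K.CS" "R X b" for X b
    unfolding \<phi>_def by (rule the_equality) (use that uniq in blast)+
  have \<phi>R: "R X (\<phi> (K.cls X))" if X: "X \<in> K.CS" for X
    using ex[OF X] \<phi>[OF X] by auto
  have RD: "b \<in> carrier B" "N.null (\<lambda>n. ?e (X n)) (\<lambda>_. b)" if "R X b" for X b
    using that by (auto simp: R_def)
  have "star_hom K.C B \<phi>"
    unfolding star_hom_def
  proof (intro conjI ballI allI Pi_I)
    fix x assume "x \<in> carrier K.C"
    then obtain X where X: "X \<in> K.CS" "x = K.cls X" by (rule K.C_cases)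
    note RX = \<phi>R[OF X(1), folded X(2)] and eX = eCS[OF X(1)]
    show "\<phi> x \<in> carrier B" using RD(1)[OF RX] .
    show "\<phi> (c \<odot>\<^bsub>K.C\<^esub> x) = c \<odot>\<^bsub>B\<^esub> \<phi> x" for c
    proof -
      have "R (\<lambda>n. c \<odot>\<^bsub>F\<^esub> X n) (c \<odot>\<^bsub>B\<^esub> \<phi> x)"
        using N.null_smult[OF eX _ RD(2)[OF RX]] RD(1)[OF RX] X(1)
        by (simp add: R_def P.hom_simps)
      then show ?thesis using X by (simp add: K.C_smult \<phi>)
    qed
    show "\<phi> (star K.C x) = star B (\<phi> x)"
    proof -
      have "R (\<lambda>n. star F (X n)) (star B (\<phi> x))"
        using N.null_star[OF eX _ RD(2)[OF RX]] RD(1)[OF RX] X(1)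
        by (simp add: R_def P.hom_simps)
      then show ?thesis using X by (simp add: K.C_star \<phi>)
    qed
    fix y assume "y \<in> carrier K.C"
    then obtain Y where Y: "Y \<in> K.CS" "y = K.cls Y" by (rule K.C_cases)
    note RY = \<phi>R[OF Y(1), folded Y(2)] and eY = eCS[OF Y(1)]
    show "\<phi> (x \<oplus>\<^bsub>K.C\<^esub> y) = \<phi> x \<oplus>\<^bsub>B\<^esub> \<phi> y"
    proof -
      have "R (\<lambda>n. X n \<oplus>\<^bsub>F\<^esub> Y n) (\<phi> x \<oplus>\<^bsub>B\<^esub> \<phi> y)"
        using N.null_add[OF eX eY _ _ RD(2)[OF RX] RD(2)[OF RY]] RD(1)[OF RX] RD(1)[OF RY] X(1) Y(1)
        by (simp add: R_def P.hom_simps)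
      then show ?thesis using X Y by (simp add: K.C_add \<phi>)
    qed
    show "\<phi> (x \<otimes>\<^bsub>K.C\<^esub> y) = \<phi> x \<otimes>\<^bsub>B\<^esub> \<phi> y"
    proof -
      have "R (\<lambda>n. X n \<otimes>\<^bsub>F\<^esub> Y n) (\<phi> x \<otimes>\<^bsub>B\<^esub> \<phi> y)"
        using N.null_mult[OF eX eY _ _ RD(2)[OF RX] RD(2)[OF RY]] RD(1)[OF RX] RD(1)[OF RY] X(1) Y(1)
        by (simp add: R_def P.hom_simps)
      then show ?thesis using X Y by (simp add: K.C_mult \<phi>)
    qed
  qed
  moreover have "\<phi> (kgraph_gen \<Lambda> \<mu>) = t \<mu>" if \<mu>: "\<mu> \<in> mor \<Lambda>" for \<mu>
  proof -
    have "t \<mu> \<in> carrier B" using tc \<mu> by auto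
    then have "R (\<lambda>_. free_gen \<mu>) (t \<mu>)"
      using N.null_refl[of "\<lambda>_. t \<mu>"] by (simp add: R_def gen \<mu>)
    then show ?thesis unfolding kgraph_gen_def by (intro \<phi>) (simp_all add: g' \<mu>)
  qed
  ultimately show ?thesis unfolding kgraph_cstar_def by blast
qed

end

subsection \<open>Primitive ideals and the choice of Hilbert spaces\<close>

context hilbert_space
begin

lemma hinner_add_right: "\<lbrakk>u \<in> carrier H; v \<in> carrier H; w \<in> carrier H\<rbrakk> \<Longrightarrow>
    hinner H u (v \<oplus> w) = hinner H u v + hinner H u w"
  using hinner_cnj[of "v \<oplus> w" u] hinner_cnj[of v u] hinner_cnj[of w u]
  by (simp add: hinner_add_left)

lemma hinner_smult_right: "\<lbrakk>v \<in> carrier H; w \<in> carrier H\<rbrakk> \<Longrightarrow>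
    hinner H v (c \<odot> w) = cnj c * hinner H v w"
  using hinner_cnj[of "c \<odot> w" v] hinner_cnj[of w v] by (simp add: hinner_smult_left)

lemma hinner_minus_left: "\<lbrakk>u \<in> carrier H; v \<in> carrier H; w \<in> carrier H\<rbrakk> \<Longrightarrow>
    hinner H (u \<ominus> v) w = hinner H u w - hinner H v w"
  by (simp add: M.minus_eq minus_conv hinner_add_left hinner_smult_left)

lemma hinner_zero_left: "w \<in> carrier H \<Longrightarrow> hinner H \<zero> w = 0"
  using hinner_smult_left[of w w 0] by (simp add: complex_smult_distr)

lemma hinner_self: "v \<in> carrier H \<Longrightarrow> hinner H v v = complex_of_real ((hnorm H v)\<^sup>2)"
  using hinner_cnj[of v v] hinner_nonneg[of v] by (auto simp: hnorm_def complex_eq_iff)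

lemma hnorm_nonneg: "v \<in> carrier H \<Longrightarrow> 0 \<le> hnorm H v"
  using hinner_nonneg by (simp add: hnorm_def)

lemma Cauchy_Schwarz:
  assumes x: "x \<in> carrier H" and y: "y \<in> carrier H"
  shows "cmod (hinner H x y) \<le> hnorm H x * hnorm H y"
proof (cases "hnorm H y = 0")
  case True
  then have "y = \<zero>" using hinner_eq_0[OF y] hinner_self[OF y] by simp
  then have "hinner H x y = 0" using hinner_cnj[of y x] x y hinner_zero_left[OF x] by simp
  then show ?thesis using hnorm_nonneg[OF x] hnorm_nonneg[OF y] by simp
next
  case False
  define n where "n = (hnorm H y)\<^sup>2"
  have n: "n > 0" using False by (simp add: n_def)
  define c where "c = hinner H x y / complex_of_real n"
  have yx: "hinner H y x = cnj (hinner H x y)" using hinner_cnj[OF x y] .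
  have "hinner H (x \<ominus> c \<odot> y) (x \<ominus> c \<odot> y) =
      hinner H x x - cnj c * hinner H x y - c * hinner H y x + c * cnj c * hinner H y y"
    using x y by (simp add: M.minus_eq minus_conv hinner_add_left hinner_add_right hinner_smult_left
        hinner_smult_right algebra_simps flip: complex_smult_distr(3))
  also have "\<dots> = complex_of_real ((hnorm H x)\<^sup>2) - complex_of_real ((cmod (hinner H x y))\<^sup>2 / n)"
  proof -
    let ?h = "hinner H x y"
    have 1: "cnj c * ?h = complex_of_real ((cmod ?h)\<^sup>2 / n)" "c * cnj ?h = complex_of_real ((cmod ?h)\<^sup>2 / n)"
      unfolding c_def of_real_divide complex_norm_square complex_cnj_divide complex_cnj_complex_of_real
      by (simp_all add: mult.commute)
    have "c * complex_of_real n = ?h" using n by (simp add: c_def)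
    then have 2: "c * cnj c * complex_of_real n = complex_of_real ((cmod ?h)\<^sup>2 / n)"
      using 1(1) by (metis mult.commute mult.left_commute)
    show ?thesis
      unfolding hinner_self[OF x] hinner_self[OF y] yx n_def[symmetric] 1 2 by simp
  qed
  finally have "Re (hinner H (x \<ominus> c \<odot> y) (x \<ominus> c \<odot> y)) = (hnorm H x)\<^sup>2 - (cmod (hinner H x y))\<^sup>2 / n"
    by simp
  then have "(cmod (hinner H x y))\<^sup>2 / n \<le> (hnorm H x)\<^sup>2"
    using hinner_nonneg[of "x \<ominus> c \<odot> y"] x y by simp
  then have "(cmod (hinner H x y))\<^sup>2 \<le> (hnorm H x * hnorm H y)\<^sup>2"
    using n by (simp add: n_def power_mult_distrib divide_le_eq)
  then show ?thesis
    by (rule power2_le_imp_le) (simp add: hnorm_nonneg x y)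
qed

lemma hinner_tendsto:
  assumes X: "\<And>n. X n \<in> carrier H" and l: "l \<in> carrier H" and y: "y \<in> carrier H"
    and lim: "norm_tendsto H (hnorm H) X l"
  shows "(\<lambda>n. hinner H (X n) y) \<longlonglongrightarrow> hinner H l y"
proof -
  have "(\<lambda>n. hinner H (X n) y - hinner H l y) \<longlonglongrightarrow> 0"
  proof (rule Lim_null_comparison)
    have "norm (hinner H (X n) y - hinner H l y) \<le> hnorm H (X n \<ominus> l) * hnorm H y" for n
      using Cauchy_Schwarz[of "X n \<ominus> l" y] X[of n] l y by (simp add: hinner_minus_left)
    then show "\<forall>\<^sub>F n in sequentially. norm (hinner H (X n) y - hinner H l y) \<le> hnorm H (X n \<ominus> l) * hnorm H y"
      by (rule always_eventually[OF allI])
    show "(\<lambda>n. hnorm H (X n \<ominus> l) * hnorm H y) \<longlonglongrightarrow> 0"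
      using lim tendsto_mult_left_zero unfolding norm_tendsto_def by blast
  qed
  then show ?thesis by (simp add: LIM_zero_iff)
qed

end

lemma hilbert_repD:
  assumes "hilbert_rep A H \<pi>"
  shows "\<And>a v. \<lbrakk>a \<in> carrier A; v \<in> carrier H\<rbrakk> \<Longrightarrow> \<pi> a v \<in> carrier H"
    and "\<And>a v w. \<lbrakk>a \<in> carrier A; v \<in> carrier H; w \<in> carrier H\<rbrakk> \<Longrightarrow>
      \<pi> a (v \<oplus>\<^bsub>H\<^esub> w) = \<pi> a v \<oplus>\<^bsub>H\<^esub> \<pi> a w"
    and "\<And>a c v. \<lbrakk>a \<in> carrier A; v \<in> carrier H\<rbrakk> \<Longrightarrow> \<pi> a (c \<odot>\<^bsub>H\<^esub> v) = c \<odot>\<^bsub>H\<^esub> \<pi> a v"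
    and "\<And>a. a \<in> carrier A \<Longrightarrow> \<exists>C. \<forall>v\<in>carrier H. hnorm H (\<pi> a v) \<le> C * hnorm H v"
    and "\<And>a b v. \<lbrakk>a \<in> carrier A; b \<in> carrier A; v \<in> carrier H\<rbrakk> \<Longrightarrow>
      \<pi> (a \<oplus>\<^bsub>A\<^esub> b) v = \<pi> a v \<oplus>\<^bsub>H\<^esub> \<pi> b v"
    and "\<And>c a v. \<lbrakk>a \<in> carrier A; v \<in> carrier H\<rbrakk> \<Longrightarrow> \<pi> (c \<odot>\<^bsub>A\<^esub> a) v = c \<odot>\<^bsub>H\<^esub> \<pi> a v"
    and "\<And>a b v. \<lbrakk>a \<in> carrier A; b \<in> carrier A; v \<in> carrier H\<rbrakk> \<Longrightarrow>
      \<pi> (a \<otimes>\<^bsub>A\<^esub> b) v = \<pi> a (\<pi> b v)"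
    and "\<And>a v w. \<lbrakk>a \<in> carrier A; v \<in> carrier H; w \<in> carrier H\<rbrakk> \<Longrightarrow>
      hinner H (\<pi> a v) w = hinner H v (\<pi> (star A a) w)"
  using assms unfolding hilbert_rep_def bounded_operator_def by (blast | simp add: Pi_iff)+

locale hilbert_transport = hilbert_space H for H :: "('h, 'n) hilbert_scheme" +
  fixes J :: "'h \<Rightarrow> 'k"
  assumes inj: "inj_on J (carrier H)"
begin

definition "K = the_inv_into (carrier H) J"

definition H' :: "'k hilbert" where
  "H' = \<lparr>carrier = J ` carrier H, mult = undefined, one = undefined, zero = J \<zero>\<^bsub>H\<^esub>,
     add = (\<lambda>f g. J (K f \<oplus>\<^bsub>H\<^esub> K g)), smult = (\<lambda>c f. J (c \<odot>\<^bsub>H\<^esub> K f)),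
     hinner = (\<lambda>f g. hinner H (K f) (K g))\<rparr>"

lemma K [simp]: "v \<in> carrier H \<Longrightarrow> K (J v) = v"
  by (simp add: K_def inj the_inv_into_f_f)

lemma H'_sel [simp]: "carrier H' = J ` carrier H" "zero H' = J \<zero>\<^bsub>H\<^esub>"
  by (simp_all add: H'_def)

lemma H'_ops [simp]:
  "\<lbrakk>v \<in> carrier H; w \<in> carrier H\<rbrakk> \<Longrightarrow> J v \<oplus>\<^bsub>H'\<^esub> J w = J (v \<oplus>\<^bsub>H\<^esub> w)"
  "v \<in> carrier H \<Longrightarrow> c \<odot>\<^bsub>H'\<^esub> J v = J (c \<odot>\<^bsub>H\<^esub> v)"
  "\<lbrakk>v \<in> carrier H; w \<in> carrier H\<rbrakk> \<Longrightarrow> hinner H' (J v) (J w) = hinner H v w"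
  by (simp_all add: H'_def)

lemma H'_norm [simp]: "v \<in> carrier H \<Longrightarrow> hnorm H' (J v) = hnorm H v"
  by (simp add: hnorm_def)

lemma H'_module: "Module.module complex_ring H'"
proof (rule complex_moduleI)
  fix x y assume "x \<in> carrier H'" "y \<in> carrier H'"
  then show "x \<oplus>\<^bsub>H'\<^esub> y = y \<oplus>\<^bsub>H'\<^esub> x" by (auto simp: M.a_comm)
next
  fix x assume "x \<in> carrier H'"
  then show "(-1) \<odot>\<^bsub>H'\<^esub> x \<oplus>\<^bsub>H'\<^esub> x = \<zero>\<^bsub>H'\<^esub>"
    by (auto simp: M.l_neg simp flip: minus_conv)
qed (auto simp: M.a_assoc complex_smult_distr)

lemma H'_minus [simp]: "\<lbrakk>v \<in> carrier H; w \<in> carrier H\<rbrakk> \<Longrightarrow> J v \<ominus>\<^bsub>H'\<^esub> J w = J (v \<ominus>\<^bsub>H\<^esub> w)"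
proof -
  interpret H': complex_module H' by (rule complex_module.intro) (rule H'_module)
  assume "v \<in> carrier H" "w \<in> carrier H"
  then show ?thesis by (simp add: H'.M.minus_eq H'.minus_conv M.minus_eq minus_conv)
qed

lemma H'_tendsto:
  assumes "\<And>n. X n \<in> carrier H" "l \<in> carrier H"
  shows "norm_tendsto H' (hnorm H') (\<lambda>n. J (X n)) (J l) \<longleftrightarrow> norm_tendsto H (hnorm H) X l"
  using assms by (simp add: norm_tendsto_def)

lemma H'_seq:
  assumes "\<And>n. Y n \<in> carrier H'"
  obtains X where "\<And>n. X n \<in> carrier H" "Y = (\<lambda>n. J (X n))"
proof
  show "K (Y n) \<in> carrier H" for n using assms[of n] by auto
  show "Y = (\<lambda>n. J (K (Y n)))"
  proof
    fix n show "Y n = J (K (Y n))" using assms[of n] by auto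
  qed
qed

lemma H'_hilbert: "hilbert_space H'"
proof (rule hilbert_space.intro)
  show "Module.module complex_ring H'" by (rule H'_module)
  have "norm_complete H' (hnorm H')"
    unfolding norm_complete_def
  proof (intro allI impI, elim conjE)
    fix Y assume Y: "\<forall>n. Y n \<in> carrier H'" and C: "norm_Cauchy H' (hnorm H') Y"
    obtain X where X: "\<And>n. X n \<in> carrier H" "Y = (\<lambda>n. J (X n))" using H'_seq Y by blast
    have "norm_Cauchy H (hnorm H) X" using C X(1) unfolding norm_Cauchy_def X(2) by simp
    then obtain l where "l \<in> carrier H" "norm_tendsto H (hnorm H) X l"
      using complete X(1) unfolding norm_complete_def by blast
    then have "J l \<in> carrier H' \<and> norm_tendsto H' (hnorm H') Y (J l)"
      using X H'_tendsto by simp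
    then show "\<exists>l\<in>carrier H'. norm_tendsto H' (hnorm H') Y l" by blast
  qed
  then show "hilbert_space_axioms H'"
    unfolding hilbert_space_axioms_def
    by (auto intro: hinner_cnj hinner_nonneg simp: hinner_add_left hinner_smult_left
        dest: hinner_eq_0)
qed

definition tr :: "('a \<Rightarrow> 'h \<Rightarrow> 'h) \<Rightarrow> 'a \<Rightarrow> 'k \<Rightarrow> 'k" where
  "tr \<pi> a f = J (\<pi> a (K f))"

lemma tr [simp]: "v \<in> carrier H \<Longrightarrow> tr \<pi> a (J v) = J (\<pi> a v)"
  by (simp add: tr_def)

lemma H'_irreducible:
  assumes A: "star_algebra A" and irr: "irreducible_rep A H \<pi>"
  shows "irreducible_rep A H' (tr \<pi>)"
proof -
  interpret A: star_algebra A by fact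
  interpret H': complex_module H' by (rule complex_module.intro) (rule H'_module)
  have rep: "hilbert_rep A H \<pi>" using irr by (simp add: irreducible_rep_def)
  note r = hilbert_repD[OF rep]
  have bo: "bounded_operator H' (tr \<pi> a)" if a: "a \<in> carrier A" for a
  proof -
    obtain C where "\<forall>v\<in>carrier H. hnorm H (\<pi> a v) \<le> C * hnorm H v" using r(4)[OF a] by blast
    then show ?thesis
      unfolding bounded_operator_def by (auto simp: r(1-3)[OF a] intro!: exI[of _ C])
  qed
  have "hilbert_rep A H' (tr \<pi>)"
    unfolding hilbert_rep_def by (auto simp: bo r)
  moreover have "\<exists>a\<in>carrier A. \<exists>v\<in>carrier H'. tr \<pi> a v \<noteq> \<zero>\<^bsub>H'\<^esub>"
  proof -
    obtain a v where av: "a \<in> carrier A" "v \<in> carrier H" "\<pi> a v \<noteq> \<zero>\<^bsub>H\<^esub>"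
      using irr by (auto simp: irreducible_rep_def)
    then have "J (\<pi> a v) \<noteq> J \<zero>\<^bsub>H\<^esub>" using r(1)[of a v] inj by (auto dest: inj_onD)
    then show ?thesis using av by (intro bexI[of _ a] bexI[of _ "J v"]) auto
  qed
  moreover have "W' = {\<zero>\<^bsub>H'\<^esub>} \<or> W' = carrier H'"
    if sub: "submodule W' complex_ring H'" and cl: "norm_closed H' (hnorm H') W'"
      and inv: "\<forall>a\<in>carrier A. \<forall>w\<in>W'. tr \<pi> a w \<in> W'" for W'
  proof -
    define W where "W = {v \<in> carrier H. J v \<in> W'}"
    have s: "W' \<subseteq> carrier H'" using cl by (simp add: norm_closed_def)
    have W': "W' = J ` W" using s by (auto simp: W_def)
    note sm = H'.submoduleE[OF sub]
    have zero: "J \<zero>\<^bsub>H\<^esub> \<in> W'"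
    proof -
      obtain w where "w \<in> W'" using sm(2) by blast
      then have "0 \<odot>\<^bsub>H'\<^esub> w \<in> W'" "w \<in> carrier H'" using sm(4)[of 0 w] s by auto
      then show ?thesis by (simp add: H'.complex_smult_distr(5) del: H'_sel(1)) 
    qed
    have smu: "J (c \<odot>\<^bsub>H\<^esub> v) \<in> W'" if "v \<in> carrier H" "J v \<in> W'" for c v
      using sm(4)[of c "J v"] that by simp
    have add: "J (v \<oplus>\<^bsub>H\<^esub> w) \<in> W'" if "v \<in> carrier H" "J v \<in> W'" "w \<in> carrier H" "J w \<in> W'" for v w
      using sm(5)[of "J v" "J w"] that by simp
    have "submodule W complex_ring H"
      by (rule submoduleI) (auto simp: W_def zero smu add minus_conv)
    moreover have "norm_closed H (hnorm H) W"
      unfolding norm_closed_def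
    proof (intro conjI allI impI, goal_cases)
      case 1
      show ?case by (auto simp: W_def)
    next
      case (2 X l)
      then have X: "\<And>n. X n \<in> carrier H" "\<And>n. J (X n) \<in> W'" and l: "l \<in> carrier H"
        and lim: "norm_tendsto H (hnorm H) X l" by (auto simp: W_def)
      have "norm_tendsto H' (hnorm H') (\<lambda>n. J (X n)) (J l)" using H'_tendsto[of X l, OF X(1) l] lim by (rule iffD2)
      then have "J l \<in> W'"
        using cl[unfolded norm_closed_def, THEN conjunct2, THEN spec, THEN spec, THEN mp,
            OF conjI[OF allI[OF X(2)] conjI]] l by simp
      then show ?case using l by (simp add: W_def)
    qed
    moreover have "\<forall>a\<in>carrier A. \<forall>w\<in>W. \<pi> a w \<in> W"
      using inv by (auto simp: W_def r(1)) (metis tr)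
    ultimately have "W = {\<zero>\<^bsub>H\<^esub>} \<or> W = carrier H" using irr by (simp add: irreducible_rep_def)
    then show ?thesis unfolding W' by auto
  qed
  ultimately show ?thesis unfolding irreducible_rep_def by blast
qed

lemma H'_kernel:
  assumes "hilbert_rep A H \<pi>"
  shows "rep_kernel A H' (tr \<pi>) = rep_kernel A H \<pi>"
proof -
  have "J (\<pi> a v) = J \<zero>\<^bsub>H\<^esub> \<longleftrightarrow> \<pi> a v = \<zero>\<^bsub>H\<^esub>" if "a \<in> carrier A" "v \<in> carrier H" for a v
    using hilbert_repD(1)[OF assms that] inj by (auto dest: inj_onD)
  then show ?thesis by (auto simp: rep_kernel_def)
qed

end

theorem rep_kernel_primitive:
  fixes A :: "('a, 'm) star_algebra_scheme" and H :: "('h, 'n) hilbert_scheme"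
  assumes A: "star_algebra A" and H: "hilbert_space H" and irr: "irreducible_rep A H \<pi>"
  shows "rep_kernel A H \<pi> \<in> primitive_ideals A"
proof -
  interpret A: star_algebra A by fact
  interpret hilbert_space H by fact
  have rep: "hilbert_rep A H \<pi>" using irr by (simp add: irreducible_rep_def)
  note r = hilbert_repD[OF rep]
  obtain a0 v0 where v0: "a0 \<in> carrier A" "v0 \<in> carrier H" "\<pi> a0 v0 \<noteq> \<zero>\<^bsub>H\<^esub>"
    using irr by (auto simp: irreducible_rep_def)
  define N where "N = {u \<in> carrier H. \<forall>a\<in>carrier A. hinner H u (\<pi> a v0) = 0}"
  have "submodule N complex_ring H"
    by (rule submoduleI)
      (auto simp: N_def minus_conv hinner_zero_left hinner_add_left hinner_smult_left r(1) v0)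
  moreover have "norm_closed H (hnorm H) N"
    unfolding norm_closed_def
  proof (intro conjI allI impI, goal_cases)
    case 1
    show ?case by (auto simp: N_def)
  next
    case (2 X l)
    then have X: "\<And>n. X n \<in> carrier H" and l: "l \<in> carrier H"
      and lim: "norm_tendsto H (hnorm H) X l" by (auto simp: N_def)
    have "hinner H l (\<pi> a v0) = 0" if a: "a \<in> carrier A" for a
    proof -
      have "hinner H (X n) (\<pi> a v0) = 0" for n using 2 a by (auto simp: N_def)
      then show ?thesis
        using hinner_tendsto[OF X l r(1)[OF a v0(2)] lim] by (simp add: LIMSEQ_const_iff)
    qed
    then show ?case using l by (simp add: N_def)
  qed
  moreover have "\<forall>a\<in>carrier A. \<forall>w\<in>N. \<pi> a w \<in> N"
  proof (intro ballI)
    fix b u assume b: "b \<in> carrier A" and u: "u \<in> N"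
    have "hinner H (\<pi> b u) (\<pi> a v0) = 0" if a: "a \<in> carrier A" for a
    proof -
      have "hinner H (\<pi> b u) (\<pi> a v0) = hinner H u (\<pi> (star A b \<otimes>\<^bsub>A\<^esub> a) v0)"
        using a b u v0 by (simp add: r N_def)
      then show ?thesis using a b u by (simp add: N_def)
    qed
    then show "\<pi> b u \<in> N" using b u by (simp add: N_def r)
  qed
  ultimately have "N = {\<zero>\<^bsub>H\<^esub>} \<or> N = carrier H" using irr by (simp add: irreducible_rep_def)
  moreover have "N \<noteq> carrier H"
  proof
    assume "N = carrier H"
    then have "hinner H (\<pi> a0 v0) (\<pi> a0 v0) = 0" using r(1)[OF v0(1,2)] v0 by (auto simp: N_def)
    then show False using hinner_eq_0[OF r(1)[OF v0(1,2)]] v0 by simp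
  qed
  ultimately have N: "N = {\<zero>\<^bsub>H\<^esub>}" by blast
  define J where "J v = (\<lambda>a. if a \<in> carrier A then hinner H v (\<pi> a v0) else 0)" for v
  have "inj_on J (carrier H)"
  proof (rule inj_onI)
    fix v w assume vw: "v \<in> carrier H" "w \<in> carrier H" "J v = J w"
    have "hinner H v (\<pi> a v0) = hinner H w (\<pi> a v0)" if "a \<in> carrier A" for a
      using fun_cong[OF vw(3), of a] that by (simp add: J_def)
    then have "v \<ominus>\<^bsub>H\<^esub> w \<in> N" using vw v0 by (simp add: N_def hinner_minus_left r(1))
    then show "v = w" using N minus_eq_zero_iff[OF vw(1,2)] by simp
  qed
  then interpret T: hilbert_transport H J by unfold_locales
  have "rep_kernel A H \<pi> = rep_kernel A T.H' (T.tr \<pi>)" using T.H'_kernel[OF rep] by simp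
  then show ?thesis
    unfolding primitive_ideals_def using T.H'_hilbert T.H'_irreducible[OF A irr] by blast
qed

end

theory Submission
  imports Defs
begin

text \<open>Both the primitive ideals and the pairs \<open>(T, \<gamma>)\<close> are compared with irreducible representations. Every
irreducible representation \<open>\<pi>\<close> determines such a pair: the vertices \<open>v\<close> with \<open>\<pi> s\<^sub>v \<noteq> 0\<close> form a maximal
tail \<open>T\<close> (\<open>rep_tail_maximal\<close>), and whenever \<open>\<mu> \<sim> \<nu>\<close> in \<open>\<Lambda>T\<close> the operator \<open>\<pi> (s\<^sub>\<nu>\<^sup>* s\<^sub>\<mu>)\<close> commutes with the
corner at the vertex \<open>s(\<mu>)\<close>, so by Schur's lemma \<open>\<pi> s\<^sub>\<mu>\<close> is a scalar multiple of \<open>\<pi> s\<^sub>\<nu>\<close>. The scalar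
depends on \<open>d(\<mu>) - d(\<nu>)\<close> only and is a character \<open>\<gamma>\<close> of \<open>Per(\<Lambda>T)\<close> (\<open>tail_rep_exists\<close>). Conversely the
path representation attached to a cofinal path in \<open>T\<close> and to an extension of \<open>\<gamma>\<close> to \<open>\<int>\<^sup>k\<close> is irreducible
and determines \<open>(T, \<gamma>)\<close> (\<open>irreducible_path_rep\<close>, \<open>tail_rep_path\<close>).

So everything follows from the fact that the kernel of an irreducible representation depends on
\<open>(T, \<gamma>)\<close> only (\<open>tail_rep_kernel_le\<close>). An irreducible representation is prime in the sense that
\<open>\<pi> x \<noteq> 0\<close> and \<open>\<pi> y \<noteq> 0\<close> give \<open>\<pi> (x b y) \<noteq> 0\<close> for some \<open>b\<close>, so a nonzero ideal of its image meets the
corner of any vertex \<open>w\<close> of \<open>T\<close>. The vertex \<open>w\<close> is chosen such that every degree that is allowed by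
\<open>Per(\<Lambda>T)\<close> can be exchanged at \<open>w\<close> (\<open>periodic_verts\<close>; such vertices exist because the pairs of degrees
that differ by an element of the group form a finitely generated monoid). For a finite combination
\<open>\<Sum> c s\<^sub>\<alpha> s\<^sub>\<beta>\<^sup>*\<close> in that corner its norm in any representation with data \<open>(T, \<gamma>)\<close> is compared with a
scalar matrix \<open>coef\<close> that is indexed by long paths and depends on \<open>\<gamma>\<close> only. Paths whose degrees do not
differ by a period can be separated by an extension, so the matrix is a compression of the operator
in each representation (\<open>coef_bound\<close>). In the other direction the combination is recovered from the
matrix by averaging over the degrees in a large box modulo the periods: \<open>\<int>\<^sup>k / Per(\<Lambda>T)\<close> is amenable,
so the error is small (\<open>form_bound\<close>).

Operators are handled through their matrix coefficients \<open>\<langle>S h, k\<rangle>\<close>: a Cuntz--Krieger family consists of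
operators with given adjoints, and its relations are identities between inner products.\<close>

section \<open>Paths and their initial segments\<close>

lemma vec_le_add [simp]: "(p :: nat ^ 'k::finite) \<le> p + q" "(p :: nat ^ 'k::finite) \<le> q + p"
 by (auto simp: less_eq_vec_def)

lemma vec_add_diff [simp]: "(p :: nat ^ 'k::finite) \<le> q \<Longrightarrow> p + (q - p) = q"
 "(p :: nat ^ 'k::finite) \<le> q \<Longrightarrow> q - p + p = q"
 by (auto simp: less_eq_vec_def vec_eq_iff)

lemma vec_add_le [simp]: "(p :: nat ^ 'k::finite) + q \<le> p + q' \<longleftrightarrow> q \<le> q'"
 "(q :: nat ^ 'k::finite) + p \<le> q' + p \<longleftrightarrow> q \<le> q'"
 by (auto simp: less_eq_vec_def)

lemma vec_zero_le [simp]: "(0 :: nat ^ 'k::finite) \<le> p" by (auto simp: less_eq_vec_def)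

lemma vec_diff_zero [simp]: "(p :: nat ^ 'k::finite) - 0 = p" "(p :: nat ^ 'k::finite) - p = 0"
 by auto

lemma vec_le_diff: "(p :: nat ^ 'k::finite) \<le> q \<Longrightarrow> p \<le> q + q'"
 by (auto simp: less_eq_vec_def intro: trans_le_add1)

locale rf_kgraph = kgraph \<Lambda> for \<Lambda> :: "('e, 'k::finite) kgraph" +
 assumes row_finite: "row_finite_no_sources \<Lambda>"

context kgraph
begin

abbreviation M where "M \<equiv> mor \<Lambda>"
abbreviation r where "r \<equiv> rng \<Lambda>"
abbreviation s where "s \<equiv> src \<Lambda>"
abbreviation d where "d \<equiv> deg \<Lambda>"
abbreviation V where "V \<equiv> verts \<Lambda>"
abbreviation ipaths where "ipaths \<equiv> inf_paths \<Lambda>"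
abbreviation pre where "pre \<equiv> prepend \<Lambda>"
abbreviation orbit where "orbit \<equiv> shift_tail_class \<Lambda>"
abbreviation sub where "sub \<equiv> tail_subgraph \<Lambda>"
abbreviation compose (infixl "\<cdot>" 70) where "\<mu> \<cdot> \<nu> \<equiv> cmp \<Lambda> \<mu> \<nu>"

lemma vertsD: "v \<in> V \<Longrightarrow> v \<in> M" "v \<in> V \<Longrightarrow> s v = v" "v \<in> V \<Longrightarrow> r v = v"
 using rng_src_src[of v] by (auto simp: verts_def)

lemma rng_verts: "\<mu> \<in> M \<Longrightarrow> r \<mu> \<in> V"
 using rng_src_rng[of \<mu>] rng_closed[of \<mu>] by (simp add: verts_def)

lemma cmp_vert: "\<lbrakk>v \<in> V; \<mu> \<in> M; r \<mu> = v\<rbrakk> \<Longrightarrow> v \<cdot> \<mu> = \<mu>"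
 "\<lbrakk>v \<in> V; \<mu> \<in> M; s \<mu> = v\<rbrakk> \<Longrightarrow> \<mu> \<cdot> v = \<mu>"
 using cmp_rng_left cmp_src_right by auto

lemma cmp_cancel:
 assumes "\<mu> \<in> M" "\<nu> \<in> M" "s \<mu> = r \<nu>" "\<mu>' \<in> M" "\<nu>' \<in> M" "s \<mu>' = r \<nu>'"
  and "\<mu> \<cdot> \<nu> = \<mu>' \<cdot> \<nu>'" "d \<mu> = d \<mu>'"
 shows "\<mu> = \<mu>'" "\<nu> = \<nu>'"
proof -
 have dd: "d (\<mu> \<cdot> \<nu>) = d \<mu> + d \<nu>" "d (\<mu> \<cdot> \<nu>) = d \<mu> + d \<nu>'"
  using deg_cmp[OF assms(1-3)] deg_cmp[OF assms(4-6)] assms(7,8) by auto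
 then have "d \<nu> = d \<nu>'" by simp
 then have dn: "d \<nu>' = d \<nu>" by simp
 let ?P = "\<lambda>(\<alpha>, \<beta>). \<alpha> \<in> M \<and> \<beta> \<in> M \<and> d \<alpha> = d \<mu> \<and> d \<beta> = d \<nu> \<and> s \<alpha> = r \<beta> \<and> \<mu> \<cdot> \<nu> = \<alpha> \<cdot> \<beta>"
 have "\<exists>!x. ?P x" using factorisation[OF cmp_closed[OF assms(1-3)] dd(1)] .
 moreover have "?P (\<mu>, \<nu>)" using assms(1-3) by (intro case_prodI conjI refl)
 moreover have "?P (\<mu>', \<nu>')" using assms dn by (intro case_prodI conjI) (assumption | rule sym, assumption)+
 ultimately have "(\<mu>, \<nu>) = (\<mu>', \<nu>')" by blast
 then show "\<mu> = \<mu>'" "\<nu> = \<nu>'" by auto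
qed

text \<open>The factorisation of a path at a degree below its own.\<close>

definition pfx :: "nat ^ 'k \<Rightarrow> 'e \<Rightarrow> 'e" where
 "pfx p \<kappa> = (SOME \<mu>. \<mu> \<in> M \<and> d \<mu> = p \<and> (\<exists>\<nu>\<in>M. s \<mu> = r \<nu> \<and> \<kappa> = \<mu> \<cdot> \<nu>))"

definition sfx :: "nat ^ 'k \<Rightarrow> 'e \<Rightarrow> 'e" where
 "sfx p \<kappa> = (SOME \<nu>. \<nu> \<in> M \<and> s (pfx p \<kappa>) = r \<nu> \<and> \<kappa> = pfx p \<kappa> \<cdot> \<nu>)"

lemma pfx_sfx:
 assumes "\<kappa> \<in> M" "p \<le> d \<kappa>"
 shows "pfx p \<kappa> \<in> M" "sfx p \<kappa> \<in> M" "d (pfx p \<kappa>) = p" "d (sfx p \<kappa>) = d \<kappa> - p"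
  "s (pfx p \<kappa>) = r (sfx p \<kappa>)" "pfx p \<kappa> \<cdot> sfx p \<kappa> = \<kappa>" "r (pfx p \<kappa>) = r \<kappa>" "s (sfx p \<kappa>) = s \<kappa>"
proof -
 have "d \<kappa> = p + (d \<kappa> - p)" using assms by simp
 from factorisation[OF assms(1) this]
 have "\<exists>\<mu>. \<mu> \<in> M \<and> d \<mu> = p \<and> (\<exists>\<nu>\<in>M. s \<mu> = r \<nu> \<and> \<kappa> = \<mu> \<cdot> \<nu>)" by blast
 from someI_ex[OF this] have 1: "pfx p \<kappa> \<in> M" "d (pfx p \<kappa>) = p"
  "\<exists>\<nu>. \<nu> \<in> M \<and> s (pfx p \<kappa>) = r \<nu> \<and> \<kappa> = pfx p \<kappa> \<cdot> \<nu>" unfolding pfx_def by auto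
 from someI_ex[OF this(3)] have 2: "sfx p \<kappa> \<in> M" "s (pfx p \<kappa>) = r (sfx p \<kappa>)" "\<kappa> = pfx p \<kappa> \<cdot> sfx p \<kappa>"
  unfolding sfx_def by auto
 show "pfx p \<kappa> \<in> M" "sfx p \<kappa> \<in> M" "d (pfx p \<kappa>) = p"
  "s (pfx p \<kappa>) = r (sfx p \<kappa>)" "pfx p \<kappa> \<cdot> sfx p \<kappa> = \<kappa>"
  using 1 2 by auto
 show "r (pfx p \<kappa>) = r \<kappa>" "s (sfx p \<kappa>) = s \<kappa>"
  using rng_cmp[OF 1(1) 2(1,2)] src_cmp[OF 1(1) 2(1,2)] 2(3) by auto
 have "p + d (sfx p \<kappa>) = d \<kappa>" using deg_cmp[OF 1(1) 2(1,2)] 1(2) 2(3) by metis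
 then show "d (sfx p \<kappa>) = d \<kappa> - p" by (metis add_diff_cancel_left')
qed

lemma pfx_cmp:
 assumes "\<mu> \<in> M" "\<nu> \<in> M" "s \<mu> = r \<nu>"
 shows "pfx (d \<mu>) (\<mu> \<cdot> \<nu>) = \<mu>" "sfx (d \<mu>) (\<mu> \<cdot> \<nu>) = \<nu>"
proof -
 have "\<mu> \<cdot> \<nu> \<in> M" "d \<mu> \<le> d (\<mu> \<cdot> \<nu>)" using assms by (auto simp: cmp_closed deg_cmp)
 note * = pfx_sfx[OF this]
 show "pfx (d \<mu>) (\<mu> \<cdot> \<nu>) = \<mu>" "sfx (d \<mu>) (\<mu> \<cdot> \<nu>) = \<nu>"
  using cmp_cancel[OF *(1,2,5) assms] * by auto
qed

lemma pfx_unique: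
 assumes "\<mu> \<in> M" "\<nu> \<in> M" "s \<mu> = r \<nu>" "\<mu> \<cdot> \<nu> = \<kappa>" "d \<mu> = p"
 shows "pfx p \<kappa> = \<mu>" "sfx p \<kappa> = \<nu>"
 using pfx_cmp[OF assms(1-3)] assms by auto

lemma pfx_0: "\<kappa> \<in> M \<Longrightarrow> pfx 0 \<kappa> = r \<kappa>" "\<kappa> \<in> M \<Longrightarrow> sfx 0 \<kappa> = \<kappa>"
 using pfx_unique[of "r \<kappa>" \<kappa> \<kappa> 0] rng_verts[of \<kappa>] by (auto simp: vertsD deg_vert cmp_vert)

lemma pfx_all: "\<kappa> \<in> M \<Longrightarrow> pfx (d \<kappa>) \<kappa> = \<kappa>" "\<kappa> \<in> M \<Longrightarrow> sfx (d \<kappa>) \<kappa> = s \<kappa>"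
 using pfx_unique[of \<kappa> "s \<kappa>" \<kappa> "d \<kappa>"] src_verts[of \<kappa>] by (auto simp: vertsD cmp_vert)

lemma pfx_pfx:
 assumes "\<kappa> \<in> M" "p \<le> q" "q \<le> d \<kappa>"
 shows "pfx p (pfx q \<kappa>) = pfx p \<kappa>" "sfx p \<kappa> = sfx p (pfx q \<kappa>) \<cdot> sfx q \<kappa>"
proof -
 note q = pfx_sfx[OF assms(1,3)]
 have "p \<le> d (pfx q \<kappa>)" using assms q by simp
 note p = pfx_sfx[OF q(1) this]
 have 1: "s (sfx p (pfx q \<kappa>)) = r (sfx q \<kappa>)" using p q by simp
 have 2: "pfx p (pfx q \<kappa>) \<cdot> (sfx p (pfx q \<kappa>) \<cdot> sfx q \<kappa>) = \<kappa>"
  using p q cmp_assoc[OF p(1,2) q(2) p(5) 1] by simp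
 have 3: "s (pfx p (pfx q \<kappa>)) = r (sfx p (pfx q \<kappa>) \<cdot> sfx q \<kappa>)"
  using p q by (simp add: rng_cmp)
 show "pfx p (pfx q \<kappa>) = pfx p \<kappa>" "sfx p \<kappa> = sfx p (pfx q \<kappa>) \<cdot> sfx q \<kappa>"
  using pfx_unique[OF p(1) cmp_closed[OF p(2) q(2) 1] 3 2 p(3)] by auto
qed

lemma pfx_cmp_le:
 assumes "\<mu> \<in> M" "\<nu> \<in> M" "s \<mu> = r \<nu>" "p \<le> d \<mu>"
 shows "pfx p (\<mu> \<cdot> \<nu>) = pfx p \<mu>"
 using pfx_pfx(1)[of "\<mu> \<cdot> \<nu>" p "d \<mu>"] assms by (simp add: pfx_cmp cmp_closed deg_cmp)

lemma pfx_cmp_ge: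
 assumes "\<mu> \<in> M" "\<nu> \<in> M" "s \<mu> = r \<nu>" "p \<le> d \<nu>"
 shows "pfx (d \<mu> + p) (\<mu> \<cdot> \<nu>) = \<mu> \<cdot> pfx p \<nu>" "sfx (d \<mu> + p) (\<mu> \<cdot> \<nu>) = sfx p \<nu>"
proof -
 note p = pfx_sfx[OF assms(2,4)]
 have 1: "s \<mu> = r (pfx p \<nu>)" using p assms by simp
 have 2: "s (\<mu> \<cdot> pfx p \<nu>) = r (sfx p \<nu>)" using src_cmp[OF assms(1) p(1) 1] p by simp
 have 3: "\<mu> \<cdot> pfx p \<nu> \<cdot> sfx p \<nu> = \<mu> \<cdot> \<nu>" using cmp_assoc[OF assms(1) p(1,2) 1] p by simp
 show "pfx (d \<mu> + p) (\<mu> \<cdot> \<nu>) = \<mu> \<cdot> pfx p \<nu>" "sfx (d \<mu> + p) (\<mu> \<cdot> \<nu>) = sfx p \<nu>"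
  using pfx_unique[OF cmp_closed[OF assms(1) p(1) 1] p(2) 2 3] p assms 1 by (auto simp: deg_cmp)
qed

text \<open>Two paths can have a common extension only if their initial segments agree as far as both are
defined.\<close>

definition compat :: "'e \<Rightarrow> 'e \<Rightarrow> bool" where
 "compat \<mu> \<nu> \<longleftrightarrow> (\<forall>n. n \<le> d \<mu> \<and> n \<le> d \<nu> \<longrightarrow> pfx n \<mu> = pfx n \<nu>)"

lemma compat_pfx:
 assumes "\<mu> \<in> M" "\<nu> \<in> M" "\<mu>' \<in> M" "\<nu>' \<in> M" "s \<mu> = r \<mu>'" "s \<nu> = r \<nu>'"
  and "compat (\<mu> \<cdot> \<mu>') (\<nu> \<cdot> \<nu>')"
 shows "compat \<mu> \<nu>"
 unfolding compat_def
proof (intro allI impI, elim conjE)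
 fix n assume n: "n \<le> d \<mu>" "n \<le> d \<nu>"
 then have "n \<le> d (\<mu> \<cdot> \<mu>')" "n \<le> d (\<nu> \<cdot> \<nu>')" using assms by (auto simp: deg_cmp vec_le_diff)
 then have "pfx n (\<mu> \<cdot> \<mu>') = pfx n (\<nu> \<cdot> \<nu>')" using assms(7) by (auto simp: compat_def)
 then show "pfx n \<mu> = pfx n \<nu>" using pfx_cmp_le n assms by metis
qed

lemma compat_sym: "compat \<mu> \<nu> \<Longrightarrow> compat \<nu> \<mu>"
 by (auto simp: compat_def)

text \<open>The form of \<open>\<mu> \<sim> \<nu>\<close> that speaks of finite paths: no common extension tells \<open>\<mu>\<close> and \<open>\<nu>\<close> apart. The relation
between infinite paths is recovered in \<open>path_equiv_iff_feq\<close>.\<close>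

definition feq :: "'e \<Rightarrow> 'e \<Rightarrow> bool" where
 "feq \<mu> \<nu> \<longleftrightarrow> \<mu> \<in> M \<and> \<nu> \<in> M \<and> s \<mu> = s \<nu> \<and> (\<forall>\<tau>\<in>M. r \<tau> = s \<mu> \<longrightarrow> compat (\<mu> \<cdot> \<tau>) (\<nu> \<cdot> \<tau>))"

lemma feqD:
 assumes "feq \<mu> \<nu>"
 shows "\<mu> \<in> M" "\<nu> \<in> M" "s \<mu> = s \<nu>"
  "\<And>\<tau> n. \<lbrakk>\<tau> \<in> M; r \<tau> = s \<mu>; n \<le> d \<mu> + d \<tau>; n \<le> d \<nu> + d \<tau>\<rbrakk> \<Longrightarrow> pfx n (\<mu> \<cdot> \<tau>) = pfx n (\<nu> \<cdot> \<tau>)"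
 using assms unfolding feq_def compat_def by (auto simp: deg_cmp)

lemma feqI:
 assumes "\<mu> \<in> M" "\<nu> \<in> M" "s \<mu> = s \<nu>"
  "\<And>\<tau> n. \<lbrakk>\<tau> \<in> M; r \<tau> = s \<mu>; n \<le> d \<mu> + d \<tau>; n \<le> d \<nu> + d \<tau>\<rbrakk> \<Longrightarrow> pfx n (\<mu> \<cdot> \<tau>) = pfx n (\<nu> \<cdot> \<tau>)"
 shows "feq \<mu> \<nu>"
 using assms unfolding feq_def compat_def by (auto simp: deg_cmp)

lemma feq_refl: "\<mu> \<in> M \<Longrightarrow> feq \<mu> \<mu>"
 by (auto intro: feqI)

lemma feq_sym: "feq \<mu> \<nu> \<Longrightarrow> feq \<nu> \<mu>"
 unfolding feq_def by (metis compat_sym)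

lemma feq_cmp_right:
 assumes "feq \<mu> \<nu>" "\<alpha> \<in> M" "r \<alpha> = s \<mu>"
 shows "feq (\<mu> \<cdot> \<alpha>) (\<nu> \<cdot> \<alpha>)"
proof (rule feqI)
 note f = feqD[OF assms(1)]
 show "\<mu> \<cdot> \<alpha> \<in> M" "\<nu> \<cdot> \<alpha> \<in> M" "s (\<mu> \<cdot> \<alpha>) = s (\<nu> \<cdot> \<alpha>)" using f assms by (auto simp: cmp_closed src_cmp)
 fix \<tau> n assume t: "\<tau> \<in> M" "r \<tau> = s (\<mu> \<cdot> \<alpha>)" "n \<le> d (\<mu> \<cdot> \<alpha>) + d \<tau>" "n \<le> d (\<nu> \<cdot> \<alpha>) + d \<tau>"
 have "r \<tau> = s \<alpha>" using t f assms by (simp add: src_cmp)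
 then show "pfx n (\<mu> \<cdot> \<alpha> \<cdot> \<tau>) = pfx n (\<nu> \<cdot> \<alpha> \<cdot> \<tau>)"
  using t f assms by (simp add: cmp_closed cmp_assoc rng_cmp deg_cmp add.assoc)
qed

lemma feq_same_deg:
 assumes "feq \<mu> \<nu>" "d \<mu> = d \<nu>"
 shows "\<mu> = \<nu>"
proof -
 note f = feqD[OF assms(1)]
 have "\<mu> \<cdot> s \<mu> = \<mu>" "\<nu> \<cdot> s \<mu> = \<nu>" using f src_verts[OF f(1)] by (auto simp: cmp_vert)
 then have "pfx (d \<mu>) \<mu> = pfx (d \<mu>) \<nu>"
  using f(4)[of "s \<mu>" "d \<mu>"] src_verts[OF f(1)] assms(2) by (simp add: vertsD)
 then show ?thesis unfolding pfx_all(1)[OF f(1)] unfolding assms(2) pfx_all(1)[OF f(2)] .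
qed

lemma feq_rng: "feq \<mu> \<nu> \<Longrightarrow> r \<mu> = r \<nu>"
 using feqD(4)[of \<mu> \<nu> "s \<mu>" 0] feqD(1-3)[of \<mu> \<nu>] src_verts[of \<mu>] by (simp add: vertsD cmp_vert pfx_0)

lemma feq_cancel:
 assumes "feq (\<kappa> \<cdot> \<mu>) (\<kappa> \<cdot> \<nu>)" "\<kappa> \<in> M" "\<mu> \<in> M" "\<nu> \<in> M" "r \<mu> = s \<kappa>" "r \<nu> = s \<kappa>"
 shows "feq \<mu> \<nu>"
proof (rule feqI)
 note f = feqD[OF assms(1)]
 show "\<mu> \<in> M" "\<nu> \<in> M" "s \<mu> = s \<nu>" using f assms by (auto simp: src_cmp)
 fix \<tau> n assume t: "\<tau> \<in> M" "r \<tau> = s \<mu>" "n \<le> d \<mu> + d \<tau>" "n \<le> d \<nu> + d \<tau>"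
 have sn: "s \<nu> = r \<tau>" using \<open>s \<mu> = s \<nu>\<close> t by simp
 have "pfx (d \<kappa> + n) (\<kappa> \<cdot> (\<mu> \<cdot> \<tau>)) = pfx (d \<kappa> + n) (\<kappa> \<cdot> (\<nu> \<cdot> \<tau>))"
  using f(4)[of \<tau> "d \<kappa> + n"] t assms sn by (simp add: deg_cmp src_cmp cmp_assoc add.assoc)
 then have eq: "\<kappa> \<cdot> pfx n (\<mu> \<cdot> \<tau>) = \<kappa> \<cdot> pfx n (\<nu> \<cdot> \<tau>)"
  using t assms sn by (simp add: pfx_cmp_ge cmp_closed rng_cmp deg_cmp)
 have 1: "pfx n (\<mu> \<cdot> \<tau>) \<in> M" "s \<kappa> = r (pfx n (\<mu> \<cdot> \<tau>))"
  using pfx_sfx[of "\<mu> \<cdot> \<tau>" n] t assms by (auto simp: cmp_closed deg_cmp rng_cmp)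
 have 2: "pfx n (\<nu> \<cdot> \<tau>) \<in> M" "s \<kappa> = r (pfx n (\<nu> \<cdot> \<tau>))"
  using pfx_sfx[of "\<nu> \<cdot> \<tau>" n] t assms sn by (auto simp: cmp_closed deg_cmp rng_cmp)
 show "pfx n (\<mu> \<cdot> \<tau>) = pfx n (\<nu> \<cdot> \<tau>)"
  by (rule cmp_cancel(2)[OF assms(2) 1 assms(2) 2 eq refl])
qed

text \<open>A long extension of \<open>\<mu>\<close> is also an extension of \<open>\<nu>\<close>. The tails of the two factorisations are again
equivalent, so an equivalence can be moved from the ranges to the source.\<close>

lemma feq_shift:
 assumes "feq \<mu> \<nu>" "\<tau> \<in> M" "r \<tau> = s \<mu>" "d \<nu> \<le> d \<mu> + d \<tau>"
 obtains \<rho> where "\<rho> \<in> M" "r \<rho> = s \<nu>" "s \<rho> = s \<tau>" "\<mu> \<cdot> \<tau> = \<nu> \<cdot> \<rho>" "feq \<rho> \<tau>" "d \<nu> + d \<rho> = d \<mu> + d \<tau>"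
proof -
 note f = feqD[OF assms(1)]
 define \<rho> where "\<rho> = sfx (d \<nu>) (\<mu> \<cdot> \<tau>)"
 have m: "\<mu> \<cdot> \<tau> \<in> M" "d \<nu> \<le> d (\<mu> \<cdot> \<tau>)" using f assms by (auto simp: cmp_closed deg_cmp)
 have "pfx (d \<nu>) (\<mu> \<cdot> \<tau>) = \<nu>"
  using f assms by (simp add: pfx_cmp)
 note p = pfx_sfx[OF m, unfolded this, folded \<rho>_def]
 have "feq (\<nu> \<cdot> \<rho>) (\<nu> \<cdot> \<tau>)" using feq_cmp_right[OF assms(1-3)] p by simp
 then have "feq \<rho> \<tau>" using feq_cancel[of \<nu> \<rho> \<tau>] p f assms by simp
 moreover have "d \<nu> + d \<rho> = d \<mu> + d \<tau>"
  using deg_cmp[OF f(2) p(2) p(5)] p(6) f assms by (simp add: deg_cmp)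
 moreover have "s \<rho> = s \<tau>" "r \<rho> = s \<nu>" using p(5,8) f assms by (simp_all add: src_cmp)
 ultimately show thesis by (intro that[OF p(2)] p(6)[symmetric])
qed

end

context rf_kgraph
begin

definition outp :: "'e \<Rightarrow> nat ^ 'k \<Rightarrow> 'e set" where
 "outp v n = {\<kappa> \<in> M. r \<kappa> = v \<and> d \<kappa> = n}"

lemma outp: "v \<in> V \<Longrightarrow> finite (outp v n)" "v \<in> V \<Longrightarrow> outp v n \<noteq> {}"
 using row_finite unfolding row_finite_no_sources_def outp_def by auto

lemma outpE:
 assumes "v \<in> V"
 obtains \<kappa> where "\<kappa> \<in> M" "r \<kappa> = v" "d \<kappa> = n"
 using outp(2)[OF assms, of n] by (auto simp: outp_def)

lemma feq_trans:
 assumes "feq \<mu> \<nu>" "feq \<nu> \<kappa>"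
 shows "feq \<mu> \<kappa>"
proof (rule feqI)
 note f = feqD[OF assms(1)] and g = feqD[OF assms(2)]
 show "\<mu> \<in> M" "\<kappa> \<in> M" "s \<mu> = s \<kappa>" using f g by auto
 fix \<tau> n assume t: "\<tau> \<in> M" "r \<tau> = s \<mu>" "n \<le> d \<mu> + d \<tau>" "n \<le> d \<kappa> + d \<tau>"
 obtain \<sigma> where o: "\<sigma> \<in> M" "r \<sigma> = s \<tau>" "d \<sigma> = n" using outpE[OF src_verts[OF t(1)]] by metis
 have ts: "\<tau> \<cdot> \<sigma> \<in> M" "r (\<tau> \<cdot> \<sigma>) = s \<mu>" "d (\<tau> \<cdot> \<sigma>) = d \<tau> + n"
  using t o by (auto simp: cmp_closed rng_cmp deg_cmp)
 have "pfx n (\<mu> \<cdot> \<tau>) = pfx n (\<mu> \<cdot> (\<tau> \<cdot> \<sigma>))"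
  using pfx_cmp_le[of "\<mu> \<cdot> \<tau>" \<sigma> n] f t o by (simp add: cmp_assoc cmp_closed src_cmp deg_cmp)
 also have "\<dots> = pfx n (\<nu> \<cdot> (\<tau> \<cdot> \<sigma>))"
  using f(4)[OF ts(1,2)] ts by (simp add: add.assoc[symmetric])
 also have "\<dots> = pfx n (\<kappa> \<cdot> (\<tau> \<cdot> \<sigma>))"
  using g(4)[OF ts(1)] ts f by (simp add: add.assoc[symmetric])
 also have "\<dots> = pfx n (\<kappa> \<cdot> \<tau>)"
  using pfx_cmp_le[of "\<kappa> \<cdot> \<tau>" \<sigma> n] f g t o by (simp add: cmp_assoc cmp_closed src_cmp deg_cmp)
 finally show "pfx n (\<mu> \<cdot> \<tau>) = pfx n (\<kappa> \<cdot> \<tau>)" .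
qed

text \<open>A common extension of \<open>\<kappa> \<mu>\<close> and \<open>\<kappa> \<nu>\<close> is compared at a degree \<open>n\<close>. The path \<open>\<tau>\<close> is first prolonged by a
path of degree \<open>n\<close>, so that everything in sight is determined by the segments of degree \<open>n\<close> of the
prolonged extensions of \<open>\<mu>\<close> and \<open>\<nu>\<close>, and these agree.\<close>

lemma feq_cmp_left:
 assumes "feq \<mu> \<nu>" "\<kappa> \<in> M" "s \<kappa> = r \<mu>"
 shows "feq (\<kappa> \<cdot> \<mu>) (\<kappa> \<cdot> \<nu>)"
proof (rule feqI)
 note f = feqD[OF assms(1)] and g = feq_rng[OF assms(1)]
 show "\<kappa> \<cdot> \<mu> \<in> M" "\<kappa> \<cdot> \<nu> \<in> M" "s (\<kappa> \<cdot> \<mu>) = s (\<kappa> \<cdot> \<nu>)"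
  using f g assms by (auto simp: cmp_closed src_cmp)
 fix \<tau> n assume t: "\<tau> \<in> M" "r \<tau> = s (\<kappa> \<cdot> \<mu>)" "n \<le> d (\<kappa> \<cdot> \<mu>) + d \<tau>" "n \<le> d (\<kappa> \<cdot> \<nu>) + d \<tau>"
 have rt: "r \<tau> = s \<mu>" using t f assms by (simp add: src_cmp)
 obtain \<sigma> where o: "\<sigma> \<in> M" "r \<sigma> = s \<tau>" "d \<sigma> = n" using outpE[OF src_verts[OF t(1)]] by metis
 have ts: "\<tau> \<cdot> \<sigma> \<in> M" "r (\<tau> \<cdot> \<sigma>) = s \<mu>" "d (\<tau> \<cdot> \<sigma>) = d \<tau> + n"
  using t o rt by (auto simp: cmp_closed rng_cmp deg_cmp)
 have *: "pfx n (\<kappa> \<cdot> \<alpha> \<cdot> \<tau>) = pfx n (\<kappa> \<cdot> pfx n (\<alpha> \<cdot> (\<tau> \<cdot> \<sigma>)))"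
  if a: "\<alpha> \<in> M" "s \<alpha> = r \<tau>" "s \<kappa> = r \<alpha>" "n \<le> d (\<kappa> \<cdot> \<alpha>) + d \<tau>" for \<alpha>
 proof -
  have at: "\<alpha> \<cdot> \<tau> \<in> M" "s \<kappa> = r (\<alpha> \<cdot> \<tau>)" "s (\<alpha> \<cdot> \<tau>) = r \<sigma>" "\<alpha> \<cdot> (\<tau> \<cdot> \<sigma>) \<in> M" "s \<kappa> = r (\<alpha> \<cdot> (\<tau> \<cdot> \<sigma>))"
   "n \<le> d (\<alpha> \<cdot> (\<tau> \<cdot> \<sigma>))"
   using a t o by (auto simp: cmp_closed src_cmp rng_cmp deg_cmp add.assoc[symmetric])
  have "pfx n (\<kappa> \<cdot> \<alpha> \<cdot> \<tau>) = pfx n (\<kappa> \<cdot> (\<alpha> \<cdot> \<tau>))" using a t assms by (simp add: cmp_assoc)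
  also have "\<dots> = pfx n (\<kappa> \<cdot> (\<alpha> \<cdot> \<tau>) \<cdot> \<sigma>)"
   using pfx_cmp_le[of "\<kappa> \<cdot> (\<alpha> \<cdot> \<tau>)" \<sigma> n] at a t o assms
   by (simp add: cmp_closed src_cmp deg_cmp add.assoc)
  also have "\<kappa> \<cdot> (\<alpha> \<cdot> \<tau>) \<cdot> \<sigma> = \<kappa> \<cdot> (\<alpha> \<cdot> (\<tau> \<cdot> \<sigma>))"
   using at a t o assms by (simp add: cmp_assoc)
  also have "pfx n \<dots> = pfx n (pfx (d \<kappa> + n) (\<kappa> \<cdot> (\<alpha> \<cdot> (\<tau> \<cdot> \<sigma>))))"
   using pfx_pfx(1)[of "\<kappa> \<cdot> (\<alpha> \<cdot> (\<tau> \<cdot> \<sigma>))" n "d \<kappa> + n"] assms at by (simp add: cmp_closed deg_cmp)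
  also have "\<dots> = pfx n (\<kappa> \<cdot> pfx n (\<alpha> \<cdot> (\<tau> \<cdot> \<sigma>)))"
   using pfx_cmp_ge[of \<kappa> "\<alpha> \<cdot> (\<tau> \<cdot> \<sigma>)" n] at assms by simp
  finally show ?thesis .
 qed
 have "pfx n (\<mu> \<cdot> (\<tau> \<cdot> \<sigma>)) = pfx n (\<nu> \<cdot> (\<tau> \<cdot> \<sigma>))"
  using f(4)[OF ts(1,2)] ts by (simp add: add.assoc[symmetric])
 then show "pfx n (\<kappa> \<cdot> \<mu> \<cdot> \<tau>) = pfx n (\<kappa> \<cdot> \<nu> \<cdot> \<tau>)"
  using *[of \<mu>] *[of \<nu>] f g assms t rt by simp
qed

end

section \<open>Periodicity\<close>

definition vdiff :: "nat ^ 'k::finite \<Rightarrow> nat ^ 'k \<Rightarrow> int ^ 'k" where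
 "vdiff p q = (\<chi> i. int (p $ i) - int (q $ i))"

lemma vdiff_simps [simp]:
 "vdiff p p = 0" "vdiff (p + m) (q + m) = vdiff p q" "vdiff (m + p) (m + q) = vdiff p q"
 by (simp_all add: vdiff_def vec_eq_iff)

lemma vdiff_add: "vdiff p q + vdiff p' q' = vdiff (p + p') (q + q')"
 and vdiff_uminus: "- vdiff p q = vdiff q p"
 and vdiff_eq_iff: "vdiff p q = vdiff p' q' \<longleftrightarrow> p + q' = p' + q"
 by (auto simp: vdiff_def vec_eq_iff) (smt (verit) of_nat_add of_nat_eq_iff)+

lemma nat_mono_subseq:
 fixes x :: "nat \<Rightarrow> nat"
 obtains \<phi> :: "nat \<Rightarrow> nat" where "strict_mono \<phi>" "\<And>i j. i \<le> j \<Longrightarrow> x (\<phi> i) \<le> x (\<phi> j)"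
proof -
 obtain f where f: "strict_mono f" "monoseq (\<lambda>n. x (f n))" using seq_monosub by blast
 show thesis
 proof (cases "\<forall>m n. m \<le> n \<longrightarrow> x (f m) \<le> x (f n)")
  case True
  then show ?thesis using that f(1) by blast
 next
  case False
  then have dec: "m \<le> n \<Longrightarrow> x (f n) \<le> x (f m)" for m n using f(2) by (auto simp: monoseq_def)
  obtain n0 where n0: "\<And>n. x (f n0) \<le> x (f n)" using ex_has_least_nat[of "\<lambda>_. True" 0 "\<lambda>n. x (f n)"] by auto
  have "strict_mono (\<lambda>n. f (n0 + n))" using f(1) by (auto simp: strict_mono_def)
  moreover have "x (f (n0 + n)) = x (f n0)" for n using dec[of n0 "n0 + n"] n0[of "n0 + n"] by simp
  ultimately show ?thesis using that by simp
 qed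
qed

lemma vec_mono_subseq:
 fixes x :: "nat \<Rightarrow> nat ^ 'k::finite"
 obtains \<phi> :: "nat \<Rightarrow> nat" where "strict_mono \<phi>" "\<And>i j. i \<le> j \<Longrightarrow> x (\<phi> i) \<le> x (\<phi> j)"
proof -
 have "\<exists>\<phi>::nat \<Rightarrow> nat. strict_mono \<phi> \<and> (\<forall>i j. i \<le> j \<longrightarrow> (\<forall>k\<in>I. x (\<phi> i) $ k \<le> x (\<phi> j) $ k))" if "finite I" for I
  using that
 proof (induction I)
  case empty
  show ?case by (auto intro: simp: strict_mono_def)
 next
  case (insert k I)
  then obtain \<phi> :: "nat \<Rightarrow> nat" where p: "strict_mono \<phi>" "\<And>i j k. i \<le> j \<Longrightarrow> k \<in> I \<Longrightarrow> x (\<phi> i) $ k \<le> x (\<phi> j) $ k" by blast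
  obtain \<psi> :: "nat \<Rightarrow> nat" where q: "strict_mono \<psi>" "\<And>i j. i \<le> j \<Longrightarrow> x (\<phi> (\<psi> i)) $ k \<le> x (\<phi> (\<psi> j)) $ k"
   using nat_mono_subseq[of "\<lambda>n. x (\<phi> n) $ k"] by blast
  have "strict_mono (\<phi> \<circ> \<psi>)" using p q by (simp add: strict_mono_o)
  moreover have "\<psi> i \<le> \<psi> j" if "i \<le> j" for i j using q(1) that by (simp add: strict_mono_less_eq)
  ultimately show ?case using p(2) q(2) by (intro exI) auto
 qed
 from this[of UNIV] show thesis using that by (auto simp: less_eq_vec_def)
qed

text \<open>Antichains are finite: every infinite sequence of pairs has a subsequence along which all coordinates
are nondecreasing.\<close>

lemma pair_Dickson:
 fixes S :: "((nat ^ 'k::finite) \<times> (nat ^ 'k)) set"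
 assumes anti: "\<And>p q p' q'. \<lbrakk>(p, q) \<in> S; (p', q') \<in> S; p \<le> p'; q \<le> q'\<rbrakk> \<Longrightarrow> p = p' \<and> q = q'"
 shows "finite S"
proof (rule ccontr)
 assume "infinite S"
 then obtain f :: "nat \<Rightarrow> _" where f: "inj f" "range f \<subseteq> S" using infinite_countable_subset by blast
 obtain \<phi> :: "nat \<Rightarrow> nat" where p: "strict_mono \<phi>" "\<And>i j. i \<le> j \<Longrightarrow> fst (f (\<phi> i)) \<le> fst (f (\<phi> j))"
  using vec_mono_subseq[of "\<lambda>n. fst (f n)"] by blast
 obtain \<psi> :: "nat \<Rightarrow> nat" where q: "strict_mono \<psi>" "\<And>i j. i \<le> j \<Longrightarrow> snd (f (\<phi> (\<psi> i))) \<le> snd (f (\<phi> (\<psi> j)))"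
  using vec_mono_subseq[of "\<lambda>n. snd (f (\<phi> n))"] by blast
 have lt: "\<psi> 0 < \<psi> 1" using q(1) by (simp add: strict_mono_def)
 then have "fst (f (\<phi> (\<psi> 0))) \<le> fst (f (\<phi> (\<psi> 1)))" "snd (f (\<phi> (\<psi> 0))) \<le> snd (f (\<phi> (\<psi> 1)))"
  using p(2) q(2) by auto
 then have "f (\<phi> (\<psi> 0)) = f (\<phi> (\<psi> 1))"
  using anti[of "fst (f (\<phi> (\<psi> 0)))" "snd (f (\<phi> (\<psi> 0)))" "fst (f (\<phi> (\<psi> 1)))" "snd (f (\<phi> (\<psi> 1)))"] f(2)
  by (auto simp: prod_eq_iff)
 then have "\<phi> (\<psi> 0) = \<phi> (\<psi> 1)" using f(1) by (simp add: inj_eq)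
 then show False using p(1) lt by (simp add: strict_mono_eq)
qed

text \<open>A form of Dickson's lemma. A set of pairs of vectors that is closed under differences lies in the monoid
generated by its minimal nonzero elements, and these form an antichain. The conclusion is stated as an
induction rule.\<close>

lemma pair_monoid_generators:
 fixes S :: "((nat ^ 'k::finite) \<times> (nat ^ 'k)) set"
 assumes sub: "\<And>p q p' q'. \<lbrakk>(p, q) \<in> S; (p + p', q + q') \<in> S\<rbrakk> \<Longrightarrow> (p', q') \<in> S"
 obtains G where "finite G" "G \<subseteq> S"
  "\<And>P. \<lbrakk>P 0 0; \<And>p q. (p, q) \<in> G \<Longrightarrow> P p q; \<And>p q p' q'. \<lbrakk>P p q; P p' q'\<rbrakk> \<Longrightarrow> P (p + p') (q + q')\<rbrakk> \<Longrightarrow> \<forall>(p, q)\<in>S. P p q"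
proof
 define G where "G = {(p, q) \<in> S. (p, q) \<noteq> (0, 0) \<and> (\<forall>p' q'. (p', q') \<in> S \<and> (p', q') \<noteq> (0, 0) \<and> p' \<le> p \<and> q' \<le> q \<longrightarrow> p' = p \<and> q' = q)}"
 show "finite G" by (rule pair_Dickson) (auto simp: G_def)
 show "G \<subseteq> S" by (auto simp: G_def)
 define sz where "sz p q = (\<Sum>i\<in>UNIV. p $ i + q $ i)" for p q :: "nat ^ 'k"
 have sz_add: "sz (p + p') (q + q') = sz p q + sz p' q'" for p p' q q'
  by (simp add: sz_def sum.distrib)
 have sz0: "sz p q = 0 \<longleftrightarrow> p = 0 \<and> q = 0" for p q by (auto simp: sz_def vec_eq_iff)
 fix P assume P0: "P 0 0" and PG: "\<And>p q. (p, q) \<in> G \<Longrightarrow> P p q"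
  and Padd: "\<And>p q p' q'. \<lbrakk>P p q; P p' q'\<rbrakk> \<Longrightarrow> P (p + p') (q + q')"
 have "P p q" if "(p, q) \<in> S" for p q
  using that
 proof (induction "sz p q" arbitrary: p q rule: less_induct)
  case less
  show ?case
  proof (cases "(p, q) = (0, 0)")
   case True
   then show ?thesis using P0 by simp
  next
   case False
   define A where "A = (\<lambda>x. x \<in> S \<and> x \<noteq> (0, 0) \<and> fst x \<le> p \<and> snd x \<le> q)"
   have "A (p, q)" using less False by (simp add: A_def)
   then obtain x where x: "A x" "\<And>y. A y \<Longrightarrow> sz (fst x) (snd x) \<le> sz (fst y) (snd y)"
    using ex_has_least_nat[of A "(p, q)" "\<lambda>x. sz (fst x) (snd x)"] by blast
   obtain a b where ab: "x = (a, b)" by (cases x)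
   have aS: "(a, b) \<in> S" "a \<le> p" "b \<le> q" and nz: "(a, b) \<noteq> (0, 0)" using x(1) ab by (auto simp: A_def)
   have min: "p' = a \<and> q' = b" if 1: "(p', q') \<in> S" "(p', q') \<noteq> (0, 0)" "p' \<le> a" "q' \<le> b" for p' q'
   proof -
    have "A (p', q')" using 1 aS by (auto simp: A_def)
    then have le: "sz a b \<le> sz p' q'" using x(2) ab by fastforce
    have "a = p' + (a - p')" "b = q' + (b - q')" using 1 by auto
    then have "sz a b = sz p' q' + sz (a - p') (b - q')" using sz_add by metis
    then have "sz (a - p') (b - q') = 0" using le by simp
    then show ?thesis using \<open>a = p' + (a - p')\<close> \<open>b = q' + (b - q')\<close> sz0 by (metis add.right_neutral)
   qed
   have "(a, b) \<in> G"
    using G_def aS nz min by auto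
   then have Pab: "P a b" using PG by blast
   have pq: "p = a + (p - a)" "q = b + (q - b)" using aS by auto
   then have "sz p q = sz a b + sz (p - a) (q - b)" using sz_add by metis
   moreover have "sz a b > 0" using nz sz0 by auto
   moreover have "(p - a, q - b) \<in> S" using sub[OF aS(1), of "p - a" "q - b"] less(2) pq by simp
   ultimately have "P (p - a) (q - b)" using less(1) by simp
   then show ?thesis using Padd[OF Pab] pq by metis
  qed
 qed
 then show "\<forall>(p, q)\<in>S. P p q" by blast
qed

context rf_kgraph
begin

text \<open>The set \<open>Per\<close>, described through \<open>feq\<close>; see \<open>Per_eq_perset\<close>.\<close>

definition perset :: "(int ^ 'k) set" where
 "perset = {vdiff (d \<mu>) (d \<nu>) | \<mu> \<nu>. feq \<mu> \<nu>}"

lemma perset_uminus: "g \<in> perset \<Longrightarrow> - g \<in> perset"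
 unfolding perset_def using feq_sym by (force simp: vdiff_uminus)

lemma perset_vdiff_commute: "vdiff p q \<in> perset \<longleftrightarrow> vdiff q p \<in> perset"
 using perset_uminus[of "vdiff p q"] perset_uminus[of "vdiff q p"] by (auto simp: vdiff_uminus)

lemma feq_sfx:
 assumes "feq \<mu> \<nu>" "n \<le> d \<mu>" "n \<le> d \<nu>"
 shows "pfx n \<mu> = pfx n \<nu>" "feq (sfx n \<mu>) (sfx n \<nu>)"
proof -
 note f = feqD[OF assms(1)]
 have v: "\<mu> \<cdot> s \<mu> = \<mu>" "\<nu> \<cdot> s \<mu> = \<nu>" using f src_verts by (auto simp: cmp_vert)
 show 1: "pfx n \<mu> = pfx n \<nu>"
  using f(4)[of "s \<mu>" n] src_verts[OF f(1)] assms(2,3) unfolding v by (simp add: vertsD deg_vert)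
 note p = pfx_sfx[OF f(1) assms(2)] and q = pfx_sfx[OF f(2) assms(3)]
 have "feq (pfx n \<mu> \<cdot> sfx n \<mu>) (pfx n \<mu> \<cdot> sfx n \<nu>)"
  using assms(1) unfolding p(6) unfolding 1 q(6) .
 then show "feq (sfx n \<mu>) (sfx n \<nu>)"
  by (rule feq_cancel) (use p q 1 in auto)
qed

text \<open>Periodicity at \<open>w\<close>, uniformly in the paths. In this form it passes to all later vertices.\<close>

definition swap_at :: "'e \<Rightarrow> nat ^ 'k \<Rightarrow> nat ^ 'k \<Rightarrow> bool" where
 "swap_at w p q \<longleftrightarrow> (\<forall>\<mu>\<in>outp w p. \<exists>\<nu>\<in>outp w q. feq \<mu> \<nu>)"

lemma swap_at_refl: "swap_at w p p"
 unfolding swap_at_def outp_def using feq_refl by blast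

lemma swap_at_hereditary:
 assumes "swap_at w p q" "\<kappa> \<in> M" "r \<kappa> = w"
 shows "swap_at (s \<kappa>) p q"
 unfolding swap_at_def
proof
 fix \<mu> assume "\<mu> \<in> outp (s \<kappa>) p"
 then have m: "\<mu> \<in> M" "s \<kappa> = r \<mu>" "d \<mu> = p" by (auto simp: outp_def)
 have km: "\<kappa> \<cdot> \<mu> \<in> M" "d (\<kappa> \<cdot> \<mu>) = d \<kappa> + p" "p \<le> d (\<kappa> \<cdot> \<mu>)" "r (\<kappa> \<cdot> \<mu>) = w"
  using m assms by (auto simp: cmp_closed deg_cmp rng_cmp)
 note p = pfx_sfx[OF km(1,3)]
 have "pfx p (\<kappa> \<cdot> \<mu>) \<in> outp w p" using p km by (simp add: outp_def)
 then obtain \<alpha> where a: "\<alpha> \<in> outp w q" "feq (pfx p (\<kappa> \<cdot> \<mu>)) \<alpha>" using assms(1) by (auto simp: swap_at_def)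
 note f = feqD[OF a(2)]
 let ?a = "\<alpha> \<cdot> sfx p (\<kappa> \<cdot> \<mu>)"
 have fa: "feq (\<kappa> \<cdot> \<mu>) ?a"
  using feq_cmp_right[OF a(2) p(2)] p by simp
 have da: "d ?a = d \<kappa> + q"
  using a f p km deg_cmp by (simp add: outp_def add.commute)
 have k: "pfx (d \<kappa>) (\<kappa> \<cdot> \<mu>) = \<kappa>" "sfx (d \<kappa>) (\<kappa> \<cdot> \<mu>) = \<mu>" using m assms by (auto simp: pfx_cmp)
 have "feq \<mu> (sfx (d \<kappa>) ?a)" using feq_sfx(2)[OF fa, of "d \<kappa>"] km da k by simp
 moreover have "sfx (d \<kappa>) ?a \<in> outp (s \<kappa>) q"
  using pfx_sfx feqD(2)[OF fa] da feq_rng[OF calculation] m by (simp add: outp_def)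
 ultimately show "\<exists>\<nu>\<in>outp (s \<kappa>) q. feq \<mu> \<nu>" by blast
qed

lemma swap_at_add:
 assumes "swap_at w p q" "swap_at w p' q'"
 shows "swap_at w (p + p') (q + q')"
 unfolding swap_at_def
proof
 fix \<mu> assume "\<mu> \<in> outp w (p + p')"
 then have m: "\<mu> \<in> M" "r \<mu> = w" "d \<mu> = p + p'" "p \<le> d \<mu>" by (auto simp: outp_def)
 note p = pfx_sfx[OF m(1,4)]
 have "pfx p \<mu> \<in> outp w p" using p m by (simp add: outp_def)
 then obtain \<alpha> where a: "\<alpha> \<in> outp w q" "feq (pfx p \<mu>) \<alpha>" using assms(1) by (auto simp: swap_at_def)
 have "swap_at (s (pfx p \<mu>)) p' q'" using swap_at_hereditary[OF assms(2) p(1)] p m by simp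
 moreover have "sfx p \<mu> \<in> outp (s (pfx p \<mu>)) p'" using p m by (simp add: outp_def)
 ultimately obtain \<beta> where b: "\<beta> \<in> outp (s (pfx p \<mu>)) q'" "feq (sfx p \<mu>) \<beta>" by (auto simp: swap_at_def)
 note fa = feqD[OF a(2)] and fb = feqD[OF b(2)]
 have "feq (pfx p \<mu> \<cdot> sfx p \<mu>) (pfx p \<mu> \<cdot> \<beta>)" using feq_cmp_left[OF b(2) p(1)] p by simp
 moreover have "feq (pfx p \<mu> \<cdot> \<beta>) (\<alpha> \<cdot> \<beta>)" using feq_cmp_right[OF a(2) fb(2)] b by (simp add: outp_def)
 ultimately have "feq \<mu> (\<alpha> \<cdot> \<beta>)" using feq_trans p(6) by metis
 moreover have "\<alpha> \<cdot> \<beta> \<in> outp w (q + q')"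
  using a b fa by (auto simp: outp_def cmp_closed rng_cmp deg_cmp)
 ultimately show "\<exists>\<nu>\<in>outp w (q + q'). feq \<mu> \<nu>" by blast
qed

lemma swap_at_source:
 assumes "feq \<mu> \<nu>" "vdiff p q = vdiff (d \<nu>) (d \<mu>)"
 shows "swap_at (s \<mu>) p q"
 unfolding swap_at_def
proof
 fix \<tau> assume t: "\<tau> \<in> outp (s \<mu>) p"
 have e: "p + d \<mu> = d \<nu> + q" using assms(2) by (simp add: vdiff_eq_iff)
 have t': "\<tau> \<in> M" "r \<tau> = s \<mu>" "d \<tau> = p" using t by (auto simp: outp_def)
 have "d \<nu> \<le> d \<mu> + d \<tau>" using e t' by (metis add.commute vec_le_add(1))
 from feq_shift[OF assms(1) t'(1,2) this] obtain \<rho> where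
  r: "\<rho> \<in> M" "r \<rho> = s \<nu>" "feq \<rho> \<tau>" "d \<nu> + d \<rho> = d \<mu> + d \<tau>" by metis
 have "d \<rho> = q" using r(4) t' e by (metis add.commute add_left_cancel)
 then have "\<rho> \<in> outp (s \<mu>) q" using r feqD(3)[OF assms(1)] by (simp add: outp_def)
 then show "\<exists>\<nu>\<in>outp (s \<mu>) q. feq \<tau> \<nu>" using feq_sym[OF r(3)] by blast
qed

lemma swap_at_exists:
 assumes "vdiff p q \<in> perset"
 obtains w where "w \<in> V" "swap_at w p q"
proof -
 have "vdiff q p \<in> perset" using assms perset_vdiff_commute by blast
 then obtain \<mu> \<nu> where m: "feq \<mu> \<nu>" "vdiff q p = vdiff (d \<mu>) (d \<nu>)" by (auto simp: perset_def)
 then have "vdiff p q = vdiff (d \<nu>) (d \<mu>)" by (metis vdiff_uminus)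
 then show thesis using that swap_at_source[OF m(1)] src_verts[OF feqD(1)[OF m(1)]] by blast
qed

text \<open>A pair of paths with the same source that are not equivalent has incompatible extensions, and
incompatibility survives further extension. So finitely many pairs can be separated one after the
other.\<close>

lemma separate:
 assumes "finite Z" "v \<in> V"
  and "\<And>a b. (a, b) \<in> Z \<Longrightarrow> a \<in> M \<and> b \<in> M \<and> s a = v \<and> s b = v \<and> vdiff (d a) (d b) \<notin> perset"
 obtains \<tau> where "\<tau> \<in> M" "r \<tau> = v" "\<And>a b. (a, b) \<in> Z \<Longrightarrow> \<not> compat (a \<cdot> \<tau>) (b \<cdot> \<tau>)"
proof -
 have "\<exists>\<tau>\<in>M. r \<tau> = v \<and> (\<forall>(a, b)\<in>Z. \<not> compat (a \<cdot> \<tau>) (b \<cdot> \<tau>))"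
  using assms(1,3)
 proof (induction Z)
  case empty
  then show ?case using assms(2) vertsD by blast
 next
  case (insert x Z)
  obtain a b where x: "x = (a, b)" by (cases x)
  obtain \<tau> where t: "\<tau> \<in> M" "r \<tau> = v" "\<forall>(a, b)\<in>Z. \<not> compat (a \<cdot> \<tau>) (b \<cdot> \<tau>)"
   using insert by blast
  have ab: "a \<in> M" "b \<in> M" "s a = v" "s b = v" "vdiff (d a) (d b) \<notin> perset" using insert.prems x by auto
  have at: "a \<cdot> \<tau> \<in> M" "b \<cdot> \<tau> \<in> M" "s (a \<cdot> \<tau>) = s \<tau>" "s (b \<cdot> \<tau>) = s \<tau>"
   using ab t by (auto simp: cmp_closed src_cmp)
  \<comment> \<open>An equivalence would put the difference of the degrees into the group.\<close>
  have "\<not> feq (a \<cdot> \<tau>) (b \<cdot> \<tau>)"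
   using perset_def ab t deg_cmp by simp
  then obtain \<sigma> where o: "\<sigma> \<in> M" "r \<sigma> = s \<tau>" "\<not> compat (a \<cdot> \<tau> \<cdot> \<sigma>) (b \<cdot> \<tau> \<cdot> \<sigma>)"
   using at by (auto simp: feq_def)
  have ts: "\<tau> \<cdot> \<sigma> \<in> M" "r (\<tau> \<cdot> \<sigma>) = v" using t o by (auto simp: cmp_closed rng_cmp)
  have "\<not> compat (a' \<cdot> (\<tau> \<cdot> \<sigma>)) (b' \<cdot> (\<tau> \<cdot> \<sigma>))" if "(a', b') \<in> insert x Z" for a' b'
   using insert.prems that cmp_assoc t o compat_pfx cmp_closed src_cmp x by fastforce
  then show ?case using ts by blast
 qed
 then show thesis using that by blast
qed

end

locale directed_kgraph = rf_kgraph \<Lambda> for \<Lambda> :: "('e, 'k::finite) kgraph" +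
 assumes verts_nonempty: "verts \<Lambda> \<noteq> {}"
  and directed: "\<lbrakk>v \<in> verts \<Lambda>; v' \<in> verts \<Lambda>\<rbrakk> \<Longrightarrow>
   \<exists>w. connected_to \<Lambda> v w \<and> connected_to \<Lambda> v' w"
begin

lemma common_source:
 assumes "v \<in> V" "v' \<in> V"
 obtains \<alpha> \<beta> where "\<alpha> \<in> M" "\<beta> \<in> M" "r \<alpha> = v" "r \<beta> = v'" "s \<alpha> = s \<beta>"
 using directed[OF assms] unfolding connected_to_def by metis

lemma perset_0: "0 \<in> perset"
  using verts_nonempty vertsD feq_refl perset_def by fastforce

lemma feq_common_source:
 assumes "feq \<mu> \<nu>" "feq \<mu>' \<nu>'"
 obtains \<alpha> \<beta> where "\<alpha> \<in> M" "\<beta> \<in> M" "r \<alpha> = s \<mu>" "r \<beta> = s \<mu>'" "s \<alpha> = s \<beta>"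
  "feq (\<mu> \<cdot> \<alpha>) (\<nu> \<cdot> \<alpha>)" "feq (\<mu>' \<cdot> \<beta>) (\<nu>' \<cdot> \<beta>)"
  "s (\<mu> \<cdot> \<alpha>) = s (\<mu>' \<cdot> \<beta>)"
  "vdiff (d (\<mu> \<cdot> \<alpha>)) (d (\<nu> \<cdot> \<alpha>)) = vdiff (d \<mu>) (d \<nu>)"
  "vdiff (d (\<mu>' \<cdot> \<beta>)) (d (\<nu>' \<cdot> \<beta>)) = vdiff (d \<mu>') (d \<nu>')"
proof -
 note f = feqD[OF assms(1)] and f' = feqD[OF assms(2)]
 obtain \<alpha> \<beta> where a: "\<alpha> \<in> M" "\<beta> \<in> M" "r \<alpha> = s \<mu>" "r \<beta> = s \<mu>'" "s \<alpha> = s \<beta>"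
  using common_source[OF src_verts[OF f(1)] src_verts[OF f'(1)]] by metis
 show thesis
  by (rule that[OF a]) (use a f f' feq_cmp_right assms in \<open>auto simp: src_cmp deg_cmp\<close>)
qed

lemma perset_add:
 assumes "g \<in> perset" "h \<in> perset"
 shows "g + h \<in> perset"
proof -
 obtain p q p' q' where g: "g = vdiff p q" "h = vdiff p' q'" using assms by (auto simp: perset_def)
 obtain w w' where w: "w \<in> V" "swap_at w p q" "w' \<in> V" "swap_at w' p' q'"
  using swap_at_exists assms g by metis
 obtain \<alpha> \<beta> where a: "\<alpha> \<in> M" "\<beta> \<in> M" "r \<alpha> = w" "r \<beta> = w'" "s \<alpha> = s \<beta>"
  using common_source[OF w(1,3)] by metis
 have "swap_at (s \<alpha>) (p + p') (q + q')"
  using swap_at_add swap_at_hereditary[OF w(2) a(1,3)] swap_at_hereditary[OF w(4) a(2,4)] a(5) by metis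
 moreover obtain \<mu> where "\<mu> \<in> outp (s \<alpha>) (p + p')" using outp(2)[OF src_verts[OF a(1)]] by blast
 ultimately obtain \<nu> where "\<nu> \<in> outp (s \<alpha>) (q + q')" "feq \<mu> \<nu>" by (auto simp: swap_at_def)
 moreover have "vdiff (d \<mu>) (d \<nu>) = g + h"
  using \<open>\<mu> \<in> _\<close> \<open>\<nu> \<in> _\<close> by (simp add: g vdiff_add outp_def)
 ultimately show ?thesis unfolding perset_def by (intro CollectI exI[of _ \<mu>] exI[of _ \<nu>]) simp
qed

lemma perset_equiv:
 "vdiff p p \<in> perset" "vdiff p q \<in> perset \<Longrightarrow> vdiff q p \<in> perset"
 "\<lbrakk>vdiff p q \<in> perset; vdiff q m \<in> perset\<rbrakk> \<Longrightarrow> vdiff p m \<in> perset"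
proof -
 show "vdiff p p \<in> perset" using perset_0 by simp
 show "vdiff p q \<in> perset \<Longrightarrow> vdiff q p \<in> perset" using perset_vdiff_commute by blast
 assume "vdiff p q \<in> perset" "vdiff q m \<in> perset"
 then have "vdiff p q + vdiff q m \<in> perset" by (rule perset_add)
 moreover have "vdiff p q + vdiff q m = vdiff p m" by (simp add: vdiff_def vec_eq_iff)
 ultimately show "vdiff p m \<in> perset" by simp
qed

text \<open>The vertices at which every period is realised. A single period is realised at some vertex and then
at all later ones; as the pairs of degrees that differ by a period form a finitely generated monoid,
finitely many periods suffice and directedness gives a common later vertex.\<close>

definition periodic_verts :: "'e set" where
 "periodic_verts = {w \<in> V. \<forall>p q. vdiff p q \<in> perset \<longrightarrow> swap_at w p q}"

lemma periodic_verts_hereditary: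
 "\<lbrakk>w \<in> periodic_verts; \<kappa> \<in> M; r \<kappa> = w\<rbrakk> \<Longrightarrow> s \<kappa> \<in> periodic_verts"
 using swap_at_hereditary src_verts unfolding periodic_verts_def by blast

lemma periodic_verts_swap:
 assumes "w \<in> periodic_verts" "\<mu> \<in> M" "r \<mu> = w" "vdiff (d \<mu>) q \<in> perset"
 obtains \<nu> where "\<nu> \<in> M" "r \<nu> = w" "d \<nu> = q" "feq \<mu> \<nu>"
 using assms unfolding periodic_verts_def swap_at_def outp_def by blast

lemma periodic_verts_nonempty: "periodic_verts \<noteq> {}"
proof -
 define S where "S = {(p, q). vdiff p q \<in> perset}"
 have sub: "(p', q') \<in> S" if "(p, q) \<in> S" "(p + p', q + q') \<in> S" for p q p' q'
 proof -
  have "vdiff q p + vdiff (p + p') (q + q') \<in> perset"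
   using that perset_add perset_vdiff_commute unfolding S_def by blast
  moreover have "vdiff q p + vdiff (p + p') (q + q') = vdiff p' q'" by (simp add: vdiff_def vec_eq_iff)
  ultimately show ?thesis by (simp add: S_def)
 qed
 obtain G where G: "finite G" "G \<subseteq> S"
  "\<And>P. \<lbrakk>P 0 0; \<And>p q. (p, q) \<in> G \<Longrightarrow> P p q; \<And>p q p' q'. \<lbrakk>P p q; P p' q'\<rbrakk> \<Longrightarrow> P (p + p') (q + q')\<rbrakk> \<Longrightarrow> \<forall>(p, q)\<in>S. P p q"
  by (rule pair_monoid_generators[of S]) (blast intro: sub)+
 have "\<exists>w\<in>V. \<forall>(p, q)\<in>G. swap_at w p q" using G(1,2)
 proof (induction G)
  case empty
  then show ?case using verts_nonempty by blast
 next
  case (insert x G)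
  obtain p q where x: "x = (p, q)" by (cases x)
  obtain w where w: "w \<in> V" "\<forall>(p, q)\<in>G. swap_at w p q" using insert by blast
  obtain w' where w': "w' \<in> V" "swap_at w' p q"
   using swap_at_exists insert.prems x unfolding S_def by blast
  obtain \<alpha> \<beta> where a: "\<alpha> \<in> M" "\<beta> \<in> M" "r \<alpha> = w" "r \<beta> = w'" "s \<alpha> = s \<beta>"
   using common_source[OF w(1) w'(1)] by metis
  have "swap_at (s \<alpha>) p q" using swap_at_hereditary[OF w'(2) a(2,4)] a(5) by simp
  moreover have "\<forall>(p, q)\<in>G. swap_at (s \<alpha>) p q" using swap_at_hereditary[OF _ a(1,3)] w(2) by blast
  ultimately show ?case using src_verts[OF a(1)] x by blast
 qed
 then obtain w where w: "w \<in> V" "\<And>p q. (p, q) \<in> G \<Longrightarrow> swap_at w p q" by blast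
 have "\<forall>(p, q)\<in>S. swap_at w p q" by (rule G(3)) (use w swap_at_refl swap_at_add in auto)
 then show ?thesis using w by (auto simp: periodic_verts_def S_def)
qed

end

section \<open>Infinite paths\<close>

context kgraph
begin

lemma inf_pathsD:
 assumes "x \<in> ipaths" "m \<le> n"
 shows "x (m, n) \<in> M" "d (x (m, n)) = n - m" "r (x (m, n)) = x (m, m)" "s (x (m, n)) = x (n, n)"
  "n \<le> p \<Longrightarrow> x (m, n) \<cdot> x (n, p) = x (m, p)"
 using assms unfolding inf_paths_def by blast+

lemma inf_path_vert: "x \<in> ipaths \<Longrightarrow> x (n, n) \<in> V"
 using inf_pathsD src_verts[of "x (n, n)"] by simp

lemma inf_path_pfx:
 assumes "x \<in> ipaths" "m \<le> n"
 shows "pfx m (x (0, n)) = x (0, m)" "sfx m (x (0, n)) = x (m, n)"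
proof -
 note a = inf_pathsD[OF assms(1), of 0 m, simplified] and b = inf_pathsD[OF assms]
 show "pfx m (x (0, n)) = x (0, m)" "sfx m (x (0, n)) = x (m, n)"
  using pfx_unique[OF a(1) b(1) _ a(5)[OF assms(2)]] a b by auto
qed

lemma inf_path_eqI:
 assumes "x \<in> ipaths" "y \<in> ipaths" "\<And>n. \<exists>n'. n \<le> n' \<and> x (0, n') = y (0, n')"
 shows "x = y"
proof
 have 0: "x (0, n) = y (0, n)" for n
  using assms(3) inf_path_pfx(1)[OF assms(1)] inf_path_pfx(1)[OF assms(2)] by metis
 fix mn
 show "x mn = y mn"
 proof (cases mn)
  case (Pair m n)
  show ?thesis
  proof (cases "m \<le> n")
   case True
   then show ?thesis using 0[of n] inf_path_pfx(2)[OF assms(1)] inf_path_pfx(2)[OF assms(2)] Pair by metis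
  next
   case False
   have "x \<in> extensional {(m, n). m \<le> n}" "y \<in> extensional {(m, n). m \<le> n}"
    using assms(1,2) by (auto simp: inf_paths_def)
   then show ?thesis using False Pair by (simp add: extensional_def)
  qed
 qed
qed

text \<open>An infinite path is determined by its initial segments.\<close>

definition inf_of :: "(nat ^ 'k \<Rightarrow> 'e) \<Rightarrow> ('e, 'k) inf_path" where
 "inf_of X = (\<lambda>(m, n)\<in>{(m, n). m \<le> n}. sfx m (X n))"

lemma inf_of:
 assumes "\<And>n. X n \<in> M" "\<And>n. d (X n) = n" "\<And>m n. m \<le> n \<Longrightarrow> pfx m (X n) = X m"
 shows "inf_of X \<in> ipaths" "inf_of X (0, n) = X n"
proof -
 have x: "inf_of X (m, n) = sfx m (X n)" if "m \<le> n" for m n using that by (simp add: inf_of_def)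
 show "inf_of X (0, n) = X n" using assms(1) by (simp add: x pfx_0)
 show "inf_of X \<in> ipaths"
  unfolding inf_paths_def
 proof (intro CollectI conjI allI impI)
  show "inf_of X \<in> extensional {(m, n). m \<le> n}" by (auto simp: inf_of_def)
  fix m n :: "nat ^ 'k" assume mn: "m \<le> n"
  have "m \<le> d (X n)" using assms mn by simp
  note p = pfx_sfx[OF assms(1) this]
  have v: "sfx m (X m) = s (X m)" for m using pfx_all(2)[OF assms(1)[of m]] assms(2) by simp
  show "inf_of X (m, n) \<in> M" "deg \<Lambda> (inf_of X (m, n)) = n - m" "r (inf_of X (m, n)) = inf_of X (m, m)"
   "s (inf_of X (m, n)) = inf_of X (n, n)"
   using p mn assms(2) assms(3) by (simp_all add: x v)
 next
  fix m n p :: "nat ^ 'k" assume mnp: "m \<le> n \<and> n \<le> p"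
  then have "sfx m (X p) = sfx m (X n) \<cdot> sfx n (X p)"
   using pfx_pfx(2)[OF assms(1)[of p], of m n] assms by simp
  moreover have "m \<le> p" using mnp by auto
  ultimately show "inf_of X (m, n) \<cdot> inf_of X (n, p) = inf_of X (m, p)" using mnp by (simp add: x)
 qed
qed

lemma inf_path_of_chain:
 fixes \<rho> :: "nat \<Rightarrow> 'e"
 assumes "\<And>j. \<rho> j \<in> M" "\<And>j. \<exists>\<tau>\<in>M. s (\<rho> j) = r \<tau> \<and> \<rho> (Suc j) = \<rho> j \<cdot> \<tau>"
  and cof: "\<And>n. \<exists>j. n \<le> d (\<rho> j)"
 obtains x where "x \<in> ipaths" "\<And>j. x (0, d (\<rho> j)) = \<rho> j"
proof -
 have step: "n \<le> d (\<rho> (Suc j)) \<and> pfx n (\<rho> (Suc j)) = pfx n (\<rho> j)" if n: "n \<le> d (\<rho> j)" for n j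
 proof -
  obtain \<tau> where "\<tau> \<in> M" "s (\<rho> j) = r \<tau>" "\<rho> (Suc j) = \<rho> j \<cdot> \<tau>" using assms(2) by blast
  then show ?thesis using pfx_cmp_le n assms(1) by (simp add: deg_cmp vec_le_diff)
 qed
 have mono: "n \<le> d (\<rho> j) \<and> pfx n (\<rho> j) = pfx n (\<rho> i)" if "i \<le> j" "n \<le> d (\<rho> i)" for i j n
  using that(1) by (induction j rule: dec_induct) (use that(2) step in auto)
 have same: "pfx n (\<rho> i) = pfx n (\<rho> j)" if "n \<le> d (\<rho> i)" "n \<le> d (\<rho> j)" for i j n
  using mono that by (cases "i \<le> j") auto
 define J where "J n = (SOME j. n \<le> d (\<rho> j))" for n
 have J: "n \<le> d (\<rho> (J n))" for n using someI_ex[OF cof[of n]] by (simp add: J_def)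
 define X where "X n = pfx n (\<rho> (J n))" for n
 have 1: "X n \<in> M" "d (X n) = n" for n using pfx_sfx[OF assms(1) J] by (auto simp: X_def)
 have 2: "pfx m (X n) = X m" if "m \<le> n" for m n
  using pfx_pfx(1)[OF assms(1) that J] same[of m "J n" "J m"] J that unfolding X_def by (auto intro: order_trans)
 have "X (d (\<rho> j)) = \<rho> j" for j
  using same[of "d (\<rho> j)" j "J (d (\<rho> j))"] J pfx_all(1)[OF assms(1)] by (simp add: X_def)
 then show thesis using inf_of[of X, OF 1 2] that by metis
qed

lemma shift_apply: "m \<le> n \<Longrightarrow> shift p x (m, n) = x (m + p, n + p)"
 by (simp add: shift_def)

lemma shift_closed: "x \<in> ipaths \<Longrightarrow> shift p x \<in> ipaths"
proof -
 assume x: "x \<in> ipaths"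
 show ?thesis
  unfolding inf_paths_def
 proof (intro CollectI conjI allI impI)
  show "shift p x \<in> extensional {(m, n). m \<le> n}" by (auto simp: shift_def)
  fix m n :: "nat ^ 'k" assume mn: "m \<le> n"
  then have mn': "m + p \<le> n + p" by simp
  note f = inf_pathsD[OF x mn']
  show "shift p x (m, n) \<in> M" "deg \<Lambda> (shift p x (m, n)) = n - m" "r (shift p x (m, n)) = shift p x (m, m)"
   "s (shift p x (m, n)) = shift p x (n, n)"
   using f mn by (simp_all add: shift_apply)
 next
  fix m n q :: "nat ^ 'k" assume "m \<le> n \<and> n \<le> q"
  moreover then have "m \<le> q" by auto
  ultimately show "shift p x (m, n) \<cdot> shift p x (n, q) = shift p x (m, q)"
   using inf_pathsD(5)[OF x, of "m + p" "n + p" "q + p"] by (simp add: shift_apply)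
 qed
qed

lemma shift_shift: "x \<in> ipaths \<Longrightarrow> shift p (shift q x) = shift (q + p) x"
 by (rule inf_path_eqI) (auto intro!: shift_closed simp: shift_apply add_ac)

lemma prepend:
 assumes "\<kappa> \<in> M" "x \<in> ipaths" "x (0, 0) = s \<kappa>"
 shows "pre \<kappa> x \<in> ipaths" "pre \<kappa> x (0, d \<kappa>) = \<kappa>" "shift (d \<kappa>) (pre \<kappa> x) = x"
  "pre \<kappa> x (0, d \<kappa> + n) = \<kappa> \<cdot> x (0, n)"
  "\<lbrakk>y \<in> ipaths; y (0, d \<kappa>) = \<kappa>; shift (d \<kappa>) y = x\<rbrakk> \<Longrightarrow> pre \<kappa> x = y"
proof -
 have xn: "x (0, n) \<in> M" "r (x (0, n)) = s \<kappa>" "d (x (0, n)) = n" for n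
  using inf_pathsD[OF assms(2), of 0 n] assms(3) by auto
 have kx: "\<kappa> \<cdot> x (0, n) \<in> M" "d (\<kappa> \<cdot> x (0, n)) = d \<kappa> + n" for n
  using xn assms by (auto simp: cmp_closed deg_cmp)
 define X where "X n = pfx n (\<kappa> \<cdot> x (0, n))" for n
 have 1: "X n \<in> M" "d (X n) = n" for n using pfx_sfx kx by (auto simp: X_def)
 have 2: "pfx m (X n) = X m" if mn: "m \<le> n" for m n
 proof -
  have "pfx m (X n) = pfx m (\<kappa> \<cdot> x (0, n))"
   using pfx_pfx(1)[OF kx(1) mn, of n] kx by (simp add: X_def)
  also have "\<kappa> \<cdot> x (0, n) = \<kappa> \<cdot> x (0, m) \<cdot> x (m, n)"
   using cmp_assoc[OF assms(1) xn(1)[of m], of "x (m, n)"] xn inf_pathsD[OF assms(2) mn]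
    inf_pathsD(4,5)[OF assms(2), of 0 m] mn by simp
  also have "pfx m \<dots> = X m"
   using pfx_cmp_le inf_pathsD[OF assms(2) mn] inf_pathsD(4)[OF assms(2), of 0 m] src_cmp[OF assms(1) xn(1)] xn kx by (simp add: X_def)
  finally show ?thesis .
 qed
 let ?y = "inf_of X"
 note y = inf_of[of X, OF 1 2]
 have y1: "?y (0, d \<kappa>) = \<kappa>"
  using pfx_cmp_le[OF assms(1) xn(1), of "d \<kappa>" "d \<kappa>"] xn pfx_all[OF assms(1)] by (simp add: y(2) X_def)
 have y2: "?y (0, d \<kappa> + n) = \<kappa> \<cdot> x (0, n)" for n
  using pfx_cmp_ge(1)[OF assms(1) xn(1), of "d \<kappa> + n" n] xn inf_path_pfx(1)[OF assms(2), of n "d \<kappa> + n"]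
  by (simp add: y(2) X_def)
 have y3: "shift (d \<kappa>) ?y = x"
 proof (rule inf_path_eqI[OF shift_closed[OF y(1)] assms(2)])
  fix n
  have "shift (d \<kappa>) ?y (0, n) = sfx (d \<kappa>) (?y (0, d \<kappa> + n))"
   using inf_path_pfx(2)[OF y(1), of "d \<kappa>" "d \<kappa> + n"] by (simp add: shift_apply add.commute)
  also have "\<dots> = x (0, n)" using pfx_cmp(2)[OF assms(1) xn(1)] xn by (simp add: y2)
  finally show "\<exists>n'. n \<le> n' \<and> shift (d \<kappa>) ?y (0, n') = x (0, n')" by auto
 qed
 have y4: "y = ?y" if "y \<in> ipaths" "y (0, d \<kappa>) = \<kappa>" "shift (d \<kappa>) y = x" for y
 proof (rule inf_path_eqI[OF that(1) y(1)])
  fix n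
  have "y (d \<kappa>, d \<kappa> + n) = x (0, n)" by (simp add: shift_apply add.commute flip: that(3))
  then have "y (0, d \<kappa> + n) = \<kappa> \<cdot> x (0, n)"
   using inf_pathsD(5)[OF that(1), of 0 "d \<kappa>" "d \<kappa> + n"] that(2) by simp
  then show "\<exists>n'. n \<le> n' \<and> y (0, n') = ?y (0, n')"
   using y2 by (intro exI[of _ "d \<kappa> + n"]) simp
 qed
 have P: "pre \<kappa> x = ?y"
  by (auto simp: prepend_def y y1 y3 y4)
 show "pre \<kappa> x \<in> ipaths" "pre \<kappa> x (0, d \<kappa>) = \<kappa>" "shift (d \<kappa>) (pre \<kappa> x) = x"
  "pre \<kappa> x (0, d \<kappa> + n) = \<kappa> \<cdot> x (0, n)"
  unfolding P using y(1) y1 y2 y3 by simp_all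
 show "pre \<kappa> x = z" if "z \<in> ipaths" "z (0, d \<kappa>) = \<kappa>" "shift (d \<kappa>) z = x" for z
  unfolding P using y4[OF that] by simp
qed

lemma shift_0: "x \<in> ipaths \<Longrightarrow> shift 0 x = x"
 by (rule inf_path_eqI) (auto intro: shift_closed simp: shift_apply)

lemma prepend_shift: "x \<in> ipaths \<Longrightarrow> pre (x (0, n)) (shift n x) = x"
 using inf_pathsD by (intro prepend(5)) (auto simp: shift_closed shift_apply)

lemma prepend_rng: "\<lbrakk>\<kappa> \<in> M; x \<in> ipaths; x (0, 0) = s \<kappa>\<rbrakk> \<Longrightarrow> pre \<kappa> x (0, 0) = r \<kappa>"
 using prepend(1,2) inf_pathsD(3)[of "pre \<kappa> x" 0 "d \<kappa>"] by simp

lemma prepend_cmp: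
 assumes "\<mu> \<in> M" "\<nu> \<in> M" "s \<mu> = r \<nu>" "x \<in> ipaths" "x (0, 0) = s \<nu>"
 shows "pre (\<mu> \<cdot> \<nu>) x = pre \<mu> (pre \<nu> x)"
proof (rule inf_path_eqI)
 note n = prepend[OF assms(2,4,5)]
 have nm: "pre \<nu> x (0, 0) = s \<mu>" using prepend_rng assms by simp
 note m = prepend[OF assms(1) n(1) nm]
 have mn: "\<mu> \<cdot> \<nu> \<in> M" "x (0, 0) = s (\<mu> \<cdot> \<nu>)" using assms by (auto simp: cmp_closed src_cmp)
 note k = prepend[OF mn(1) assms(4) mn(2)]
 show "pre (\<mu> \<cdot> \<nu>) x \<in> ipaths" "pre \<mu> (pre \<nu> x) \<in> ipaths"
  by (rule k(1), rule m(1))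
 fix p
 have "pre (\<mu> \<cdot> \<nu>) x (0, d \<mu> + (d \<nu> + p)) = pre \<mu> (pre \<nu> x) (0, d \<mu> + (d \<nu> + p))"
  using k(4) m(4) n(4) assms inf_pathsD by (simp add: deg_cmp cmp_assoc add.assoc)
 then show "\<exists>n'. p \<le> n' \<and> pre (\<mu> \<cdot> \<nu>) x (0, n') = pre \<mu> (pre \<nu> x) (0, n')"
  by (intro exI[of _ "d \<mu> + (d \<nu> + p)"]) (simp add: add.assoc[symmetric])
qed

lemma shift_prepend:
 assumes "\<kappa> \<in> M" "x \<in> ipaths" "x (0, 0) = s \<kappa>" "n \<le> d \<kappa>"
 shows "shift n (pre \<kappa> x) = pre (sfx n \<kappa>) x"
proof -
 note p = pfx_sfx[OF assms(1,4)]
 have x: "x (0, 0) = s (sfx n \<kappa>)" using assms p by simp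
 note q = prepend[OF p(2) assms(2) x]
 have "pre (sfx n \<kappa>) x (0, 0) = s (pfx n \<kappa>)" using prepend_rng[OF p(2) assms(2) x] p by simp
 note t = prepend[OF p(1) q(1) this]
 have "pre \<kappa> x = pre (pfx n \<kappa>) (pre (sfx n \<kappa>) x)"
  using prepend_cmp[OF p(1,2,5) assms(2) x] p(6) by simp
 then show ?thesis using t(3) p(3) by simp
qed

lemma shift_tail_class:
 assumes "x \<in> ipaths"
 shows "x \<in> orbit x"
  and "y \<in> orbit x \<Longrightarrow> y \<in> ipaths"
  and "y \<in> orbit x \<Longrightarrow> shift n y \<in> orbit x"
  and "\<lbrakk>y \<in> orbit x; \<kappa> \<in> M; s \<kappa> = y (0, 0)\<rbrakk> \<Longrightarrow> pre \<kappa> y \<in> orbit x"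
  and "y \<in> orbit x \<Longrightarrow> \<exists>\<kappa> m. \<kappa> \<in> M \<and> r \<kappa> = y (0, 0) \<and> s \<kappa> = x (m, m)"
proof -
 have sx: "shift m x \<in> ipaths" "shift m x (0, 0) = x (m, m)" for m
  using shift_closed[OF assms] by (auto simp: shift_apply)
 have "x = pre (x (0, 0)) (shift 0 x)" using prepend_shift[OF assms, of 0] by simp
 then show "x \<in> orbit x"
  unfolding shift_tail_class_def using inf_pathsD[OF assms, of 0 0] by blast
 show "y \<in> ipaths" if "y \<in> orbit x" for y
  using that prepend(1)[OF _ sx(1)] sx(2) unfolding shift_tail_class_def by auto
 show "\<exists>\<kappa> m. \<kappa> \<in> M \<and> r \<kappa> = y (0, 0) \<and> s \<kappa> = x (m, m)" if y: "y \<in> orbit x" for y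
 proof -
  obtain m \<kappa> where "\<kappa> \<in> M" "s \<kappa> = x (m, m)" "y = pre \<kappa> (shift m x)"
   using y unfolding shift_tail_class_def by blast
  then show ?thesis using prepend_rng[OF _ sx(1), of \<kappa> m] sx(2) by auto
 qed
 show "shift n y \<in> orbit x" if y: "y \<in> orbit x" for y
 proof -
  obtain m \<kappa> where k: "\<kappa> \<in> M" "s \<kappa> = x (m, m)" "y = pre \<kappa> (shift m x)"
   using y unfolding shift_tail_class_def by blast
  have xm: "x (m, m + n) \<in> M" "d (x (m, m + n)) = n" "r (x (m, m + n)) = s \<kappa>" "s (x (m, m + n)) = x (m + n, m + n)"
   using inf_pathsD[OF assms, of m "m + n"] k by auto
  let ?k = "\<kappa> \<cdot> x (m, m + n)"
  have kk: "?k \<in> M" "s ?k = x (m + n, m + n)" "n \<le> d ?k" using k xm by (auto simp: cmp_closed src_cmp deg_cmp)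
  have "shift m x = pre (x (m, m + n)) (shift (m + n) x)"
   using prepend_shift[OF sx(1)[of m], of n] shift_shift[OF assms, of n m] by (simp add: shift_apply add.commute)
  then have "y = pre ?k (shift (m + n) x)"
   using k xm sx prepend_cmp by simp
  then have "shift n y = pre (sfx n ?k) (shift (m + n) x)"
   using shift_prepend[OF kk(1) sx(1)[of "m + n"]] kk sx(2) by simp
  moreover have "sfx n ?k \<in> M" "s (sfx n ?k) = x (m + n, m + n)" using pfx_sfx[OF kk(1,3)] kk(2) by auto
  ultimately show ?thesis unfolding shift_tail_class_def by blast
 qed
 show "pre \<kappa> y \<in> orbit x" if y: "y \<in> orbit x" and k: "\<kappa> \<in> M" "s \<kappa> = y (0, 0)" for y \<kappa>
 proof -
  obtain m \<mu> where m: "\<mu> \<in> M" "s \<mu> = x (m, m)" "y = pre \<mu> (shift m x)"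
   using y unfolding shift_tail_class_def by blast
  have "r \<mu> = s \<kappa>" using prepend_rng m k sx by simp
  then have "pre \<kappa> y = pre (\<kappa> \<cdot> \<mu>) (shift m x)" "\<kappa> \<cdot> \<mu> \<in> M" "s (\<kappa> \<cdot> \<mu>) = x (m, m)"
   using prepend_cmp m k sx by (auto simp: cmp_closed src_cmp)
  then show ?thesis unfolding shift_tail_class_def by blast
 qed
qed

end

context rf_kgraph
begin

text \<open>Infinite paths that meet a given sequence of requirements are built by concatenating finite paths
whose degrees have all coordinates positive.\<close>

lemma inf_path_meeting:
 fixes P :: "nat \<Rightarrow> 'e \<Rightarrow> bool"
 assumes k: "\<kappa> \<in> M"
  and step: "\<And>j v. v \<in> V \<Longrightarrow> \<exists>\<tau>\<in>M. r \<tau> = v \<and> 1 \<le> d \<tau> \<and> P j (s \<tau>)"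
 obtains x where "x \<in> ipaths" "x (0, d \<kappa>) = \<kappa>" "\<And>j. \<exists>n. P j (x (n, n))"
proof -
 have "\<exists>\<rho>. \<forall>j. (\<rho> j \<in> M \<and> (j = 0 \<longrightarrow> \<rho> j = \<kappa>)) \<and>
  (\<exists>\<tau>\<in>M. s (\<rho> j) = r \<tau> \<and> \<rho> (Suc j) = \<rho> j \<cdot> \<tau> \<and> 1 \<le> d \<tau> \<and> P j (s \<tau>))"
 proof (rule dependent_nat_choice)
  show "\<exists>\<mu>. \<mu> \<in> M \<and> (0 = 0 \<longrightarrow> \<mu> = \<kappa>)" using k by blast
  fix \<mu> and j :: nat assume "\<mu> \<in> M \<and> (j = 0 \<longrightarrow> \<mu> = \<kappa>)"
  then have m: "\<mu> \<in> M" by blast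
  obtain \<tau> where t: "\<tau> \<in> M" "r \<tau> = s \<mu>" "1 \<le> d \<tau>" "P j (s \<tau>)" using step[OF src_verts[OF m]] by blast
  then show "\<exists>y. (y \<in> M \<and> (Suc j = 0 \<longrightarrow> y = \<kappa>)) \<and>
    (\<exists>\<tau>\<in>M. s \<mu> = r \<tau> \<and> y = \<mu> \<cdot> \<tau> \<and> 1 \<le> d \<tau> \<and> P j (s \<tau>))"
   using m by (intro exI conjI bexI) (auto simp: cmp_closed)
 qed
 then obtain \<rho> where R: "\<And>j. \<rho> j \<in> M" "\<rho> 0 = \<kappa>"
  "\<And>j. \<exists>\<tau>\<in>M. s (\<rho> j) = r \<tau> \<and> \<rho> (Suc j) = \<rho> j \<cdot> \<tau> \<and> 1 \<le> d \<tau> \<and> P j (s \<tau>)"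
  by blast
 have len: "j \<le> d (\<rho> j) $ i" for i j
 proof (induction j)
  case (Suc j)
  obtain \<tau> where "\<tau> \<in> M" "s (\<rho> j) = r \<tau>" "\<rho> (Suc j) = \<rho> j \<cdot> \<tau>" "1 \<le> d \<tau>" using R(3) by blast
  then have "d (\<rho> (Suc j)) = d (\<rho> j) + d \<tau>" "1 \<le> d \<tau> $ i" using R(1) by (auto simp: deg_cmp less_eq_vec_def)
  then show ?case using Suc by simp
 qed simp
 have "\<exists>j. n \<le> d (\<rho> j)" for n
 proof
  show "n \<le> d (\<rho> (\<Sum>i\<in>UNIV. n $ i))"
   unfolding less_eq_vec_def
  proof
   fix i show "n $ i \<le> d (\<rho> (\<Sum>i\<in>UNIV. n $ i)) $ i"
    using len[of "\<Sum>i\<in>UNIV. n $ i" i] member_le_sum[of i UNIV "\<lambda>i. n $ i"] by simp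
  qed
 qed
 moreover have "\<exists>\<tau>\<in>M. s (\<rho> j) = r \<tau> \<and> \<rho> (Suc j) = \<rho> j \<cdot> \<tau>" for j using R(3) by blast
 ultimately obtain x where x: "x \<in> ipaths" "\<And>j. x (0, d (\<rho> j)) = \<rho> j"
  using inf_path_of_chain R(1) by metis
 have "\<exists>n. P j (x (n, n))" for j
 proof -
  obtain \<tau> where t: "\<tau> \<in> M" "s (\<rho> j) = r \<tau>" "\<rho> (Suc j) = \<rho> j \<cdot> \<tau>" "P j (s \<tau>)" using R(3) by blast
  have "s (\<rho> (Suc j)) = s \<tau>" using t R(1) by (simp add: src_cmp)
  then have "x (d (\<rho> (Suc j)), d (\<rho> (Suc j))) = s \<tau>"
   using inf_pathsD(4)[OF x(1), of 0 "d (\<rho> (Suc j))"] x(2) by simp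
  then show ?thesis using t by metis
 qed
 then show thesis using that x(1) x(2)[of 0] R(2) by simp
qed

lemma inf_path_extending:
 assumes "\<kappa> \<in> M"
 obtains x where "x \<in> ipaths" "x (0, d \<kappa>) = \<kappa>"
 by (rule inf_path_meeting[OF assms, of "\<lambda>_ _. True"]) (use outpE in \<open>metis order_refl\<close>)+

text \<open>If \<open>\<mu>\<close> and \<open>\<nu>\<close> can be told apart by a common finite extension, every infinite path that continues the
extension tells \<open>\<mu> x\<close> and \<open>\<nu> x\<close> apart; the converse holds because infinite paths are compared on
initial segments.\<close>

lemma path_equiv_iff_feq:
 assumes "\<mu> \<in> M" "\<nu> \<in> M"
 shows "path_equiv \<Lambda> \<mu> \<nu> \<longleftrightarrow> feq \<mu> \<nu>"
proof
 assume "feq \<mu> \<nu>"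
 note f = feqD[OF this]
 show "path_equiv \<Lambda> \<mu> \<nu>"
  unfolding path_equiv_def
 proof (intro conjI ballI impI)
  show "s \<mu> = s \<nu>" by (rule f)
  fix x assume x: "x \<in> ipaths" "x (0, 0) = s \<mu>"
  have x': "x (0, 0) = s \<nu>" using x f by simp
  note m = prepend[OF assms(1) x] and n = prepend[OF assms(2) x(1) x']
  show "pre \<mu> x = pre \<nu> x"
  proof (rule inf_path_eqI[OF m(1) n(1)])
   fix p
   have "x (0, p) \<in> M" "r (x (0, p)) = s \<mu>" "d (x (0, p)) = p" using inf_pathsD x by auto
   then have "pfx p (\<mu> \<cdot> x (0, p)) = pfx p (\<nu> \<cdot> x (0, p))" using f(4) by simp
   then have "pre \<mu> x (0, p) = pre \<nu> x (0, p)"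
    using inf_path_pfx(1)[OF m(1), of p "d \<mu> + p"] inf_path_pfx(1)[OF n(1), of p "d \<nu> + p"] m(4) n(4) by simp
   then show "\<exists>n'. p \<le> n' \<and> pre \<mu> x (0, n') = pre \<nu> x (0, n')" by blast
  qed
 qed
next
 assume e: "path_equiv \<Lambda> \<mu> \<nu>"
 have s: "s \<mu> = s \<nu>" using e by (simp add: path_equiv_def)
 show "feq \<mu> \<nu>"
 proof (rule feqI[OF assms s])
  fix \<tau> n assume t: "\<tau> \<in> M" "r \<tau> = s \<mu>" "n \<le> d \<mu> + d \<tau>" "n \<le> d \<nu> + d \<tau>"
  obtain x where x: "x \<in> ipaths" "x (0, d \<tau>) = \<tau>" using inf_path_extending[OF t(1)] .
  have x0: "x (0, 0) = s \<mu>" using inf_pathsD(3)[OF x(1), of 0 "d \<tau>"] x t by simp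
  have x0': "x (0, 0) = s \<nu>" using x0 s by simp
  note m = prepend[OF assms(1) x(1) x0] and n = prepend[OF assms(2) x(1) x0']
  have "pre \<mu> x = pre \<nu> x" using e x x0 by (simp add: path_equiv_def)
  then show "pfx n (\<mu> \<cdot> \<tau>) = pfx n (\<nu> \<cdot> \<tau>)"
   using inf_path_pfx(1)[OF m(1) t(3)] inf_path_pfx(1)[OF n(1) t(4)] m(4) n(4) x(2) by simp
 qed
qed

lemma Per_eq_perset: "Per \<Lambda> = perset"
 unfolding Per_def perset_def vdiff_def using path_equiv_iff_feq feqD(1,2) by blast

end

context directed_kgraph
begin

text \<open>The vertices are countably many and any two have a common successor, so a path can be made to pass
below all of them in turn.\<close>

lemma cofinal_path_exists:
 obtains x where "x \<in> ipaths" "\<And>v. v \<in> V \<Longrightarrow> \<exists>n. connected_to \<Lambda> v (x (n, n))"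
proof -
 have c: "countable V" using countable_mor by (rule countable_subset[rotated]) (auto simp: verts_def)
 define u where "u = from_nat_into V"
 have u: "u j \<in> V" for j using from_nat_into[OF verts_nonempty] by (simp add: u_def)
 obtain v where v: "v \<in> V" using verts_nonempty by blast
 have step: "\<exists>\<tau>\<in>M. r \<tau> = w \<and> 1 \<le> d \<tau> \<and> connected_to \<Lambda> (u j) (s \<tau>)" if w: "w \<in> V" for j w
 proof -
  obtain \<alpha> \<beta> where a: "\<alpha> \<in> M" "\<beta> \<in> M" "r \<alpha> = w" "r \<beta> = u j" "s \<alpha> = s \<beta>"
   using common_source[OF w u] by metis
  obtain \<sigma> where o: "\<sigma> \<in> M" "r \<sigma> = s \<alpha>" "d \<sigma> = 1" using outpE[OF src_verts[OF a(1)]] by metis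
  have "\<alpha> \<cdot> \<sigma> \<in> M" "r (\<alpha> \<cdot> \<sigma>) = w" "1 \<le> d (\<alpha> \<cdot> \<sigma>)" "s (\<alpha> \<cdot> \<sigma>) = s \<sigma>"
   "\<beta> \<cdot> \<sigma> \<in> M" "r (\<beta> \<cdot> \<sigma>) = u j" "s (\<beta> \<cdot> \<sigma>) = s \<sigma>"
   using a o by (auto simp: cmp_closed rng_cmp src_cmp deg_cmp)
  then show ?thesis unfolding connected_to_def by metis
 qed
 obtain x where x: "x \<in> ipaths" "\<And>j. \<exists>n. connected_to \<Lambda> (u j) (x (n, n))"
  using inf_path_meeting[OF vertsD(1)[OF v], of "\<lambda>j. connected_to \<Lambda> (u j)"] step by metis
 show thesis
  by (metis that x from_nat_into_surj c u_def)
qed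

end

subsection \<open>The subgraph of a maximal tail\<close>

lemma tail_subgraph_simps [simp]:
 "mor (tail_subgraph \<Lambda> T) = {\<kappa> \<in> mor \<Lambda>. src \<Lambda> \<kappa> \<in> T}" "rng (tail_subgraph \<Lambda> T) = rng \<Lambda>"
 "src (tail_subgraph \<Lambda> T) = src \<Lambda>" "cmp (tail_subgraph \<Lambda> T) = cmp \<Lambda>" "deg (tail_subgraph \<Lambda> T) = deg \<Lambda>"
 by (simp_all add: tail_subgraph_def)

context rf_kgraph
begin

context
 fixes T
 assumes T: "T \<in> maximal_tails \<Lambda>"
begin

lemma tail_props:
 "T \<noteq> {}" "T \<subseteq> V"
 "\<lbrakk>v \<in> T; v' \<in> T\<rbrakk> \<Longrightarrow> \<exists>w\<in>T. connected_to \<Lambda> v w \<and> connected_to \<Lambda> v' w"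
 "v \<in> T \<Longrightarrow> \<exists>\<kappa>\<in>M. r \<kappa> = v \<and> d \<kappa> = axis i 1 \<and> s \<kappa> \<in> T"
 "\<lbrakk>\<kappa> \<in> M; s \<kappa> \<in> T\<rbrakk> \<Longrightarrow> r \<kappa> \<in> T"
 using T rng_verts unfolding maximal_tails_def connected_to_def by (blast+)

abbreviation "\<Sigma> \<equiv> sub T"

lemma verts_tail: "verts \<Sigma> = T"
 using tail_props(2) by (auto simp: verts_def)

lemma connected_to_tail: "w \<in> T \<Longrightarrow> connected_to \<Sigma> v w \<longleftrightarrow> connected_to \<Lambda> v w"
 by (auto simp: connected_to_def)

lemma kgraph_tail: "kgraph \<Sigma>"
proof
 show "countable (mor \<Sigma>)" using countable_mor by (rule countable_subset[rotated]) auto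
 fix \<kappa> p q assume k: "\<kappa> \<in> mor \<Sigma>" "deg \<Sigma> \<kappa> = p + q"
 let ?P = "\<lambda>(\<mu>, \<nu>). \<mu> \<in> M \<and> \<nu> \<in> M \<and> d \<mu> = p \<and> d \<nu> = q \<and> s \<mu> = r \<nu> \<and> \<kappa> = \<mu> \<cdot> \<nu>"
 let ?Q = "\<lambda>(\<mu>, \<nu>). \<mu> \<in> mor \<Sigma> \<and> \<nu> \<in> mor \<Sigma> \<and> deg \<Sigma> \<mu> = p \<and> deg \<Sigma> \<nu> = q \<and> src \<Sigma> \<mu> = rng \<Sigma> \<nu> \<and> \<kappa> = cmp \<Sigma> \<mu> \<nu>"
 have "?P x = ?Q x" for x
  using k by (cases x) (auto simp: src_cmp intro!: tail_props(5))
 moreover have "\<exists>!x. ?P x" using factorisation k by simp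
 ultimately show "\<exists>!x. ?Q x" by simp
next
 fix v assume "v \<in> verts \<Sigma>"
 then show "deg \<Sigma> v = 0" using verts_tail tail_props(2) deg_vert by auto
qed (auto simp: rng_closed src_closed rng_src_rng rng_src_src cmp_closed rng_cmp src_cmp cmp_assoc
  cmp_rng_left cmp_src_right deg_cmp intro: tail_props(5))

lemma tail_no_sources:
 assumes "v \<in> T"
 shows "\<exists>\<kappa>\<in>M. r \<kappa> = v \<and> d \<kappa> = n \<and> s \<kappa> \<in> T"
proof (induction "\<Sum>i\<in>UNIV. n $ i" arbitrary: n)
 case 0
 then have "n = 0" by (simp add: vec_eq_iff)
 then show ?case using assms tail_props(2) vertsD deg_vert by (metis subsetD)
next
 case (Suc m)
 then obtain i where i: "n $ i \<noteq> 0" by (metis nat.distinct(1) sum.neutral)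
 define n' where "n' = n - axis i 1"
 have n: "n = n' + axis i 1" using i by (auto simp: n'_def vec_eq_iff axis_def)
 have "(\<Sum>j\<in>UNIV. n $ j) = (\<Sum>j\<in>UNIV. n' $ j) + (\<Sum>j\<in>UNIV. axis i 1 $ j)"
  by (subst n) (simp add: sum.distrib)
 moreover have "(\<Sum>j\<in>UNIV. axis i (1::nat) $ j) = 1" by (simp add: axis_def)
 ultimately have "m = (\<Sum>j\<in>UNIV. n' $ j)" using Suc(2) by simp
 from Suc(1)[OF this] obtain \<kappa> where k: "\<kappa> \<in> M" "r \<kappa> = v" "d \<kappa> = n'" "s \<kappa> \<in> T" by blast
 obtain \<mu> where m: "\<mu> \<in> M" "r \<mu> = s \<kappa>" "d \<mu> = axis i 1" "s \<mu> \<in> T" using tail_props(4)[OF k(4)] by blast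
 show ?case using k m n by (intro bexI[of _ "\<kappa> \<cdot> \<mu>"]) (auto simp: cmp_closed rng_cmp src_cmp deg_cmp)
qed

lemma directed_kgraph_tail: "directed_kgraph \<Sigma>"
proof (intro directed_kgraph.intro rf_kgraph.intro rf_kgraph_axioms.intro directed_kgraph_axioms.intro kgraph_tail)
 show "row_finite_no_sources \<Sigma>"
  unfolding row_finite_no_sources_def verts_tail
 proof (intro ballI allI conjI)
  fix v n assume v: "v \<in> T"
  then have "finite (outp v n)" using outp(1) tail_props(2) by blast
  then show "finite {\<kappa> \<in> mor \<Sigma>. rng \<Sigma> \<kappa> = v \<and> deg \<Sigma> \<kappa> = n}"
   by (rule finite_subset[rotated]) (auto simp: outp_def)
  show "{\<kappa> \<in> mor \<Sigma>. rng \<Sigma> \<kappa> = v \<and> deg \<Sigma> \<kappa> = n} \<noteq> {}" using tail_no_sources[OF v, of n] by auto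
 qed
 show "verts \<Sigma> \<noteq> {}" using verts_tail tail_props(1) by simp
 fix v v' assume "v \<in> verts \<Sigma>" "v' \<in> verts \<Sigma>"
 then show "\<exists>w. connected_to \<Sigma> v w \<and> connected_to \<Sigma> v' w"
  using tail_props(3)[of v v'] connected_to_tail unfolding verts_tail by blast
qed

lemma inf_paths_tail: "inf_paths \<Sigma> = {x \<in> ipaths. \<forall>n. x (n, n) \<in> T}"
proof
 show "inf_paths \<Sigma> \<subseteq> {x \<in> ipaths. \<forall>n. x (n, n) \<in> T}"
  unfolding inf_paths_def by (auto; metis order_refl)
 show "{x \<in> ipaths. \<forall>n. x (n, n) \<in> T} \<subseteq> inf_paths \<Sigma>"
  unfolding inf_paths_def by auto
qed

lemma prepend_tail:
 assumes "\<kappa> \<in> mor \<Sigma>" "x \<in> inf_paths \<Sigma>" "x (0, 0) = s \<kappa>"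
 shows "prepend \<Sigma> \<kappa> x = pre \<kappa> x"
proof -
 interpret S: kgraph \<Sigma> by (rule kgraph_tail)
 have "x \<in> ipaths" using assms(2) inf_paths_tail by simp
 then show ?thesis
  using S.prepend(1-3) prepend(5)[of \<kappa> x "prepend \<Sigma> \<kappa> x"] assms inf_paths_tail by simp
qed

lemma shift_tail_class_tail:
 assumes "x \<in> inf_paths \<Sigma>" "y \<in> orbit x"
 shows "y \<in> inf_paths \<Sigma>"
proof -
 have x: "x \<in> ipaths" "\<And>n. x (n, n) \<in> T" using assms(1) inf_paths_tail by auto
 have y: "y \<in> ipaths" using shift_tail_class(2)[OF x(1) assms(2)] .
 have "y (n, n) \<in> T" for n
 proof -
  have "shift n y \<in> orbit x" using shift_tail_class(3)[OF x(1) assms(2)] .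
  from shift_tail_class(5)[OF x(1) this] obtain \<kappa> m where "\<kappa> \<in> M" "r \<kappa> = y (n, n)" "s \<kappa> = x (m, m)"
   by (auto simp: shift_apply)
  then show ?thesis using tail_props(5)[of \<kappa>] x(2) by simp
 qed
 then show ?thesis using y inf_paths_tail by simp
qed

end

end

section \<open>Square roots and contractivity\<close>

sublocale cstar_algebra \<subseteq> cstar_seminormed A "cnorm A"
 by (intro cstar_seminormed.intro cstar_seminormed_axioms.intro star_algebra_axioms cstar_norm)

context cstar_algebra
begin

abbreviation "\<A> \<equiv> carrier A"

lemma cnorm_minus_eq_0: "\<lbrakk>x \<in> \<A>; y \<in> \<A>; cnorm A (x \<ominus> y) = 0\<rbrakk> \<Longrightarrow> x = y"
 using cnorm_eq_0 minus_eq_zero_iff[of x y] by simp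

lemma null_const_unique:
 assumes "X \<in> CS" "x \<in> \<A>" "y \<in> \<A>" "null X (\<lambda>_. x)" "null X (\<lambda>_. y)"
 shows "x = y"
proof -
 have "null (\<lambda>_. x) (\<lambda>_. y)"
  using assms by (intro null_trans[of "\<lambda>_. x" X "\<lambda>_. y"]) (auto intro: null_sym)
 then show ?thesis using assms by (intro cnorm_minus_eq_0) (simp_all add: null_def LIMSEQ_const_iff)
qed

lemma CS_Suc: "X \<in> CS \<Longrightarrow> (\<lambda>n. X (Suc n)) \<in> CS"
proof (rule CSI)
 fix e :: real assume X: "X \<in> CS" and "e > 0"
 then obtain K where K: "\<forall>m\<ge>K. \<forall>n\<ge>K. cnorm A (X m \<ominus> X n) < e" using CS_ge by blast
 show "\<exists>K. \<forall>m\<ge>K. \<forall>n\<ge>K. cnorm A (X (Suc m) \<ominus> X (Suc n)) < e"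
 proof (intro exI[of _ K] allI impI)
  fix m n assume "K \<le> m" "K \<le> n"
  then show "cnorm A (X (Suc m) \<ominus> X (Suc n)) < e" using K[rule_format, of "Suc m" "Suc n"] by linarith
 qed
qed (simp add: CS_carrier)

primrec root_iter :: "'a \<Rightarrow> nat \<Rightarrow> 'a" where
 "root_iter b 0 = \<zero>"
| "root_iter b (Suc n) = (1 / 2) \<odot> (b \<oplus> root_iter b n \<otimes> root_iter b n)"

primrec root_majorant :: "nat \<Rightarrow> real" where
 "root_majorant 0 = 0"
| "root_majorant (Suc n) = (1 + (root_majorant n)\<^sup>2) / 2"

lemma root_majorant: "0 \<le> root_majorant n" "root_majorant n \<le> 1" "root_majorant n \<le> root_majorant (Suc n)"
proof -
 have 1: "0 \<le> root_majorant n \<and> root_majorant n \<le> 1" for n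
  by (induction n) (auto simp: power_le_one)
 then show "0 \<le> root_majorant n" "root_majorant n \<le> 1" by auto
 show "root_majorant n \<le> root_majorant (Suc n)"
  using sum_squares_bound[of "root_majorant n" 1] by simp
qed

text \<open>The element \<open>1 - c\<close> is a square root of \<open>1 - b\<close>, written in an algebra without a unit. The iteration
\<open>c \<mapsto> (b + c\<^sup>2) / 2\<close> is dominated by the scalar iteration that starts at \<open>0\<close> with \<open>b = 1\<close>. The latter increases
to \<open>1\<close>, so the increments are summable even for \<open>\<parallel>b\<parallel> = 1\<close>, where the binomial series would be delicate.\<close>

lemma half_root:
 assumes b: "b \<in> \<A>" "star A b = b" "cnorm A b \<le> 1"
  and S: "norm_closed A (cnorm A) S" "\<zero> \<in> S" "b \<in> S"
  "\<And>x y. \<lbrakk>x \<in> S; y \<in> S\<rbrakk> \<Longrightarrow> x \<oplus> y \<in> S" "\<And>c x. x \<in> S \<Longrightarrow> c \<odot> x \<in> S"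
  "\<And>x y. \<lbrakk>x \<in> S; y \<in> S\<rbrakk> \<Longrightarrow> x \<otimes> y \<in> S"
 obtains c where "c \<in> S" "c \<in> \<A>" "star A c = c" "cnorm A c \<le> 1" "2 \<odot> c = b \<oplus> c \<otimes> c"
proof -
 define c where "c = root_iter b"
 define k where "k = root_majorant"
 have c0: "c 0 = \<zero>" and cS: "c (Suc n) = (1 / 2) \<odot> (b \<oplus> c n \<otimes> c n)" for n by (simp_all add: c_def)
 have kk: "0 \<le> k n" "k n \<le> 1" "k n \<le> k (Suc n)" for n
  unfolding k_def by (rule root_majorant)+
 have k0: "k 0 = 0" and kS: "k (Suc n) = (1 + (k n)\<^sup>2) / 2" for n by (simp_all add: k_def)
 have cc: "c n \<in> \<A> \<and> c n \<in> S \<and> star A (c n) = c n" for n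
  by (induction n) (auto simp: c0 cS b S star_smult star_add star_mult)
 have cn: "cnorm A (c n) \<le> k n" for n
 proof (induction n)
  case (Suc n)
  have "cnorm A (c (Suc n)) = 1 / 2 * cnorm A (b \<oplus> c n \<otimes> c n)"
   using b cc by (simp add: cS p_smult)
  also have "cnorm A (b \<oplus> c n \<otimes> c n) \<le> 1 + cnorm A (c n) * cnorm A (c n)"
   using p_add[of b "c n \<otimes> c n"] p_mult[of "c n" "c n"] b cc by fastforce
  also have "cnorm A (c n) * cnorm A (c n) \<le> k n * k n"
   using Suc cc kk by (intro mult_mono) auto
  finally show ?case by (simp add: kS power2_eq_square)
 qed (simp add: c0 k0)
 \<comment> \<open>The increments are dominated by those of the scalar iteration.\<close>
 have step: "cnorm A (c (Suc n) \<ominus> c n) \<le> k (Suc n) - k n" for n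
 proof (induction n)
  case 0
  have "c (Suc 0) \<ominus> c 0 = (1 / 2) \<odot> b" using b by (simp add: c0 cS)
  then show ?case using b by (simp add: kS k0 p_smult)
 next
  case (Suc n)
  have e: "cnorm A ((b \<oplus> x) \<ominus> (b \<oplus> y)) \<le> cnorm A (x \<ominus> y)" if "x \<in> \<A>" "y \<in> \<A>" for x y
   using p_add_diff[of b x b y] that b by (simp add: M.minus_eq M.r_neg)
  have "cnorm A (c (Suc (Suc n)) \<ominus> c (Suc n)) \<le> 1/2 * cnorm A (c (Suc n) \<otimes> c (Suc n) \<ominus> c n \<otimes> c n)"
   using e b cc by (subst (1 2) cS) (simp add: p_smult_diff)
  also have "cnorm A (c (Suc n) \<otimes> c (Suc n) \<ominus> c n \<otimes> c n)
    \<le> cnorm A (c (Suc n)) * cnorm A (c (Suc n) \<ominus> c n) + cnorm A (c (Suc n) \<ominus> c n) * cnorm A (c n)"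
   using cc by (intro p_mult_diff) auto
  also have "\<dots> \<le> k (Suc n) * (k (Suc n) - k n) + (k (Suc n) - k n) * k n"
   using cn Suc cc kk by (intro add_mono mult_mono) auto
  also have "1/2 * \<dots> = k (Suc (Suc n)) - k (Suc n)"
   by simp (simp add: kS field_simps power2_eq_square)
  finally show ?case by simp
 qed
 have diff: "cnorm A (c m \<ominus> c n) \<le> k m - k n" if "n \<le> m" for m n
  using that
 proof (induction m rule: dec_induct)
  case base
  then show ?case using cc by (simp add: M.minus_eq M.r_neg)
 next
  case (step m)
  then show ?case using p_triangle[of "c (Suc m)" "c m" "c n"] cc \<open>\<And>n. cnorm A (c (Suc n) \<ominus> c n) \<le> k (Suc n) - k n\<close>[of m]
   by fastforce
 qed
 have "incseq k" by (rule incseq_SucI) (rule kk)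
 then have "Cauchy k"
  using incseq_convergent kk(2) by (metis Cauchy_convergent_iff convergent_def)
 have CSc: "c \<in> CS"
 proof (rule CSI)
  show "c n \<in> \<A>" for n using cc by blast
  fix e :: real assume "e > 0"
  then obtain K where K: "\<And>m n. m \<ge> K \<Longrightarrow> n \<ge> K \<Longrightarrow> dist (k m) (k n) < e"
   using \<open>Cauchy k\<close> unfolding Cauchy_def by blast
  have "cnorm A (c m \<ominus> c n) < e" if "K \<le> m" "K \<le> n" for m n
  proof (cases "n \<le> m")
   case True
   then show ?thesis using diff[OF True] K[OF that] by (simp add: dist_real_def)
  next
   case False
   then show ?thesis using diff[of m n] K[OF that] p_minus_commute cc by (simp add: dist_real_def)
  qed
  then show "\<exists>K. \<forall>m\<ge>K. \<forall>n\<ge>K. cnorm A (c m \<ominus> c n) < e" by blast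
 qed
 then obtain l where l: "l \<in> \<A>" "norm_tendsto A (cnorm A) c l"
  using complete unfolding norm_complete_def Cauchy_seqs_def by blast
 then have nl: "null c (\<lambda>_. l)" by (simp add: null_def norm_tendsto_def)
 have lS: "l \<in> S" using S(1) cc l unfolding norm_closed_def by blast
 have "null (\<lambda>n. star A (c n)) (\<lambda>_. star A l)" using null_star[OF CSc _ nl] l by simp
 then have "star A l = l" using null_const_unique[OF CSc _ l(1) _ nl] l cc by simp
 moreover have "cnorm A l \<le> 1"
 proof (rule LIMSEQ_le_const2)
  have "(\<lambda>n. cnorm A (c n) - cnorm A l) \<longlonglongrightarrow> 0"
   by (rule Lim_null_comparison[OF _ nl[unfolded null_def]])
    (use cc l in \<open>auto intro!: always_eventually p_reverse\<close>)
  then show "(\<lambda>n. cnorm A (c n)) \<longlonglongrightarrow> cnorm A l" by (simp add: LIM_zero_iff)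
  show "\<exists>N. \<forall>n\<ge>N. cnorm A (c n) \<le> 1" using cn kk(2) by (blast intro: order_trans)
 qed
 moreover have "2 \<odot> l = b \<oplus> l \<otimes> l"
 proof -
  have n1: "null (\<lambda>n. c (Suc n)) (\<lambda>_. l)" using nl unfolding null_def by (rule LIMSEQ_Suc)
  have "null (\<lambda>n. 2 \<odot> c (Suc n)) (\<lambda>_. 2 \<odot> l)"
   using null_smult[OF CS_Suc[OF CSc] _ n1] l by simp
  moreover have "2 \<odot> c (Suc n) = b \<oplus> c n \<otimes> c n" for n
   using b cc by (simp add: cS complex_smult_distr(4) flip: complex_smult_distr(3))
  ultimately have a: "null (\<lambda>n. b \<oplus> c n \<otimes> c n) (\<lambda>_. 2 \<odot> l)" by simp
  have "null (\<lambda>n. b \<oplus> c n \<otimes> c n) (\<lambda>_. b \<oplus> l \<otimes> l)"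
   using null_add null_mult[OF CSc CSc _ _ nl nl] null_refl CSc l b by simp
  then show ?thesis using null_const_unique[OF _ _ _ a] CSc l b by simp
 qed
 ultimately show thesis using that lS l by blast
qed

lemma norm_closed_carrier: "norm_closed A (cnorm A) \<A>"
 by (auto simp: norm_closed_def)

end

section \<open>Hilbert spaces\<close>

context hilbert_space
begin

abbreviation "\<H> \<equiv> carrier H"
abbreviation "ip \<equiv> hinner H"
abbreviation "nrm \<equiv> hnorm H"

lemma hinner_zero_right: "w \<in> \<H> \<Longrightarrow> ip w \<zero> = 0"
 using hinner_cnj[of \<zero> w] hinner_zero_left by simp

lemma hinner_minus_right: "\<lbrakk>u \<in> \<H>; v \<in> \<H>; w \<in> \<H>\<rbrakk> \<Longrightarrow>
  ip w (u \<ominus> v) = ip w u - ip w v"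
 using hinner_cnj[of "u \<ominus> v" w] hinner_cnj[of u w] hinner_cnj[of v w] by (simp add: hinner_minus_left)

lemma hinner_eqI:
 assumes "u \<in> \<H>" "v \<in> \<H>" "\<And>w. w \<in> \<H> \<Longrightarrow> ip u w = ip v w"
 shows "u = v"
proof -
 have "ip (u \<ominus> v) (u \<ominus> v) = 0" using assms by (simp add: hinner_minus_left)
 then show ?thesis using hinner_eq_0 minus_eq_zero_iff[of u v] assms by simp
qed

lemma hnorm_power2: "v \<in> \<H> \<Longrightarrow> (nrm v)\<^sup>2 = Re (ip v v)"
 by (simp add: hnorm_def hinner_nonneg)

lemma hnorm_eq_0: "v \<in> \<H> \<Longrightarrow> nrm v = 0 \<longleftrightarrow> v = \<zero>"
  using hinner_self hinner_eq_0 hinner_zero_left by fastforce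

lemma hnorm_zero [simp]: "nrm \<zero> = 0"
 using hnorm_eq_0 by simp

lemma hnorm_smult: "v \<in> \<H> \<Longrightarrow> nrm (c \<odot> v) = cmod c * nrm v"
proof -
 assume v: "v \<in> \<H>"
 have "ip (c \<odot> v) (c \<odot> v) = (c * cnj c) * ip v v"
  using v by (simp add: hinner_smult_left hinner_smult_right)
 also have "c * cnj c = complex_of_real ((cmod c)\<^sup>2)" by (rule complex_norm_square[symmetric])
 finally have "(nrm (c \<odot> v))\<^sup>2 = (cmod c * nrm v)\<^sup>2"
  using v hnorm_power2 by (simp add: power_mult_distrib)
 then show ?thesis using hnorm_nonneg v by simp
qed

lemma hnorm_triangle: "\<lbrakk>u \<in> \<H>; v \<in> \<H>\<rbrakk> \<Longrightarrow> nrm (u \<oplus> v) \<le> nrm u + nrm v"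
proof -
 assume uv: "u \<in> \<H>" "v \<in> \<H>"
 have "(nrm (u \<oplus> v))\<^sup>2 = (nrm u)\<^sup>2 + (nrm v)\<^sup>2 + 2 * Re (ip u v)"
  using uv hinner_cnj[of u v] by (simp add: hnorm_power2 hinner_add_left hinner_add_right)
 also have "\<dots> \<le> (nrm u)\<^sup>2 + (nrm v)\<^sup>2 + 2 * (nrm u * nrm v)"
  using Cauchy_Schwarz[OF uv] complex_Re_le_cmod[of "ip u v"] by simp
 also have "\<dots> = (nrm u + nrm v)\<^sup>2" by (simp add: power2_sum)
 finally show ?thesis by (rule power2_le_imp_le) (use uv hnorm_nonneg in simp)
qed

lemma hnorm_minus_commute: "\<lbrakk>u \<in> \<H>; v \<in> \<H>\<rbrakk> \<Longrightarrow> nrm (u \<ominus> v) = nrm (v \<ominus> u)"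
proof -
 assume uv: "u \<in> \<H>" "v \<in> \<H>"
 have "u \<ominus> v = (-1) \<odot> (v \<ominus> u)"
  using uv by (intro hinner_eqI) (simp_all add: hinner_minus_left hinner_smult_left)
 then show ?thesis using hnorm_smult uv by simp
qed

lemma hnorm_triangle_minus:
 assumes "u \<in> \<H>" "v \<in> \<H>" "w \<in> \<H>"
 shows "nrm (u \<ominus> w) \<le> nrm (u \<ominus> v) + nrm (v \<ominus> w)"
proof -
 have "u \<ominus> w = (u \<ominus> v) \<oplus> (v \<ominus> w)"
  using assms by (intro hinner_eqI) (simp_all add: hinner_minus_left hinner_add_left)
 then show ?thesis using hnorm_triangle assms by simp
qed

lemma minus_zero_vec: "u \<in> \<H> \<Longrightarrow> u \<ominus> \<zero> = u"
 by (intro hinner_eqI) (simp_all add: hinner_minus_left hinner_zero_left)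

lemma hnorm_reverse:
 assumes "u \<in> \<H>" "v \<in> \<H>"
 shows "\<bar>nrm u - nrm v\<bar> \<le> nrm (u \<ominus> v)"
 using hnorm_triangle_minus[of u v \<zero>] hnorm_triangle_minus[of v u \<zero>] hnorm_minus_commute assms by (simp add: minus_zero_vec)

lemma hnorm_tendsto:
 assumes "\<And>n. X n \<in> \<H>" "l \<in> \<H>" "norm_tendsto H nrm X l"
 shows "(\<lambda>n. nrm (X n)) \<longlonglongrightarrow> nrm l"
proof -
 have "(\<lambda>n. nrm (X n) - nrm l) \<longlonglongrightarrow> 0"
  by (rule Lim_null_comparison[OF _ assms(3)[unfolded norm_tendsto_def]])
   (use assms in \<open>auto intro!: always_eventually hnorm_reverse\<close>)
 then show ?thesis by (simp add: LIM_zero_iff)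
qed

lemma tendsto_minus_const:
 assumes "\<And>n. X n \<in> \<H>" "l \<in> \<H>" "norm_tendsto H nrm X l" "u \<in> \<H>"
 shows "norm_tendsto H nrm (\<lambda>n. u \<ominus> X n) (u \<ominus> l)"
proof -
 have "(u \<ominus> X n) \<ominus> (u \<ominus> l) = l \<ominus> X n" for n
  using assms by (intro hinner_eqI) (simp_all add: hinner_minus_left)
 then show ?thesis using assms by (simp add: norm_tendsto_def hnorm_minus_commute)
qed

lemma hinner_finsum_left:
 assumes "finite J" "\<And>j. j \<in> J \<Longrightarrow> f j \<in> \<H>" "w \<in> \<H>"
 shows "ip (finsum H f J) w = (\<Sum>j\<in>J. ip (f j) w)"
 using assms by (induction J) (auto simp: hinner_zero_left hinner_add_left)

lemma hinner_finsum_right: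
 assumes "finite J" "\<And>j. j \<in> J \<Longrightarrow> f j \<in> \<H>" "w \<in> \<H>"
 shows "ip w (finsum H f J) = (\<Sum>j\<in>J. ip w (f j))"
 using assms by (induction J) (auto simp: hinner_zero_right hinner_add_right)

end

text \<open>For \<open>b = a\<^sup>* a\<close> with \<open>\<parallel>a\<parallel> \<le> 1\<close> and the element \<open>c\<close> of \<open>half_root\<close>, the identity \<open>b = 2 c - c\<^sup>2\<close> gives
\<open>\<parallel>v\<parallel>\<^sup>2 - \<parallel>\<pi> a v\<parallel>\<^sup>2 = \<parallel>v - \<pi> c v\<parallel>\<^sup>2 \<ge> 0\<close>.\<close>

lemma hilbert_rep_contractive:
 assumes "cstar_algebra A" "hilbert_space H" "hilbert_rep A H \<pi>" "a \<in> carrier A" "v \<in> carrier H"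
 shows "hnorm H (\<pi> a v) \<le> cnorm A a * hnorm H v"
proof -
 interpret A: cstar_algebra A by fact
 interpret hilbert_space H by fact
 note \<pi> = hilbert_repD[OF assms(3)]
 note ps = \<pi>(1,5-7)
 have one: "hnorm H (\<pi> a v) \<le> hnorm H v" if a: "a \<in> carrier A" "cnorm A a \<le> 1" for a
 proof -
  define b where "b = star A a \<otimes>\<^bsub>A\<^esub> a"
  have b: "b \<in> carrier A" "star A b = b" "cnorm A b \<le> 1"
   using a A.p_star_mult by (auto simp: b_def A.star_mult power_le_one)
  obtain c where c: "c \<in> carrier A" "star A c = c" "2 \<odot>\<^bsub>A\<^esub> c = b \<oplus>\<^bsub>A\<^esub> c \<otimes>\<^bsub>A\<^esub> c"
   using A.half_root[OF b A.norm_closed_carrier] b by auto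
  have pc: "\<pi> c v \<in> carrier H" "\<pi> a v \<in> carrier H" using ps c a assms by auto
  have "2 * hinner H (\<pi> c v) v = hinner H (\<pi> (2 \<odot>\<^bsub>A\<^esub> c) v) v"
   using ps c(1) assms(5) by (simp add: hinner_smult_left)
  also have "\<dots> = hinner H (\<pi> b v) v + hinner H (\<pi> c (\<pi> c v)) v"
   using ps c(1) b(1) assms(5) by (simp add: c(3) hinner_add_left)
  also have "hinner H (\<pi> c (\<pi> c v)) v = hinner H (\<pi> c v) (\<pi> c v)"
   using \<pi>(8) c(1,2) assms(5) pc by simp
  also have "hinner H (\<pi> b v) v = hinner H (\<pi> a v) (\<pi> a v)"
   using \<pi>(8) a assms(5) by (simp add: b_def ps)
  finally have 1: "2 * hinner H (\<pi> c v) v = hinner H (\<pi> a v) (\<pi> a v) + hinner H (\<pi> c v) (\<pi> c v)" .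
  have "hinner H v (\<pi> c v) = hinner H (\<pi> c v) v" using \<pi>(8) c(1,2) assms(5) by simp
  then have "hinner H (v \<ominus>\<^bsub>H\<^esub> \<pi> c v) (v \<ominus>\<^bsub>H\<^esub> \<pi> c v)
    = hinner H v v - 2 * hinner H (\<pi> c v) v + hinner H (\<pi> c v) (\<pi> c v)"
   using assms pc by (simp add: hinner_minus_left hinner_minus_right)
  also have "\<dots> = hinner H v v - hinner H (\<pi> a v) (\<pi> a v)" using 1 by simp
  finally have "0 \<le> Re (hinner H v v - hinner H (\<pi> a v) (\<pi> a v))"
   using hinner_nonneg[of "v \<ominus>\<^bsub>H\<^esub> \<pi> c v"] assms pc by simp
  then have "(hnorm H (\<pi> a v))\<^sup>2 \<le> (hnorm H v)\<^sup>2" using assms pc by (simp add: hnorm_power2)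
  then show ?thesis by (rule power2_le_imp_le) (use assms hnorm_nonneg in simp)
 qed
 show ?thesis
 proof (cases "cnorm A a = 0")
  case True
  then have "a = 0 \<odot>\<^bsub>A\<^esub> a" using A.cnorm_eq_0 assms(4) by (simp add: A.complex_smult_distr)
  then have "\<pi> a v = 0 \<odot>\<^bsub>H\<^esub> \<pi> a v" using \<pi>(6)[OF assms(4,5), of 0] by simp
  then have "\<pi> a v = \<zero>\<^bsub>H\<^esub>" using \<pi>(1)[OF assms(4,5)] by (simp add: complex_smult_distr)
  then show ?thesis using True by simp
 next
  case False
  define t where "t = cnorm A a"
  have t: "t > 0" using False A.p_nonneg[OF assms(4)] by (simp add: t_def)
  let ?a = "complex_of_real (1 / t) \<odot>\<^bsub>A\<^esub> a"
  have "cnorm A ?a \<le> 1" using t assms(4) by (simp add: A.p_smult norm_divide flip: t_def)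
  then have "hnorm H (\<pi> ?a v) \<le> hnorm H v" using one assms(4) by simp
  moreover have "hnorm H (\<pi> ?a v) = hnorm H (\<pi> a v) / t"
   using ps assms t by (simp add: hnorm_smult norm_divide)
  ultimately have "hnorm H (\<pi> a v) / t \<le> hnorm H v" by simp
  then show ?thesis using t by (simp add: pos_divide_le_eq mult.commute flip: t_def)
 qed
qed

section \<open>The \<open>C\<^sup>*\<close>-algebra of bounded operators\<close>

definition adjoint_pair :: "('h, 'm) hilbert_scheme \<Rightarrow> ('h \<Rightarrow> 'h) \<Rightarrow> ('h \<Rightarrow> 'h) \<Rightarrow> bool" where
 "adjoint_pair H S S' \<longleftrightarrow> S \<in> extensional (carrier H) \<and> S' \<in> extensional (carrier H) \<and>
   bounded_operator H S \<and> bounded_operator H S' \<and>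
   (\<forall>v\<in>carrier H. \<forall>w\<in>carrier H. hinner H (S v) w = hinner H v (S' w))"

definition operator_norm :: "('h, 'm) hilbert_scheme \<Rightarrow> ('h \<Rightarrow> 'h) \<Rightarrow> real" where
 "operator_norm H S = Inf {C. 0 \<le> C \<and> (\<forall>v\<in>carrier H. hnorm H (S v) \<le> C * hnorm H v)}"

text \<open>The elements are the operators that come with an adjoint, which is unique, so the choice in \<open>star\<close> is
harmless. By the Riesz representation theorem these are all bounded operators. The values outside the
carrier are fixed by extensionality to make equality of operators the equality on vectors.\<close>

definition bounded_operators :: "('h, 'm) hilbert_scheme \<Rightarrow> ('h \<Rightarrow> 'h) cstar_algebra" where
 "bounded_operators H =
   \<lparr>carrier = {S. \<exists>S'. adjoint_pair H S S'},
   mult = (\<lambda>S T. \<lambda>v\<in>carrier H. S (T v)), one = undefined,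
   zero = (\<lambda>v\<in>carrier H. \<zero>\<^bsub>H\<^esub>),
   add = (\<lambda>S T. \<lambda>v\<in>carrier H. S v \<oplus>\<^bsub>H\<^esub> T v),
   smult = (\<lambda>c S. \<lambda>v\<in>carrier H. c \<odot>\<^bsub>H\<^esub> S v),
   star = (\<lambda>S. SOME S'. adjoint_pair H S S'),
   cnorm = operator_norm H\<rparr>"

context hilbert_space
begin

abbreviation "B \<equiv> bounded_operators H"
abbreviation "\<B> \<equiv> carrier B"

lemma B_simps:
 "mult B S T = (\<lambda>v\<in>\<H>. S (T v))" "\<zero>\<^bsub>B\<^esub> = (\<lambda>v\<in>\<H>. \<zero>)"
 "S \<oplus>\<^bsub>B\<^esub> T = (\<lambda>v\<in>\<H>. S v \<oplus> T v)" "c \<odot>\<^bsub>B\<^esub> S = (\<lambda>v\<in>\<H>. c \<odot> S v)"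
 "cnorm B = operator_norm H"
 by (simp_all add: bounded_operators_def)

lemma B_carrier: "S \<in> \<B> \<longleftrightarrow> (\<exists>S'. adjoint_pair H S S')"
 by (simp add: bounded_operators_def)

lemma adjoint_pairD:
 assumes "adjoint_pair H S S'"
 shows "S \<in> extensional \<H>" "S' \<in> extensional \<H>"
  "v \<in> \<H> \<Longrightarrow> S v \<in> \<H>" "v \<in> \<H> \<Longrightarrow> S' v \<in> \<H>"
  "\<lbrakk>v \<in> \<H>; w \<in> \<H>\<rbrakk> \<Longrightarrow> ip (S v) w = ip v (S' w)"
  "\<lbrakk>v \<in> \<H>; w \<in> \<H>\<rbrakk> \<Longrightarrow> ip (S' v) w = ip v (S w)"
  "\<exists>C\<ge>0. \<forall>v\<in>\<H>. nrm (S v) \<le> C * nrm v"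
  "\<exists>C\<ge>0. \<forall>v\<in>\<H>. nrm (S' v) \<le> C * nrm v"
proof -
 show c: "S \<in> extensional \<H>" "S' \<in> extensional \<H>"
  "\<And>v. v \<in> \<H> \<Longrightarrow> S v \<in> \<H>" "\<And>v. v \<in> \<H> \<Longrightarrow> S' v \<in> \<H>"
  "\<And>v w. \<lbrakk>v \<in> \<H>; w \<in> \<H>\<rbrakk> \<Longrightarrow> ip (S v) w = ip v (S' w)"
  using assms by (auto simp: adjoint_pair_def bounded_operator_def)
 show "\<lbrakk>v \<in> \<H>; w \<in> \<H>\<rbrakk> \<Longrightarrow> ip (S' v) w = ip v (S w)"
  using c(5) hinner_cnj[of w "S' v"] hinner_cnj[of "S w" v] c(3,4) by simp
 have *: "\<exists>C\<ge>0. \<forall>v\<in>\<H>. nrm (T v) \<le> C * nrm v" if bo: "bounded_operator H T" for T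
 proof -
  obtain C where C: "\<forall>v\<in>\<H>. nrm (T v) \<le> C * nrm v"
   using bo unfolding bounded_operator_def by blast
  have "nrm (T v) \<le> \<bar>C\<bar> * nrm v" if "v \<in> \<H>" for v
   using C[rule_format, OF that] mult_right_mono[OF abs_ge_self[of C] hnorm_nonneg[OF that]] by linarith
  then show ?thesis by (intro exI[of _ "\<bar>C\<bar>"]) auto
 qed
 show "\<exists>C\<ge>0. \<forall>v\<in>\<H>. nrm (S v) \<le> C * nrm v"
  "\<exists>C\<ge>0. \<forall>v\<in>\<H>. nrm (S' v) \<le> C * nrm v"
  using assms * unfolding adjoint_pair_def by blast+
qed

lemma adjoint_pairI:
 assumes ext: "S \<in> extensional \<H>" "S' \<in> extensional \<H>"
  and cl: "\<And>v. v \<in> \<H> \<Longrightarrow> S v \<in> \<H>" "\<And>v. v \<in> \<H> \<Longrightarrow> S' v \<in> \<H>"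
  and adj: "\<And>v w. \<lbrakk>v \<in> \<H>; w \<in> \<H>\<rbrakk> \<Longrightarrow> ip (S v) w = ip v (S' w)"
  and bd: "\<And>v. v \<in> \<H> \<Longrightarrow> nrm (S v) \<le> C * nrm v"
   "\<And>v. v \<in> \<H> \<Longrightarrow> nrm (S' v) \<le> C' * nrm v"
 shows "adjoint_pair H S S'"
proof -
 have adj': "ip (S' v) w = ip v (S w)" if "v \<in> \<H>" "w \<in> \<H>" for v w
  using adj hinner_cnj[of w "S' v"] hinner_cnj[of "S w" v] cl that by simp
 have "bounded_operator H T" if t: "\<And>v. v \<in> \<H> \<Longrightarrow> T v \<in> \<H>" "\<And>v. v \<in> \<H> \<Longrightarrow> T' v \<in> \<H>"
  and a: "\<And>v w. \<lbrakk>v \<in> \<H>; w \<in> \<H>\<rbrakk> \<Longrightarrow> ip (T v) w = ip v (T' w)"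
  and b: "\<And>v. v \<in> \<H> \<Longrightarrow> nrm (T v) \<le> C * nrm v" for T T' C
  unfolding bounded_operator_def
 proof (intro conjI ballI allI Pi_I t exI[of _ C] b)
  fix v w c assume v: "v \<in> \<H>"
  show "T (c \<odot> v) = c \<odot> T v" by (intro hinner_eqI) (use v t a in \<open>simp_all add: hinner_smult_left\<close>)
  assume w: "w \<in> \<H>"
  show "T (v \<oplus> w) = T v \<oplus> T w" by (intro hinner_eqI) (use v w t a in \<open>simp_all add: hinner_add_left\<close>)
 qed
 from this[of S S' C] this[of S' S C'] show ?thesis
  using assms adj' unfolding adjoint_pair_def by blast
qed

lemma adjoint_pair_sym: "adjoint_pair H S S' \<Longrightarrow> adjoint_pair H S' S"
 using adjoint_pairD(6) unfolding adjoint_pair_def by blast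

lemma adjoint_pair_unique:
 assumes "adjoint_pair H S S'" "adjoint_pair H S S''"
 shows "S' = S''"
proof (rule extensionalityI)
 note 1 = adjoint_pairD[OF assms(1)] and 2 = adjoint_pairD[OF assms(2)]
 show "S' \<in> extensional \<H>" "S'' \<in> extensional \<H>" using 1 2 by blast+
 fix v assume v: "v \<in> \<H>"
 show "S' v = S'' v" by (rule hinner_eqI) (use v 1(4,6) 2(4,6) in auto)
qed

lemma star_B_eq: "adjoint_pair H S S' \<Longrightarrow> star B S = S'"
  by (auto simp: bounded_operators_def adjoint_pair_unique)

lemma B_adjoint: "S \<in> \<B> \<Longrightarrow> adjoint_pair H S (star B S)"
 using star_B_eq B_carrier by metis

lemma B_apply:
 assumes "S \<in> \<B>"
 shows "S \<in> extensional \<H>" "v \<in> \<H> \<Longrightarrow> S v \<in> \<H>"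
  "\<lbrakk>v \<in> \<H>; w \<in> \<H>\<rbrakk> \<Longrightarrow> S (v \<oplus> w) = S v \<oplus> S w"
  "v \<in> \<H> \<Longrightarrow> S (c \<odot> v) = c \<odot> S v"
  "\<lbrakk>v \<in> \<H>; w \<in> \<H>\<rbrakk> \<Longrightarrow> ip (S v) w = ip v (star B S w)"
 using B_adjoint[OF assms] by (auto simp: adjoint_pair_def bounded_operator_def)

lemma operator_norm:
 assumes "S \<in> \<B>"
 shows "0 \<le> operator_norm H S"
  and "v \<in> \<H> \<Longrightarrow> nrm (S v) \<le> operator_norm H S * nrm v"
  and "\<lbrakk>0 \<le> C; \<And>v. v \<in> \<H> \<Longrightarrow> nrm (S v) \<le> C * nrm v\<rbrakk> \<Longrightarrow> operator_norm H S \<le> C"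
proof -
 let ?X = "{C. 0 \<le> C \<and> (\<forall>v\<in>\<H>. nrm (S v) \<le> C * nrm v)}"
 have ne: "?X \<noteq> {}" using adjoint_pairD(7)[OF B_adjoint[OF assms]] by blast
 show "0 \<le> operator_norm H S" unfolding operator_norm_def by (rule cInf_greatest[OF ne]) auto
 show "operator_norm H S \<le> C" if "0 \<le> C" "\<And>v. v \<in> \<H> \<Longrightarrow> nrm (S v) \<le> C * nrm v" for C
  unfolding operator_norm_def by (rule cInf_lower) (use that in auto)
 show "nrm (S v) \<le> operator_norm H S * nrm v" if v: "v \<in> \<H>"
 proof (cases "nrm v = 0")
  case True
  obtain C where "C \<ge> 0" "nrm (S v) \<le> C * nrm v"
   using adjoint_pairD(7)[OF B_adjoint[OF assms]] v by blast
  then show ?thesis using True by simp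
 next
  case False
  then have pos: "nrm v > 0" using hnorm_nonneg[OF v] by simp
  have "nrm (S v) / nrm v \<le> operator_norm H S"
   unfolding operator_norm_def by (rule cInf_greatest[OF ne]) (use v pos in \<open>auto simp: pos_divide_le_eq\<close>)
  then show ?thesis using pos by (simp add: pos_divide_le_eq)
 qed
qed

lemma adjoint_pair_ops:
 assumes "adjoint_pair H S S'" "adjoint_pair H T T'"
 shows "adjoint_pair H (S \<oplus>\<^bsub>B\<^esub> T) (S' \<oplus>\<^bsub>B\<^esub> T')" "adjoint_pair H (c \<odot>\<^bsub>B\<^esub> S) (cnj c \<odot>\<^bsub>B\<^esub> S')"
  "adjoint_pair H (S \<otimes>\<^bsub>B\<^esub> T) (T' \<otimes>\<^bsub>B\<^esub> S')" "adjoint_pair H \<zero>\<^bsub>B\<^esub> \<zero>\<^bsub>B\<^esub>"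
proof -
 note s = adjoint_pairD[OF assms(1)] and t = adjoint_pairD[OF assms(2)]
 obtain C C' D D' where bd:
  "C \<ge> 0" "\<And>v. v \<in> \<H> \<Longrightarrow> nrm (S v) \<le> C * nrm v"
  "C' \<ge> 0" "\<And>v. v \<in> \<H> \<Longrightarrow> nrm (S' v) \<le> C' * nrm v"
  "D \<ge> 0" "\<And>v. v \<in> \<H> \<Longrightarrow> nrm (T v) \<le> D * nrm v"
  "D' \<ge> 0" "\<And>v. v \<in> \<H> \<Longrightarrow> nrm (T' v) \<le> D' * nrm v"
  using s(7,8) t(7,8) by metis
 have add: "nrm (u \<oplus> v) \<le> (a + b) * n" if "u \<in> \<H>" "v \<in> \<H>" "nrm u \<le> a * n" "nrm v \<le> b * n" for u v a b n
  using hnorm_triangle[OF that(1,2)] that(3,4) by (simp add: distrib_right)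
 have mul: "nrm (P (Q v)) \<le> (a * b) * nrm v"
  if "v \<in> \<H>" "Q v \<in> \<H>" "a \<ge> 0" "\<And>v. v \<in> \<H> \<Longrightarrow> nrm (P v) \<le> a * nrm v"
   "nrm (Q v) \<le> b * nrm v" for P Q v a b
  by (smt (verit) that mult_left_mono mult.assoc)
 have b1: "nrm (S v \<oplus> T v) \<le> (C + D) * nrm v" "nrm (S' v \<oplus> T' v) \<le> (C' + D') * nrm v"
  if "v \<in> \<H>" for v
  using add bd s(3,4) t(3,4) that by auto
 have b2: "nrm (S (T v)) \<le> (C * D) * nrm v" "nrm (T' (S' v)) \<le> (D' * C') * nrm v"
  if "v \<in> \<H>" for v
  using mul[of v T C S D, OF that t(3)[OF that] bd(1,2) bd(6)[OF that]]
   mul[of v S' D' T' C', OF that s(4)[OF that] bd(7,8) bd(4)[OF that]] by - assumption+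
 have b3: "nrm (c \<odot> S v) \<le> (cmod c * C) * nrm v" "nrm (cnj c \<odot> S' v) \<le> (cmod c * C') * nrm v"
  if "v \<in> \<H>" for v
  using mult_left_mono[OF bd(2)[OF that], of "cmod c"] mult_left_mono[OF bd(4)[OF that], of "cmod c"] s(3,4)[OF that] by (simp_all add: hnorm_smult)
 show "adjoint_pair H (S \<oplus>\<^bsub>B\<^esub> T) (S' \<oplus>\<^bsub>B\<^esub> T')"
  by (rule adjoint_pairI) (use s(3-5) t(3-5) b1 in \<open>simp_all add: B_simps hinner_add_left hinner_add_right\<close>)
 show "adjoint_pair H (S \<otimes>\<^bsub>B\<^esub> T) (T' \<otimes>\<^bsub>B\<^esub> S')"
  by (rule adjoint_pairI) (use s(3-5) t(3-5) b2 in \<open>simp_all add: B_simps\<close>)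
 show "adjoint_pair H (c \<odot>\<^bsub>B\<^esub> S) (cnj c \<odot>\<^bsub>B\<^esub> S')"
  by (rule adjoint_pairI) (use s(3-5) b3 in \<open>simp_all add: B_simps hinner_smult_left hinner_smult_right\<close>)
 show "adjoint_pair H \<zero>\<^bsub>B\<^esub> \<zero>\<^bsub>B\<^esub>"
  by (rule adjoint_pairI[where C = 0 and C' = 0]) (auto simp: B_simps hinner_zero_left hinner_zero_right)
qed

lemma B_closed:
 "\<lbrakk>S \<in> \<B>; T \<in> \<B>\<rbrakk> \<Longrightarrow> S \<oplus>\<^bsub>B\<^esub> T \<in> \<B>"
 "\<lbrakk>S \<in> \<B>; T \<in> \<B>\<rbrakk> \<Longrightarrow> S \<otimes>\<^bsub>B\<^esub> T \<in> \<B>"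
 "S \<in> \<B> \<Longrightarrow> c \<odot>\<^bsub>B\<^esub> S \<in> \<B>"
 "S \<in> \<B> \<Longrightarrow> star B S \<in> \<B>"
proof -
 have I: "adjoint_pair H S S' \<Longrightarrow> S \<in> \<B>" for S S' using B_carrier by metis
 show "S \<oplus>\<^bsub>B\<^esub> T \<in> \<B>" "S \<otimes>\<^bsub>B\<^esub> T \<in> \<B>" if "S \<in> \<B>" "T \<in> \<B>"
  using I[OF adjoint_pair_ops(1)[OF B_adjoint B_adjoint, OF that]]
   I[OF adjoint_pair_ops(3)[OF B_adjoint B_adjoint, OF that]] by - assumption+
 show "c \<odot>\<^bsub>B\<^esub> S \<in> \<B>" "star B S \<in> \<B>" if "S \<in> \<B>"
  using I[OF adjoint_pair_ops(2)[OF B_adjoint B_adjoint, OF that that]]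
   I[OF adjoint_pair_sym[OF B_adjoint, OF that]] by - assumption+
qed

lemma B_zero_closed: "\<zero>\<^bsub>B\<^esub> \<in> \<B>"
proof -
 have "adjoint_pair H \<zero>\<^bsub>B\<^esub> \<zero>\<^bsub>B\<^esub>"
  by (rule adjoint_pairI[where C = 0 and C' = 0]) (auto simp: B_simps hinner_zero_left hinner_zero_right)
 then show ?thesis using B_carrier by blast
qed

lemma B_eqI:
 assumes "S \<in> \<B>" "T \<in> \<B>" "\<And>v. v \<in> \<H> \<Longrightarrow> S v = T v"
 shows "S = T"
 using assms B_apply(1) by (intro extensionalityI) auto

lemma B_star_algebra: "star_algebra B"
proof (rule star_algebra.intro)
 note cl = B_closed B_zero_closed
 note ap = B_apply(2-4)
 show "Module.module complex_ring B"
 proof (rule complex_moduleI)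
  fix S T U assume ST: "S \<in> \<B>" "T \<in> \<B>"
  show "S \<oplus>\<^bsub>B\<^esub> T = T \<oplus>\<^bsub>B\<^esub> S"
   by (rule B_eqI, (intro cl ST; fail)+, simp add: B_simps ap ST M.a_comm)
  assume U: "U \<in> \<B>"
  show "(S \<oplus>\<^bsub>B\<^esub> T) \<oplus>\<^bsub>B\<^esub> U = S \<oplus>\<^bsub>B\<^esub> (T \<oplus>\<^bsub>B\<^esub> U)"
   by (rule B_eqI, (intro cl ST U; fail)+, simp add: B_simps ap ST U M.a_assoc)
 next
  fix S assume S: "S \<in> \<B>"
  have "(-1) \<odot> u \<oplus> u = \<zero>" if "u \<in> \<H>" for u using that M.l_neg minus_conv by metis
  then show "(-1) \<odot>\<^bsub>B\<^esub> S \<oplus>\<^bsub>B\<^esub> S = \<zero>\<^bsub>B\<^esub>"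
   by - (rule B_eqI, (intro cl S; fail)+, simp add: B_simps ap S)
 next
  fix S T c e assume S: "S \<in> \<B>"
  show "(c + e) \<odot>\<^bsub>B\<^esub> S = c \<odot>\<^bsub>B\<^esub> S \<oplus>\<^bsub>B\<^esub> e \<odot>\<^bsub>B\<^esub> S"
   "(c * e) \<odot>\<^bsub>B\<^esub> S = c \<odot>\<^bsub>B\<^esub> (e \<odot>\<^bsub>B\<^esub> S)"
   by - (rule B_eqI, (intro cl S; fail)+, simp add: B_simps ap S complex_smult_distr)+
  assume T: "T \<in> \<B>"
  show "c \<odot>\<^bsub>B\<^esub> (S \<oplus>\<^bsub>B\<^esub> T) = c \<odot>\<^bsub>B\<^esub> S \<oplus>\<^bsub>B\<^esub> c \<odot>\<^bsub>B\<^esub> T"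
   by (rule B_eqI, (intro cl S T; fail)+, simp add: B_simps ap S T complex_smult_distr)
 next
  fix S assume S: "S \<in> \<B>"
  show "\<zero>\<^bsub>B\<^esub> \<oplus>\<^bsub>B\<^esub> S = S" "1 \<odot>\<^bsub>B\<^esub> S = S"
   by - (rule B_eqI, (intro cl S; fail)+, simp add: B_simps ap S complex_smult_distr)+
 qed (simp_all add: cl)
 show "star_algebra_axioms B"
 proof
  fix S T U c assume S: "S \<in> \<B>"
  show "star B S \<in> \<B>" by (intro cl S)
  show "star B (star B S) = S" using star_B_eq[OF adjoint_pair_sym[OF B_adjoint[OF S]]] .
  show "star B (c \<odot>\<^bsub>B\<^esub> S) = cnj c \<odot>\<^bsub>B\<^esub> star B S"
   by (rule star_B_eq) (rule adjoint_pair_ops(2)[OF B_adjoint[OF S] B_adjoint[OF S]])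
  assume T: "T \<in> \<B>"
  note o = adjoint_pair_ops[OF B_adjoint[OF S] B_adjoint[OF T]]
  show "S \<otimes>\<^bsub>B\<^esub> T \<in> \<B>" by (intro cl S T)
  show "star B (S \<oplus>\<^bsub>B\<^esub> T) = star B S \<oplus>\<^bsub>B\<^esub> star B T" by (rule star_B_eq[OF o(1)])
  show "star B (S \<otimes>\<^bsub>B\<^esub> T) = star B T \<otimes>\<^bsub>B\<^esub> star B S" by (rule star_B_eq[OF o(3)])
  show "(c \<odot>\<^bsub>B\<^esub> S) \<otimes>\<^bsub>B\<^esub> T = c \<odot>\<^bsub>B\<^esub> (S \<otimes>\<^bsub>B\<^esub> T)" "S \<otimes>\<^bsub>B\<^esub> (c \<odot>\<^bsub>B\<^esub> T) = c \<odot>\<^bsub>B\<^esub> (S \<otimes>\<^bsub>B\<^esub> T)"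
   by - (rule B_eqI, (intro cl S T; fail)+, simp add: B_simps ap S T)+
  assume U: "U \<in> \<B>"
  show "(S \<otimes>\<^bsub>B\<^esub> T) \<otimes>\<^bsub>B\<^esub> U = S \<otimes>\<^bsub>B\<^esub> (T \<otimes>\<^bsub>B\<^esub> U)"
   "(S \<oplus>\<^bsub>B\<^esub> T) \<otimes>\<^bsub>B\<^esub> U = S \<otimes>\<^bsub>B\<^esub> U \<oplus>\<^bsub>B\<^esub> T \<otimes>\<^bsub>B\<^esub> U"
   "U \<otimes>\<^bsub>B\<^esub> (S \<oplus>\<^bsub>B\<^esub> T) = U \<otimes>\<^bsub>B\<^esub> S \<oplus>\<^bsub>B\<^esub> U \<otimes>\<^bsub>B\<^esub> T"
   by - (rule B_eqI, (intro cl S T U; fail)+, simp add: B_simps ap S T U)+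
 qed
qed

interpretation B: star_algebra B by (rule B_star_algebra)

lemma B_minus_apply:
 assumes "S \<in> \<B>" "T \<in> \<B>" "v \<in> \<H>"
 shows "(S \<ominus>\<^bsub>B\<^esub> T) v = S v \<ominus> T v"
 using assms B_apply(2) by (simp add: B.M.minus_eq B.minus_conv M.minus_eq minus_conv B_simps)

lemma operator_norm_mult:
 assumes "S \<in> \<B>" "T \<in> \<B>"
 shows "operator_norm H (S \<otimes>\<^bsub>B\<^esub> T) \<le> operator_norm H S * operator_norm H T"
proof (rule operator_norm(3))
 note s = operator_norm[OF assms(1)] and t = operator_norm[OF assms(2)]
 show "S \<otimes>\<^bsub>B\<^esub> T \<in> \<B>" "0 \<le> operator_norm H S * operator_norm H T" using assms s t by auto
 fix v assume v: "v \<in> \<H>"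
 have "nrm (S (T v)) \<le> operator_norm H S * nrm (T v)" using s v B_apply(2)[OF assms(2)] by blast
 also have "\<dots> \<le> operator_norm H S * (operator_norm H T * nrm v)" using s t v by (intro mult_left_mono)
 finally show "nrm ((S \<otimes>\<^bsub>B\<^esub> T) v) \<le> operator_norm H S * operator_norm H T * nrm v"
  using v by (simp add: B_simps)
qed

lemma operator_norm_star_le:
 assumes "S \<in> \<B>"
 shows "operator_norm H (star B S) \<le> operator_norm H S"
proof (rule operator_norm(3))
 note s = operator_norm[OF assms] and a = adjoint_pairD[OF B_adjoint[OF assms]]
 show "star B S \<in> \<B>" "0 \<le> operator_norm H S" using assms s by auto
 fix v assume v: "v \<in> \<H>"
 let ?w = "star B S v"
 have w: "?w \<in> \<H>" using a v by blast
 have "(nrm ?w)\<^sup>2 = Re (ip (S ?w) v)" using a v by (simp add: hnorm_power2)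
 also have "\<dots> \<le> nrm (S ?w) * nrm v"
  using Cauchy_Schwarz[of "S ?w" v] complex_Re_le_cmod[of "ip (S ?w) v"] a v by fastforce
 also have "\<dots> \<le> operator_norm H S * nrm ?w * nrm v"
  using s w v hnorm_nonneg by (intro mult_right_mono) auto
 finally have "nrm ?w * nrm ?w \<le> nrm ?w * (operator_norm H S * nrm v)"
  by (simp add: power2_eq_square mult_ac)
 then show "nrm ?w \<le> operator_norm H S * nrm v"
  using hnorm_nonneg[OF w] hnorm_nonneg[OF v] s(1) by (cases "nrm ?w = 0") auto
qed

text \<open>One half of the \<open>C\<^sup>*\<close>-identity, and also the estimate \<open>\<parallel>P\<parallel>\<^sup>2 \<le> \<parallel>P\<^sup>* P + Q\<^sup>* Q\<parallel>\<close> that Schur's lemma needs.\<close>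

lemma operator_norm_square_le:
 assumes S: "S \<in> \<B>" and R: "R \<in> \<B>"
  and le: "\<And>v. v \<in> \<H> \<Longrightarrow> (nrm (S v))\<^sup>2 \<le> Re (ip v (R v))"
 shows "(operator_norm H S)\<^sup>2 \<le> operator_norm H R"
proof -
 note n = operator_norm[OF R]
 have "operator_norm H S \<le> sqrt (operator_norm H R)"
 proof (rule operator_norm(3)[OF S])
  fix v assume v: "v \<in> \<H>"
  have "Re (ip v (R v)) \<le> nrm v * nrm (R v)"
   using Cauchy_Schwarz[OF v B_apply(2)[OF R v]] complex_Re_le_cmod order_trans by blast
  also have "\<dots> \<le> nrm v * (operator_norm H R * nrm v)"
   using n(2)[OF v] hnorm_nonneg[OF v] by (intro mult_left_mono)
  also have "\<dots> = (sqrt (operator_norm H R) * nrm v)\<^sup>2" using n(1) by (simp add: power2_eq_square mult_ac)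
  finally show "nrm (S v) \<le> sqrt (operator_norm H R) * nrm v"
   by (intro power2_le_imp_le[OF order_trans[OF le[OF v]]]) (use n(1) hnorm_nonneg[OF v] in auto)
 qed (use n in simp)
 then show ?thesis using n(1) operator_norm(1)[OF S] by (simp add: sqrt_ge_absD)
qed

lemma B_seminorm: "cstar_seminorm B (cnorm B)"
 unfolding cstar_seminorm_def B_simps(5)
proof (intro conjI ballI allI)
 fix S assume S: "S \<in> \<B>"
 note s = operator_norm[OF S]
 show "0 \<le> operator_norm H S" by (rule s)
 have le: "operator_norm H (c \<odot>\<^bsub>B\<^esub> T) \<le> cmod c * operator_norm H T" if T: "T \<in> \<B>" for c T
 proof (rule operator_norm(3))
  fix v assume v: "v \<in> \<H>"
  show "nrm ((c \<odot>\<^bsub>B\<^esub> T) v) \<le> cmod c * operator_norm H T * nrm v"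
   using operator_norm(2)[OF T v] v B_apply(2)[OF T v] by (simp add: B_simps hnorm_smult mult.assoc mult_left_mono)
 qed (use T operator_norm(1)[OF T] in auto)
 show "operator_norm H (c \<odot>\<^bsub>B\<^esub> S) = cmod c * operator_norm H S" for c
 proof (rule antisym[OF le[OF S]])
  show "cmod c * operator_norm H S \<le> operator_norm H (c \<odot>\<^bsub>B\<^esub> S)"
  proof (cases "c = 0")
   case True
   then show ?thesis using operator_norm(1) S by simp
  next
   case False
   have "operator_norm H S \<le> cmod (1 / c) * operator_norm H (c \<odot>\<^bsub>B\<^esub> S)"
    using le[of "c \<odot>\<^bsub>B\<^esub> S" "1 / c"] S False by (simp add: B.complex_smult_distr(4) flip: B.complex_smult_distr(3))
   then show ?thesis using False by (simp add: norm_divide field_simps)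
  qed
 qed
 show "operator_norm H (star B S \<otimes>\<^bsub>B\<^esub> S) = (operator_norm H S)\<^sup>2"
 proof (rule antisym)
  have "operator_norm H (star B S \<otimes>\<^bsub>B\<^esub> S) \<le> operator_norm H (star B S) * operator_norm H S"
   using S by (intro operator_norm_mult) auto
  also have "\<dots> \<le> operator_norm H S * operator_norm H S"
   using s operator_norm_star_le[OF S] by (intro mult_right_mono)
  finally show "operator_norm H (star B S \<otimes>\<^bsub>B\<^esub> S) \<le> (operator_norm H S)\<^sup>2" by (simp add: power2_eq_square)
  show "(operator_norm H S)\<^sup>2 \<le> operator_norm H (star B S \<otimes>\<^bsub>B\<^esub> S)"
  proof (rule operator_norm_square_le[OF S])
   fix v assume v: "v \<in> \<H>"
   show "(nrm (S v))\<^sup>2 \<le> Re (ip v ((star B S \<otimes>\<^bsub>B\<^esub> S) v))"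
    using B_apply(2,5)[OF S v] v by (simp add: hnorm_power2 B_simps)
  qed (use S in auto)
 qed
 fix T assume T: "T \<in> \<B>"
 note t = operator_norm[OF T]
 show "operator_norm H (S \<otimes>\<^bsub>B\<^esub> T) \<le> operator_norm H S * operator_norm H T" using operator_norm_mult S T .
 show "operator_norm H (S \<oplus>\<^bsub>B\<^esub> T) \<le> operator_norm H S + operator_norm H T"
 proof (rule operator_norm(3))
  fix v assume v: "v \<in> \<H>"
  show "nrm ((S \<oplus>\<^bsub>B\<^esub> T) v) \<le> (operator_norm H S + operator_norm H T) * nrm v"
   using hnorm_triangle[of "S v" "T v"] s(2)[OF v] t(2)[OF v] v B_apply(2) S T by (simp add: B_simps distrib_right)
 qed (use S T s t in auto)
qed

interpretation B: cstar_seminormed B "cnorm B"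
 by (intro cstar_seminormed.intro cstar_seminormed_axioms.intro B_star_algebra B_seminorm)

text \<open>The values of a Cauchy sequence of operators at a vector form a Cauchy sequence.\<close>

lemma strong_limit:
 assumes X: "X \<in> Cauchy_seqs B (cnorm B)"
 obtains S where "\<And>v. v \<in> \<H> \<Longrightarrow> S v \<in> \<H>" "S \<in> extensional \<H>"
  "\<And>v. v \<in> \<H> \<Longrightarrow> norm_tendsto H nrm (\<lambda>n. X n v) (S v)"
proof -
 have XB: "X n \<in> \<B>" for n using X by (rule B.CS_carrier)
 have "\<exists>l. l \<in> \<H> \<and> norm_tendsto H nrm (\<lambda>n. X n v) l" if v: "v \<in> \<H>" for v
 proof -
  have "norm_Cauchy H nrm (\<lambda>n. X n v)"
   unfolding norm_Cauchy_def
  proof (intro allI impI)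
   fix e :: real assume e: "e > 0"
   define e' where "e' = e / (nrm v + 1)"
   have e': "e' > 0" using e hnorm_nonneg[OF v] by (simp add: e'_def)
   then obtain K where K: "\<forall>m\<ge>K. \<forall>n\<ge>K. cnorm B (X m \<ominus>\<^bsub>B\<^esub> X n) < e'" using B.CS_ge[OF X] by blast
   have "nrm (X m v \<ominus> X n v) < e" if "m \<ge> K" "n \<ge> K" for m n
   proof -
    have "nrm (X m v \<ominus> X n v) \<le> cnorm B (X m \<ominus>\<^bsub>B\<^esub> X n) * nrm v"
     using operator_norm(2)[of "X m \<ominus>\<^bsub>B\<^esub> X n" v] XB v by (simp add: B_minus_apply B_simps(5))
    also have "\<dots> \<le> e' * nrm v"
     using K that hnorm_nonneg[OF v] by (intro mult_right_mono) (auto intro: less_imp_le)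
    also have "\<dots> < e' * (nrm v + 1)" using e' by simp
    also have "\<dots> = e" using hnorm_nonneg[OF v] by (simp add: e'_def)
    finally show ?thesis .
   qed
   then show "\<exists>K. \<forall>m\<ge>K. \<forall>n\<ge>K. nrm (X m v \<ominus> X n v) < e" by blast
  qed
  moreover have "\<forall>n. X n v \<in> \<H>" using XB B_apply(2) v by blast
  ultimately show ?thesis using complete[unfolded norm_complete_def, THEN spec, of "\<lambda>n. X n v"] by blast
 qed
 then obtain S where S: "\<And>v. v \<in> \<H> \<Longrightarrow> S v \<in> \<H> \<and> norm_tendsto H nrm (\<lambda>n. X n v) (S v)" by metis
 show thesis by (rule that[of "restrict S \<H>"]) (use S in auto)
qed

text \<open>Completeness: the strong limit of a Cauchy sequence has the strong limit of the adjoints as its adjoint,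
and the norm estimates for differences survive in the limit.\<close>

theorem cstar_algebra_B: "cstar_algebra B"
proof (intro cstar_algebra.intro cstar_algebra_axioms.intro B_star_algebra B_seminorm)
 show "S = \<zero>\<^bsub>B\<^esub>" if S: "S \<in> \<B>" "cnorm B S = 0" for S
 proof (rule B_eqI[OF S(1) B_zero_closed])
  fix v assume v: "v \<in> \<H>"
  have "nrm (S v) = 0" using operator_norm(2)[OF S(1) v] S(2) hnorm_nonneg[OF B_apply(2)[OF S(1) v]] by (simp add: B_simps)
  then show "S v = \<zero>\<^bsub>B\<^esub> v" using hnorm_eq_0[OF B_apply(2)[OF S(1) v]] v by (simp add: B_simps)
 qed
 show "norm_complete B (cnorm B)"
  unfolding norm_complete_def
 proof (intro allI impI, elim conjE)
  fix X :: "nat \<Rightarrow> 'h \<Rightarrow> 'h"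
  assume XB: "\<forall>n. X n \<in> \<B>" and "norm_Cauchy B (cnorm B) X"
  then have X: "X \<in> Cauchy_seqs B (cnorm B)" unfolding Cauchy_seqs_def mem_Collect_eq by (rule)
  have X': "(\<lambda>n. star B (X n)) \<in> Cauchy_seqs B (cnorm B)" using X by (rule B.CS_star)
  obtain S where S: "\<And>v. v \<in> \<H> \<Longrightarrow> S v \<in> \<H>" "S \<in> extensional \<H>"
   "\<And>v. v \<in> \<H> \<Longrightarrow> norm_tendsto H nrm (\<lambda>n. X n v) (S v)" using strong_limit[OF X] by blast
  obtain S' where S': "\<And>v. v \<in> \<H> \<Longrightarrow> S' v \<in> \<H>" "S' \<in> extensional \<H>"
   "\<And>v. v \<in> \<H> \<Longrightarrow> norm_tendsto H nrm (\<lambda>n. star B (X n) v) (S' v)" using strong_limit[OF X'] by blast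
  obtain K where K: "K > 0" "\<And>n. cnorm B (X n) \<le> K" using B.CS_bounded[OF X] by blast
  have K': "cnorm B (star B (X n)) \<le> K" for n using K(2) XB by simp
  have Xc: "X n v \<in> \<H>" "star B (X n) v \<in> \<H>" if "v \<in> \<H>" for n v
   using XB B_apply(2) that by auto
  have bd: "nrm (T v) \<le> K * nrm v"
   if "v \<in> \<H>" "\<And>n. Y n \<in> \<B>" "\<And>n. cnorm B (Y n) \<le> K" "T v \<in> \<H>"
    "norm_tendsto H nrm (\<lambda>n. Y n v) (T v)" for T Y v
  proof (rule LIMSEQ_le_const2)
   show "(\<lambda>n. nrm (Y n v)) \<longlonglongrightarrow> nrm (T v)"
    using that B_apply(2) by (intro hnorm_tendsto) auto
   have "nrm (Y n v) \<le> K * nrm v" for n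
    using operator_norm(2)[OF that(2,1), of n] mult_right_mono[OF that(3)[of n] hnorm_nonneg[OF that(1)]]
    by (simp add: B_simps)
   then show "\<exists>N. \<forall>n\<ge>N. nrm (Y n v) \<le> K * nrm v" by blast
  qed
  have "adjoint_pair H S S'"
  proof (rule adjoint_pairI[where C = K and C' = K])
   fix v w assume v: "v \<in> \<H>" and w: "w \<in> \<H>"
   have "(\<lambda>n. ip (star B (X n) w) v) \<longlonglongrightarrow> ip (S' w) v"
    using Xc S' v w by (intro hinner_tendsto) auto
   then have "(\<lambda>n. cnj (ip (star B (X n) w) v)) \<longlonglongrightarrow> cnj (ip (S' w) v)"
    by (rule tendsto_cnj)
   moreover have "cnj (ip (star B (X n) w) v) = ip (X n v) w" for n
    using hinner_cnj[of "star B (X n) w" v] B_apply(5) XB Xc v w by simp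
   moreover have "(\<lambda>n. ip (X n v) w) \<longlonglongrightarrow> ip (S v) w"
    using Xc S v w by (intro hinner_tendsto) auto
   ultimately have "cnj (ip (S' w) v) = ip (S v) w" using LIMSEQ_unique by simp
   then show "ip (S v) w = ip v (S' w)" using hinner_cnj[of "S' w" v] S' v w by simp
  qed (use S S' bd[of _ X S] bd[of _ "\<lambda>n. star B (X n)" S'] K K' XB in auto)
  then have SB: "S \<in> \<B>" using B_carrier by blast
  have "norm_tendsto B (cnorm B) X S"
   unfolding norm_tendsto_def
  proof (rule LIMSEQ_I)
   fix e :: real assume e: "e > 0"
   then obtain N where N: "\<forall>m\<ge>N. \<forall>n\<ge>N. cnorm B (X m \<ominus>\<^bsub>B\<^esub> X n) < e / 2" using B.CS_ge[OF X, of "e / 2"] by auto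
   have "cnorm B (X m \<ominus>\<^bsub>B\<^esub> S) < e" if m: "m \<ge> N" for m
   proof -
    have "cnorm B (X m \<ominus>\<^bsub>B\<^esub> S) \<le> e / 2"
     unfolding B_simps(5)
    proof (rule operator_norm(3))
     show "X m \<ominus>\<^bsub>B\<^esub> S \<in> \<B>" "0 \<le> e / 2" using XB SB e by auto
     fix v assume v: "v \<in> \<H>"
     show "nrm ((X m \<ominus>\<^bsub>B\<^esub> S) v) \<le> e / 2 * nrm v"
     proof (rule LIMSEQ_le_const2)
      show "(\<lambda>n. nrm (X m v \<ominus> X n v)) \<longlonglongrightarrow> nrm ((X m \<ominus>\<^bsub>B\<^esub> S) v)"
       using Xc S v XB SB by (simp add: B_minus_apply) (intro hnorm_tendsto tendsto_minus_const, auto)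
      have "nrm (X m v \<ominus> X n v) \<le> e / 2 * nrm v" if "n \<ge> N" for n
      proof -
       have "nrm (X m v \<ominus> X n v) \<le> cnorm B (X m \<ominus>\<^bsub>B\<^esub> X n) * nrm v"
        using operator_norm(2)[of "X m \<ominus>\<^bsub>B\<^esub> X n" v] XB v by (simp add: B_minus_apply B_simps(5))
       also have "\<dots> \<le> e / 2 * nrm v"
        using N m that hnorm_nonneg[OF v] by (intro mult_right_mono) (auto intro: less_imp_le)
       finally show ?thesis .
      qed
      then show "\<exists>N. \<forall>n\<ge>N. nrm (X m v \<ominus> X n v) \<le> e / 2 * nrm v" by blast
     qed
    qed
    then show ?thesis using e by simp
   qed
   moreover have "0 \<le> cnorm B (X m \<ominus>\<^bsub>B\<^esub> S)" for m using XB SB by simp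
   ultimately show "\<exists>N. \<forall>m\<ge>N. norm (cnorm B (X m \<ominus>\<^bsub>B\<^esub> S) - 0) < e" by auto
  qed
  then show "\<exists>l\<in>\<B>. norm_tendsto B (cnorm B) X l" using SB by blast
 qed
qed

lemma finsum_B_apply:
 assumes "finite J" "\<And>j. j \<in> J \<Longrightarrow> f j \<in> \<B>" "v \<in> \<H>" "w \<in> \<H>"
 shows "ip (finsum B f J v) w = (\<Sum>j\<in>J. ip (f j v) w)"
 using assms
proof (induction J)
 case (insert j J)
 have "finsum B f J \<in> \<B>" using insert.prems by (intro B.M.finsum_closed) auto
 moreover have "finsum B f (insert j J) = f j \<oplus>\<^bsub>B\<^esub> finsum B f J"
  using insert by (intro B.M.finsum_insert) auto
 ultimately show ?case using insert B_apply(2) by (simp add: B_simps(3) hinner_add_left)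
qed (simp add: B_simps hinner_zero_left)

lemma star_hom_hilbert_rep:
 assumes "star_algebra A" "star_hom A B \<phi>"
 shows "hilbert_rep A H \<phi>"
proof -
 interpret A: star_algebra A by fact
 note h = star_homD[OF assms(2)]
 have bo: "bounded_operator H S" if "S \<in> \<B>" for S
  using B_adjoint[OF that] by (simp add: adjoint_pair_def)
 show ?thesis
  unfolding hilbert_rep_def using bo h(1) B_apply(5) by (auto simp: h(2-5) B_simps)
qed

end

section \<open>The Hilbert space \<open>\<ell>\<^sup>2\<close>\<close>

lemma ell2_sel [simp]:
 "f \<in> carrier (ell2 X) \<longleftrightarrow> (\<forall>i. i \<notin> X \<longrightarrow> f i = 0) \<and> (\<lambda>i. (cmod (f i))\<^sup>2) summable_on X"
 "\<zero>\<^bsub>ell2 X\<^esub> = (\<lambda>i. 0)" "f \<oplus>\<^bsub>ell2 X\<^esub> g = (\<lambda>i. f i + g i)" "c \<odot>\<^bsub>ell2 X\<^esub> f = (\<lambda>i. c * f i)"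
 "hinner (ell2 X) f g = (\<Sum>\<^sub>\<infinity>i\<in>X. f i * cnj (g i))"
 by (simp_all add: ell2_def)

lemma summable_sq_add:
 fixes f g :: "'i \<Rightarrow> complex"
 assumes "(\<lambda>i. (cmod (f i))\<^sup>2) summable_on X" "(\<lambda>i. (cmod (g i))\<^sup>2) summable_on X"
 shows "(\<lambda>i. (cmod (f i + g i))\<^sup>2) summable_on X"
proof (rule summable_on_comparison_test)
 show "(\<lambda>i. 2 * (cmod (f i))\<^sup>2 + 2 * (cmod (g i))\<^sup>2) summable_on X"
  using assms by (intro summable_on_add summable_on_cmult_right)
 fix i
 have "(cmod (f i + g i))\<^sup>2 \<le> (cmod (f i) + cmod (g i))\<^sup>2" by (intro power_mono norm_triangle_ineq) auto
 also have "\<dots> \<le> 2 * (cmod (f i))\<^sup>2 + 2 * (cmod (g i))\<^sup>2"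
  using sum_squares_bound[of "cmod (f i)" "cmod (g i)"] by (simp add: power2_sum)
 finally show "(cmod (f i + g i))\<^sup>2 \<le> 2 * (cmod (f i))\<^sup>2 + 2 * (cmod (g i))\<^sup>2" .
qed auto

lemma summable_sq_mult:
 fixes f g :: "'i \<Rightarrow> complex"
 assumes "(\<lambda>i. (cmod (f i))\<^sup>2) summable_on X" "(\<lambda>i. (cmod (g i))\<^sup>2) summable_on X"
 shows "(\<lambda>i. f i * cnj (g i)) summable_on X"
 by (rule abs_summable_summable, rule abs_summable_product)
  (use assms in \<open>simp_all add: norm_mult power2_eq_square\<close>)

lemma ell2_self: "f i * cnj (f i) = complex_of_real ((cmod (f i))\<^sup>2)"
 by (rule complex_norm_square[symmetric])

lemma ell2_hinner_self:
 assumes "f \<in> carrier (ell2 X)"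
 shows "hinner (ell2 X) f f = complex_of_real (\<Sum>\<^sub>\<infinity>i\<in>X. (cmod (f i))\<^sup>2)"
proof -
 have "((\<lambda>i. (cmod (f i))\<^sup>2) has_sum (\<Sum>\<^sub>\<infinity>i\<in>X. (cmod (f i))\<^sup>2)) X" using assms by auto
 then have "((\<lambda>i. complex_of_real ((cmod (f i))\<^sup>2)) has_sum complex_of_real (\<Sum>\<^sub>\<infinity>i\<in>X. (cmod (f i))\<^sup>2)) X"
  by (rule has_sum_of_real)
 from infsumI[OF this] show ?thesis by (simp only: ell2_sel ell2_self)
qed

lemma ell2_norm:
 assumes "f \<in> carrier (ell2 X)"
 shows "hnorm (ell2 X) f = sqrt (\<Sum>\<^sub>\<infinity>i\<in>X. (cmod (f i))\<^sup>2)"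
 unfolding hnorm_def ell2_hinner_self[OF assms] by simp

lemma ell2_norm_power2:
 assumes "f \<in> carrier (ell2 X)"
 shows "(hnorm (ell2 X) f)\<^sup>2 = (\<Sum>\<^sub>\<infinity>i\<in>X. (cmod (f i))\<^sup>2)"
 unfolding ell2_norm[OF assms] by (simp add: infsum_nonneg)

lemma ell2_sum_le:
 assumes "f \<in> carrier (ell2 X)" "finite F" "F \<subseteq> X"
 shows "(\<Sum>i\<in>F. (cmod (f i))\<^sup>2) \<le> (hnorm (ell2 X) f)\<^sup>2"
 unfolding ell2_norm_power2[OF assms(1)] using assms by (intro finite_sum_le_infsum) auto

lemma ell2_coord_le:
 assumes "f \<in> carrier (ell2 X)"
 shows "cmod (f i) \<le> hnorm (ell2 X) f"
proof (cases "i \<in> X")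
 case True
 then have "(cmod (f i))\<^sup>2 \<le> (hnorm (ell2 X) f)\<^sup>2" using ell2_sum_le[OF assms, of "{i}"] by simp
 then show ?thesis by (rule power2_le_imp_le) (simp add: ell2_norm[OF assms] infsum_nonneg)
next
 case False
 then show ?thesis using assms by (simp add: ell2_norm infsum_nonneg)
qed

lemma ell2_module: "Module.module complex_ring (ell2 X)"
proof (rule complex_moduleI)
 fix f g assume "f \<in> carrier (ell2 X)" "g \<in> carrier (ell2 X)"
 then show "f \<oplus>\<^bsub>ell2 X\<^esub> g \<in> carrier (ell2 X)" by (simp add: summable_sq_add)
next
 fix c f assume "f \<in> carrier (ell2 X)"
 then show "c \<odot>\<^bsub>ell2 X\<^esub> f \<in> carrier (ell2 X)"
  by (simp add: norm_mult power_mult_distrib summable_on_cmult_right)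
qed (auto simp: algebra_simps)

lemma ell2_minus:
 assumes "f \<in> carrier (ell2 X)" "g \<in> carrier (ell2 X)"
 shows "f \<ominus>\<^bsub>ell2 X\<^esub> g = (\<lambda>i. f i - g i)"
proof -
 interpret complex_module "ell2 X" by (rule complex_module.intro) (rule ell2_module)
 show ?thesis using minus_conv[OF assms(2)] by (simp only: M.minus_eq) simp
qed

lemma ell2_minus_closed:
 assumes "f \<in> carrier (ell2 X)" "g \<in> carrier (ell2 X)"
 shows "(\<lambda>i. f i - g i) \<in> carrier (ell2 X)"
proof -
 interpret complex_module "ell2 X" by (rule complex_module.intro) (rule ell2_module)
 show ?thesis using M.minus_closed[OF assms] unfolding ell2_minus[OF assms] .
qed

text \<open>The coordinatewise limit of a Cauchy sequence is its norm limit, because the bounds for finite partial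
sums pass to the limit.\<close>

lemma ell2_complete: "norm_complete (ell2 X) (hnorm (ell2 X))"
 unfolding norm_complete_def
proof (intro allI impI, elim conjE)
 fix F :: "nat \<Rightarrow> 'a \<Rightarrow> complex"
 assume Fc: "\<forall>n. F n \<in> carrier (ell2 X)" and C: "norm_Cauchy (ell2 X) (hnorm (ell2 X)) F"
 have D: "(\<lambda>i. F m i - F n i) \<in> carrier (ell2 X)" for m n using Fc ell2_minus_closed by blast
 have C': "\<exists>M. \<forall>m\<ge>M. \<forall>n\<ge>M. hnorm (ell2 X) (\<lambda>i. F m i - F n i) < e" if "e > 0" for e
  using C that Fc unfolding norm_Cauchy_def by (simp only: ell2_minus)
 have "Cauchy (\<lambda>n. F n i)" for i
  by (smt (verit) metric_CauchyI C' ell2_coord_le D dist_norm)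
 then have "\<exists>l. (\<lambda>n. F n i) \<longlonglongrightarrow> l" for i by (simp add: Cauchy_convergent_iff convergent_def)
 then obtain f where f: "\<And>i. (\<lambda>n. F n i) \<longlonglongrightarrow> f i" by metis
 have f0: "f i = 0" if "i \<notin> X" for i
 proof -
  have "F n i = 0" for n using Fc that by simp
  then show ?thesis using f[of i] by (simp add: LIMSEQ_const_iff)
 qed
 have tail: "\<exists>M. \<forall>m\<ge>M. (\<forall>S. finite S \<and> S \<subseteq> X \<longrightarrow> (\<Sum>i\<in>S. (cmod (F m i - f i))\<^sup>2) \<le> e\<^sup>2)" if e: "e > 0" for e
 proof -
  obtain M where M: "\<forall>m\<ge>M. \<forall>n\<ge>M. hnorm (ell2 X) (\<lambda>i. F m i - F n i) < e" using C' e by blast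
  have "(\<Sum>i\<in>S. (cmod (F m i - f i))\<^sup>2) \<le> e\<^sup>2" if m: "m \<ge> M" and S: "finite S" "S \<subseteq> X" for m S
  proof (rule LIMSEQ_le_const2)
   show "(\<lambda>n. \<Sum>i\<in>S. (cmod (F m i - F n i))\<^sup>2) \<longlonglongrightarrow> (\<Sum>i\<in>S. (cmod (F m i - f i))\<^sup>2)"
    by (intro tendsto_intros f)
   have "(\<Sum>i\<in>S. (cmod (F m i - F n i))\<^sup>2) \<le> e\<^sup>2" if n: "n \<ge> M" for n
   proof -
    have "(\<Sum>i\<in>S. (cmod (F m i - F n i))\<^sup>2) \<le> (hnorm (ell2 X) (\<lambda>i. F m i - F n i))\<^sup>2"
     using ell2_sum_le[OF D S] .
    also have "\<dots> \<le> e\<^sup>2"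
     using M m n by (intro power_mono) (auto intro: less_imp_le simp: ell2_norm[OF D] infsum_nonneg)
    finally show ?thesis .
   qed
   then show "\<exists>N. \<forall>n\<ge>N. (\<Sum>i\<in>S. (cmod (F m i - F n i))\<^sup>2) \<le> e\<^sup>2" by blast
  qed
  then show ?thesis by blast
 qed
 have Df: "(\<lambda>i. F m i - f i) \<in> carrier (ell2 X) \<and> hnorm (ell2 X) (\<lambda>i. F m i - f i) \<le> e"
  if "\<forall>S. finite S \<and> S \<subseteq> X \<longrightarrow> (\<Sum>i\<in>S. (cmod (F m i - f i))\<^sup>2) \<le> e\<^sup>2" "e > 0" for m e
 proof
  have sm: "(\<lambda>i. (cmod (F m i - f i))\<^sup>2) summable_on X"
   by (rule nonneg_bdd_above_summable_on) (use that in \<open>auto intro!: bdd_aboveI[of _ "e\<^sup>2"]\<close>)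
  then show c: "(\<lambda>i. F m i - f i) \<in> carrier (ell2 X)" using Fc f0 by simp
  have "(\<Sum>\<^sub>\<infinity>i\<in>X. (cmod (F m i - f i))\<^sup>2) \<le> e\<^sup>2"
   by (rule infsum_le_finite_sums[OF sm]) (use that in auto)
  then show "hnorm (ell2 X) (\<lambda>i. F m i - f i) \<le> e"
   unfolding ell2_norm[OF c] using that(2) by (simp add: real_le_lsqrt)
 qed
 obtain M1 where "\<forall>S. finite S \<and> S \<subseteq> X \<longrightarrow> (\<Sum>i\<in>S. (cmod (F M1 i - f i))\<^sup>2) \<le> 1\<^sup>2"
  using tail[of 1] by auto
 then have "(\<lambda>i. F M1 i - f i) \<in> carrier (ell2 X)" using Df[of M1 1] by simp
 then have "(\<lambda>i. F M1 i - (F M1 i - f i)) \<in> carrier (ell2 X)" using Fc ell2_minus_closed by blast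
 then have fc: "f \<in> carrier (ell2 X)" by simp
 have "norm_tendsto (ell2 X) (hnorm (ell2 X)) F f"
  unfolding norm_tendsto_def
 proof (rule LIMSEQ_I)
  fix e :: real assume e: "e > 0"
  then obtain M where M: "\<forall>m\<ge>M. (\<forall>S. finite S \<and> S \<subseteq> X \<longrightarrow> (\<Sum>i\<in>S. (cmod (F m i - f i))\<^sup>2) \<le> (e/2)\<^sup>2)"
   using tail[of "e/2"] by auto
  have "hnorm (ell2 X) (F m \<ominus>\<^bsub>ell2 X\<^esub> f) \<le> e / 2" if "m \<ge> M" for m
   using Df[of m "e/2"] M that e ell2_minus[of "F m" X f] Fc fc by simp
  moreover have "0 \<le> hnorm (ell2 X) (F m \<ominus>\<^bsub>ell2 X\<^esub> f)" for m
   using ell2_norm[OF ell2_minus_closed, of "F m" X f] ell2_minus[of "F m" X f] Fc fc by (simp add: infsum_nonneg)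
  ultimately show "\<exists>M. \<forall>m\<ge>M. norm (hnorm (ell2 X) (F m \<ominus>\<^bsub>ell2 X\<^esub> f) - 0) < e"
   using e by (intro exI) fastforce
 qed
 then show "\<exists>l\<in>carrier (ell2 X). norm_tendsto (ell2 X) (hnorm (ell2 X)) F l" using fc by blast
qed

theorem hilbert_space_ell2: "hilbert_space (ell2 X)"
proof (intro hilbert_space.intro hilbert_space_axioms.intro ell2_module ell2_complete)
 fix f g :: "'a \<Rightarrow> complex" assume f: "f \<in> carrier (ell2 X)" and g: "g \<in> carrier (ell2 X)"
 show "hinner (ell2 X) g f = cnj (hinner (ell2 X) f g)"
  by (simp add: mult.commute flip: infsum_cnj)
 show "hinner (ell2 X) (c \<odot>\<^bsub>ell2 X\<^esub> f) g = c * hinner (ell2 X) f g" for c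
  using f g by (simp add: mult.assoc infsum_cmult_right summable_sq_mult)
 fix h assume h: "h \<in> carrier (ell2 X)"
 show "hinner (ell2 X) (f \<oplus>\<^bsub>ell2 X\<^esub> g) h = hinner (ell2 X) f h + hinner (ell2 X) g h"
  using f g h by (simp add: distrib_right infsum_add summable_sq_mult)
next
 fix f :: "'a \<Rightarrow> complex" assume f: "f \<in> carrier (ell2 X)"
 show "0 \<le> Re (hinner (ell2 X) f f)" unfolding ell2_hinner_self[OF f] by (simp add: infsum_nonneg)
 assume "hinner (ell2 X) f f = 0"
 then have "(\<Sum>\<^sub>\<infinity>i\<in>X. (cmod (f i))\<^sup>2) \<le> 0" unfolding ell2_hinner_self[OF f] by simp
 then have "(cmod (f i))\<^sup>2 = 0" if "i \<in> X" for i
  by (rule nonneg_infsum_le_0D) (use f that in auto)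
 then show "f = \<zero>\<^bsub>ell2 X\<^esub>" using f by auto
qed

lemma ell2_restrict:
 assumes "f \<in> carrier (ell2 X)"
 shows "(\<lambda>i. if i \<in> Y then f i else 0) \<in> carrier (ell2 X)"
proof -
 have "(\<lambda>i. (cmod (if i \<in> Y then f i else 0))\<^sup>2) summable_on X"
  by (rule summable_on_comparison_test) (use assms in auto)
 then show ?thesis using assms by simp
qed

lemma ket_closed: "i \<in> X \<Longrightarrow> ket i \<in> carrier (ell2 X)"
proof -
 assume "i \<in> X"
 moreover have "(\<lambda>j. (cmod (ket i j))\<^sup>2) summable_on X \<longleftrightarrow> (\<lambda>j. (cmod (ket i j))\<^sup>2) summable_on {i}"
  using \<open>i \<in> X\<close> by (intro summable_on_cong_neutral) (auto simp: ket_def)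
 ultimately show ?thesis by (auto simp: ket_def)
qed

lemma hinner_ket:
 assumes "i \<in> X"
 shows "hinner (ell2 X) f (ket i) = f i"
proof -
 have "(\<Sum>\<^sub>\<infinity>j\<in>X. f j * cnj (ket i j)) = (\<Sum>\<^sub>\<infinity>j\<in>{i}. f j * cnj (ket i j))"
  by (rule infsum_cong_neutral) (use assms in \<open>auto simp: ket_def\<close>)
 then show ?thesis by (simp add: ket_def)
qed

lemma ell2_small_tail:
 assumes "f \<in> carrier (ell2 X)" "e > 0"
 obtains F where "finite F" "F \<subseteq> X"
  "\<And>Y. F \<inter> Y = {} \<Longrightarrow> hnorm (ell2 X) (\<lambda>i. if i \<in> Y then f i else 0) \<le> e"
proof -
 let ?g = "\<lambda>i. (cmod (f i))\<^sup>2"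
 have sm: "?g summable_on X" using assms by simp
 obtain F where F: "finite F" "F \<subseteq> X" "dist (sum ?g F) (infsum ?g X) \<le> e\<^sup>2"
  using infsum_finite_approximation[OF sm, of "e\<^sup>2"] assms by auto
 have "hnorm (ell2 X) (\<lambda>i. if i \<in> Y then f i else 0) \<le> e" if Y: "F \<inter> Y = {}" for Y
 proof -
  let ?h = "\<lambda>i. if i \<in> Y then f i else 0"
  have hc: "?h \<in> carrier (ell2 X)" by (rule ell2_restrict[OF assms(1)])
  have "(\<Sum>\<^sub>\<infinity>i\<in>X. (cmod (?h i))\<^sup>2) \<le> e\<^sup>2"
  proof (rule infsum_le_finite_sums)
   show "(\<lambda>i. (cmod (?h i))\<^sup>2) summable_on X" using hc by simp
   fix S assume S: "finite S" "S \<subseteq> X"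
   have "(\<Sum>i\<in>S. (cmod (?h i))\<^sup>2) = (\<Sum>i\<in>S \<inter> Y. ?g i)" unfolding sum.inter_restrict[OF S(1)] by (rule sum.cong) auto
   also have "\<dots> = (\<Sum>i\<in>F \<union> (S \<inter> Y). ?g i) - sum ?g F"
    using S F Y by (subst sum.union_disjoint) auto
   also have "(\<Sum>i\<in>F \<union> (S \<inter> Y). ?g i) \<le> infsum ?g X"
    using S F by (intro finite_sum_le_infsum[OF sm]) auto
   finally show "(\<Sum>i\<in>S. (cmod (?h i))\<^sup>2) \<le> e\<^sup>2" using F(3) by (simp add: dist_real_def)
  qed
  then show ?thesis unfolding ell2_norm[OF hc] using assms(2) by (simp add: real_le_lsqrt)
 qed
 then show thesis using that F by blast
qed

text \<open>Finitely supported functions are combinations of basis vectors and approximate all others.\<close>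

lemma ell2_closed_subspace_kets:
 assumes W: "submodule W complex_ring (ell2 X)" "norm_closed (ell2 X) (hnorm (ell2 X)) W"
  and kets: "\<And>i. i \<in> X \<Longrightarrow> ket i \<in> W"
 shows "W = carrier (ell2 X)"
proof
 interpret hilbert_space "ell2 X" by (rule hilbert_space_ell2)
 show "W \<subseteq> carrier (ell2 X)" using W(2) by (simp add: norm_closed_def)
 note sm = submoduleE[OF W(1)]
 show "carrier (ell2 X) \<subseteq> W"
 proof
  fix f assume f: "f \<in> carrier (ell2 X)"
  have fin: "(\<lambda>i. if i \<in> F then f i else 0) \<in> W" if "finite F" "F \<subseteq> X" for F
   using that
  proof (induction F)
   case empty
   obtain w where w: "w \<in> W" using sm(2) by blast
   then have "0 \<odot>\<^bsub>ell2 X\<^esub> w \<in> W" using sm(4)[of 0 w] by simp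
   then show ?case by simp
  next
   case (insert j F)
   then have "f j \<odot>\<^bsub>ell2 X\<^esub> ket j \<in> W" using sm(4) kets by simp
   then have "(f j \<odot>\<^bsub>ell2 X\<^esub> ket j) \<oplus>\<^bsub>ell2 X\<^esub> (\<lambda>i. if i \<in> F then f i else 0) \<in> W"
    using insert sm(5) by blast
   moreover have "(f j \<odot>\<^bsub>ell2 X\<^esub> ket j) \<oplus>\<^bsub>ell2 X\<^esub> (\<lambda>i. if i \<in> F then f i else 0)
     = (\<lambda>i. if i \<in> insert j F then f i else 0)"
    using insert by (auto simp: ket_def)
   ultimately show ?case by simp
  qed
  have "\<exists>F. finite F \<and> F \<subseteq> X \<and> hnorm (ell2 X) (\<lambda>i. if i \<in> - F then f i else 0) \<le> 1 / Suc n" for n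
   using ell2_small_tail[OF f, of "1 / Suc n"] by (metis Compl_disjoint divide_pos_pos of_nat_0_less_iff zero_less_Suc zero_less_one)
  then obtain F where F: "\<And>n. finite (F n)" "\<And>n. F n \<subseteq> X"
   "\<And>n. hnorm (ell2 X) (\<lambda>i. if i \<in> - F n then f i else 0) \<le> 1 / Suc n" by metis
  define g where "g n = (\<lambda>i. if i \<in> F n then f i else 0)" for n
  have g: "g n \<in> W" "g n \<in> carrier (ell2 X)" for n
   using fin[OF F(1,2)[of n]] ell2_restrict[OF f, of "F n"] unfolding g_def by - assumption+
  have "hnorm (ell2 X) (g n \<ominus>\<^bsub>ell2 X\<^esub> f) \<le> 1 / Suc n" for n
  proof -
   have "f \<ominus>\<^bsub>ell2 X\<^esub> g n = (\<lambda>i. if i \<in> - F n then f i else 0)"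
    unfolding ell2_minus[OF f g(2)] by (auto simp: g_def)
   then show ?thesis using F(3) hnorm_minus_commute[OF g(2) f] by simp
  qed
  then have "norm_tendsto (ell2 X) (hnorm (ell2 X)) g f"
   unfolding norm_tendsto_def by (intro tendsto_sandwich[OF _ _ tendsto_const LIMSEQ_inverse_real_of_nat]) (use hnorm_nonneg g f in \<open>auto simp: inverse_eq_divide simp del: ell2_sel\<close>)
  then show "f \<in> W" using W(2) g f unfolding norm_closed_def by blast
 qed
qed

section \<open>Scalar matrices acting on vectors\<close>

context hilbert_space
begin

lemma unit_split:
 assumes u: "u \<in> \<H>" "ip u u = 1" and v: "v \<in> \<H>" "w \<in> \<H>"
 shows "ip (v \<ominus> ip v u \<odot> u) (w \<ominus> ip w u \<odot> u) = ip v w - ip v u * cnj (ip w u)"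
  and "(nrm (v \<ominus> ip v u \<odot> u))\<^sup>2 = (nrm v)\<^sup>2 - (cmod (ip v u))\<^sup>2"
proof -
 have 1: "ip (v \<ominus> ip v u \<odot> u) (w \<ominus> ip w u \<odot> u) = ip v w - ip v u * cnj (ip w u)"
  if v: "v \<in> \<H>" "w \<in> \<H>" for v w
  using u v hinner_cnj[of w u]
  by (simp add: hinner_minus_left hinner_minus_right hinner_smult_left hinner_smult_right algebra_simps)
 from this[OF v] show "ip (v \<ominus> ip v u \<odot> u) (w \<ominus> ip w u \<odot> u) = ip v w - ip v u * cnj (ip w u)" .
 show "(nrm (v \<ominus> ip v u \<odot> u))\<^sup>2 = (nrm v)\<^sup>2 - (cmod (ip v u))\<^sup>2"
  using arg_cong[OF 1[OF v(1) v(1)], of Re] u v by (simp add: hnorm_power2 cmod_power2) (simp add: power2_eq_square)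
qed

text \<open>A bound for a scalar matrix persists for its ampliation to a Hilbert space. Split all vectors into the
component along one of the \<open>x j\<close> and the part orthogonal to it. The components are scalars, to which
the bound applies; among the orthogonal parts one more of the \<open>x j\<close> is zero, so induction applies. The
two estimates are combined by the Cauchy--Schwarz inequality in the plane.\<close>

lemma matrix_bound_vectors:
 fixes C :: "'i \<Rightarrow> 'i \<Rightarrow> complex"
 assumes J: "finite J" and x: "\<And>j. j \<in> J \<Longrightarrow> x j \<in> \<H>" and y: "\<And>j. j \<in> J \<Longrightarrow> y j \<in> \<H>"
  and \<epsilon>: "\<epsilon> \<ge> 0"
  and bound: "\<And>\<xi> \<eta>. cmod (\<Sum>i\<in>J. \<Sum>j\<in>J. C i j * \<xi> j * cnj (\<eta> i))
   \<le> \<epsilon> * (sqrt (\<Sum>j\<in>J. (cmod (\<xi> j))\<^sup>2) * sqrt (\<Sum>i\<in>J. (cmod (\<eta> i))\<^sup>2))"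
 shows "cmod (\<Sum>i\<in>J. \<Sum>j\<in>J. C i j * ip (x j) (y i))
   \<le> \<epsilon> * (sqrt (\<Sum>j\<in>J. (nrm (x j))\<^sup>2) * sqrt (\<Sum>i\<in>J. (nrm (y i))\<^sup>2))"
  (is "?P x y")
proof -
 \<comment> \<open>Induction on a set \<open>K\<close> that contains the indices with \<open>x j \<noteq> 0\<close>.\<close>
 have "?P x y" if "finite K" "\<And>j. j \<in> J \<Longrightarrow> j \<notin> K \<Longrightarrow> x j = \<zero>"
   "\<And>j. j \<in> J \<Longrightarrow> x j \<in> \<H>" "\<And>j. j \<in> J \<Longrightarrow> y j \<in> \<H>" for K x y
  using that
 proof (induction K arbitrary: x y)
  case empty
  have "(\<Sum>i\<in>J. \<Sum>j\<in>J. C i j * ip (x j) (y i)) = 0"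
   by (intro sum.neutral ballI) (use empty in \<open>simp add: hinner_zero_left\<close>)
  then show ?case using \<epsilon> by (simp add: sum_nonneg)
 next
  case (insert k K)
  show ?case
  proof (cases "k \<in> J \<and> x k \<noteq> \<zero>")
   case False
   then show ?thesis using insert.prems by (intro insert.IH) auto
  next
   case True
   note x = insert.prems(2) and y = insert.prems(3)
   define u where "u = complex_of_real (1 / nrm (x k)) \<odot> x k"
   have n: "nrm (x k) \<noteq> 0" using True hnorm_eq_0 x by blast
   have u: "u \<in> \<H>" "ip u u = 1" using True x n hinner_self[of "x k"]
    by (simp_all add: u_def hinner_smult_left hinner_smult_right power2_eq_square)
   define p where "p v = v \<ominus> ip v u \<odot> u" for v
   have pc: "p v \<in> \<H>" if "v \<in> \<H>" for v using that u by (simp add: p_def)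
   note split = unit_split[OF u, folded p_def]
   have xk: "complex_of_real (nrm (x k)) \<odot> u = x k"
    using True x n by (simp add: u_def complex_smult_distr(4) flip: complex_smult_distr(3))
   have "ip (x k) u = complex_of_real (nrm (x k))"
    using hinner_smult_left[OF u(1) u(1), of "complex_of_real (nrm (x k))"] u by (simp add: xk)
   then have "p (x k) = \<zero>" using True x minus_eq_zero_iff by (simp add: p_def xk)
   moreover have "p \<zero> = \<zero>" using u by (simp add: p_def hinner_zero_left complex_smult_distr(5) minus_eq_zero_iff)
   ultimately have "p (x j) = \<zero>" if "j \<in> J" "j \<notin> K" for j
    using insert.prems(1)[of j] that by (cases "j = k") auto
   then have IH: "cmod (\<Sum>i\<in>J. \<Sum>j\<in>J. C i j * ip (p (x j)) (p (y i)))
     \<le> \<epsilon> * (sqrt (\<Sum>j\<in>J. (nrm (p (x j)))\<^sup>2) * sqrt (\<Sum>i\<in>J. (nrm (p (y i)))\<^sup>2))"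
    using insert.prems pc by (intro insert.IH) auto
   let ?s = "\<lambda>z. \<Sum>j\<in>J. (cmod (ip (z j) u))\<^sup>2" and ?t = "\<lambda>z. \<Sum>j\<in>J. (nrm (p (z j)))\<^sup>2"
   have sum: "(\<Sum>j\<in>J. (nrm (z j))\<^sup>2) = ?s z + ?t z" if "\<And>j. j \<in> J \<Longrightarrow> z j \<in> \<H>" for z
    using split(2)[OF that that] by (simp flip: sum.distrib)
   have "(\<Sum>i\<in>J. \<Sum>j\<in>J. C i j * ip (x j) (y i)) = (\<Sum>i\<in>J. \<Sum>j\<in>J. C i j * ip (x j) u * cnj (ip (y i) u))
     + (\<Sum>i\<in>J. \<Sum>j\<in>J. C i j * ip (p (x j)) (p (y i)))"
    unfolding sum.distrib[symmetric] by (intro sum.cong refl) (simp add: split(1)[OF x y] algebra_simps)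
   also have "cmod \<dots> \<le> \<epsilon> * (sqrt (?s x) * sqrt (?s y)) + \<epsilon> * (sqrt (?t x) * sqrt (?t y))"
    using bound[of "\<lambda>j. ip (x j) u" "\<lambda>j. ip (y j) u"] IH by (intro order_trans[OF norm_triangle_ineq] add_mono)
   also have "\<dots> = \<epsilon> * (sqrt (?s x) * sqrt (?s y) + sqrt (?t x) * sqrt (?t y))" by (simp add: distrib_left)
   also have "\<dots> \<le> \<epsilon> * (sqrt (?s x + ?t x) * sqrt (?s y + ?t y))"
   proof (intro mult_left_mono \<epsilon>)
    have cs: "a * b + c * d \<le> sqrt (a\<^sup>2 + c\<^sup>2) * sqrt (b\<^sup>2 + d\<^sup>2)" for a b c d :: real
     unfolding real_sqrt_mult[symmetric]
     using zero_le_power2[of "a * d - b * c"] by (intro real_le_rsqrt) (simp add: power2_eq_square algebra_simps)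
    show "sqrt (?s x) * sqrt (?s y) + sqrt (?t x) * sqrt (?t y) \<le> sqrt (?s x + ?t x) * sqrt (?s y + ?t y)"
     using cs[of "sqrt (?s x)" "sqrt (?s y)" "sqrt (?t x)" "sqrt (?t y)"] by (simp add: sum_nonneg)
   qed
   finally show ?thesis using sum[of x] sum[of y] x y by simp
  qed
 qed
 from this[OF J] show ?thesis using x y by blast
qed

end

section \<open>Cuntz--Krieger families on Hilbert spaces\<close>

text \<open>A Cuntz--Krieger family given by operators \<open>S \<kappa>\<close> with adjoints \<open>S' \<kappa>\<close>. The last relation is stated between
matrix coefficients, so that no sums of operators occur.\<close>

locale ck_ops = rf_kgraph \<Lambda> + hilbert_space H
 for \<Lambda> :: "('e, 'k::finite) kgraph" and H :: "('h, 'n) hilbert_scheme" (structure) +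
 fixes S S' :: "'e \<Rightarrow> 'h \<Rightarrow> 'h"
 assumes S_closed: "\<lbrakk>\<kappa> \<in> mor \<Lambda>; h \<in> carrier H\<rbrakk> \<Longrightarrow> S \<kappa> h \<in> carrier H"
  and S'_closed: "\<lbrakk>\<kappa> \<in> mor \<Lambda>; h \<in> carrier H\<rbrakk> \<Longrightarrow> S' \<kappa> h \<in> carrier H"
  and S_adj: "\<lbrakk>\<kappa> \<in> mor \<Lambda>; h \<in> carrier H; k \<in> carrier H\<rbrakk> \<Longrightarrow> hinner H (S \<kappa> h) k = hinner H h (S' \<kappa> k)"
  and S_vert: "\<lbrakk>v \<in> verts \<Lambda>; h \<in> carrier H\<rbrakk> \<Longrightarrow> S' v h = S v h"
  and S_vert_orth: "\<lbrakk>v \<in> verts \<Lambda>; w \<in> verts \<Lambda>; v \<noteq> w; h \<in> carrier H\<rbrakk> \<Longrightarrow> S v (S w h) = \<zero>\<^bsub>H\<^esub>"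
  and S_mult: "\<lbrakk>\<mu> \<in> mor \<Lambda>; \<nu> \<in> mor \<Lambda>; src \<Lambda> \<mu> = rng \<Lambda> \<nu>; h \<in> carrier H\<rbrakk> \<Longrightarrow> S \<mu> (S \<nu> h) = S (cmp \<Lambda> \<mu> \<nu>) h"
  and S_iso: "\<lbrakk>\<kappa> \<in> mor \<Lambda>; h \<in> carrier H\<rbrakk> \<Longrightarrow> S' \<kappa> (S \<kappa> h) = S (src \<Lambda> \<kappa>) h"
  and S_CK: "\<lbrakk>v \<in> verts \<Lambda>; h \<in> carrier H; k \<in> carrier H\<rbrakk> \<Longrightarrow>
   hinner H (S v h) k = (\<Sum>\<kappa>\<in>{\<kappa> \<in> mor \<Lambda>. rng \<Lambda> \<kappa> = v \<and> deg \<Lambda> \<kappa> = n}. hinner H (S' \<kappa> h) (S' \<kappa> k))"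
begin

lemma S'_adj: "\<lbrakk>\<kappa> \<in> M; h \<in> \<H>; k \<in> \<H>\<rbrakk> \<Longrightarrow> ip (S' \<kappa> h) k = ip h (S \<kappa> k)"
 using S_adj hinner_cnj[of k "S' \<kappa> h"] hinner_cnj[of "S \<kappa> k" h] by (simp add: S_closed S'_closed)

lemma S_zero: "\<kappa> \<in> M \<Longrightarrow> S \<kappa> \<zero> = \<zero>" "\<kappa> \<in> M \<Longrightarrow> S' \<kappa> \<zero> = \<zero>"
 by (rule hinner_eqI; simp add: S_closed S'_closed S_adj S'_adj hinner_zero_left)+

lemma S_src: "\<lbrakk>\<kappa> \<in> M; h \<in> \<H>\<rbrakk> \<Longrightarrow> S \<kappa> (S (s \<kappa>) h) = S \<kappa> h"
 "\<lbrakk>\<kappa> \<in> M; h \<in> \<H>\<rbrakk> \<Longrightarrow> S (r \<kappa>) (S \<kappa> h) = S \<kappa> h"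
 using S_mult src_verts rng_verts by (auto simp: vertsD cmp_vert)

lemma S'_cmp:
 assumes "\<mu> \<in> M" "\<nu> \<in> M" "s \<mu> = r \<nu>" "h \<in> \<H>"
 shows "S' (\<mu> \<cdot> \<nu>) h = S' \<nu> (S' \<mu> h)"
 by (rule hinner_eqI) (use assms S_mult in \<open>simp_all add: S_closed S'_closed S'_adj cmp_closed\<close>)

lemma S'_rng: "\<lbrakk>\<kappa> \<in> M; h \<in> \<H>\<rbrakk> \<Longrightarrow> S' \<kappa> (S (r \<kappa>) h) = S' \<kappa> h"
 "\<lbrakk>\<kappa> \<in> M; h \<in> \<H>\<rbrakk> \<Longrightarrow> S (s \<kappa>) (S' \<kappa> h) = S' \<kappa> h"
proof -
 assume a: "\<kappa> \<in> M" "h \<in> \<H>"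
 note v = rng_verts[OF a(1)] src_verts[OF a(1)]
 show "S' \<kappa> (S (r \<kappa>) h) = S' \<kappa> h"
  using S'_cmp[of "r \<kappa>" \<kappa> h] a vertsD[OF v(1)] cmp_vert(1)[OF v(1) a(1) refl] S_vert[OF v(1) a(2)] by simp
 show "S (s \<kappa>) (S' \<kappa> h) = S' \<kappa> h"
  using S'_cmp[of \<kappa> "s \<kappa>" h] a vertsD[OF v(2)] cmp_vert(2)[OF v(2) a(1) refl] S_vert[OF v(2) S'_closed[OF a]] by simp
qed

lemma S_inner: "\<lbrakk>\<kappa> \<in> M; h \<in> \<H>; k \<in> \<H>\<rbrakk> \<Longrightarrow> ip (S \<kappa> h) (S \<kappa> k) = ip (S (s \<kappa>) h) k"
 using S'_adj[of \<kappa> "S \<kappa> h" k] by (simp add: S_closed S_iso)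

lemma S_vert_inner: "\<lbrakk>v \<in> V; h \<in> \<H>; k \<in> \<H>\<rbrakk> \<Longrightarrow> ip (S v h) (S v k) = ip (S v h) k"
 using S_inner by (simp add: vertsD)

lemma S_vert_idem: "\<lbrakk>v \<in> V; h \<in> \<H>\<rbrakk> \<Longrightarrow> S v (S v h) = S v h"
 using S_src(1)[of v h] by (simp add: vertsD)

lemma S_vert_norm_le: "\<lbrakk>v \<in> V; h \<in> \<H>\<rbrakk> \<Longrightarrow> nrm (S v h) \<le> nrm h"
proof -
 assume a: "v \<in> V" "h \<in> \<H>"
 have c: "S v h \<in> \<H>" using a S_closed vertsD by blast
 have "(nrm (S v h))\<^sup>2 = Re (ip (S v h) h)" using a S_vert_inner by (simp add: hnorm_power2 c)
 also have "\<dots> \<le> nrm (S v h) * nrm h"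
  using Cauchy_Schwarz[OF c a(2)] complex_Re_le_cmod[of "ip (S v h) h"] by linarith
 finally show ?thesis using hnorm_nonneg[OF c] hnorm_nonneg[OF a(2)]
  by (cases "nrm (S v h) = 0") (auto simp: power2_eq_square)
qed

lemma S_norm: "\<lbrakk>\<kappa> \<in> M; h \<in> \<H>\<rbrakk> \<Longrightarrow> nrm (S \<kappa> h) = nrm (S (s \<kappa>) h)"
 using S_inner S_vert_inner src_verts by (simp add: hnorm_def)

lemma CK: "\<lbrakk>v \<in> V; h \<in> \<H>; k \<in> \<H>\<rbrakk> \<Longrightarrow>
  ip (S v h) k = (\<Sum>\<kappa>\<in>outp v n. ip (S' \<kappa> h) (S' \<kappa> k))"
 unfolding outp_def by (rule S_CK)

lemma CK_norm_sum: "\<lbrakk>v \<in> V; h \<in> \<H>\<rbrakk> \<Longrightarrow> (\<Sum>\<kappa>\<in>outp v n. (nrm (S' \<kappa> h))\<^sup>2) = (nrm (S v h))\<^sup>2"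
proof -
 assume a: "v \<in> V" "h \<in> \<H>"
 have "(\<Sum>\<kappa>\<in>outp v n. (nrm (S' \<kappa> h))\<^sup>2) = (\<Sum>\<kappa>\<in>outp v n. Re (ip (S' \<kappa> h) (S' \<kappa> h)))"
  using a by (intro sum.cong) (auto simp: outp_def hnorm_power2 S'_closed)
 also have "\<dots> = Re (ip (S v h) h)" using CK[OF a(1) a(2) a(2), of n] by simp
 also have "\<dots> = (nrm (S v h))\<^sup>2" using a S_closed vertsD S_vert_inner by (simp add: hnorm_power2)
 finally show ?thesis .
qed

lemma S'_S_same_degree:
 assumes "\<mu> \<in> M" "\<nu> \<in> M" "d \<mu> = d \<nu>" "\<mu> \<noteq> \<nu>" "h \<in> \<H>"
 shows "S' \<mu> (S \<nu> h) = \<zero>"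
proof (cases "r \<mu> = r \<nu>")
 case False
 let ?k = "S \<nu> h"
 have k: "?k \<in> \<H>" using assms S_closed by blast
 have "S' \<mu> ?k = S' \<mu> (S (r \<mu>) (S (r \<nu>) ?k))" using S'_rng(1)[OF assms(1) k] S_src(2)[OF assms(2,5)] by simp
 also have "S (r \<mu>) (S (r \<nu>) ?k) = \<zero>" using False k rng_verts assms by (intro S_vert_orth) auto
 finally show ?thesis using S_zero assms by simp
next
 case True
 let ?k = "S \<nu> h" and ?v = "r \<nu>"
 have v: "?v \<in> V" using rng_verts assms by blast
 have k: "?k \<in> \<H>" using assms S_closed by blast
 have n: "\<nu> \<in> outp ?v (d \<nu>)" and m: "\<mu> \<in> outp ?v (d \<nu>) - {\<nu>}" using assms True by (auto simp: outp_def)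
 have "(\<Sum>\<kappa>\<in>outp ?v (d \<nu>). (nrm (S' \<kappa> ?k))\<^sup>2) = (nrm ?k)\<^sup>2"
  using CK_norm_sum[OF v k, of "d \<nu>"] S_src(2)[OF assms(2,5)] by simp
 moreover have "(\<Sum>\<kappa>\<in>outp ?v (d \<nu>). (nrm (S' \<kappa> ?k))\<^sup>2)
   = (nrm (S' \<nu> ?k))\<^sup>2 + (\<Sum>\<kappa>\<in>outp ?v (d \<nu>) - {\<nu>}. (nrm (S' \<kappa> ?k))\<^sup>2)"
  using outp(1)[OF v] n by (simp add: sum.remove)
 moreover have "nrm (S' \<nu> ?k) = nrm ?k" using S_iso[OF assms(2,5)] S_norm[OF assms(2,5)] by simp
 ultimately have "(\<Sum>\<kappa>\<in>outp ?v (d \<nu>) - {\<nu>}. (nrm (S' \<kappa> ?k))\<^sup>2) = 0" by simp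
 then have "(nrm (S' \<mu> ?k))\<^sup>2 = 0" using outp(1)[OF v] m by (subst (asm) sum_nonneg_eq_0_iff) auto
 then show ?thesis using hnorm_eq_0 S'_closed[OF assms(1) k] by simp
qed

lemma S'_S_prefix:
 assumes "\<alpha> \<in> M" "\<nu> \<in> M" "d \<alpha> \<le> d \<nu>" "h \<in> \<H>"
 shows "S' \<alpha> (S \<nu> h) = (if pfx (d \<alpha>) \<nu> = \<alpha> then S (sfx (d \<alpha>) \<nu>) h else \<zero>)"
proof -
 note p = pfx_sfx[OF assms(2,3)]
 have "S \<nu> h = S (pfx (d \<alpha>) \<nu>) (S (sfx (d \<alpha>) \<nu>) h)" using S_mult[OF p(1,2,5) assms(4)] p(6) by simp
 then show ?thesis
  using S'_S_same_degree[OF assms(1) p(1), of "S (sfx (d \<alpha>) \<nu>) h"] p S_iso S_src(2)[OF p(2) assms(4)] S_closed[OF p(2) assms(4)] by auto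
qed

lemma S_S'_prefix:
 assumes "\<alpha> \<in> M" "\<nu> \<in> M" "d \<alpha> \<le> d \<nu>" "h \<in> \<H>"
 shows "S' \<nu> (S \<alpha> h) = (if pfx (d \<alpha>) \<nu> = \<alpha> then S' (sfx (d \<alpha>) \<nu>) h else \<zero>)"
proof (rule hinner_eqI)
 note p = pfx_sfx[OF assms(2,3)]
 show "S' \<nu> (S \<alpha> h) \<in> \<H>" using assms S_closed S'_closed by blast
 show "(if pfx (d \<alpha>) \<nu> = \<alpha> then S' (sfx (d \<alpha>) \<nu>) h else \<zero>) \<in> \<H>" using S'_closed p assms by simp
 fix k assume k: "k \<in> \<H>"
 have "ip (S' \<nu> (S \<alpha> h)) k = ip h (S' \<alpha> (S \<nu> k))" using S'_adj S_adj assms k S_closed by simp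
 then show "ip (S' \<nu> (S \<alpha> h)) k = ip (if pfx (d \<alpha>) \<nu> = \<alpha> then S' (sfx (d \<alpha>) \<nu>) h else \<zero>) k"
  using S'_S_prefix S'_adj[OF p(2) assms(4) k] assms k by (simp add: hinner_zero_left hinner_zero_right)
qed

lemma incompatible_orth:
 assumes "\<mu> \<in> M" "\<nu> \<in> M" "\<not> compat \<mu> \<nu>" "h \<in> \<H>" "k \<in> \<H>"
 shows "ip (S \<mu> h) (S \<nu> k) = 0"
proof -
 obtain n where n: "n \<le> d \<mu>" "n \<le> d \<nu>" "pfx n \<mu> \<noteq> pfx n \<nu>" using assms(3) by (auto simp: compat_def)
 note p = pfx_sfx[OF assms(1) n(1)] and q = pfx_sfx[OF assms(2) n(2)]
 have "S' (pfx n \<mu>) (S \<nu> k) = \<zero>" using S'_S_prefix[OF p(1) assms(2) _ assms(5)] p n by auto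
 moreover have "S \<mu> h = S (pfx n \<mu>) (S (sfx n \<mu>) h)" using S_mult[OF p(1,2,5) assms(4)] p(6) by simp
 ultimately show ?thesis
  using S_adj[OF p(1) S_closed[OF p(2) assms(4)] S_closed[OF assms(2,5)]] S_closed[OF p(2) assms(4)]
  by (simp add: hinner_zero_right)
qed

lemma expand:
 assumes "\<alpha> \<in> M" "\<beta> \<in> M" "s \<alpha> = s \<beta>" "h \<in> \<H>" "k \<in> \<H>"
 shows "ip (S' \<alpha> h) (S' \<beta> k) = (\<Sum>\<tau>\<in>outp (s \<alpha>) n. ip (S' (\<alpha> \<cdot> \<tau>) h) (S' (\<beta> \<cdot> \<tau>) k))"
proof -
 have "ip (S' \<alpha> h) (S' \<beta> k) = ip (S (s \<alpha>) (S' \<alpha> h)) (S' \<beta> k)"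
  unfolding S'_rng(2)[OF assms(1,4)] ..
 also have "\<dots> = (\<Sum>\<tau>\<in>outp (s \<alpha>) n. ip (S' \<tau> (S' \<alpha> h)) (S' \<tau> (S' \<beta> k)))"
  using assms src_verts S'_closed by (intro CK) auto
 also have "\<dots> = (\<Sum>\<tau>\<in>outp (s \<alpha>) n. ip (S' (\<alpha> \<cdot> \<tau>) h) (S' (\<beta> \<cdot> \<tau>) k))"
  using assms by (intro sum.cong) (auto simp: outp_def S'_cmp)
 finally show ?thesis .
qed

end

context rf_kgraph
begin

text \<open>The minimal common extensions of \<open>\<alpha>\<close> and \<open>\<beta>\<close>, padded to the degree \<open>d \<alpha> + d \<beta>\<close>.\<close>

definition common_ext :: "'e \<Rightarrow> 'e \<Rightarrow> 'e set" where
 "common_ext \<alpha> \<beta> = {\<kappa> \<in> outp (r \<alpha>) (d \<alpha> + d \<beta>). pfx (d \<alpha>) \<kappa> = \<alpha> \<and> pfx (d \<beta>) \<kappa> = \<beta>}"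

lemma common_extD:
 assumes "\<kappa> \<in> common_ext \<alpha> \<beta>"
 shows "sfx (d \<alpha>) \<kappa> \<in> M" "s \<alpha> = r (sfx (d \<alpha>) \<kappa>)" "s (sfx (d \<alpha>) \<kappa>) = s \<kappa>"
  "sfx (d \<beta>) \<kappa> \<in> M" "s \<beta> = r (sfx (d \<beta>) \<kappa>)" "s (sfx (d \<beta>) \<kappa>) = s \<kappa>"
 using pfx_sfx[of \<kappa> "d \<alpha>"] pfx_sfx[of \<kappa> "d \<beta>"] assms by (auto simp: common_ext_def outp_def)

definition common_ext_list :: "'e \<Rightarrow> 'e \<Rightarrow> 'e list" where
 "common_ext_list \<alpha> \<beta> = (SOME xs. distinct xs \<and> set xs = common_ext \<alpha> \<beta>)"

lemma common_ext_list:
 assumes "\<alpha> \<in> M"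
 shows "distinct (common_ext_list \<alpha> \<beta>)" "set (common_ext_list \<alpha> \<beta>) = common_ext \<alpha> \<beta>"
 using someI_ex[of "\<lambda>xs. distinct xs \<and> set xs = common_ext \<alpha> \<beta>"] finite_distinct_list[of "common_ext \<alpha> \<beta>"] outp(1)[OF rng_verts[OF assms]]
 unfolding common_ext_list_def common_ext_def by fastforce+

text \<open>A list of triples \<open>(c, \<alpha>, \<beta>)\<close> stands for the element \<open>\<Sum> c s\<^sub>\<alpha> s\<^sub>\<beta>\<^sup>*\<close>.\<close>

definition valid_terms :: "(complex \<times> 'e \<times> 'e) list \<Rightarrow> bool" where
 "valid_terms L \<longleftrightarrow> (\<forall>(c, \<alpha>, \<beta>)\<in>set L. \<alpha> \<in> M \<and> \<beta> \<in> M \<and> s \<alpha> = s \<beta>)"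

definition mult_terms :: "(complex \<times> 'e \<times> 'e) list \<Rightarrow> (complex \<times> 'e \<times> 'e) list \<Rightarrow> (complex \<times> 'e \<times> 'e) list" where
 "mult_terms L L' = concat (map (\<lambda>(c, \<alpha>, \<beta>). concat (map (\<lambda>(c', \<alpha>', \<beta>').
   map (\<lambda>\<kappa>. (c * c', \<alpha> \<cdot> sfx (d \<beta>) \<kappa>, \<beta>' \<cdot> sfx (d \<alpha>') \<kappa>)) (common_ext_list \<alpha>' \<beta>)) L')) L)"

lemma valid_terms_mult: "\<lbrakk>valid_terms L; valid_terms L'\<rbrakk> \<Longrightarrow> valid_terms (mult_terms L L')"
 unfolding valid_terms_def mult_terms_def
proof clarsimp
 fix c c' \<alpha> \<beta> \<alpha>' \<beta>' \<kappa>
 assume L: "\<forall>x\<in>set L. case x of (c, \<alpha>, \<beta>) \<Rightarrow> \<alpha> \<in> M \<and> \<beta> \<in> M \<and> s \<alpha> = s \<beta>"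
  "\<forall>x\<in>set L'. case x of (c, \<alpha>, \<beta>) \<Rightarrow> \<alpha> \<in> M \<and> \<beta> \<in> M \<and> s \<alpha> = s \<beta>"
  and x: "(c, \<alpha>, \<beta>) \<in> set L" "(c', \<alpha>', \<beta>') \<in> set L'" "\<kappa> \<in> set (common_ext_list \<alpha>' \<beta>)"
 have v: "\<alpha> \<in> M" "s \<alpha> = s \<beta>" "\<alpha>' \<in> M" "\<beta>' \<in> M" "s \<alpha>' = s \<beta>'" using L x by auto
 show "\<alpha> \<cdot> sfx (d \<beta>) \<kappa> \<in> M \<and> \<beta>' \<cdot> sfx (d \<alpha>') \<kappa> \<in> M \<and> s (\<alpha> \<cdot> sfx (d \<beta>) \<kappa>) = s (\<beta>' \<cdot> sfx (d \<alpha>') \<kappa>)"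
  using common_extD x(3) common_ext_list(2) v by (simp add: cmp_closed src_cmp)
qed

end

context ck_ops
begin

text \<open>The sesquilinear form \<open>\<langle>a h, k\<rangle>\<close> of the combination \<open>a = \<Sum> c s\<^sub>\<alpha> s\<^sub>\<beta>\<^sup>*\<close> listed in \<open>L\<close>.\<close>

definition form :: "(complex \<times> 'e \<times> 'e) list \<Rightarrow> 'h \<Rightarrow> 'h \<Rightarrow> complex" where
 "form L h k = (\<Sum>(c, \<alpha>, \<beta>)\<leftarrow>L. c * ip (S' \<beta> h) (S' \<alpha> k))"

lemma form_star:
 assumes "valid_terms L" "h \<in> \<H>" "k \<in> \<H>"
 shows "form (map (\<lambda>(c, \<alpha>, \<beta>). (cnj c, \<beta>, \<alpha>)) L) h k = cnj (form L k h)"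
 using assms(1)
proof (induction L)
 case (Cons x L)
 obtain c \<alpha> \<beta> where x: "x = (c, \<alpha>, \<beta>)" by (cases x)
 have v: "\<alpha> \<in> M" "\<beta> \<in> M" "valid_terms L" using Cons.prems x by (auto simp: valid_terms_def)
 then show ?case
  using Cons.IH hinner_cnj[of "S' \<beta> k" "S' \<alpha> h"] S'_closed assms(2,3) x by (simp add: form_def)
qed (simp add: form_def)

text \<open>The expansion of \<open>s\<^sub>\<beta>\<^sup>* s\<^sub>\<alpha>\<close> as a combination of products \<open>s\<^sub>\<sigma> s\<^sub>\<tau>\<^sup>*\<close>. Inserting the Cuntz--Krieger relation at the
degree \<open>d \<alpha> + d \<beta>\<close> leaves exactly the paths that extend both \<open>\<alpha>\<close> and \<open>\<beta>\<close>.\<close>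

lemma product_formula:
 assumes "\<alpha> \<in> M" "\<beta> \<in> M" "h \<in> \<H>" "k \<in> \<H>"
 shows "ip (S \<alpha> h) (S \<beta> k) = (\<Sum>\<kappa>\<in>common_ext \<alpha> \<beta>. ip (S' (sfx (d \<alpha>) \<kappa>) h) (S' (sfx (d \<beta>) \<kappa>) k))"
proof -
 let ?v = "r \<alpha>" and ?n = "d \<alpha> + d \<beta>"
 have v: "?v \<in> V" using assms rng_verts by blast
 have c: "S \<alpha> h \<in> \<H>" "S \<beta> k \<in> \<H>" using assms S_closed by auto
 have "ip (S \<alpha> h) (S \<beta> k) = (\<Sum>\<kappa>\<in>outp ?v ?n. ip (S' \<kappa> (S \<alpha> h)) (S' \<kappa> (S \<beta> k)))"
  using CK[OF v c, of ?n] S_src(2)[OF assms(1,3)] by simp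
 also have "\<dots> = (\<Sum>\<kappa>\<in>common_ext \<alpha> \<beta>. ip (S' (sfx (d \<alpha>) \<kappa>) h) (S' (sfx (d \<beta>) \<kappa>) k))"
 proof (rule sum.mono_neutral_cong_right)
  show "finite (outp ?v ?n)" by (rule outp(1)[OF v])
  have S'k: "S' \<kappa> (S \<alpha> h) = (if pfx (d \<alpha>) \<kappa> = \<alpha> then S' (sfx (d \<alpha>) \<kappa>) h else \<zero>)"
   "S' \<kappa> (S \<beta> k) = (if pfx (d \<beta>) \<kappa> = \<beta> then S' (sfx (d \<beta>) \<kappa>) k else \<zero>)" if "\<kappa> \<in> outp ?v ?n" for \<kappa>
   using S_S'_prefix[OF assms(1) _ _ assms(3), of \<kappa>] S_S'_prefix[OF assms(2) _ _ assms(4), of \<kappa>] that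
   by (auto simp: outp_def)
  show "\<forall>\<kappa>\<in>outp ?v ?n - common_ext \<alpha> \<beta>. ip (S' \<kappa> (S \<alpha> h)) (S' \<kappa> (S \<beta> k)) = 0"
  proof
   fix \<kappa> assume k': "\<kappa> \<in> outp ?v ?n - common_ext \<alpha> \<beta>"
   then have "S' \<kappa> (S \<alpha> h) = \<zero> \<or> S' \<kappa> (S \<beta> k) = \<zero>" using S'k by (auto simp: common_ext_def)
   moreover have "S' \<kappa> (S \<alpha> h) \<in> \<H>" "S' \<kappa> (S \<beta> k) \<in> \<H>" using k' c S'_closed by (auto simp: outp_def)
   ultimately show "ip (S' \<kappa> (S \<alpha> h)) (S' \<kappa> (S \<beta> k)) = 0" using hinner_zero_left hinner_zero_right by metis
  qed
  show "ip (S' \<kappa> (S \<alpha> h)) (S' \<kappa> (S \<beta> k)) = ip (S' (sfx (d \<alpha>) \<kappa>) h) (S' (sfx (d \<beta>) \<kappa>) k)" if "\<kappa> \<in> common_ext \<alpha> \<beta>" for \<kappa>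
   using S'k that by (auto simp: common_ext_def)
 qed (auto simp: common_ext_def)
 finally show ?thesis .
qed

lemma form_mult_terms:
 assumes "valid_terms L" "valid_terms L'" "h \<in> \<H>" "k \<in> \<H>"
 shows "form (mult_terms L L') h k = (\<Sum>(c, \<alpha>, \<beta>)\<leftarrow>L. c * form L' h (S \<beta> (S' \<alpha> k)))"
proof -
 have cc: "(\<Sum>x\<leftarrow>concat (map g xs). f x) = (\<Sum>y\<leftarrow>xs. \<Sum>x\<leftarrow>g y. f x)"
  for f :: "complex \<times> 'e \<times> 'e \<Rightarrow> complex" and g :: "complex \<times> 'e \<times> 'e \<Rightarrow> _" and xs
  by (induction xs) auto
 have one: "(\<Sum>\<kappa>\<leftarrow>common_ext_list \<alpha>' \<beta>. c * c' * ip (S' (\<beta>' \<cdot> sfx (d \<alpha>') \<kappa>) h) (S' (\<alpha> \<cdot> sfx (d \<beta>) \<kappa>) k))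
   = c * (c' * ip (S' \<beta>' h) (S' \<alpha>' (S \<beta> (S' \<alpha> k))))"
  if x: "(c, \<alpha>, \<beta>) \<in> set L" "(c', \<alpha>', \<beta>') \<in> set L'" for c \<alpha> \<beta> c' \<alpha>' \<beta>'
 proof -
  have v: "\<alpha> \<in> M" "\<beta> \<in> M" "s \<alpha> = s \<beta>" "\<alpha>' \<in> M" "\<beta>' \<in> M" "s \<alpha>' = s \<beta>'"
   using assms(1,2) x by (auto simp: valid_terms_def)
  have c: "S' \<beta>' h \<in> \<H>" "S' \<alpha> k \<in> \<H>" using v assms S'_closed by auto
  have "(\<Sum>\<kappa>\<leftarrow>common_ext_list \<alpha>' \<beta>. c * c' * ip (S' (\<beta>' \<cdot> sfx (d \<alpha>') \<kappa>) h) (S' (\<alpha> \<cdot> sfx (d \<beta>) \<kappa>) k))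
    = (\<Sum>\<kappa>\<in>common_ext \<alpha>' \<beta>. c * c' * ip (S' (\<beta>' \<cdot> sfx (d \<alpha>') \<kappa>) h) (S' (\<alpha> \<cdot> sfx (d \<beta>) \<kappa>) k))"
   using common_ext_list[OF v(4)] by (simp add: sum_list_distinct_conv_sum_set)
  also have "\<dots> = (\<Sum>\<kappa>\<in>common_ext \<alpha>' \<beta>. c * c' * ip (S' (sfx (d \<alpha>') \<kappa>) (S' \<beta>' h)) (S' (sfx (d \<beta>) \<kappa>) (S' \<alpha> k)))"
   using v assms by (intro sum.cong) (simp_all add: common_extD S'_cmp)
  also have "\<dots> = c * c' * (\<Sum>\<kappa>\<in>common_ext \<alpha>' \<beta>. ip (S' (sfx (d \<alpha>') \<kappa>) (S' \<beta>' h)) (S' (sfx (d \<beta>) \<kappa>) (S' \<alpha> k)))"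
   by (simp add: sum_distrib_left)
  also have "\<dots> = c * c' * ip (S \<alpha>' (S' \<beta>' h)) (S \<beta> (S' \<alpha> k))"
   using product_formula[OF v(4,2) c] by simp
  also have "\<dots> = c * (c' * ip (S' \<beta>' h) (S' \<alpha>' (S \<beta> (S' \<alpha> k))))"
   using S_adj[OF v(4) c(1) S_closed[OF v(2) c(2)]] by simp
  finally show ?thesis .
 qed
 have "form (mult_terms L L') h k = (\<Sum>(c, \<alpha>, \<beta>)\<leftarrow>L. \<Sum>(c', \<alpha>', \<beta>')\<leftarrow>L'.
   \<Sum>\<kappa>\<leftarrow>common_ext_list \<alpha>' \<beta>. c * c' * ip (S' (\<beta>' \<cdot> sfx (d \<alpha>') \<kappa>) h) (S' (\<alpha> \<cdot> sfx (d \<beta>) \<kappa>) k))"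
  unfolding form_def mult_terms_def by (simp add: cc o_def case_prod_unfold)
 also have "\<dots> = (\<Sum>(c, \<alpha>, \<beta>)\<leftarrow>L. \<Sum>(c', \<alpha>', \<beta>')\<leftarrow>L'. c * (c' * ip (S' \<beta>' h) (S' \<alpha>' (S \<beta> (S' \<alpha> k)))))"
  by (intro arg_cong[where f = sum_list] refl) (auto intro!: arg_cong[where f = sum_list] one)
 also have "\<dots> = (\<Sum>(c, \<alpha>, \<beta>)\<leftarrow>L. c * form L' h (S \<beta> (S' \<alpha> k)))"
  by (simp add: form_def case_prod_unfold sum_list_const_mult)
 finally show ?thesis .
qed

end

section \<open>Representations and finite linear combinations\<close>

text \<open>The closure of a subalgebra that contains the generators is everything. The closure is described by
approximation, where the algebraic operations are estimated directly.\<close>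

lemma (in kgraph) kgraph_cstar_dense:
 defines "A \<equiv> kgraph_cstar \<Lambda>"
 assumes D: "D \<subseteq> carrier A" "\<zero>\<^bsub>A\<^esub> \<in> D" and gen: "\<And>\<mu>. \<mu> \<in> M \<Longrightarrow> kgraph_gen \<Lambda> \<mu> \<in> D"
  and add: "\<And>a b. \<lbrakk>a \<in> D; b \<in> D\<rbrakk> \<Longrightarrow> a \<oplus>\<^bsub>A\<^esub> b \<in> D" and smult: "\<And>c a. a \<in> D \<Longrightarrow> c \<odot>\<^bsub>A\<^esub> a \<in> D"
  and mult: "\<And>a b. \<lbrakk>a \<in> D; b \<in> D\<rbrakk> \<Longrightarrow> a \<otimes>\<^bsub>A\<^esub> b \<in> D" and star: "\<And>a. a \<in> D \<Longrightarrow> star A a \<in> D"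
  and a: "a \<in> carrier A" and e: "e > 0"
 shows "\<exists>b\<in>D. cnorm A (b \<ominus>\<^bsub>A\<^esub> a) < e"
proof -
 interpret A: cstar_algebra A unfolding A_def by (rule cstar_algebra_kgraph)
 have Dc: "b \<in> carrier A" if "b \<in> D" for b using D that by blast
 define E where "E = {a \<in> carrier A. \<forall>e>0. \<exists>b\<in>D. cnorm A (b \<ominus>\<^bsub>A\<^esub> a) < e}"
 have E: "a \<in> carrier A" "e > 0 \<Longrightarrow> \<exists>b\<in>D. cnorm A (b \<ominus>\<^bsub>A\<^esub> a) < e" if "a \<in> E" for a e
  using that by (auto simp: E_def)
 have sub: "D \<subseteq> E"
 proof
  fix b assume b: "b \<in> D"
  then have "b \<ominus>\<^bsub>A\<^esub> b = \<zero>\<^bsub>A\<^esub>" using A.minus_eq_zero_iff Dc by blast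
  then have "cnorm A (b \<ominus>\<^bsub>A\<^esub> b) = 0" by simp
  then show "b \<in> E" using b Dc unfolding E_def by force
 qed
 have "E = carrier A"
  unfolding A_def
 proof (rule kgraph_cstar_generated, fold A_def)
  show "norm_closed A (cnorm A) E"
   unfolding norm_closed_def
  proof (intro conjI allI impI)
   show "E \<subseteq> carrier A" by (auto simp: E_def)
   fix X l assume X: "(\<forall>n. X n \<in> E) \<and> l \<in> carrier A \<and> norm_tendsto A (cnorm A) X l"
   have "\<exists>b\<in>D. cnorm A (b \<ominus>\<^bsub>A\<^esub> l) < e" if e: "e > 0" for e
   proof -
    have "\<forall>\<^sub>F n in sequentially. cnorm A (X n \<ominus>\<^bsub>A\<^esub> l) < e / 2"
     using X e unfolding norm_tendsto_def by (intro order_tendstoD(2)) auto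
    then obtain n where n: "cnorm A (X n \<ominus>\<^bsub>A\<^esub> l) < e / 2" using eventually_happens'[OF sequentially_bot] by blast
    obtain b where b: "b \<in> D" "cnorm A (b \<ominus>\<^bsub>A\<^esub> X n) < e / 2" using E(2)[of "X n" "e / 2"] X e by auto
    show ?thesis using A.p_triangle[OF Dc[OF b(1)] E(1), of "X n" l] X n b by force
   qed
   then show "l \<in> E" using X by (simp add: E_def)
  qed
  fix a assume a: "a \<in> E"
  note ac = E(1)[OF a]
  show "star A a \<in> E"
   unfolding E_def using E(2)[OF a] star Dc ac A.p_star_diff by simp metis
  show "c \<odot>\<^bsub>A\<^esub> a \<in> E" for c
  proof -
   have "\<exists>b\<in>D. cnorm A (b \<ominus>\<^bsub>A\<^esub> c \<odot>\<^bsub>A\<^esub> a) < e" if e: "e > 0" for e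
   proof -
    obtain b where b: "b \<in> D" "cnorm A (b \<ominus>\<^bsub>A\<^esub> a) < e / (cmod c + 1)"
     using E(2)[OF a, of "e / (cmod c + 1)"] e by (auto simp: add_nonneg_pos)
    have "cmod c * cnorm A (b \<ominus>\<^bsub>A\<^esub> a) \<le> (cmod c + 1) * cnorm A (b \<ominus>\<^bsub>A\<^esub> a)"
     using Dc[OF b(1)] ac by (intro mult_right_mono) auto
    also have "\<dots> < e" using b(2) by (simp add: pos_less_divide_eq add_nonneg_pos mult.commute)
    finally show ?thesis using A.p_smult_diff[OF Dc[OF b(1)] ac, of c] by (intro bexI[OF _ smult[OF b(1), of c]]) simp
   qed
   then show ?thesis using ac by (simp add: E_def)
  qed
  fix b assume b: "b \<in> E"
  note bc = E(1)[OF b]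
  have "\<exists>d\<in>D. cnorm A (d \<ominus>\<^bsub>A\<^esub> (a \<oplus>\<^bsub>A\<^esub> b)) < e" if e: "e > 0" for e
  proof -
   obtain a' b' where ab: "a' \<in> D" "cnorm A (a' \<ominus>\<^bsub>A\<^esub> a) < e / 2" "b' \<in> D" "cnorm A (b' \<ominus>\<^bsub>A\<^esub> b) < e / 2"
    using E(2)[OF a, of "e / 2"] E(2)[OF b, of "e / 2"] e by auto
   then show ?thesis using A.p_add_diff[OF Dc[OF ab(1)] Dc[OF ab(3)] ac bc] add by force
  qed
  then show "a \<oplus>\<^bsub>A\<^esub> b \<in> E" using ac bc by (simp add: E_def)
  have "\<exists>d\<in>D. cnorm A (d \<ominus>\<^bsub>A\<^esub> a \<otimes>\<^bsub>A\<^esub> b) < e" if e: "e > 0" for e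
  proof -
   obtain a' where a': "a' \<in> D" "cnorm A (a' \<ominus>\<^bsub>A\<^esub> a) < e / (2 * (cnorm A b + 1))"
    using E(2)[OF a, of "e / (2 * (cnorm A b + 1))"] e bc by (auto simp: add_nonneg_pos)
   obtain b' where b': "b' \<in> D" "cnorm A (b' \<ominus>\<^bsub>A\<^esub> b) < e / (2 * (cnorm A a' + 1))"
    using E(2)[OF b, of "e / (2 * (cnorm A a' + 1))"] e Dc[OF a'(1)] by (auto simp: add_nonneg_pos)
   have *: "s * t < e / 2" if "0 \<le> s" "0 \<le> t" "t < e / (2 * (s + 1))" for s t :: real
   proof (cases "t = 0")
    case False
    then have "s * t < (s + 1) * t" using that by simp
    also have "\<dots> \<le> (s + 1) * (e / (2 * (s + 1)))" using that by (intro mult_left_mono) auto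
    also have "\<dots> = e / 2" using that(1) by (simp add: divide_simps)
    finally show ?thesis .
   qed (use e in simp)
   have "cnorm A (a' \<otimes>\<^bsub>A\<^esub> b' \<ominus>\<^bsub>A\<^esub> a \<otimes>\<^bsub>A\<^esub> b) \<le> cnorm A a' * cnorm A (b' \<ominus>\<^bsub>A\<^esub> b) + cnorm A (a' \<ominus>\<^bsub>A\<^esub> a) * cnorm A b"
    by (rule A.p_mult_diff[OF Dc[OF a'(1)] Dc[OF b'(1)] ac bc])
   also have "\<dots> < e / 2 + e / 2"
    using *[OF _ _ b'(2)] *[OF _ _ a'(2)] Dc[OF a'(1)] Dc[OF b'(1)] ac bc by (intro add_strict_mono) (auto simp: mult.commute)
   finally show ?thesis using mult[OF a'(1) b'(1)] by auto
  qed
  then show "a \<otimes>\<^bsub>A\<^esub> b \<in> E" using ac bc by (simp add: E_def)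
 qed (use sub D gen in auto)
 then show ?thesis using E(2) a e by blast
qed

locale kgraph_rep = rf_kgraph \<Lambda> + hilbert_space H
 for \<Lambda> :: "('e, 'k::finite) kgraph" and H :: "('h, 'n) hilbert_scheme" (structure) +
 fixes \<pi> :: "(nat \<Rightarrow> 'e star_word \<Rightarrow>\<^sub>0 complex) set \<Rightarrow> 'h \<Rightarrow> 'h"
 assumes rep: "hilbert_rep (kgraph_cstar \<Lambda>) H \<pi>"
begin

abbreviation "A \<equiv> kgraph_cstar \<Lambda>"
abbreviation "\<A> \<equiv> carrier A"
abbreviation "g \<equiv> kgraph_gen \<Lambda>"

sublocale A: cstar_algebra A by (rule cstar_algebra_kgraph)

lemmas rep_closed = hilbert_repD(1)[OF rep]
lemmas rep_linear = hilbert_repD(2,3)[OF rep]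
lemmas rep_add = hilbert_repD(5)[OF rep]
lemmas rep_smult = hilbert_repD(6)[OF rep]
lemmas rep_mult = hilbert_repD(7)[OF rep]
lemmas rep_adj = hilbert_repD(8)[OF rep]

lemma rep_contractive: "\<lbrakk>a \<in> \<A>; v \<in> \<H>\<rbrakk> \<Longrightarrow> nrm (\<pi> a v) \<le> cnorm A a * nrm v"
 by (rule hilbert_rep_contractive[OF A.cstar_algebra_axioms hilbert_space_axioms rep])

lemma gen_closed: "\<mu> \<in> M \<Longrightarrow> g \<mu> \<in> \<A>"
 using CK_family_kgraph by (auto simp: CK_family_def)

lemma gen_relations:
 "v \<in> V \<Longrightarrow> star A (g v) = g v" "v \<in> V \<Longrightarrow> g v \<otimes>\<^bsub>A\<^esub> g v = g v"
 "\<lbrakk>v \<in> V; w \<in> V; v \<noteq> w\<rbrakk> \<Longrightarrow> g v \<otimes>\<^bsub>A\<^esub> g w = \<zero>\<^bsub>A\<^esub>"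
 "\<lbrakk>\<mu> \<in> M; \<nu> \<in> M; s \<mu> = r \<nu>\<rbrakk> \<Longrightarrow> g \<mu> \<otimes>\<^bsub>A\<^esub> g \<nu> = g (\<mu> \<cdot> \<nu>)"
 "\<kappa> \<in> M \<Longrightarrow> star A (g \<kappa>) \<otimes>\<^bsub>A\<^esub> g \<kappa> = g (s \<kappa>)"
 "v \<in> V \<Longrightarrow> g v = (\<Oplus>\<^bsub>A\<^esub>\<kappa>\<in>{\<kappa> \<in> M. r \<kappa> = v \<and> d \<kappa> = n}. g \<kappa> \<otimes>\<^bsub>A\<^esub> star A (g \<kappa>))"
proof -
 have "CK_relations \<Lambda> A (=) g" using CK_family_kgraph by (simp add: CK_family_def)
 note R1 = conjunct1[OF this[unfolded CK_relations_def]] and R' = conjunct2[OF this[unfolded CK_relations_def]]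
 note R2 = conjunct1[OF R'] and R'' = conjunct2[OF R']
 note R3 = conjunct1[OF R''] and R4 = conjunct1[OF conjunct2[OF R'']] and R5 = conjunct2[OF conjunct2[OF R'']]
 show "v \<in> V \<Longrightarrow> star A (g v) = g v" "v \<in> V \<Longrightarrow> g v \<otimes>\<^bsub>A\<^esub> g v = g v"
  using R1 by auto
 show "\<lbrakk>v \<in> V; w \<in> V; v \<noteq> w\<rbrakk> \<Longrightarrow> g v \<otimes>\<^bsub>A\<^esub> g w = \<zero>\<^bsub>A\<^esub>" using R2 by auto
 show "\<lbrakk>\<mu> \<in> M; \<nu> \<in> M; s \<mu> = r \<nu>\<rbrakk> \<Longrightarrow> g \<mu> \<otimes>\<^bsub>A\<^esub> g \<nu> = g (\<mu> \<cdot> \<nu>)" using R3 by auto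
 show "\<kappa> \<in> M \<Longrightarrow> star A (g \<kappa>) \<otimes>\<^bsub>A\<^esub> g \<kappa> = g (s \<kappa>)" using R4 by auto
 show "v \<in> V \<Longrightarrow> g v = (\<Oplus>\<^bsub>A\<^esub>\<kappa>\<in>{\<kappa> \<in> M. r \<kappa> = v \<and> d \<kappa> = n}. g \<kappa> \<otimes>\<^bsub>A\<^esub> star A (g \<kappa>))"
  by (rule R5[rule_format])
qed

lemma rep_zero: "v \<in> \<H> \<Longrightarrow> \<pi> \<zero>\<^bsub>A\<^esub> v = \<zero>"
 using rep_smult[of "\<zero>\<^bsub>A\<^esub>" v 0] rep_closed by (simp add: complex_smult_distr)

lemma rep_finsum:
 assumes "finite J" "\<And>j. j \<in> J \<Longrightarrow> f j \<in> \<A>" "v \<in> \<H>" "w \<in> \<H>"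
 shows "ip (\<pi> (finsum A f J) v) w = (\<Sum>j\<in>J. ip (\<pi> (f j) v) w)"
 using assms
proof (induction J)
 case (insert j J)
 have "finsum A f J \<in> \<A>" using insert.prems by (intro A.M.finsum_closed) auto
 moreover have "finsum A f (insert j J) = f j \<oplus>\<^bsub>A\<^esub> finsum A f J"
  using insert by (intro A.M.finsum_insert) auto
 ultimately show ?case using insert rep_closed by (simp add: rep_add hinner_add_left)
qed (simp add: rep_zero hinner_zero_left)

lemma ck_ops: "ck_ops \<Lambda> H (\<lambda>\<kappa>. \<pi> (g \<kappa>)) (\<lambda>\<kappa>. \<pi> (star A (g \<kappa>)))"
proof
 note cl = gen_closed A.star_closed[OF gen_closed]
 fix \<kappa> h assume k: "\<kappa> \<in> mor \<Lambda>" and h: "h \<in> \<H>"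
 show "\<pi> (g \<kappa>) h \<in> \<H>" "\<pi> (star A (g \<kappa>)) h \<in> \<H>" using k h cl rep_closed by auto
 show "\<pi> (star A (g \<kappa>)) (\<pi> (g \<kappa>) h) = \<pi> (g (s \<kappa>)) h"
  using rep_mult[OF cl(2)[OF k] cl(1)[OF k] h] gen_relations(5)[OF k] by simp
 show "ip (\<pi> (g \<kappa>) h) w = ip h (\<pi> (star A (g \<kappa>)) w)" if "w \<in> \<H>" for w
  using rep_adj k h cl that by simp
 fix \<nu> assume n: "\<nu> \<in> mor \<Lambda>" "s \<kappa> = r \<nu>"
 show "\<pi> (g \<kappa>) (\<pi> (g \<nu>) h) = \<pi> (g (\<kappa> \<cdot> \<nu>)) h"
  using rep_mult[OF cl(1)[OF k] cl(1)[OF n(1)] h] gen_relations(4)[OF k n] by simp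
next
 fix v h assume v: "v \<in> V" and h: "h \<in> \<H>"
 show "\<pi> (star A (g v)) h = \<pi> (g v) h" using gen_relations(1)[OF v] by simp
 show "\<pi> (g v) (\<pi> (g w) h) = \<zero>" if w: "w \<in> V" "v \<noteq> w" for w
  using rep_mult[OF gen_closed gen_closed h, of v w] gen_relations(3) rep_zero[OF h] vertsD v w by simp
 fix k and n :: "nat ^ 'k" assume k: "k \<in> \<H>"
 let ?J = "{\<kappa> \<in> M. r \<kappa> = v \<and> d \<kappa> = n}"
 have fin: "finite ?J" using outp(1)[OF v, of n] by (simp add: outp_def)
 have "ip (\<pi> (g v) h) k = (\<Sum>\<kappa>\<in>?J. ip (\<pi> (g \<kappa> \<otimes>\<^bsub>A\<^esub> star A (g \<kappa>)) h) k)"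
  by (subst gen_relations(6)[OF v, of n], rule rep_finsum[OF fin _ h k]) (use gen_closed in auto)
 also have "\<dots> = (\<Sum>\<kappa>\<in>?J. ip (\<pi> (star A (g \<kappa>)) h) (\<pi> (star A (g \<kappa>)) k))"
  using gen_closed h k rep_closed by (intro sum.cong) (auto simp: rep_mult rep_adj)
 finally show "ip (\<pi> (g v) h) k = (\<Sum>\<kappa>\<in>?J. ip (\<pi> (star A (g \<kappa>)) h) (\<pi> (star A (g \<kappa>)) k))" .
qed

sublocale ck_ops \<Lambda> H "\<lambda>\<kappa>. \<pi> (g \<kappa>)" "\<lambda>\<kappa>. \<pi> (star A (g \<kappa>))"
 by (rule ck_ops)

abbreviation "S \<kappa> \<equiv> \<pi> (g \<kappa>)"
abbreviation "S' \<kappa> \<equiv> \<pi> (star A (g \<kappa>))"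

definition represents :: "(nat \<Rightarrow> 'e star_word \<Rightarrow>\<^sub>0 complex) set \<Rightarrow> (complex \<times> 'e \<times> 'e) list \<Rightarrow> bool" where
 "represents a L \<longleftrightarrow> a \<in> \<A> \<and> valid_terms L \<and> (\<forall>h\<in>\<H>. \<forall>k\<in>\<H>. ip (\<pi> a h) k = form L h k)"

lemma representsD:
 assumes "represents a L"
 shows "a \<in> \<A>" "valid_terms L" "\<lbrakk>h \<in> \<H>; k \<in> \<H>\<rbrakk> \<Longrightarrow> ip (\<pi> a h) k = form L h k"
 using assms by (auto simp: represents_def)

lemma represents_zero: "represents \<zero>\<^bsub>A\<^esub> []"
 by (simp add: represents_def valid_terms_def form_def rep_zero hinner_zero_left)

lemma represents_gen:
 assumes m: "\<mu> \<in> M" shows "represents (g \<mu>) [(1, \<mu>, s \<mu>)]"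
proof -
 have "ip (S \<mu> h) k = form [(1, \<mu>, s \<mu>)] h k" if "h \<in> \<H>" "k \<in> \<H>" for h k
  using S_src(1)[OF m that(1)] S_adj[OF m _ that(2), of "S (s \<mu>) h"] S_vert[OF src_verts[OF m] that(1)]
   S_closed[OF vertsD(1)[OF src_verts[OF m]] that(1)] by (simp add: form_def)
 then show ?thesis using m gen_closed src_verts vertsD by (auto simp: represents_def valid_terms_def)
qed

lemma represents_add: "\<lbrakk>represents a L; represents b L'\<rbrakk> \<Longrightarrow> represents (a \<oplus>\<^bsub>A\<^esub> b) (L @ L')"
 unfolding represents_def valid_terms_def by (auto simp: rep_add rep_closed hinner_add_left form_def)

lemma represents_smult: "represents a L \<Longrightarrow> represents (z \<odot>\<^bsub>A\<^esub> a) (map (\<lambda>(c, \<alpha>, \<beta>). (z * c, \<alpha>, \<beta>)) L)"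
 unfolding represents_def valid_terms_def
 by (auto simp: rep_smult rep_closed hinner_smult_left form_def o_def case_prod_unfold mult.assoc sum_list_const_mult)

lemma represents_star:
 assumes "represents a L" shows "represents (star A a) (map (\<lambda>(c, \<alpha>, \<beta>). (cnj c, \<beta>, \<alpha>)) L)"
proof -
 note a = representsD[OF assms]
 have "ip (\<pi> (star A a) h) k = form (map (\<lambda>(c, \<alpha>, \<beta>). (cnj c, \<beta>, \<alpha>)) L) h k"
  if h: "h \<in> \<H>" and k: "k \<in> \<H>" for h k
 proof -
  have "ip (\<pi> (star A a) h) k = ip h (\<pi> a k)" using rep_adj a(1) h k by simp
  also have "\<dots> = cnj (form L k h)" using a(3) hinner_cnj[of "\<pi> a k" h] rep_closed a(1) h k by simp
  also have "\<dots> = form (map (\<lambda>(c, \<alpha>, \<beta>). (cnj c, \<beta>, \<alpha>)) L) h k"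
   using form_star[OF a(2) h k] by simp
  finally show ?thesis .
 qed
 moreover have "valid_terms (map (\<lambda>(c, \<alpha>, \<beta>). (cnj c, \<beta>, \<alpha>)) L)" using a(2) by (auto simp: valid_terms_def)
 ultimately show ?thesis using a(1) by (simp add: represents_def)
qed

lemma represents_mult:
 assumes "represents a L" "represents b L'"
 shows "represents (a \<otimes>\<^bsub>A\<^esub> b) (mult_terms L L')"
proof -
 note a = representsD[OF assms(1)] and b = representsD[OF assms(2)]
 have "ip (\<pi> (a \<otimes>\<^bsub>A\<^esub> b) h) k = form (mult_terms L L') h k"
  if h: "h \<in> \<H>" and k: "k \<in> \<H>" for h k
 proof -
  have bh: "\<pi> b h \<in> \<H>" using rep_closed b h by blast
  have "ip (\<pi> (a \<otimes>\<^bsub>A\<^esub> b) h) k = form L (\<pi> b h) k"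
   using rep_mult[OF a(1) b(1) h] a(3)[OF bh k] by simp
  also have "\<dots> = (\<Sum>(c, \<alpha>, \<beta>)\<leftarrow>L. c * form L' h (S \<beta> (S' \<alpha> k)))"
   unfolding form_def[of L]
  proof (intro arg_cong[where f = sum_list] map_cong refl)
   fix x assume x: "x \<in> set L"
   obtain c \<alpha> \<beta> where xx: "x = (c, \<alpha>, \<beta>)" by (cases x)
   then have v: "\<alpha> \<in> M" "\<beta> \<in> M" using a(2) x by (auto simp: valid_terms_def)
   then have y: "S' \<alpha> k \<in> \<H>" using S'_closed k by blast
   show "(case x of (c, \<alpha>, \<beta>) \<Rightarrow> c * ip (S' \<beta> (\<pi> b h)) (S' \<alpha> k)) =
     (case x of (c, \<alpha>, \<beta>) \<Rightarrow> c * form L' h (S \<beta> (S' \<alpha> k)))"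
    using S'_adj[OF v(2) bh y] b(3)[OF h S_closed[OF v(2) y]] xx by simp
  qed
  also have "\<dots> = form (mult_terms L L') h k" using form_mult_terms[OF a(2) b(2) h k] by simp
  finally show ?thesis .
 qed
 then show ?thesis
  unfolding represents_def by (intro conjI ballI A.mult_closed a(1) b(1) valid_terms_mult a(2) b(2))
qed

text \<open>By the product formula the finite combinations form a subalgebra.\<close>

lemma represented_dense:
 assumes "a \<in> \<A>" "e > 0"
 shows "\<exists>b L. represents b L \<and> cnorm A (b \<ominus>\<^bsub>A\<^esub> a) < e"
proof -
 have "\<exists>b\<in>{b. \<exists>L. represents b L}. cnorm A (b \<ominus>\<^bsub>A\<^esub> a) < e"
  using assms
  by (intro kgraph_cstar_dense) (auto dest: representsD(1) intro: represents_zero represents_gen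
    represents_add represents_smult represents_mult represents_star)
 then show ?thesis by blast
qed

lemma rep_diff_le:
 assumes "a \<in> \<A>" "b \<in> \<A>" "h \<in> \<H>" "k \<in> \<H>"
 shows "cmod (ip (\<pi> b h) k - ip (\<pi> a h) k) \<le> cnorm A (b \<ominus>\<^bsub>A\<^esub> a) * nrm h * nrm k"
proof -
 have "b = (b \<ominus>\<^bsub>A\<^esub> a) \<oplus>\<^bsub>A\<^esub> a" using assms by (simp add: A.M.minus_eq A.M.a_assoc A.M.l_neg)
 then have "\<pi> b h = \<pi> (b \<ominus>\<^bsub>A\<^esub> a) h \<oplus> \<pi> a h" using rep_add[of "b \<ominus>\<^bsub>A\<^esub> a" a h] assms by simp
 then have "ip (\<pi> b h) k - ip (\<pi> a h) k = ip (\<pi> (b \<ominus>\<^bsub>A\<^esub> a) h) k"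
  using assms rep_closed by (simp add: hinner_add_left)
 also have "cmod \<dots> \<le> nrm (\<pi> (b \<ominus>\<^bsub>A\<^esub> a) h) * nrm k"
  using assms rep_closed by (intro Cauchy_Schwarz) auto
 also have "\<dots> \<le> cnorm A (b \<ominus>\<^bsub>A\<^esub> a) * nrm h * nrm k"
  using assms rep_contractive hnorm_nonneg by (intro mult_right_mono) auto
 finally show ?thesis .
qed

end

section \<open>Almost invariant weights\<close>

lemma card_box:
 fixes a b :: nat
 shows "finite {e :: nat ^ 'k::finite. \<forall>i. a \<le> e $ i \<and> e $ i < b}"
  "card {e :: nat ^ 'k. \<forall>i. a \<le> e $ i \<and> e $ i < b} = (b - a) ^ CARD('k)"
proof -
 have "bij_betw (\<lambda>f. vec_lambda f) (UNIV \<rightarrow>\<^sub>E {a..<b}) {e :: nat ^ 'k. \<forall>i. a \<le> e $ i \<and> e $ i < b}"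
  by (rule bij_betw_byWitness[where f' = vec_nth]) auto
 note bij = this
 have "finite ((UNIV :: 'k set) \<rightarrow>\<^sub>E {a..<b})" by (rule finite_PiE) auto
 then show "finite {e :: nat ^ 'k. \<forall>i. a \<le> e $ i \<and> e $ i < b}"
  "card {e :: nat ^ 'k. \<forall>i. a \<le> e $ i \<and> e $ i < b} = (b - a) ^ CARD('k)"
  using bij_betw_finite[OF bij] bij_betw_same_card[OF bij] by (simp_all add: card_PiE)
qed

lemma box_ratio: "(\<lambda>N. real (N - 2 * G) ^ K / real N ^ K) \<longlonglongrightarrow> 1"
proof -
 have "(\<lambda>N. (1 - real (2 * G) * inverse (real N)) ^ K) \<longlonglongrightarrow> (1 - real (2 * G) * 0) ^ K"
  by (intro tendsto_intros lim_inverse_n)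
 moreover have "\<forall>\<^sub>F N in sequentially. (1 - real (2 * G) * inverse (real N)) ^ K = real (N - 2 * G) ^ K / real N ^ K"
 proof (rule eventually_sequentiallyI[of "2 * G + 1"])
  fix N assume "2 * G + 1 \<le> N"
  then have "1 - real (2 * G) * inverse (real N) = real (N - 2 * G) / real N"
   by (simp add: field_simps)
  then show "(1 - real (2 * G) * inverse (real N)) ^ K = real (N - 2 * G) ^ K / real N ^ K"
   by (simp add: power_divide)
 qed
 ultimately show ?thesis by (simp add: Lim_transform_eventually)
qed

context directed_kgraph
begin

text \<open>For an orthonormal family indexed by classes of degrees with weights \<open>\<zeta>\<close>, this is the coefficient of
correlation between the weights and their translate by \<open>p - q\<close> in \<open>\<int>\<^sup>k / Per\<close>.\<close>

definition overlap :: "(nat ^ 'k) set \<Rightarrow> (nat ^ 'k \<Rightarrow> real) \<Rightarrow> nat ^ 'k \<Rightarrow> nat ^ 'k \<Rightarrow> real" where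
 "overlap Ds \<zeta> p q = (\<Sum>f\<in>Ds. \<Sum>f'\<in>Ds. if vdiff (f + q) (f' + p) \<in> perset then \<zeta> f * \<zeta> f' else 0)"

definition transversal :: "(nat ^ 'k) set \<Rightarrow> bool" where
 "transversal Ds \<longleftrightarrow> finite Ds \<and> (\<forall>f\<in>Ds. \<forall>f'\<in>Ds. f \<noteq> f' \<longrightarrow> vdiff f f' \<notin> perset)"

lemma overlap_le_1:
 assumes Ds: "transversal Ds" and z: "(\<Sum>f\<in>Ds. (\<zeta> f)\<^sup>2) = 1"
 shows "overlap Ds \<zeta> p q \<le> 1"
proof -
 have fin: "finite Ds" using Ds by (simp add: transversal_def)
 let ?R = "\<lambda>f f'. vdiff (f + q) (f' + p) \<in> perset"
 have eqF: "f1 = f2" if "f1 \<in> Ds" "f2 \<in> Ds" "vdiff f1 f2 \<in> perset" for f1 f2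
  using Ds that by (auto simp: transversal_def)
 have u1: "f1 = f2" if "f1 \<in> Ds" "f2 \<in> Ds" "?R f1 f'" "?R f2 f'" for f1 f2 f'
  using eqF[OF that(1,2)] perset_equiv(3)[OF that(3) perset_equiv(2)[OF that(4)]] by simp
 have u2: "f1 = f2" if "f1 \<in> Ds" "f2 \<in> Ds" "?R f f1" "?R f f2" for f1 f2 f
  using eqF[OF that(1,2)] perset_equiv(3)[OF perset_equiv(2)[OF that(3)] that(4)] by simp
 have le: "(\<Sum>x\<in>Ds. if P x then c else (0::real)) \<le> c" if "c \<ge> 0" "\<And>x y. \<lbrakk>x \<in> Ds; y \<in> Ds; P x; P y\<rbrakk> \<Longrightarrow> x = y" for P c
 proof (cases "\<exists>x\<in>Ds. P x")
  case True
  then obtain x where x: "x \<in> Ds" "P x" by blast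
  have "(\<Sum>y\<in>Ds. if P y then c else 0) = (\<Sum>y\<in>Ds. if y = x then c else 0)"
   using that(2) x by (intro sum.cong) auto
  then show ?thesis using fin x by simp
 next
  case False
  then have "(\<Sum>y\<in>Ds. if P y then c else 0) = (\<Sum>y\<in>Ds. 0)" by simp
  then show ?thesis using that(1) by simp
 qed
 have "overlap Ds \<zeta> p q \<le> (\<Sum>f\<in>Ds. \<Sum>f'\<in>Ds. (if ?R f f' then (\<zeta> f)\<^sup>2 / 2 else 0) + (if ?R f f' then (\<zeta> f')\<^sup>2 / 2 else 0))"
  unfolding overlap_def
 proof (intro sum_mono)
  fix f f'
  show "(if ?R f f' then \<zeta> f * \<zeta> f' else 0) \<le> (if ?R f f' then (\<zeta> f)\<^sup>2 / 2 else 0) + (if ?R f f' then (\<zeta> f')\<^sup>2 / 2 else 0)"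
   using sum_squares_bound[of "\<zeta> f" "\<zeta> f'"] by simp
 qed
 also have "\<dots> = (\<Sum>f\<in>Ds. \<Sum>f'\<in>Ds. if ?R f f' then (\<zeta> f)\<^sup>2 / 2 else 0) + (\<Sum>f'\<in>Ds. \<Sum>f\<in>Ds. if ?R f f' then (\<zeta> f')\<^sup>2 / 2 else 0)"
  by (simp add: sum.distrib) (rule sum.swap)
 also have "\<dots> \<le> (\<Sum>f\<in>Ds. (\<zeta> f)\<^sup>2 / 2) + (\<Sum>f'\<in>Ds. (\<zeta> f')\<^sup>2 / 2)"
  by (intro add_mono sum_mono le) (use u1 u2 in auto)
 also have "\<dots> = 1" using z by (simp flip: sum_divide_distrib)
 finally show ?thesis .
qed

text \<open>Folner's condition for \<open>\<int>\<^sup>k / Per\<close>. Push the uniform distribution on a large box to the quotient: the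
weight of a class is the square root of its mass, represented by one degree of the box. All but few
points of the box stay in the box when they are translated by \<open>p - q\<close>, and by the inequality between
the geometric mean and the minimum each such point contributes to the overlap.\<close>

lemma almost_invariant_weights:
 assumes G: "finite G" and \<delta>: "\<delta> > 0"
 obtains Ds \<zeta> where "transversal Ds" "\<And>f. 0 \<le> \<zeta> f" "(\<Sum>f\<in>Ds. (\<zeta> f)\<^sup>2) = 1"
  "\<And>p q. (p, q) \<in> G \<Longrightarrow> \<bar>1 - overlap Ds \<zeta> p q\<bar> \<le> \<delta>"
proof -
 define K where "K = (\<Sum>(p, q)\<in>G. \<Sum>i\<in>UNIV. p $ i + q $ i)"
 have Kge: "p $ i + q $ i \<le> K" if "(p, q) \<in> G" for p q i
 proof -
  have "p $ i + q $ i \<le> (\<Sum>i\<in>UNIV. p $ i + q $ i)" by (rule member_le_sum) auto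
  also have "\<dots> \<le> K" unfolding K_def using member_le_sum[OF that, of "\<lambda>(p, q). \<Sum>i\<in>UNIV. p $ i + q $ i"] G by auto
  finally show ?thesis .
 qed
 have "\<forall>\<^sub>F N in sequentially. 1 - \<delta> < real (N - 2 * K) ^ CARD('k) / real N ^ CARD('k)"
  using order_tendstoD(1)[OF box_ratio, of "1 - \<delta>"] \<delta> by simp
 then obtain N where N: "N \<ge> 1" "1 - \<delta> < real (N - 2 * K) ^ CARD('k) / real N ^ CARD('k)"
  using eventually_happens'[OF sequentially_bot eventually_conj[OF eventually_ge_at_top[of 1]]] by blast
 define X where "X = {e :: nat ^ 'k. \<forall>i. 0 \<le> e $ i \<and> e $ i < N}"
 have fX: "finite X" and cX: "card X = N ^ CARD('k)" unfolding X_def using card_box[of 0 N] by auto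
 have cX0: "card X > 0" using N(1) by (simp add: cX)
 \<comment> \<open>A representative in the box of the class of a degree.\<close>
 define t where "t e = (SOME f. f \<in> X \<and> vdiff e f \<in> perset)" for e
 have t: "t e \<in> X" "vdiff e (t e) \<in> perset" if "e \<in> X" for e
 proof -
  have "\<exists>f. f \<in> X \<and> vdiff e f \<in> perset" using that perset_equiv(1) by blast
  from someI_ex[OF this] show "t e \<in> X" "vdiff e (t e) \<in> perset" by (auto simp: t_def)
 qed
 have tt: "t e = t e'" if "vdiff e e' \<in> perset" for e e'
 proof -
  have "vdiff e f \<in> perset \<longleftrightarrow> vdiff e' f \<in> perset" for f
   using that perset_equiv(2,3) by blast
  then show ?thesis by (simp add: t_def)
 qed
 define Ds where "Ds = t ` X"
 have fF: "finite Ds" using fX by (simp add: Ds_def)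
 have tF: "t f = f" if "f \<in> Ds" for f
  using that tt t(2) unfolding Ds_def by (metis imageE)
 have trans: "transversal Ds"
  unfolding transversal_def using fF tF tt by metis
 define c where "c f = card {e \<in> X. t e = f}" for f
 define \<zeta> where "\<zeta> f = sqrt (real (c f) / real (card X))" for f
 have z2: "(\<zeta> f)\<^sup>2 = real (c f) / real (card X)" for f by (simp add: \<zeta>_def)
 have "card X = (\<Sum>f\<in>Ds. c f)"
  unfolding c_def Ds_def using sum.image_gen[OF fX, of "\<lambda>_. 1::nat" t] by simp
 then have z1: "(\<Sum>f\<in>Ds. (\<zeta> f)\<^sup>2) = 1"
  using cX0 by (simp add: z2 flip: sum_divide_distrib of_nat_sum)
 have "\<bar>1 - overlap Ds \<zeta> p q\<bar> \<le> \<delta>" if pq: "(p, q) \<in> G" for p q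
 proof -
  \<comment> \<open>The points of the box that stay in it under the translation by \<open>p - q\<close>.\<close>
  define E where "E = {e \<in> X. \<exists>e'\<in>X. e' + q = e + p}"
  define sh where "sh e = e + p - q" for e :: "nat ^ 'k"
  have sh: "sh e \<in> X" "sh e + q = e + p" if eE: "e \<in> E" for e
  proof -
   obtain e' where "e' \<in> X" "e' + q = e + p" using eE by (auto simp: E_def)
   then show "sh e \<in> X" "sh e + q = e + p" by (metis add_diff_cancel_right' sh_def)+
  qed
  have fE: "finite E" "E \<subseteq> X" using fX by (auto simp: E_def)
  have inj: "inj_on sh E" using sh(2) by (intro inj_onI) (metis add_right_cancel)
  have "{e :: nat ^ 'k. \<forall>i. K \<le> e $ i \<and> e $ i < N - K} \<subseteq> E"
  proof clarify
   fix e :: "nat ^ 'k" assume e: "\<forall>i. K \<le> e $ i \<and> e $ i < N - K"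
   have "e + p - q + q = e + p"
    using e Kge[OF pq] by (auto simp: vec_eq_iff) (metis add_leE le_add_diff_inverse2 trans_le_add1)
   moreover have "e + p - q \<in> X"
   proof -
    have "e $ i + p $ i - q $ i < N" for i using e[rule_format, of i] Kge[OF pq, of i] by linarith
    then show ?thesis by (simp add: X_def)
   qed
   moreover have "e \<in> X" using e by (auto simp: X_def intro: less_le_trans)
   ultimately show "e \<in> E" by (auto simp: E_def)
  qed
  then have "card {e :: nat ^ 'k. \<forall>i. K \<le> e $ i \<and> e $ i < N - K} \<le> card E"
   using fE by (intro card_mono)
  then have "(N - 2 * K) ^ CARD('k) \<le> card E" using card_box(2)[of K "N - K", where 'k = 'k] by (simp add: mult_2)
  then have "real (N - 2 * K) ^ CARD('k) / real N ^ CARD('k) \<le> real (card E) / real (card X)"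
   unfolding cX by (simp add: divide_right_mono)
  then have lower: "1 - \<delta> \<le> real (card E) / real (card X)" using N(2) by linarith
  let ?R = "\<lambda>f f'. vdiff (f + q) (f' + p) \<in> perset"
  define P where "P f f' = {e \<in> E. t (sh e) = f \<and> t e = f'}" for f f'
  have "card E = (\<Sum>x\<in>(\<lambda>e. (t (sh e), t e)) ` E. card {e \<in> E. (t (sh e), t e) = x})"
   using sum.image_gen[OF fE(1), of "\<lambda>_. 1::nat" "\<lambda>e. (t (sh e), t e)"] by simp
  also have "\<dots> \<le> (\<Sum>x\<in>Ds \<times> Ds. card {e \<in> E. (t (sh e), t e) = x})"
   using fF sh(1) fE(2) by (intro sum_mono2) (auto simp: Ds_def)
  also have "\<dots> = (\<Sum>f\<in>Ds. \<Sum>f'\<in>Ds. card (P f f'))"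
   by (simp add: P_def sum.cartesian_product case_prod_unfold prod_eq_iff)
  finally have "real (card E) \<le> (\<Sum>f\<in>Ds. \<Sum>f'\<in>Ds. real (card (P f f')))"
   by (metis (mono_tags, lifting) of_nat_le_iff of_nat_sum sum.cong)
  also have "\<dots> \<le> (\<Sum>f\<in>Ds. \<Sum>f'\<in>Ds. real (card X) * (if ?R f f' then \<zeta> f * \<zeta> f' else 0))"
  proof (intro sum_mono)
   fix f f'
   show "real (card (P f f')) \<le> real (card X) * (if ?R f f' then \<zeta> f * \<zeta> f' else 0)"
   proof (cases "P f f' = {}")
    case True
    then show ?thesis by (simp add: \<zeta>_def)
   next
    case False
    then obtain e where e: "e \<in> E" "t (sh e) = f" "t e = f'" by (auto simp: P_def)
    have eX: "e \<in> X" "sh e \<in> X" using e(1) fE sh by auto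
    have "vdiff (f + q) (sh e + q) \<in> perset" using perset_equiv(2)[OF t(2)[OF eX(2)]] e(2) by simp
    moreover have "vdiff (sh e + q) (f' + p) \<in> perset" using t(2)[OF eX(1)] e(3) sh(2)[OF e(1)] by simp
    ultimately have R: "?R f f'" by (rule perset_equiv(3))
    \<comment> \<open>The translation is injective, so the transported mass is at most the minimum of the two masses, hence at most their geometric mean.\<close>
    have "card (P f f') \<le> c f'" unfolding c_def P_def using fX fE by (intro card_mono) auto
    moreover have "card (P f f') \<le> c f"
    proof -
     have "card (P f f') = card (sh ` P f f')"
      by (rule card_image[symmetric]) (rule inj_on_subset[OF inj], auto simp: P_def)
     also have "\<dots> \<le> c f" unfolding c_def using fX sh(1) by (intro card_mono) (auto simp: P_def)
     finally show ?thesis .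
    qed
    ultimately have "real (card (P f f')) * real (card (P f f')) \<le> real (c f) * real (c f')"
     by (intro mult_mono) auto
    then have "real (card (P f f')) \<le> sqrt (real (c f) * real (c f'))"
     by (intro real_le_rsqrt) (simp add: power2_eq_square)
    also have "\<dots> = real (card X) * (\<zeta> f * \<zeta> f')"
     using cX0 by (simp add: \<zeta>_def real_sqrt_divide real_sqrt_mult)
    finally show ?thesis using R by simp
   qed
  qed
  also have "\<dots> = real (card X) * overlap Ds \<zeta> p q" by (simp add: overlap_def sum_distrib_left)
  finally have "real (card E) / real (card X) \<le> overlap Ds \<zeta> p q" using cX0 by (simp add: field_simps)
  then show ?thesis using lower overlap_le_1[OF trans z1, of p q] by linarith
 qed
 moreover have "0 \<le> \<zeta> f" for f by (simp add: \<zeta>_def)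
 ultimately show thesis using that[OF trans _ z1] by blast
qed

section \<open>Coefficient matrices\<close>

text \<open>The operator \<open>s\<^sub>\<alpha> s\<^sub>\<beta>\<^sup>*\<close> replaces the initial segment \<open>\<beta>\<close> of \<open>\<nu>\<close> by \<open>\<alpha>\<close>, and in a representation with character
\<open>\<gamma>\<close> the vector of the resulting path is a multiple of the vector of \<open>\<mu>\<close> if the two paths are equivalent.\<close>

definition matching :: "'e \<Rightarrow> 'e \<Rightarrow> 'e \<Rightarrow> 'e \<Rightarrow> bool" where
 "matching \<alpha> \<beta> \<mu> \<nu> \<longleftrightarrow> pfx (d \<beta>) \<nu> = \<beta> \<and> feq \<mu> (\<alpha> \<cdot> sfx (d \<beta>) \<nu>)"

text \<open>The entry at \<open>(\<mu>, \<nu>)\<close> of the matrix of \<open>\<Sum> c s\<^sub>\<alpha> s\<^sub>\<beta>\<^sup>*\<close>, computed as if the vectors \<open>s\<^sub>\<mu> h\<close> were orthonormal.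
It depends on \<open>\<gamma>\<close> but on no representation.\<close>

definition coef :: "(int ^ 'k \<Rightarrow> complex) \<Rightarrow> (complex \<times> 'e \<times> 'e) list \<Rightarrow> 'e \<Rightarrow> 'e \<Rightarrow> complex" where
 "coef \<gamma> L \<mu> \<nu> = (\<Sum>(c, \<alpha>, \<beta>)\<leftarrow>L. if matching \<alpha> \<beta> \<mu> \<nu>
   then c * cnj (\<gamma> (vdiff (d \<mu>) (d (\<alpha> \<cdot> sfx (d \<beta>) \<nu>)))) else 0)"

definition terms_at :: "'e \<Rightarrow> nat ^ 'k \<Rightarrow> (complex \<times> 'e \<times> 'e) list \<Rightarrow> bool" where
 "terms_at w n L \<longleftrightarrow> (\<forall>(c, \<alpha>, \<beta>)\<in>set L. \<alpha> \<in> M \<and> \<beta> \<in> M \<and> s \<alpha> = s \<beta> \<and> r \<alpha> = w \<and> r \<beta> = w \<and> d \<alpha> \<le> n \<and> d \<beta> \<le> n)"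

text \<open>The paths that index the coefficient matrix. Their degrees dominate all degrees in the list, so
every term acts on them by exchanging initial segments.\<close>

definition index_paths :: "'e \<Rightarrow> nat ^ 'k \<Rightarrow> (nat ^ 'k) set \<Rightarrow> 'e set" where
 "index_paths w n Ds = (\<Union>f\<in>Ds. outp w (n + f))"

lemma index_pathsD:
 assumes "\<mu> \<in> index_paths w n Ds"
 shows "\<mu> \<in> M" "r \<mu> = w" "n \<le> d \<mu>" "d \<mu> - n \<in> Ds" "d \<mu> = n + (d \<mu> - n)"
proof -
 obtain f where f: "f \<in> Ds" "\<mu> \<in> M" "r \<mu> = w" "d \<mu> = n + f" using assms by (auto simp: index_paths_def outp_def)
 moreover have "n + f - n = f" by simp
 ultimately show "\<mu> \<in> M" "r \<mu> = w" "n \<le> d \<mu>" "d \<mu> - n \<in> Ds" "d \<mu> = n + (d \<mu> - n)" by auto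
qed

lemma sum_index_paths:
 fixes G :: "'e \<Rightarrow> 'z::comm_monoid_add"
 assumes "w \<in> V" "finite Ds"
 shows "finite (index_paths w n Ds)" "(\<Sum>\<mu>\<in>index_paths w n Ds. G \<mu>) = (\<Sum>f\<in>Ds. \<Sum>\<mu>\<in>outp w (n + f). G \<mu>)"
proof -
 show "finite (index_paths w n Ds)" unfolding index_paths_def using assms outp(1) by blast
 show "(\<Sum>\<mu>\<in>index_paths w n Ds. G \<mu>) = (\<Sum>f\<in>Ds. \<Sum>\<mu>\<in>outp w (n + f). G \<mu>)"
  unfolding index_paths_def using assms outp(1)
  by (intro sum.UNION_disjoint) (auto simp: outp_def)
qed

end

lemma sum_sum_list_swap:
 fixes G :: "'a \<Rightarrow> 'b \<Rightarrow> 'c::comm_monoid_add"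
 shows "(\<Sum>x\<in>J. \<Sum>y\<leftarrow>L. G x y) = (\<Sum>y\<leftarrow>L. \<Sum>x\<in>J. G x y)"
 by (induction L) (auto simp: sum.distrib)

text \<open>What is left of a representation with the invariant \<open>(T, \<gamma>)\<close> on the subgraph of \<open>T\<close>. This is the setting of
the norm estimates.\<close>

locale periodic_rep = directed_kgraph \<Lambda> + ck_ops \<Lambda> H S S'
 for \<Lambda> :: "('e, 'k::finite) kgraph" and H :: "('h, 'n) hilbert_scheme" (structure) and S S' +
 fixes \<gamma> :: "int ^ 'k \<Rightarrow> complex"
 assumes periodic: "\<lbrakk>feq \<mu> \<nu>; h \<in> carrier H\<rbrakk> \<Longrightarrow> S \<mu> h = \<gamma> (vdiff (deg \<Lambda> \<mu>) (deg \<Lambda> \<nu>)) \<odot> S \<nu> h"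
  and unimodular: "p \<in> perset \<Longrightarrow> cmod (\<gamma> p) = 1"
  and nonvanishing: "v \<in> verts \<Lambda> \<Longrightarrow> \<exists>h\<in>carrier H. S v h \<noteq> \<zero>"
begin

lemma periodic': "\<lbrakk>feq \<mu> \<nu>; h \<in> \<H>\<rbrakk> \<Longrightarrow> S' \<mu> h = cnj (\<gamma> (vdiff (d \<mu>) (d \<nu>))) \<odot> S' \<nu> h"
 by (rule hinner_eqI) (use feqD periodic in \<open>auto simp: S'_closed S_closed S'_adj hinner_smult_left hinner_smult_right\<close>)

lemma form_Cons: "form ((c, \<alpha>, \<beta>) # L) h k = c * ip (S' \<beta> h) (S' \<alpha> k) + form L h k"
 by (simp add: form_def)

lemma form_finsum:
 assumes L: "valid_terms L" and J: "finite J" and e: "\<And>j. j \<in> J \<Longrightarrow> e j \<in> \<H>"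
 shows "form L (finsum H (\<lambda>j. \<xi> j \<odot> e j) J) (finsum H (\<lambda>j. \<eta> j \<odot> e j) J)
  = (\<Sum>i\<in>J. \<Sum>j\<in>J. form L (e j) (e i) * \<xi> j * cnj (\<eta> i))"
 using L
proof (induction L)
 case Nil
 then show ?case by (simp add: form_def)
next
 case (Cons x L)
 obtain c \<alpha> \<beta> where x: "x = (c, \<alpha>, \<beta>)" by (cases x)
 have v: "\<alpha> \<in> M" "\<beta> \<in> M" "valid_terms L" using Cons.prems x by (auto simp: valid_terms_def)
 let ?X = "finsum H (\<lambda>j. \<xi> j \<odot> e j) J" and ?Y = "finsum H (\<lambda>j. \<eta> j \<odot> e j) J"
 have XY: "?X \<in> \<H>" "?Y \<in> \<H>" using e by (auto intro!:)
 have "ip (S' \<beta> ?X) (S' \<alpha> ?Y) = ip ?X (S \<beta> (S' \<alpha> ?Y))"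
  using v XY by (simp add: S'_adj S'_closed)
 also have "\<dots> = (\<Sum>j\<in>J. \<xi> j * ip (e j) (S \<beta> (S' \<alpha> ?Y)))"
  using v J e by (simp add: hinner_finsum_left hinner_smult_left S_closed S'_closed)
 also have "\<dots> = (\<Sum>j\<in>J. \<xi> j * ip (S \<alpha> (S' \<beta> (e j))) ?Y)"
  using v e by (intro sum.cong) (simp_all add: S'_adj S_adj S'_closed)
 also have "\<dots> = (\<Sum>j\<in>J. \<xi> j * (\<Sum>i\<in>J. cnj (\<eta> i) * ip (S \<alpha> (S' \<beta> (e j))) (e i)))"
  using v J e by (intro sum.cong) (simp_all add: hinner_finsum_right hinner_smult_right S_closed S'_closed)
 also have "\<dots> = (\<Sum>j\<in>J. \<Sum>i\<in>J. ip (S' \<beta> (e j)) (S' \<alpha> (e i)) * \<xi> j * cnj (\<eta> i))"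
  using v e by (intro sum.cong) (simp_all add: sum_distrib_left S_adj S'_closed mult_ac)
 also have "\<dots> = (\<Sum>i\<in>J. \<Sum>j\<in>J. ip (S' \<beta> (e j)) (S' \<alpha> (e i)) * \<xi> j * cnj (\<eta> i))"
  by (rule sum.swap)
 finally show ?case
  using Cons.IH[OF v(3)] x by (simp add: form_Cons sum.distrib distrib_right sum_distrib_left mult.assoc)
qed

lemma unit_vector:
 assumes "v \<in> V"
 obtains h where "h \<in> \<H>" "S v h = h" "ip h h = 1"
proof -
 obtain h where h: "h \<in> \<H>" "S v h \<noteq> \<zero>" using nonvanishing[OF assms] by blast
 let ?k = "S v h"
 have k: "?k \<in> \<H>" using S_closed vertsD(1)[OF assms] h by blast
 define t where "t = nrm ?k"
 have t: "t > 0" using hnorm_eq_0[OF k] hnorm_nonneg[OF k] h by (simp add: t_def)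
 let ?h = "complex_of_real (1 / t) \<odot> ?k"
 have kk: "ip ?k ?k = complex_of_real (t\<^sup>2)" using hinner_self[OF k] by (simp add: t_def)
 have "S v (c \<odot> ?k) = c \<odot> ?k" for c
  by (rule hinner_eqI)
   (use k vertsD(1)[OF assms] S_vert[OF assms] S_vert_idem[OF assms h(1)] S_adj[of v ?k] in
    \<open>simp_all add: S_closed S_adj hinner_smult_left\<close>)
 moreover have "ip ?h ?h = 1"
  using k kk t by (simp add: hinner_smult_left hinner_smult_right power2_eq_square)
 ultimately show thesis using that[of ?h] k by simp
qed

text \<open>Fix the common source \<open>v\<close> of the paths and a path \<open>\<tau>\<close> from \<open>v\<close> that separates all the finitely many
pairs whose degrees do not differ by a period. Then the vectors \<open>s\<^sub>\<mu> s\<^sub>\<tau> h\<close> are orthonormal for a suitable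
unit vector \<open>h\<close>, and \<open>coef\<close> is the matrix of the operator with respect to them.\<close>

lemma coef_block_bound:
 assumes w: "w \<in> periodic_verts" and L: "terms_at w n L" and Ds: "transversal Ds" and v: "v \<in> V"
  and bound: "\<And>x y. \<lbrakk>x \<in> \<H>; y \<in> \<H>\<rbrakk> \<Longrightarrow> cmod (form L x y) \<le> \<epsilon> * nrm x * nrm y"
 defines "J \<equiv> {\<mu> \<in> index_paths w n Ds. s \<mu> = v}"
 shows "cmod (\<Sum>\<mu>\<in>J. \<Sum>\<nu>\<in>J. coef \<gamma> L \<mu> \<nu> * \<xi> \<nu> * cnj (\<eta> \<mu>))
  \<le> \<epsilon> * (sqrt (\<Sum>\<nu>\<in>J. (cmod (\<xi> \<nu>))\<^sup>2) * sqrt (\<Sum>\<mu>\<in>J. (cmod (\<eta> \<mu>))\<^sup>2))"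
proof -
 have wv: "w \<in> V" using w by (simp add: periodic_verts_def)
 have fF: "finite Ds" using Ds by (simp add: transversal_def)
 have fJ: "finite J" unfolding J_def using sum_index_paths(1)[OF wv fF, of n] by simp
 have J: "\<mu> \<in> M" "r \<mu> = w" "n \<le> d \<mu>" "d \<mu> - n \<in> Ds" "d \<mu> = n + (d \<mu> - n)" "s \<mu> = v" if "\<mu> \<in> J" for \<mu>
  using index_pathsD that by (auto simp: J_def)
 have T: "\<alpha> \<in> M" "\<beta> \<in> M" "s \<alpha> = s \<beta>" "r \<alpha> = w" "r \<beta> = w" "d \<alpha> \<le> n" "d \<beta> \<le> n" if "(c, \<alpha>, \<beta>) \<in> set L" for c \<alpha> \<beta>
  using L that by (auto simp: terms_at_def)
 \<comment> \<open>The operators strip the segments \<open>\<alpha>\<close>, \<open>\<beta>\<close> from paths of \<open>J\<close>; all the resulting remainders, and the paths themselves, are to be separated.\<close>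
 define Q where "Q = insert 0 ((\<lambda>(c, \<alpha>, \<beta>). d \<alpha>) ` set L \<union> (\<lambda>(c, \<alpha>, \<beta>). d \<beta>) ` set L)"
 have Q: "q \<le> n" if "q \<in> Q" for q using that T by (auto simp: Q_def)
 define P where "P = (\<lambda>(q, \<mu>). sfx q \<mu>) ` (Q \<times> J)"
 have fP: "finite P" unfolding P_def Q_def using fJ by simp
 have PM: "a \<in> M \<and> s a = v" if "a \<in> P" for a
 proof -
  obtain q \<mu> where "q \<in> Q" "\<mu> \<in> J" "a = sfx q \<mu>" using \<open>a \<in> P\<close> by (auto simp: P_def)
  then show ?thesis using pfx_sfx J[of \<mu>] Q[of q] by auto
 qed
 have JP: "\<mu> \<in> P" if "\<mu> \<in> J" for \<mu>
 proof -
  have "(0, \<mu>) \<in> Q \<times> J" using that by (simp add: Q_def)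
  then have "(\<lambda>(q, \<mu>). sfx q \<mu>) (0, \<mu>) \<in> P" unfolding P_def by (rule imageI)
  then show ?thesis using pfx_0(2)[OF J(1)[OF that]] by simp
 qed
 define Z where "Z = {(a, b) \<in> P \<times> P. vdiff (d a) (d b) \<notin> perset}"
 have fZ: "finite Z" unfolding Z_def by (rule finite_subset[of _ "P \<times> P"]) (use fP in auto)
 obtain \<tau> where t: "\<tau> \<in> M" "r \<tau> = v" "\<And>a b. (a, b) \<in> Z \<Longrightarrow> \<not> compat (a \<cdot> \<tau>) (b \<cdot> \<tau>)"
  by (rule separate[OF fZ v]) (use PM in \<open>auto simp: Z_def\<close>)
 obtain h where h: "h \<in> \<H>" "S (s \<tau>) h = h" "ip h h = 1" using unit_vector[OF src_verts[OF t(1)]] .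
 define e where "e \<mu> = S (\<mu> \<cdot> \<tau>) h" for \<mu>
 have at: "a \<cdot> \<tau> \<in> M" "s (a \<cdot> \<tau>) = s \<tau>" "d (a \<cdot> \<tau>) = d a + d \<tau>" "s a = r \<tau>" if "a \<in> M" "s a = v" for a
  using that t by (auto simp: cmp_closed src_cmp deg_cmp)
 have ec: "e a \<in> \<H>" if "a \<in> M" "s a = v" for a using at that S_closed h by (simp add: e_def)
 have unit: "ip (e a) (e a) = 1" if "a \<in> M" "s a = v" for a
  using S_inner at[OF that] h by (simp add: e_def)
 have same: "ip (e a) (e b) = 0" if "a \<in> M" "s a = v" "b \<in> M" "s b = v" "d a = d b" "a \<noteq> b" for a b
  by (metis cmp_cancel that t S'_S_same_degree at _ h S'_adj ec e_def hinner_zero_left)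
 have diff: "ip (e a) (e b) = 0" if "a \<in> P" "b \<in> P" "vdiff (d a) (d b) \<notin> perset" for a b
  unfolding e_def using t(3) that PM at h by (intro incompatible_orth) (auto simp: Z_def)
 have orth: "ip (e \<mu>) (e \<nu>) = (if \<mu> = \<nu> then 1 else 0)" if "\<mu> \<in> J" "\<nu> \<in> J" for \<mu> \<nu>
  by (smt (verit) same unit J that Ds transversal_def vdiff_simps diff JP)
 \<comment> \<open>The matrix of the form with respect to the orthonormal vectors \<open>e \<nu>\<close>.\<close>
 have entry: "form L (e \<nu>) (e \<mu>) = coef \<gamma> L \<mu> \<nu>" if m: "\<mu> \<in> J" and nn: "\<nu> \<in> J" for \<mu> \<nu>
  unfolding form_def coef_def
 proof (intro arg_cong[where f = sum_list] map_cong refl)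
  fix x assume x: "x \<in> set L"
  obtain c \<alpha> \<beta> where xx: "x = (c, \<alpha>, \<beta>)" by (cases x)
  note T = T[OF x[unfolded xx]]
  note jm = J[OF m] and jn = J[OF nn]
  have le: "d \<alpha> \<le> d \<mu>" "d \<beta> \<le> d \<nu>" using T jm(3) jn(3) by auto
  note pm = pfx_sfx[OF jm(1) le(1)] and pn = pfx_sfx[OF jn(1) le(2)]
  have tm: "s \<mu> = r \<tau>" "s \<nu> = r \<tau>" using jm jn t by auto
  have stm: "sfx p (\<kappa> \<cdot> \<tau>) = sfx p \<kappa> \<cdot> \<tau>" "pfx p (\<kappa> \<cdot> \<tau>) = pfx p \<kappa>"
   if k: "\<kappa> \<in> M" "s \<kappa> = r \<tau>" "p \<le> d \<kappa>" for \<kappa> p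
  proof -
   note q = pfx_sfx[OF k(1,3)]
   have 1: "sfx p \<kappa> \<cdot> \<tau> \<in> M" "s (pfx p \<kappa>) = r (sfx p \<kappa> \<cdot> \<tau>)" using q k t by (auto simp: cmp_closed rng_cmp)
   have "pfx p \<kappa> \<cdot> (sfx p \<kappa> \<cdot> \<tau>) = \<kappa> \<cdot> \<tau>"
    using cmp_assoc[OF q(1,2) t(1) q(5)] q k by simp
   from pfx_unique[OF q(1) 1 this q(3)] show "sfx p (\<kappa> \<cdot> \<tau>) = sfx p \<kappa> \<cdot> \<tau>" "pfx p (\<kappa> \<cdot> \<tau>) = pfx p \<kappa>" by auto
  qed
  have Sm: "S' \<alpha> (e \<mu>) = (if pfx (d \<alpha>) \<mu> = \<alpha> then e (sfx (d \<alpha>) \<mu>) else \<zero>)"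
   unfolding e_def using S'_S_prefix[OF T(1) at(1)[OF jm(1,6)] _ h(1)] stm[OF jm(1) tm(1) le(1)] at(3)[OF jm(1,6)] le
   by (simp add: vec_le_diff)
  have Sn: "S' \<beta> (e \<nu>) = (if pfx (d \<beta>) \<nu> = \<beta> then e (sfx (d \<beta>) \<nu>) else \<zero>)"
   unfolding e_def using S'_S_prefix[OF T(2) at(1)[OF jn(1,6)] _ h(1)] stm[OF jn(1) tm(2) le(2)] at(3)[OF jn(1,6)] le
   by (simp add: vec_le_diff)
  let ?m = "sfx (d \<alpha>) \<mu>" and ?n = "sfx (d \<beta>) \<nu>"
  have sm: "?m \<in> M" "s ?m = v" "?n \<in> M" "s ?n = v" using pm pn jm jn by auto
  have mat: "pfx (d \<alpha>) \<mu> = \<alpha>" if "feq \<mu> (\<alpha> \<cdot> ?n)" "pfx (d \<beta>) \<nu> = \<beta>"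
   using that pn T deg_cmp feq_sfx le pfx_cmp by simp
  show "(case x of (c, \<alpha>, \<beta>) \<Rightarrow> c * ip (S' \<beta> (e \<nu>)) (S' \<alpha> (e \<mu>))) =
    (case x of (c, \<alpha>, \<beta>) \<Rightarrow> if matching \<alpha> \<beta> \<mu> \<nu>
     then c * cnj (\<gamma> (vdiff (d \<mu>) (d (\<alpha> \<cdot> sfx (d \<beta>) \<nu>)))) else 0)"
  proof (cases "pfx (d \<beta>) \<nu> = \<beta> \<and> pfx (d \<alpha>) \<mu> = \<alpha>")
   case False
   then have "\<not> matching \<alpha> \<beta> \<mu> \<nu>" using mat by (auto simp: matching_def)
   moreover have "ip (S' \<beta> (e \<nu>)) (S' \<alpha> (e \<mu>)) = 0"
    using False Sm Sn ec[OF sm(1,2)] ec[OF sm(3,4)] by (auto simp: hinner_zero_left hinner_zero_right)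
   ultimately show ?thesis by (simp add: xx)
  next
   case True
   have a: "s \<alpha> = r ?n" "s \<alpha> = r ?m" using True pn(5) pm(5) T(3) by auto
   have mu: "\<mu> = \<alpha> \<cdot> ?m" using pm(6) True by simp
   have fiff: "feq \<mu> (\<alpha> \<cdot> ?n) \<longleftrightarrow> feq ?m ?n"
    using feq_cancel[OF _ T(1) sm(1,3)] feq_cmp_left[OF _ T(1), of ?m ?n] a mu by metis
   have dd: "vdiff (d \<mu>) (d (\<alpha> \<cdot> ?n)) = vdiff (d ?m) (d ?n)"
    using deg_cmp[OF T(1) sm(1) a(2)] deg_cmp[OF T(1) sm(3) a(1)] mu by simp
   have "ip (e ?n) (e ?m) = (if feq ?m ?n then cnj (\<gamma> (vdiff (d ?m) (d ?n))) else 0)"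
   proof (cases "feq ?m ?n")
    case f: True
    have "feq (?m \<cdot> \<tau>) (?n \<cdot> \<tau>)" using feq_cmp_right[OF f t(1)] sm t by simp
    then have "e ?m = \<gamma> (vdiff (d ?m) (d ?n)) \<odot> e ?n"
     unfolding e_def using periodic[OF _ h(1)] at(3)[OF sm(1,2)] at(3)[OF sm(3,4)] by simp
    then show ?thesis using f unit[OF sm(3,4)] ec[OF sm(3,4)] by (simp add: hinner_smult_right)
   next
    case nf: False
    show ?thesis
    proof (cases "vdiff (d ?n) (d ?m) \<in> perset")
     case True
     \<comment> \<open>A path \<open>\<rho>\<close> of the degree of \<open>?m\<close> is equivalent to \<open>?n\<close> but differs from \<open>?m\<close>, so orthogonality holds for equal degrees.\<close>
     have "r ?n \<in> periodic_verts" using periodic_verts_hereditary[OF w T(1,4)] a by simp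
     then obtain \<rho> where p: "\<rho> \<in> M" "d \<rho> = d ?m" "feq ?n \<rho>"
      using periodic_verts_swap[OF _ sm(3) refl True] by metis
     have "\<rho> \<noteq> ?m" using nf p(3) feq_sym by blast
     have sr: "s \<rho> = v" using feqD(3)[OF p(3)] sm by simp
     have "feq (?n \<cdot> \<tau>) (\<rho> \<cdot> \<tau>)" using feq_cmp_right[OF p(3) t(1)] sm t by simp
     then have "e ?n = \<gamma> (vdiff (d ?n) (d \<rho>)) \<odot> e \<rho>"
      unfolding e_def using periodic[OF _ h(1)] at(3)[OF sm(3,4)] at(3)[OF p(1) sr] by simp
     then show ?thesis
      using nf same[OF p(1) sr sm(1,2) p(2) \<open>\<rho> \<noteq> ?m\<close>] ec[OF p(1) sr] ec[OF sm(1,2)] by (simp add: hinner_smult_left)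
    next
     case False
     have "d \<alpha> \<in> Q" "d \<beta> \<in> Q" using x xx unfolding Q_def by force+
     then have "?m \<in> P" "?n \<in> P"
      using imageI[of "(d \<alpha>, \<mu>)" "Q \<times> J" "\<lambda>(q, \<mu>). sfx q \<mu>"] imageI[of "(d \<beta>, \<nu>)" "Q \<times> J" "\<lambda>(q, \<mu>). sfx q \<mu>"]
       m nn by (simp_all add: P_def)
     then show ?thesis using nf diff False by simp
    qed
   qed
   then show ?thesis using True Sm Sn fiff dd by (simp add: xx matching_def)
  qed
 qed
 let ?X = "finsum H (\<lambda>\<nu>. \<xi> \<nu> \<odot> e \<nu>) J" and ?Y = "finsum H (\<lambda>\<nu>. \<eta> \<nu> \<odot> e \<nu>) J"
 have eJ: "e \<mu> \<in> \<H>" if "\<mu> \<in> J" for \<mu> using ec J that by blast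
 have cl: "finsum H (\<lambda>\<nu>. \<zeta> \<nu> \<odot> e \<nu>) J \<in> \<H>" for \<zeta> using eJ by (auto intro!:)
 have nrm: "nrm (finsum H (\<lambda>\<nu>. \<zeta> \<nu> \<odot> e \<nu>) J) = sqrt (\<Sum>\<nu>\<in>J. (cmod (\<zeta> \<nu>))\<^sup>2)" for \<zeta>
 proof -
  let ?W = "finsum H (\<lambda>\<nu>. \<zeta> \<nu> \<odot> e \<nu>) J"
  have "ip ?W ?W = (\<Sum>\<mu>\<in>J. \<zeta> \<mu> * (\<Sum>\<nu>\<in>J. cnj (\<zeta> \<nu>) * ip (e \<mu>) (e \<nu>)))"
  proof -
   have "ip ?W ?W = (\<Sum>\<mu>\<in>J. \<zeta> \<mu> * ip (e \<mu>) ?W)"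
    using fJ eJ by (simp add: hinner_finsum_left hinner_smult_left)
   also have "\<dots> = (\<Sum>\<mu>\<in>J. \<zeta> \<mu> * (\<Sum>\<nu>\<in>J. cnj (\<zeta> \<nu>) * ip (e \<mu>) (e \<nu>)))"
    using fJ eJ by (intro sum.cong refl) (simp add: hinner_finsum_right hinner_smult_right)
   finally show ?thesis .
  qed
  also have "\<dots> = (\<Sum>\<mu>\<in>J. \<zeta> \<mu> * cnj (\<zeta> \<mu>))"
  proof (intro sum.cong refl)
   fix \<mu> assume m: "\<mu> \<in> J"
   have "(\<Sum>\<nu>\<in>J. cnj (\<zeta> \<nu>) * ip (e \<mu>) (e \<nu>)) = (\<Sum>\<nu>\<in>J. if \<nu> = \<mu> then cnj (\<zeta> \<mu>) else 0)"
    using orth[OF m] by (intro sum.cong) auto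
   then show "\<zeta> \<mu> * (\<Sum>\<nu>\<in>J. cnj (\<zeta> \<nu>) * ip (e \<mu>) (e \<nu>)) = \<zeta> \<mu> * cnj (\<zeta> \<mu>)" using fJ m by simp
  qed
  also have "\<dots> = complex_of_real (\<Sum>\<nu>\<in>J. (cmod (\<zeta> \<nu>))\<^sup>2)" by (simp only: complex_norm_square of_real_sum)
  finally show ?thesis unfolding hnorm_def by (simp only: Re_complex_of_real)
 qed
 have vL: "valid_terms L" using L by (auto simp: terms_at_def valid_terms_def)
 have "(\<Sum>\<mu>\<in>J. \<Sum>\<nu>\<in>J. coef \<gamma> L \<mu> \<nu> * \<xi> \<nu> * cnj (\<eta> \<mu>)) = form L ?X ?Y"
  using form_finsum[OF vL fJ eJ] entry by simp
 then show ?thesis using bound[OF cl cl, of \<xi> \<eta>] nrm by simp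
qed

end

context periodic_rep
begin

lemma coef_source:
 assumes L: "terms_at w n L" and m: "coef \<gamma> L \<mu> \<nu> \<noteq> 0" and nu: "\<nu> \<in> M" "n \<le> d \<nu>"
 shows "s \<mu> = s \<nu>"
proof (rule ccontr)
 assume ne: "s \<mu> \<noteq> s \<nu>"
 have "coef \<gamma> L \<mu> \<nu> = (\<Sum>x\<leftarrow>L. 0)"
  unfolding coef_def
 proof (intro arg_cong[where f = sum_list] map_cong refl)
  fix x assume x: "x \<in> set L"
  obtain c \<alpha> \<beta> where xx: "x = (c, \<alpha>, \<beta>)" by (cases x)
  have T: "\<alpha> \<in> M" "\<beta> \<in> M" "s \<alpha> = s \<beta>" "d \<beta> \<le> n" using L x xx by (auto simp: terms_at_def)
  have le: "d \<beta> \<le> d \<nu>" using T(4) nu(2) by (rule order_trans)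
  note p = pfx_sfx[OF nu(1) le]
  have "\<not> matching \<alpha> \<beta> \<mu> \<nu>"
   using p T matching_def src_cmp feqD ne by auto
  then show "(case x of (c, \<alpha>, \<beta>) \<Rightarrow> if matching \<alpha> \<beta> \<mu> \<nu>
     then c * cnj (\<gamma> (vdiff (d \<mu>) (d (\<alpha> \<cdot> sfx (d \<beta>) \<nu>)))) else 0) = 0" by (simp add: xx)
 qed
 then show False using m by simp
qed

text \<open>The coefficient matrix is block diagonal with respect to the sources of the paths.\<close>

lemma coef_bound:
 assumes w: "w \<in> periodic_verts" and L: "terms_at w n L" and Ds: "transversal Ds" and eps: "\<epsilon> \<ge> 0"
  and bound: "\<And>x y. \<lbrakk>x \<in> \<H>; y \<in> \<H>\<rbrakk> \<Longrightarrow> cmod (form L x y) \<le> \<epsilon> * nrm x * nrm y"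
 defines "J \<equiv> index_paths w n Ds"
 shows "cmod (\<Sum>\<mu>\<in>J. \<Sum>\<nu>\<in>J. coef \<gamma> L \<mu> \<nu> * \<xi> \<nu> * cnj (\<eta> \<mu>))
  \<le> \<epsilon> * (sqrt (\<Sum>\<nu>\<in>J. (cmod (\<xi> \<nu>))\<^sup>2) * sqrt (\<Sum>\<mu>\<in>J. (cmod (\<eta> \<mu>))\<^sup>2))"
proof -
 have wv: "w \<in> V" using w by (simp add: periodic_verts_def)
 have fF: "finite Ds" using Ds by (simp add: transversal_def)
 have fJ: "finite J" unfolding J_def by (rule sum_index_paths(1)[OF wv fF])
 have J: "\<mu> \<in> M" "n \<le> d \<mu>" if "\<mu> \<in> J" for \<mu> using index_pathsD that by (auto simp: J_def)
 define W where "W = s ` J"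
 define blk where "blk v = {\<mu> \<in> J. s \<mu> = v}" for v
 have group: "(\<Sum>\<mu>\<in>J. f \<mu>) = (\<Sum>v\<in>W. \<Sum>\<mu>\<in>blk v. f \<mu>)" for f :: "'e \<Rightarrow> 'z::comm_monoid_add"
  unfolding blk_def W_def by (rule sum.image_gen[OF fJ])
 define a where "a v = sqrt (\<Sum>\<nu>\<in>blk v. (cmod (\<xi> \<nu>))\<^sup>2)" for v
 define b where "b v = sqrt (\<Sum>\<nu>\<in>blk v. (cmod (\<eta> \<nu>))\<^sup>2)" for v
 have ab: "a v \<ge> 0" "b v \<ge> 0" "(a v)\<^sup>2 = (\<Sum>\<nu>\<in>blk v. (cmod (\<xi> \<nu>))\<^sup>2)" "(b v)\<^sup>2 = (\<Sum>\<nu>\<in>blk v. (cmod (\<eta> \<nu>))\<^sup>2)" for v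
  by (auto simp: a_def b_def sum_nonneg)
 have "(\<Sum>\<mu>\<in>J. \<Sum>\<nu>\<in>J. coef \<gamma> L \<mu> \<nu> * \<xi> \<nu> * cnj (\<eta> \<mu>))
   = (\<Sum>v\<in>W. \<Sum>\<mu>\<in>blk v. \<Sum>\<nu>\<in>blk v. coef \<gamma> L \<mu> \<nu> * \<xi> \<nu> * cnj (\<eta> \<mu>))"
  unfolding group[of "\<lambda>\<mu>. \<Sum>\<nu>\<in>J. coef \<gamma> L \<mu> \<nu> * \<xi> \<nu> * cnj (\<eta> \<mu>)"]
 proof (rule sum.cong[OF refl], rule sum.cong[OF refl])
  fix v \<mu> assume "v \<in> W" and m: "\<mu> \<in> blk v"
  show "(\<Sum>\<nu>\<in>J. coef \<gamma> L \<mu> \<nu> * \<xi> \<nu> * cnj (\<eta> \<mu>)) = (\<Sum>\<nu>\<in>blk v. coef \<gamma> L \<mu> \<nu> * \<xi> \<nu> * cnj (\<eta> \<mu>))"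
  proof (rule sum.mono_neutral_right[OF fJ])
   show "blk v \<subseteq> J" by (auto simp: blk_def)
   show "\<forall>\<nu>\<in>J - blk v. coef \<gamma> L \<mu> \<nu> * \<xi> \<nu> * cnj (\<eta> \<mu>) = 0"
    using coef_source[OF L _ J] m by (auto simp: blk_def)
  qed
 qed
 also have "cmod \<dots> \<le> (\<Sum>v\<in>W. \<epsilon> * (a v * b v))"
 proof (rule sum_norm_le)
  fix v assume "v \<in> W"
  then have v: "v \<in> V" using J src_verts by (auto simp: W_def)
  show "cmod (\<Sum>\<mu>\<in>blk v. \<Sum>\<nu>\<in>blk v. coef \<gamma> L \<mu> \<nu> * \<xi> \<nu> * cnj (\<eta> \<mu>)) \<le> \<epsilon> * (a v * b v)"
   unfolding a_def b_def blk_def J_def by (rule coef_block_bound[OF w L Ds v]) (rule bound)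
 qed
 also have "\<dots> = \<epsilon> * (\<Sum>v\<in>W. \<bar>a v\<bar> * \<bar>b v\<bar>)" using ab by (simp add: sum_distrib_left)
 also have "\<dots> \<le> \<epsilon> * (L2_set a W * L2_set b W)" using eps by (intro mult_left_mono L2_set_mult_ineq)
 also have "L2_set a W = sqrt (\<Sum>\<nu>\<in>J. (cmod (\<xi> \<nu>))\<^sup>2)" unfolding L2_set_def by (simp add: ab group)
 also have "L2_set b W = sqrt (\<Sum>\<nu>\<in>J. (cmod (\<eta> \<nu>))\<^sup>2)" unfolding L2_set_def by (simp add: ab group)
 finally show ?thesis .
qed

text \<open>Insert the vectors \<open>\<zeta> s\<^sub>\<nu>\<^sup>* h\<close> into the matrix. For given \<open>\<nu> = \<beta> \<nu>'\<close> and a given degree there is at most one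
path \<open>\<mu>\<close> equivalent to \<open>\<alpha> \<nu>'\<close>, and there is one if and only if the degrees differ by a period, since
\<open>w\<close> is a periodic vertex. The phases cancel, the sum over \<open>\<nu>'\<close> collapses by the Cuntz--Krieger
relation, and the weights add up to the overlap.\<close>

lemma averaged_term:
 assumes w: "w \<in> periodic_verts" and Ds: "transversal Ds"
  and T: "\<alpha> \<in> M" "\<beta> \<in> M" "s \<alpha> = s \<beta>" "r \<alpha> = w" "r \<beta> = w" "d \<alpha> \<le> n" "d \<beta> \<le> n"
  and h: "h \<in> \<H>" and k: "k \<in> \<H>"
 defines "J \<equiv> index_paths w n Ds"
 shows "(\<Sum>\<nu>\<in>J. \<Sum>\<mu>\<in>J. (if matching \<alpha> \<beta> \<mu> \<nu> then cnj (\<gamma> (vdiff (d \<mu>) (d (\<alpha> \<cdot> sfx (d \<beta>) \<nu>)))) else 0)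
   * ip (complex_of_real (\<zeta> (d \<nu> - n)) \<odot> S' \<nu> h) (complex_of_real (\<zeta> (d \<mu> - n)) \<odot> S' \<mu> k))
  = overlap Ds \<zeta> (d \<alpha>) (d \<beta>) * ip (S' \<beta> h) (S' \<alpha> k)"
  (is "(\<Sum>\<nu>\<in>J. \<Sum>\<mu>\<in>J. ?t \<mu> \<nu>) = _")
proof -
 have wv: "w \<in> V" using w by (simp add: periodic_verts_def)
 have fF: "finite Ds" using Ds by (simp add: transversal_def)
 let ?R = "\<lambda>f f'. vdiff (f + d \<beta>) (f' + d \<alpha>) \<in> perset"
 \<comment> \<open>For fixed \<open>\<nu>\<close> at most one path \<open>\<mu>\<close> of each degree matches.\<close>
 have inner: "(\<Sum>\<mu>\<in>outp w (n + f). ?t \<mu> \<nu>) =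
   (if ?R f f' \<and> pfx (d \<beta>) \<nu> = \<beta> then \<zeta> f * \<zeta> f' * ip (S' \<nu> h) (S' (\<alpha> \<cdot> sfx (d \<beta>) \<nu>) k) else 0)"
  if nu: "\<nu> \<in> outp w (n + f')" for f f' \<nu>
 proof (cases "pfx (d \<beta>) \<nu> = \<beta>")
  case False
  then show ?thesis by (simp add: matching_def)
 next
  case True
  have nM: "\<nu> \<in> M" "d \<nu> = n + f'" using nu by (auto simp: outp_def)
  have le: "d \<beta> \<le> d \<nu>" using T(7) nM by (simp add: order_trans)
  note p = pfx_sfx[OF nM(1) le]
  let ?\<kappa> = "\<alpha> \<cdot> sfx (d \<beta>) \<nu>"
  have a: "s \<alpha> = r (sfx (d \<beta>) \<nu>)" using T(3) True p(5) by simp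
  have kap: "?\<kappa> \<in> M" "r ?\<kappa> = w" "d ?\<kappa> = d \<alpha> + d (sfx (d \<beta>) \<nu>)"
   using cmp_closed[OF T(1) p(2) a] rng_cmp[OF T(1) p(2) a] deg_cmp[OF T(1) p(2) a] T(4) by auto
  have "d \<beta> + d (sfx (d \<beta>) \<nu>) = n + f'" using deg_cmp[OF p(1,2,5)] p(3,6) nM(2) by simp
  then have dk: "vdiff (n + f) (d ?\<kappa>) = vdiff (f + d \<beta>) (f' + d \<alpha>)"
   unfolding vdiff_eq_iff kap(3) by (metis (no_types, opaque_lifting) add.assoc add.commute)
  have mt: "matching \<alpha> \<beta> \<mu> \<nu> \<longleftrightarrow> feq \<mu> ?\<kappa>" for \<mu> using True by (simp add: matching_def)
  show ?thesis
  proof (cases "?R f f'")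
   case False
   have "\<not> matching \<alpha> \<beta> \<mu> \<nu>" if m: "\<mu> \<in> outp w (n + f)" for \<mu>
    using mt perset_def False dk m outp_def by simp
   then show ?thesis using False by simp
  next
   case R: True
   have "vdiff (d ?\<kappa>) (n + f) \<in> perset" using R dk perset_equiv(2) by metis
   then obtain \<mu>0 where m0: "\<mu>0 \<in> M" "r \<mu>0 = w" "d \<mu>0 = n + f" "feq ?\<kappa> \<mu>0"
    using periodic_verts_swap[OF w kap(1,2)] by blast
   have only: "matching \<alpha> \<beta> \<mu> \<nu> \<longleftrightarrow> \<mu> = \<mu>0" if "\<mu> \<in> outp w (n + f)" for \<mu>
   proof
    assume "matching \<alpha> \<beta> \<mu> \<nu>"
    then have "feq \<mu> \<mu>0" using feq_trans[OF _ m0(4)] mt by blast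
    then show "\<mu> = \<mu>0" using feq_same_deg that m0(3) by (simp add: outp_def)
   next
    assume "\<mu> = \<mu>0" then show "matching \<alpha> \<beta> \<mu> \<nu>" using mt feq_sym[OF m0(4)] by simp
   qed
   let ?z = "\<gamma> (vdiff (d \<mu>0) (d ?\<kappa>))"
   have per: "vdiff (d \<mu>0) (d ?\<kappa>) \<in> perset" unfolding perset_def using feq_sym[OF m0(4)] by blast
   have "(\<Sum>\<mu>\<in>outp w (n + f). ?t \<mu> \<nu>) = (\<Sum>\<mu>\<in>outp w (n + f). if \<mu> = \<mu>0 then ?t \<mu>0 \<nu> else 0)"
    using only by (intro sum.cong) auto
   also have "\<dots> = ?t \<mu>0 \<nu>" using outp(1)[OF wv, of "n + f"] m0 by (simp add: outp_def)
   also have "\<dots> = cnj ?z * (\<zeta> f' * (\<zeta> f * ip (S' \<nu> h) (S' \<mu>0 k)))"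
    using only m0 nM S'_closed h k by (simp add: outp_def hinner_smult_left hinner_smult_right)
   also have "S' \<mu>0 k = cnj ?z \<odot> S' ?\<kappa> k" by (rule periodic'[OF feq_sym[OF m0(4)] k])
   also have "cnj ?z * (\<zeta> f' * (\<zeta> f * ip (S' \<nu> h) (cnj ?z \<odot> S' ?\<kappa> k))) =
     (cnj ?z * ?z) * (\<zeta> f * \<zeta> f' * ip (S' \<nu> h) (S' ?\<kappa> k))"
    using S'_closed nM kap h k by (simp add: hinner_smult_right)
   also have "cnj ?z * ?z = 1"
    using unimodular[OF per] complex_norm_square[of ?z] by (simp add: mult.commute)
   finally show ?thesis using True R by simp
  qed
 qed
 have outer: "(\<Sum>\<nu>\<in>outp w (n + f'). if pfx (d \<beta>) \<nu> = \<beta> then ip (S' \<nu> h) (S' (\<alpha> \<cdot> sfx (d \<beta>) \<nu>) k) else 0)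
   = ip (S' \<beta> h) (S' \<alpha> k)" for f'
 proof -
  define m where "m = n + f' - d \<beta>"
  have "d \<beta> \<le> n + f'" using T(7) by (simp add: order_trans)
  then have m: "d \<beta> + m = n + f'" by (simp add: m_def)
  have "ip (S' \<beta> h) (S' \<alpha> k) = (\<Sum>\<tau>\<in>outp (s \<beta>) m. ip (S' (\<beta> \<cdot> \<tau>) h) (S' (\<alpha> \<cdot> \<tau>) k))"
   by (rule expand) (use T h k in auto)
  also have "\<dots> = (\<Sum>\<nu>\<in>{\<nu> \<in> outp w (n + f'). pfx (d \<beta>) \<nu> = \<beta>}. ip (S' \<nu> h) (S' (\<alpha> \<cdot> sfx (d \<beta>) \<nu>) k))"
  proof (rule sum.reindex_bij_witness[where i = "sfx (d \<beta>)" and j = "\<lambda>\<tau>. \<beta> \<cdot> \<tau>"])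
   fix \<tau> assume t: "\<tau> \<in> outp (s \<beta>) m"
   then have tt: "\<tau> \<in> M" "s \<beta> = r \<tau>" "d \<tau> = m" by (auto simp: outp_def)
   note pp = pfx_cmp[OF T(2) tt(1,2)]
   show "sfx (d \<beta>) (\<beta> \<cdot> \<tau>) = \<tau>" by (rule pp)
   show "\<beta> \<cdot> \<tau> \<in> {\<nu> \<in> outp w (n + f'). pfx (d \<beta>) \<nu> = \<beta>}"
    using pp cmp_closed rng_cmp deg_cmp tt m T by (simp add: outp_def)
   show "ip (S' (\<beta> \<cdot> \<tau>) h) (S' (\<alpha> \<cdot> sfx (d \<beta>) (\<beta> \<cdot> \<tau>)) k) = ip (S' (\<beta> \<cdot> \<tau>) h) (S' (\<alpha> \<cdot> \<tau>) k)"
    by (simp only: pp(2))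
  next
   fix \<nu> assume "\<nu> \<in> {\<nu> \<in> outp w (n + f'). pfx (d \<beta>) \<nu> = \<beta>}"
   then have nn: "\<nu> \<in> M" "d \<nu> = n + f'" "pfx (d \<beta>) \<nu> = \<beta>" by (auto simp: outp_def)
   have "d \<beta> \<le> d \<nu>" using nn m by (metis vec_le_add(1))
   note p = pfx_sfx[OF nn(1) this]
   show "\<beta> \<cdot> sfx (d \<beta>) \<nu> = \<nu>" using p(6) nn(3) by simp
   show "sfx (d \<beta>) \<nu> \<in> outp (s \<beta>) m" using p(2,4,5) nn by (simp add: outp_def m_def)
  qed
  also have "\<dots> = (\<Sum>\<nu>\<in>outp w (n + f'). if pfx (d \<beta>) \<nu> = \<beta> then ip (S' \<nu> h) (S' (\<alpha> \<cdot> sfx (d \<beta>) \<nu>) k) else 0)"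
   by (rule sum.inter_filter[OF outp(1)[OF wv]])
  finally show ?thesis by simp
 qed
 have "(\<Sum>\<nu>\<in>J. \<Sum>\<mu>\<in>J. ?t \<mu> \<nu>) = (\<Sum>f'\<in>Ds. \<Sum>\<nu>\<in>outp w (n + f'). \<Sum>f\<in>Ds. \<Sum>\<mu>\<in>outp w (n + f). ?t \<mu> \<nu>)"
  unfolding J_def sum_index_paths(2)[OF wv fF] by (rule refl)
 also have "\<dots> = (\<Sum>f'\<in>Ds. \<Sum>\<nu>\<in>outp w (n + f'). \<Sum>f\<in>Ds. (if ?R f f' then \<zeta> f * \<zeta> f' else 0) *
   (if pfx (d \<beta>) \<nu> = \<beta> then ip (S' \<nu> h) (S' (\<alpha> \<cdot> sfx (d \<beta>) \<nu>) k) else 0))"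
  using inner by (intro sum.cong refl) auto
 also have "\<dots> = (\<Sum>f'\<in>Ds. \<Sum>f\<in>Ds. \<Sum>\<nu>\<in>outp w (n + f'). (if ?R f f' then \<zeta> f * \<zeta> f' else 0) *
   (if pfx (d \<beta>) \<nu> = \<beta> then ip (S' \<nu> h) (S' (\<alpha> \<cdot> sfx (d \<beta>) \<nu>) k) else 0))"
  by (intro sum.cong refl sum.swap)
 also have "\<dots> = (\<Sum>f'\<in>Ds. \<Sum>f\<in>Ds. (if ?R f f' then \<zeta> f * \<zeta> f' else 0) * ip (S' \<beta> h) (S' \<alpha> k))"
  by (simp only: sum_distrib_left[symmetric] outer)
 also have "\<dots> = (\<Sum>f\<in>Ds. \<Sum>f'\<in>Ds. (if ?R f f' then \<zeta> f * \<zeta> f' else 0) * ip (S' \<beta> h) (S' \<alpha> k))"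
  by (rule sum.swap)
 also have "\<dots> = overlap Ds \<zeta> (d \<alpha>) (d \<beta>) * ip (S' \<beta> h) (S' \<alpha> k)"
  unfolding overlap_def sum_distrib_right of_real_sum by (intro refl)
 finally show ?thesis .
qed

lemma averaged_norm:
 assumes w: "w \<in> V" and Ds: "finite Ds" "(\<Sum>f\<in>Ds. (\<zeta> f)\<^sup>2) = 1" and h: "h \<in> \<H>"
 shows "sqrt (\<Sum>\<nu>\<in>index_paths w n Ds. (nrm (complex_of_real (\<zeta> (d \<nu> - n)) \<odot> S' \<nu> h))\<^sup>2) \<le> nrm h"
proof -
 have "(\<Sum>\<nu>\<in>index_paths w n Ds. (nrm (complex_of_real (\<zeta> (d \<nu> - n)) \<odot> S' \<nu> h))\<^sup>2)
   = (\<Sum>f\<in>Ds. \<Sum>\<nu>\<in>outp w (n + f). (\<zeta> f)\<^sup>2 * (nrm (S' \<nu> h))\<^sup>2)"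
  unfolding sum_index_paths(2)[OF w Ds(1)]
  by (intro sum.cong refl) (use h S'_closed in \<open>auto simp: outp_def hnorm_smult power_mult_distrib\<close>)
 also have "\<dots> = (\<Sum>f\<in>Ds. (\<zeta> f)\<^sup>2) * (nrm (S w h))\<^sup>2"
  by (simp add: sum_distrib_left[symmetric] CK_norm_sum[OF w h] sum_distrib_right)
 also have "\<dots> = (nrm (S w h))\<^sup>2" by (simp add: Ds(2))
 finally show ?thesis using S_vert_norm_le[OF w h] hnorm_nonneg S_closed[OF vertsD(1)[OF w] h] by simp
qed

text \<open>The weighted average of the matrix is the form up to the factor \<open>overlap\<close> in each term, which is
arbitrarily close to \<open>1\<close>, and the averaged vectors have norm at most \<open>\<parallel>h\<parallel>\<close> and \<open>\<parallel>k\<parallel>\<close>.\<close>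

lemma form_bound:
 assumes w: "w \<in> periodic_verts" and L: "terms_at w n L" and eps: "\<epsilon> \<ge> 0"
  and bound: "\<And>Ds \<xi> \<eta>. transversal Ds \<Longrightarrow>
   cmod (\<Sum>\<mu>\<in>index_paths w n Ds. \<Sum>\<nu>\<in>index_paths w n Ds. coef \<gamma> L \<mu> \<nu> * \<xi> \<nu> * cnj (\<eta> \<mu>))
   \<le> \<epsilon> * (sqrt (\<Sum>\<nu>\<in>index_paths w n Ds. (cmod (\<xi> \<nu>))\<^sup>2) * sqrt (\<Sum>\<mu>\<in>index_paths w n Ds. (cmod (\<eta> \<mu>))\<^sup>2))"
  and h: "h \<in> \<H>" and k: "k \<in> \<H>"
 shows "cmod (form L h k) \<le> \<epsilon> * nrm h * nrm k"
proof (rule field_le_epsilon)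
 fix e :: real assume e: "e > 0"
 have wv: "w \<in> V" using w by (simp add: periodic_verts_def)
 define K where "K = (\<Sum>(c, \<alpha>, \<beta>)\<leftarrow>L. cmod (c * ip (S' \<beta> h) (S' \<alpha> k)))"
 have K: "K \<ge> 0" unfolding K_def by (rule sum_list_nonneg) auto
 define \<delta> where "\<delta> = e / (K + 1)"
 have \<delta>: "\<delta> > 0" "\<delta> * K \<le> e" using e K by (auto simp: \<delta>_def field_simps)
 obtain Ds \<zeta> where D: "transversal Ds" "(\<Sum>f\<in>Ds. (\<zeta> f)\<^sup>2) = 1"
  and ov: "\<And>p q. (p, q) \<in> (\<lambda>(c, \<alpha>, \<beta>). (d \<alpha>, d \<beta>)) ` set L \<Longrightarrow> \<bar>1 - overlap Ds \<zeta> p q\<bar> \<le> \<delta>"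
  by (rule almost_invariant_weights[of "(\<lambda>(c, \<alpha>, \<beta>). (d \<alpha>, d \<beta>)) ` set L" \<delta>]) (use \<delta>(1) in auto)
 have fD: "finite Ds" using D by (simp add: transversal_def)
 define J where "J = index_paths w n Ds"
 have fJ: "finite J" unfolding J_def by (rule sum_index_paths(1)[OF wv fD])
 have JM: "\<mu> \<in> M" if "\<mu> \<in> J" for \<mu> using that index_pathsD(1) by (simp add: J_def)
 define x where "x \<nu> = complex_of_real (\<zeta> (d \<nu> - n)) \<odot> S' \<nu> h" for \<nu>
 define y where "y \<mu> = complex_of_real (\<zeta> (d \<mu> - n)) \<odot> S' \<mu> k" for \<mu>
 have xy: "x \<mu> \<in> \<H>" "y \<mu> \<in> \<H>" if "\<mu> \<in> J" for \<mu> using JM[OF that] S'_closed h k by (auto simp: x_def y_def)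
 have nx: "sqrt (\<Sum>\<nu>\<in>J. (nrm (x \<nu>))\<^sup>2) \<le> nrm h" and ny: "sqrt (\<Sum>\<nu>\<in>J. (nrm (y \<nu>))\<^sup>2) \<le> nrm k"
  unfolding J_def x_def y_def using averaged_norm[OF wv fD D(2)] h k by auto
 let ?A = "\<Sum>(c, \<alpha>, \<beta>)\<leftarrow>L. c * (overlap Ds \<zeta> (d \<alpha>) (d \<beta>) * ip (S' \<beta> h) (S' \<alpha> k))"
 have "(\<Sum>\<mu>\<in>J. \<Sum>\<nu>\<in>J. coef \<gamma> L \<mu> \<nu> * ip (x \<nu>) (y \<mu>)) = (\<Sum>\<nu>\<in>J. \<Sum>\<mu>\<in>J. coef \<gamma> L \<mu> \<nu> * ip (x \<nu>) (y \<mu>))"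
  by (rule sum.swap)
 also have "\<dots> = (\<Sum>\<nu>\<in>J. \<Sum>\<mu>\<in>J. \<Sum>(c, \<alpha>, \<beta>)\<leftarrow>L. c * ((if matching \<alpha> \<beta> \<mu> \<nu> then cnj (\<gamma> (vdiff (d \<mu>) (d (\<alpha> \<cdot> sfx (d \<beta>) \<nu>)))) else 0)
   * ip (x \<nu>) (y \<mu>)))"
  unfolding coef_def sum_list_mult_const[symmetric] by (intro sum.cong refl arg_cong[where f = sum_list] map_cong) auto
 also have "\<dots> = (\<Sum>(c, \<alpha>, \<beta>)\<leftarrow>L. c * (\<Sum>\<nu>\<in>J. \<Sum>\<mu>\<in>J. (if matching \<alpha> \<beta> \<mu> \<nu> then cnj (\<gamma> (vdiff (d \<mu>) (d (\<alpha> \<cdot> sfx (d \<beta>) \<nu>)))) else 0)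
   * ip (x \<nu>) (y \<mu>)))"
  unfolding sum_sum_list_swap case_prod_unfold sum_distrib_left by (rule refl)
 also have "\<dots> = ?A"
 proof (intro arg_cong[where f = sum_list] map_cong refl)
  fix z assume z: "z \<in> set L"
  obtain c \<alpha> \<beta> where zz: "z = (c, \<alpha>, \<beta>)" by (cases z)
  have T: "\<alpha> \<in> M" "\<beta> \<in> M" "s \<alpha> = s \<beta>" "r \<alpha> = w" "r \<beta> = w" "d \<alpha> \<le> n" "d \<beta> \<le> n" using L z zz by (auto simp: terms_at_def)
  show "(case z of (c, \<alpha>, \<beta>) \<Rightarrow> c * (\<Sum>\<nu>\<in>J. \<Sum>\<mu>\<in>J. (if matching \<alpha> \<beta> \<mu> \<nu> then cnj (\<gamma> (vdiff (d \<mu>) (d (\<alpha> \<cdot> sfx (d \<beta>) \<nu>)))) else 0)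
   * ip (x \<nu>) (y \<mu>))) = (case z of (c, \<alpha>, \<beta>) \<Rightarrow> c * (overlap Ds \<zeta> (d \<alpha>) (d \<beta>) * ip (S' \<beta> h) (S' \<alpha> k)))"
   unfolding zz prod.case x_def y_def J_def averaged_term[OF w D(1) T h k] by (rule refl)
 qed
 finally have A: "(\<Sum>\<mu>\<in>J. \<Sum>\<nu>\<in>J. coef \<gamma> L \<mu> \<nu> * ip (x \<nu>) (y \<mu>)) = ?A" .
 have "cmod ?A \<le> \<epsilon> * (sqrt (\<Sum>j\<in>J. (nrm (x j))\<^sup>2) * sqrt (\<Sum>i\<in>J. (nrm (y i))\<^sup>2))"
  unfolding A[symmetric]
  by (rule matrix_bound_vectors[OF fJ xy(1) xy(2) eps]) (assumption | rule bound[OF D(1), folded J_def])+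
 also have "\<dots> \<le> \<epsilon> * (nrm h * nrm k)"
  using nx ny eps hnorm_nonneg[OF h] by (intro mult_mono) (auto simp: sum_nonneg)
 finally have 1: "cmod ?A \<le> \<epsilon> * (nrm h * nrm k)" .
 have *: "cmod ((\<Sum>(c, \<alpha>, \<beta>)\<leftarrow>L'. c * ip (S' \<beta> h) (S' \<alpha> k)) -
   (\<Sum>(c, \<alpha>, \<beta>)\<leftarrow>L'. c * (overlap Ds \<zeta> (d \<alpha>) (d \<beta>) * ip (S' \<beta> h) (S' \<alpha> k))))
   \<le> \<delta> * (\<Sum>(c, \<alpha>, \<beta>)\<leftarrow>L'. cmod (c * ip (S' \<beta> h) (S' \<alpha> k)))" if "set L' \<subseteq> set L" for L'
  using that
 proof (induction L')
  case (Cons z L')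
  obtain c \<alpha> \<beta> where zz: "z = (c, \<alpha>, \<beta>)" by (cases z)
  let ?t = "c * ip (S' \<beta> h) (S' \<alpha> k)" and ?o = "overlap Ds \<zeta> (d \<alpha>) (d \<beta>)"
  have "(d \<alpha>, d \<beta>) \<in> (\<lambda>(c, \<alpha>, \<beta>). (d \<alpha>, d \<beta>)) ` set L" using Cons.prems zz by force
  then have "\<bar>1 - ?o\<bar> \<le> \<delta>" by (rule ov)
  then have o: "cmod (?t * of_real (1 - ?o)) \<le> \<delta> * cmod ?t"
   unfolding norm_mult norm_of_real by (metis mult.commute mult_right_mono norm_ge_zero norm_mult)
  let ?r = "(\<Sum>(c, \<alpha>, \<beta>)\<leftarrow>L'. c * ip (S' \<beta> h) (S' \<alpha> k)) -
   (\<Sum>(c, \<alpha>, \<beta>)\<leftarrow>L'. c * (overlap Ds \<zeta> (d \<alpha>) (d \<beta>) * ip (S' \<beta> h) (S' \<alpha> k)))"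
  have r: "cmod ?r \<le> \<delta> * (\<Sum>(c, \<alpha>, \<beta>)\<leftarrow>L'. cmod (c * ip (S' \<beta> h) (S' \<alpha> k)))" using Cons by simp
  have "(\<Sum>(c, \<alpha>, \<beta>)\<leftarrow>z # L'. c * ip (S' \<beta> h) (S' \<alpha> k)) -
   (\<Sum>(c, \<alpha>, \<beta>)\<leftarrow>z # L'. c * (overlap Ds \<zeta> (d \<alpha>) (d \<beta>) * ip (S' \<beta> h) (S' \<alpha> k))) = ?t * of_real (1 - ?o) + ?r"
   by (simp add: zz algebra_simps)
  also have "cmod \<dots> \<le> \<delta> * cmod ?t + \<delta> * (\<Sum>(c, \<alpha>, \<beta>)\<leftarrow>L'. cmod (c * ip (S' \<beta> h) (S' \<alpha> k)))"
   by (rule order_trans[OF norm_triangle_ineq add_mono[OF o r]])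
  finally show ?case by (simp add: zz distrib_left)
 qed simp
 have "cmod (form L h k - ?A) \<le> \<delta> * K" using *[of L] by (simp add: form_def K_def)
 then show "cmod (form L h k) \<le> \<epsilon> * nrm h * nrm k + e"
  using 1 \<delta>(2) norm_triangle_ineq2[of "form L h k" ?A] by simp
qed

end

text \<open>The coefficient matrix does not depend on the representation, so it carries norm estimates from one
representation to another with the same periodicity data.\<close>

lemma form_bound_transfer:
 assumes P1: "periodic_rep \<Lambda> H1 S1 S1' \<gamma>" and P2: "periodic_rep \<Lambda> H2 S2 S2' \<gamma>"
  and w: "w \<in> directed_kgraph.periodic_verts \<Lambda>" and L: "directed_kgraph.terms_at \<Lambda> w n L" and eps: "\<epsilon> \<ge> 0"
  and bound: "\<And>x y. \<lbrakk>x \<in> carrier H2; y \<in> carrier H2\<rbrakk> \<Longrightarrow> cmod (ck_ops.form H2 S2' L x y) \<le> \<epsilon> * hnorm H2 x * hnorm H2 y"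
  and h: "h \<in> carrier H1" and k: "k \<in> carrier H1"
 shows "cmod (ck_ops.form H1 S1' L h k) \<le> \<epsilon> * hnorm H1 h * hnorm H1 k"
proof -
 interpret P1: periodic_rep \<Lambda> H1 S1 S1' \<gamma> by (rule P1)
 interpret P2: periodic_rep \<Lambda> H2 S2 S2' \<gamma> by (rule P2)
 show ?thesis
  by (rule P1.form_bound[OF w L eps _ h k]) (rule P2.coef_bound[OF w L _ eps bound])
qed

section \<open>Irreducible representations\<close>

context kgraph_rep
begin

lemma rep_zero_vec: "a \<in> \<A> \<Longrightarrow> \<pi> a \<zero> = \<zero>"
 by (rule hinner_eqI) (simp_all add: rep_closed rep_adj hinner_zero_left)

lemma S'_vert: "\<lbrakk>\<kappa> \<in> M; w \<in> V; y \<in> \<H>\<rbrakk> \<Longrightarrow>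
  S' \<kappa> (S w y) = (if r \<kappa> = w then S' \<kappa> y else \<zero>)"
  by (smt (verit) S'_rng S_closed vertsD S_vert_orth rng_verts S_zero)

end

locale irreducible_kgraph_rep = kgraph_rep +
 assumes irreducible: "irreducible_rep A H \<pi>"
begin

text \<open>The vectors orthogonal to an invariant set form a closed invariant subspace.\<close>

lemma invariant_orthogonal:
 assumes Y: "Y \<subseteq> \<H>" and inv: "\<And>a y. \<lbrakk>a \<in> \<A>; y \<in> Y\<rbrakk> \<Longrightarrow> \<pi> a y \<in> Y"
 shows "Y \<subseteq> {\<zero>} \<or> (\<forall>u\<in>\<H>. (\<forall>y\<in>Y. ip u y = 0) \<longrightarrow> u = \<zero>)"
proof -
 define W where "W = {u \<in> \<H>. \<forall>y\<in>Y. ip u y = 0}"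
 have Yc: "y \<in> \<H>" if "y \<in> Y" for y using that Y by blast
 have "submodule W complex_ring H"
  by (rule submoduleI) (use Yc in \<open>auto simp: W_def minus_conv hinner_zero_left hinner_add_left hinner_smult_left\<close>)
 moreover have "norm_closed H nrm W"
  unfolding norm_closed_def
 proof (intro conjI allI impI)
  fix X l assume X: "(\<forall>n. X n \<in> W) \<and> l \<in> \<H> \<and> norm_tendsto H nrm X l"
  have "ip l y = 0" if y: "y \<in> Y" for y
   using hinner_tendsto[of X l y] X Yc[OF y] y by (auto simp: W_def LIMSEQ_const_iff)
  then show "l \<in> W" using X by (simp add: W_def)
 qed (auto simp: W_def)
 moreover have "\<pi> a u \<in> W" if a: "a \<in> \<A>" and u: "u \<in> W" for a u
  unfolding W_def using u rep_closed[OF a] rep_adj[OF a] inv[OF A.star_closed[OF a]] Yc by (auto simp: W_def)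
 ultimately have "W = {\<zero>} \<or> W = \<H>" using irreducible by (simp add: irreducible_rep_def)
 then show ?thesis
  using Yc hinner_eq_0 W_def by blast
qed

lemma nondegenerate:
 assumes v: "v \<in> \<H>" and z: "\<And>a. a \<in> \<A> \<Longrightarrow> \<pi> a v = \<zero>"
 shows "v = \<zero>"
proof -
 let ?Y = "{\<pi> a h | a h. a \<in> \<A> \<and> h \<in> \<H>}"
 have "ip v (\<pi> a h) = 0" if a: "a \<in> \<A>" and h: "h \<in> \<H>" for a h
  using rep_adj[of "star A a" v h] z v a h hinner_zero_left by simp
 moreover have "\<pi> b (\<pi> a h) \<in> ?Y" if "b \<in> \<A>" "a \<in> \<A>" "h \<in> \<H>" for a b h
  using that rep_mult[OF that, symmetric] by blast
 then have "?Y \<subseteq> {\<zero>} \<or> (\<forall>u\<in>\<H>. (\<forall>y\<in>?Y. ip u y = 0) \<longrightarrow> u = \<zero>)"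
  by (intro invariant_orthogonal) (use rep_closed in auto)
 moreover obtain a h where "a \<in> \<A>" "h \<in> \<H>" "\<pi> a h \<noteq> \<zero>"
  using irreducible by (auto simp: irreducible_rep_def)
 then have "\<not> ?Y \<subseteq> {\<zero>}" by blast
 ultimately show ?thesis using v by blast
qed

lemma cyclic:
 assumes v: "v \<in> \<H>" "v \<noteq> \<zero>" and u: "u \<in> \<H>" and z: "\<And>a. a \<in> \<A> \<Longrightarrow> ip u (\<pi> a v) = 0"
 shows "u = \<zero>"
proof -
 let ?Y = "{\<pi> a v | a. a \<in> \<A>}"
 have "\<pi> b (\<pi> a v) \<in> ?Y" if "b \<in> \<A>" "a \<in> \<A>" for a b
  using rep_mult[OF that v(1), symmetric] A.mult_closed[OF that] by blast
 then have "?Y \<subseteq> {\<zero>} \<or> (\<forall>u\<in>\<H>. (\<forall>y\<in>?Y. ip u y = 0) \<longrightarrow> u = \<zero>)"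
  by (intro invariant_orthogonal) (use rep_closed v in auto)
 moreover have "\<not> ?Y \<subseteq> {\<zero>}" using nondegenerate v by blast
 ultimately show ?thesis using u z by blast
qed

text \<open>If \<open>\<pi> (x b) v = 0\<close> for all \<open>b\<close> then \<open>\<pi> x\<^sup>*\<close> maps everything to a vector orthogonal to the cyclic
subspace of \<open>v\<close>.\<close>

lemma prime:
 assumes x: "x \<in> \<A>" "h \<in> \<H>" "\<pi> x h \<noteq> \<zero>" and v: "v \<in> \<H>" "v \<noteq> \<zero>"
 obtains b where "b \<in> \<A>" "\<pi> x (\<pi> b v) \<noteq> \<zero>"
proof -
 have "\<exists>b\<in>\<A>. \<pi> x (\<pi> b v) \<noteq> \<zero>"
 proof (rule ccontr)
  assume c: "\<not> ?thesis"
  let ?u = "\<pi> (star A x) (\<pi> x h)"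
  have xh: "\<pi> x h \<in> \<H>" by (rule rep_closed[OF x(1,2)])
  have u: "?u \<in> \<H>" by (rule rep_closed[OF A.star_closed[OF x(1)] xh])
  have "ip ?u (\<pi> b v) = 0" if b: "b \<in> \<A>" for b
   using rep_adj x rep_closed b v c hinner_zero_right by simp
  then have "?u = \<zero>" by (rule cyclic[OF v u])
  then have "ip (\<pi> x h) (\<pi> x h) = 0"
   using rep_adj[OF A.star_closed[OF x(1)] xh x(2)] x hinner_zero_left by simp
  then show False using hinner_eq_0[OF xh] x(3) by simp
 qed
 then show thesis using that by blast
qed

end

section \<open>Representations with a given tail and a given character\<close>

text \<open>If the projections outside a maximal tail vanish, the family restricts to the subgraph: paths with
source outside \<open>T\<close> act as zero.\<close>

lemma (in ck_ops) ck_ops_tail: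
 assumes T: "T \<in> maximal_tails \<Lambda>" and van: "\<And>v h. \<lbrakk>v \<in> V; v \<notin> T; h \<in> \<H>\<rbrakk> \<Longrightarrow> S v h = \<zero>"
 shows "ck_ops (sub T) H S S'"
proof -
 interpret \<Sigma>: directed_kgraph "sub T" by (rule directed_kgraph_tail[OF T])
 have vT: "v \<in> V" "v \<in> T" if "v \<in> verts (sub T)" for v
  using that tail_props(2)[OF T] verts_tail[OF T] by auto
 have ax: "ck_ops_axioms (sub T) H S S'"
 proof
  fix v h k n assume v: "v \<in> verts (sub T)" and h: "h \<in> \<H>" and k: "k \<in> \<H>"
  have "ip (S v h) k = (\<Sum>\<kappa>\<in>{\<kappa> \<in> M. r \<kappa> = v \<and> d \<kappa> = n}. ip (S' \<kappa> h) (S' \<kappa> k))"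
   by (rule S_CK[OF vT(1)[OF v] h k])
  also have "\<dots> = (\<Sum>\<kappa>\<in>{\<kappa> \<in> M. s \<kappa> \<in> T \<and> r \<kappa> = v \<and> d \<kappa> = n}. ip (S' \<kappa> h) (S' \<kappa> k))"
  proof (rule sum.mono_neutral_right)
   show "finite {\<kappa> \<in> M. r \<kappa> = v \<and> d \<kappa> = n}" using outp(1)[OF vT(1)[OF v], of n] by (simp add: outp_def)
   show "\<forall>\<kappa>\<in>{\<kappa> \<in> M. r \<kappa> = v \<and> d \<kappa> = n} - {\<kappa> \<in> M. s \<kappa> \<in> T \<and> r \<kappa> = v \<and> d \<kappa> = n}. ip (S' \<kappa> h) (S' \<kappa> k) = 0"
   proof
    fix \<kappa> assume "\<kappa> \<in> {\<kappa> \<in> M. r \<kappa> = v \<and> d \<kappa> = n} - {\<kappa> \<in> M. s \<kappa> \<in> T \<and> r \<kappa> = v \<and> d \<kappa> = n}"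
    then have kk: "\<kappa> \<in> M" "s \<kappa> \<notin> T" by auto
    have "S' \<kappa> h = \<zero>" using S'_rng(2)[OF kk(1) h] van[OF src_verts[OF kk(1)] kk(2) S'_closed[OF kk(1) h]] by simp
    then show "ip (S' \<kappa> h) (S' \<kappa> k) = 0" using hinner_zero_left[OF S'_closed[OF kk(1) k]] by simp
   qed
  qed auto
  finally show "ip (S v h) k = (\<Sum>\<kappa>\<in>{\<kappa> \<in> mor (sub T). rng (sub T) \<kappa> = v \<and>
    deg (sub T) \<kappa> = n}. ip (S' \<kappa> h) (S' \<kappa> k))" by simp
 qed (use vT in \<open>auto simp: S_closed S'_closed S_adj S_mult S_vert S_vert_orth S_iso\<close>)
 show ?thesis
  by (intro ck_ops.intro \<Sigma>.rf_kgraph_axioms hilbert_space_axioms ax)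
qed

text \<open>The representations that have the pair \<open>(T, \<gamma>)\<close> as their invariant.\<close>

locale tail_rep = kgraph_rep \<Lambda> H \<pi>
 for \<Lambda> :: "('e, 'k::finite) kgraph" and H :: "('h, 'n) hilbert_scheme" (structure) and \<pi> +
 fixes T :: "'e set" and \<gamma> :: "int ^ 'k \<Rightarrow> complex"
 assumes tail: "T \<in> maximal_tails \<Lambda>"
  and character: "\<gamma> \<in> characters (Per (tail_subgraph \<Lambda> T))"
  and support: "v \<in> verts \<Lambda> \<Longrightarrow> v \<in> T \<longleftrightarrow> (\<exists>h\<in>carrier H. \<pi> (kgraph_gen \<Lambda> v) h \<noteq> \<zero>)"
  and twist: "\<lbrakk>\<mu> \<in> mor (tail_subgraph \<Lambda> T); \<nu> \<in> mor (tail_subgraph \<Lambda> T); path_equiv (tail_subgraph \<Lambda> T) \<mu> \<nu>; h \<in> carrier H\<rbrakk> \<Longrightarrow>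
   \<pi> (kgraph_gen \<Lambda> \<mu>) h = \<gamma> (vdiff (deg \<Lambda> \<mu>) (deg \<Lambda> \<nu>)) \<odot> \<pi> (kgraph_gen \<Lambda> \<nu>) h"
begin

lemma vanishing: "\<lbrakk>v \<in> V; v \<notin> T; h \<in> \<H>\<rbrakk> \<Longrightarrow> S v h = \<zero>"
 using support by blast

lemma periodic_rep_tail: "periodic_rep (sub T) H S S' \<gamma>"
proof -
 interpret \<Sigma>: directed_kgraph "sub T" by (rule directed_kgraph_tail[OF tail])
 interpret S: ck_ops "sub T" H S S'
  by (rule ck_ops_tail[OF tail vanishing])
 show ?thesis
 proof (intro periodic_rep.intro \<Sigma>.directed_kgraph_axioms S.ck_ops_axioms periodic_rep_axioms.intro)
  fix \<mu> \<nu> h assume f: "\<Sigma>.feq \<mu> \<nu>" and h: "h \<in> \<H>"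
  note m = \<Sigma>.feqD(1,2)[OF f]
  show "S \<mu> h = \<gamma> (vdiff (deg (sub T) \<mu>) (deg (sub T) \<nu>)) \<odot> S \<nu> h"
   using twist[OF m _ h] \<Sigma>.path_equiv_iff_feq[OF m] f by simp
 next
  fix p assume "p \<in> \<Sigma>.perset"
  then show "cmod (\<gamma> p) = 1" using character \<Sigma>.Per_eq_perset by (auto simp: characters_def)
 next
  fix v assume "v \<in> verts (sub T)"
  then have "v \<in> T" "v \<in> V" using verts_tail[OF tail] tail_props(2)[OF tail] by auto
  then show "\<exists>h\<in>\<H>. S v h \<noteq> \<zero>" using support by blast
 qed
qed

definition terms_between :: "'e \<Rightarrow> (complex \<times> 'e \<times> 'e) list \<Rightarrow> (complex \<times> 'e \<times> 'e) list" where
 "terms_between w L = filter (\<lambda>(c, \<alpha>, \<beta>). r \<alpha> = w \<and> r \<beta> = w \<and> s \<alpha> \<in> T) L"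

lemma form_terms_between:
 assumes L: "valid_terms L" and w: "w \<in> V" and h: "h \<in> \<H>" and k: "k \<in> \<H>"
 shows "form (terms_between w L) h k = form L (S w h) (S w k)"
 using L
proof (induction L)
 case Nil
 then show ?case by (simp add: terms_between_def form_def)
next
 case (Cons x L)
 obtain c \<alpha> \<beta> where x: "x = (c, \<alpha>, \<beta>)" by (cases x)
 have v: "\<alpha> \<in> M" "\<beta> \<in> M" "s \<alpha> = s \<beta>" "valid_terms L" using Cons.prems x by (auto simp: valid_terms_def)

 note cut = S'_vert[OF _ w]
 have sT: "S' \<kappa> y = \<zero>" if kM: "\<kappa> \<in> M" "s \<kappa> \<notin> T" and y: "y \<in> \<H>" for \<kappa> y
  using S'_rng(2)[OF kM(1) y] vanishing[OF src_verts[OF kM(1)] kM(2) S'_closed[OF kM(1) y]] by simp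
 have "c * ip (S' \<beta> (S w h)) (S' \<alpha> (S w k)) =
   (if r \<alpha> = w \<and> r \<beta> = w \<and> s \<alpha> \<in> T then c * ip (S' \<beta> h) (S' \<alpha> k) else 0)"
  unfolding cut[OF v(1) k] cut[OF v(2) h] using sT S'_closed v h k by (auto simp: hinner_zero_left hinner_zero_right)
 then show ?case using Cons.IH[OF v(4)] x by (auto simp: terms_between_def form_def)
qed

end

text \<open>One list can be used for both representations, because the formal operations on lists do not
depend on the representation.\<close>

lemma (in rf_kgraph) common_representation:
 assumes R1: "kgraph_rep \<Lambda> H1 \<pi>1" and R2: "kgraph_rep \<Lambda> H2 \<pi>2"
  and a: "a \<in> carrier (kgraph_cstar \<Lambda>)" and e: "e > 0"
 shows "\<exists>b L. kgraph_rep.represents \<Lambda> H1 \<pi>1 b L \<and> kgraph_rep.represents \<Lambda> H2 \<pi>2 b L \<and>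
  cnorm (kgraph_cstar \<Lambda>) (b \<ominus>\<^bsub>kgraph_cstar \<Lambda>\<^esub> a) < e"
proof -
 interpret R1: kgraph_rep \<Lambda> H1 \<pi>1 by (rule R1)
 interpret R2: kgraph_rep \<Lambda> H2 \<pi>2 by (rule R2)
 have "\<exists>b\<in>{b. \<exists>L. R1.represents b L \<and> R2.represents b L}. cnorm (kgraph_cstar \<Lambda>) (b \<ominus>\<^bsub>kgraph_cstar \<Lambda>\<^esub> a) < e"
 proof (rule kgraph_cstar_dense[OF _ _ _ _ _ _ _ a e])
 qed (blast dest: R1.representsD(1) intro: R1.represents_zero R1.represents_gen R2.represents_zero R2.represents_gen
   R1.represents_add R1.represents_smult R1.represents_mult R1.represents_star
   R2.represents_add R2.represents_smult R2.represents_mult R2.represents_star)+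
 then show ?thesis by blast
qed

text \<open>Suppose that \<open>\<pi>1 b \<noteq> 0\<close> and \<open>\<pi>2 b = 0\<close>. Primeness moves \<open>b\<close> into the corner of a periodic vertex \<open>w\<close>.
A finite combination that approximates the element has small norm in \<open>\<pi>2\<close>, hence its part at \<open>w\<close> has
small norm in \<open>\<pi>1\<close>, which is a contradiction.\<close>

theorem tail_rep_kernel_le:
 assumes R1: "tail_rep \<Lambda> H1 \<pi>1 T \<gamma>" and irr: "irreducible_rep (kgraph_cstar \<Lambda>) H1 \<pi>1"
  and R2: "tail_rep \<Lambda> H2 \<pi>2 T \<gamma>"
 shows "rep_kernel (kgraph_cstar \<Lambda>) H2 \<pi>2 \<subseteq> rep_kernel (kgraph_cstar \<Lambda>) H1 \<pi>1"
proof -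
 interpret R1: tail_rep \<Lambda> H1 \<pi>1 T \<gamma> by (rule R1)
 interpret R2: tail_rep \<Lambda> H2 \<pi>2 T \<gamma> by (rule R2)
 interpret I: irreducible_kgraph_rep \<Lambda> H1 \<pi>1 by unfold_locales (rule irr)
 let ?A = "kgraph_cstar \<Lambda>" and ?g = "kgraph_gen \<Lambda>" and ?\<Sigma> = "tail_subgraph \<Lambda> T"
 interpret \<Sigma>: directed_kgraph ?\<Sigma> by (rule R1.directed_kgraph_tail[OF R1.tail])
 obtain w where w: "w \<in> \<Sigma>.periodic_verts" using \<Sigma>.periodic_verts_nonempty by blast
 have wT: "w \<in> T" using w R1.verts_tail[OF R1.tail] by (simp add: \<Sigma>.periodic_verts_def)
 have wv: "w \<in> verts \<Lambda>" using wT R1.tail_props(2)[OF R1.tail] by blast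
 note wM = R1.vertsD(1)[OF wv] and gw = R1.gen_closed[OF R1.vertsD(1)[OF wv]]
 show ?thesis
 proof
  fix b assume b: "b \<in> rep_kernel ?A H2 \<pi>2"
  then have bA: "b \<in> carrier ?A" and b0: "\<And>h. h \<in> carrier H2 \<Longrightarrow> \<pi>2 b h = \<zero>\<^bsub>H2\<^esub>" by (auto simp: rep_kernel_def)
  show "b \<in> rep_kernel ?A H1 \<pi>1"
  proof (rule ccontr)
   assume "b \<notin> rep_kernel ?A H1 \<pi>1"
   then obtain h0 where h0: "h0 \<in> carrier H1" "\<pi>1 b h0 \<noteq> \<zero>\<^bsub>H1\<^esub>" using bA by (auto simp: rep_kernel_def)
   obtain h1 where h1: "h1 \<in> carrier H1" "\<pi>1 (?g w) h1 \<noteq> \<zero>\<^bsub>H1\<^esub>" using wT R1.support[OF wv] by blast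
   let ?v = "\<pi>1 (?g w) h1"
   have v: "?v \<in> carrier H1" by (rule R1.rep_closed[OF gw h1(1)])
   obtain c2 where c2: "c2 \<in> carrier ?A" "\<pi>1 b (\<pi>1 c2 ?v) \<noteq> \<zero>\<^bsub>H1\<^esub>"
    using I.prime[OF bA h0 v h1(2)] by blast
   let ?u = "\<pi>1 b (\<pi>1 c2 ?v)"
   have u: "?u \<in> carrier H1" using R1.rep_closed bA c2(1) v by blast
   obtain c1 where c1: "c1 \<in> carrier ?A" "\<pi>1 (?g w) (\<pi>1 c1 ?u) \<noteq> \<zero>\<^bsub>H1\<^esub>"
    using I.prime[OF gw h1 u c2(2)] by blast
   \<comment> \<open>Still in the kernel of \<open>\<pi>2\<close>, but with a nonzero compression to the corner of \<open>w\<close> under \<open>\<pi>1\<close>.\<close>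
   define a where "a = c1 \<otimes>\<^bsub>?A\<^esub> (b \<otimes>\<^bsub>?A\<^esub> c2)"
   have aA: "a \<in> carrier ?A" using c1 c2 bA by (simp add: a_def)
   have a1: "\<pi>1 (?g w) (\<pi>1 a ?v) \<noteq> \<zero>\<^bsub>H1\<^esub>"
    using c1 c2 bA R1.rep_mult[OF c1(1) _ v, of "b \<otimes>\<^bsub>?A\<^esub> c2"] R1.rep_mult[OF bA c2(1) v] by (simp add: a_def)
   have a2: "\<pi>2 a h = \<zero>\<^bsub>H2\<^esub>" if h: "h \<in> carrier H2" for h
    using c2 bA R2.rep_mult[OF c1(1) _ h, of "b \<otimes>\<^bsub>?A\<^esub> c2"] R2.rep_mult[OF bA c2(1) h] b0[OF R2.rep_closed[OF c2(1) h]] R2.rep_zero_vec[OF c1(1)] by (simp add: a_def)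
   have small: "cmod (hinner H1 (\<pi>1 a (\<pi>1 (?g w) h)) (\<pi>1 (?g w) k)) \<le> 2 * e * hnorm H1 h * hnorm H1 k"
    if e: "e > 0" and h: "h \<in> carrier H1" and k: "k \<in> carrier H1" for e h k
   proof -
    obtain b' L where L: "R1.represents b' L" "R2.represents b' L" "cnorm ?A (b' \<ominus>\<^bsub>?A\<^esub> a) < e"
     using R1.common_representation[OF R1.kgraph_rep_axioms R2.kgraph_rep_axioms aA e] by blast
    note L1 = R1.representsD[OF L(1)] and L2 = R2.representsD[OF L(2)]
    let ?L = "R1.terms_between w L"
    define n where "n = (\<Sum>(c, \<alpha>, \<beta>)\<leftarrow>L. deg \<Lambda> \<alpha> + deg \<Lambda> \<beta>)"
    have nle: "deg \<Lambda> \<alpha> \<le> n" "deg \<Lambda> \<beta> \<le> n" if "(c, \<alpha>, \<beta>) \<in> set L" for c \<alpha> \<beta>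
    proof -
     have "deg \<Lambda> \<alpha> $ i + deg \<Lambda> \<beta> $ i \<le> (\<Sum>(c, \<alpha>, \<beta>)\<leftarrow>L. deg \<Lambda> \<alpha> + deg \<Lambda> \<beta>) $ i" for i
      using that by (induction L) auto
     then show "deg \<Lambda> \<alpha> \<le> n" "deg \<Lambda> \<beta> \<le> n" unfolding n_def less_eq_vec_def by (meson add_leD1 add_leD2)+
    qed
    have TL: "\<Sigma>.terms_at w n ?L"
     unfolding \<Sigma>.terms_at_def R1.terms_between_def using L1(2) nle by (auto simp: R1.valid_terms_def)
    \<comment> \<open>The element nearly vanishes under \<open>\<pi>2\<close>, so its part at \<open>w\<close> has small norm there.\<close>
    have bound2: "cmod (R2.form ?L x y) \<le> e * hnorm H2 x * hnorm H2 y" if x: "x \<in> carrier H2" and y: "y \<in> carrier H2" for x y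
    proof -
     let ?x = "\<pi>2 (?g w) x" and ?y = "\<pi>2 (?g w) y"
     have xy: "?x \<in> carrier H2" "?y \<in> carrier H2" using R2.rep_closed[OF gw] x y by auto
     have "R2.form ?L x y = hinner H2 (\<pi>2 b' ?x) ?y"
      using R2.form_terms_between[OF L2(2) wv x y] L2(3)[OF xy] by simp
     also have "cmod \<dots> \<le> cnorm ?A (b' \<ominus>\<^bsub>?A\<^esub> a) * hnorm H2 ?x * hnorm H2 ?y"
      using R2.rep_diff_le[OF aA L2(1) xy] a2[OF xy(1)] R2.hinner_zero_left[OF xy(2)] by simp
     also have "\<dots> \<le> e * hnorm H2 x * hnorm H2 y"
      using L(3) e R2.S_vert_norm_le[OF wv] x y R2.hnorm_nonneg xy by (intro mult_mono) auto
     finally show ?thesis .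
    qed
    let ?h = "\<pi>1 (?g w) h" and ?k = "\<pi>1 (?g w) k"
    have hk: "?h \<in> carrier H1" "?k \<in> carrier H1" using R1.rep_closed[OF gw] h k by auto
    have "cmod (R1.form ?L h k) \<le> e * hnorm H1 h * hnorm H1 k"
     using form_bound_transfer[OF R1.periodic_rep_tail R2.periodic_rep_tail w TL _ bound2 h k] e by simp
    then have 1: "cmod (hinner H1 (\<pi>1 b' ?h) ?k) \<le> e * hnorm H1 h * hnorm H1 k"
     using R1.form_terms_between[OF L1(2) wv h k] L1(3)[OF hk] by simp
    have "cmod (hinner H1 (\<pi>1 b' ?h) ?k - hinner H1 (\<pi>1 a ?h) ?k) \<le> cnorm ?A (b' \<ominus>\<^bsub>?A\<^esub> a) * hnorm H1 ?h * hnorm H1 ?k"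
     by (rule R1.rep_diff_le[OF aA L1(1) hk])
    also have "\<dots> \<le> e * hnorm H1 h * hnorm H1 k"
     using L(3) e R1.S_vert_norm_le[OF wv] h k R1.hnorm_nonneg hk by (intro mult_mono) auto
    finally have "cmod (hinner H1 (\<pi>1 a ?h) ?k - hinner H1 (\<pi>1 b' ?h) ?k) \<le> e * hnorm H1 h * hnorm H1 k"
     by (simp add: norm_minus_commute)
    then show ?thesis
     using 1 norm_triangle_ineq2[of "hinner H1 (\<pi>1 a ?h) ?k" "hinner H1 (\<pi>1 b' ?h) ?k"] by simp
   qed
   have zero: "hinner H1 (\<pi>1 a (\<pi>1 (?g w) h)) (\<pi>1 (?g w) k) = 0" if h: "h \<in> carrier H1" and k: "k \<in> carrier H1" for h k
   proof -
    let ?t = "cmod (hinner H1 (\<pi>1 a (\<pi>1 (?g w) h)) (\<pi>1 (?g w) k))" and ?K = "hnorm H1 h * hnorm H1 k"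
    have K: "?K \<ge> 0" using R1.hnorm_nonneg h k by simp
    have "?t \<le> 0 + e" if e: "e > 0" for e
    proof -
     have "?t \<le> 2 * (e / (2 * (?K + 1))) * hnorm H1 h * hnorm H1 k" using small[of "e / (2 * (?K + 1))"] e K h k by simp
     also have "\<dots> = e * (?K / (?K + 1))" using K by (simp add: field_simps)
     also have "\<dots> \<le> e * 1" using e K by (intro mult_left_mono) auto
     finally show ?thesis by simp
    qed
    then have "?t \<le> 0" by (rule field_le_epsilon)
    then show ?thesis by simp
   qed
   let ?y = "\<pi>1 a ?v"
   have y: "?y \<in> carrier H1" by (rule R1.rep_closed[OF aA v])
   have "hinner H1 (\<pi>1 (?g w) ?y) (\<pi>1 (?g w) ?y) = hinner H1 ?y (\<pi>1 (?g w) (\<pi>1 (?g w) ?y))"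
    using R1.S_adj[OF wM y, of "\<pi>1 (?g w) ?y"] R1.S_vert[OF wv] R1.rep_closed[OF gw y] by simp
   also have "\<dots> = 0" using zero[OF h1(1) R1.rep_closed[OF gw y]] by simp
   finally show False using a1 R1.hinner_eq_0[OF R1.rep_closed[OF gw y]] by simp
  qed
 qed
qed

section \<open>Schur's lemma\<close>

context cstar_algebra
begin

definition commutant :: "'a \<Rightarrow> 'a set \<Rightarrow> 'a set" where
 "commutant e X = {y \<in> \<A>. e \<otimes> y = y \<and> y \<otimes> e = y \<and> (\<forall>t\<in>X. y \<otimes> t = t \<otimes> y)}"

lemma norm_limit_unique:
 assumes X: "\<And>n. X n \<in> \<A>" and x: "x \<in> \<A>" and y: "y \<in> \<A>"
  and l: "(\<lambda>n. cnorm A (X n \<ominus> x)) \<longlonglongrightarrow> 0" "(\<lambda>n. cnorm A (X n \<ominus> y)) \<longlonglongrightarrow> 0"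
 shows "x = y"
proof -
 have "cnorm A (x \<ominus> y) \<le> cnorm A (X n \<ominus> x) + cnorm A (X n \<ominus> y)" for n
  using p_triangle[OF x X y, of n] p_minus_commute[OF x X, of n] by simp
 moreover have "(\<lambda>n. cnorm A (X n \<ominus> x) + cnorm A (X n \<ominus> y)) \<longlonglongrightarrow> 0"
  using tendsto_add[OF l] by simp
 ultimately have "cnorm A (x \<ominus> y) \<le> 0" by (intro LIMSEQ_le_const) auto
 then show ?thesis using cnorm_minus_eq_0 x y by (simp add: order_antisym)
qed

lemma norm_tendsto_mult:
 assumes X: "\<And>n. X n \<in> \<A>" and l: "l \<in> \<A>" and t: "t \<in> \<A>"
  and lim: "norm_tendsto A (cnorm A) X l"
 shows "(\<lambda>n. cnorm A (X n \<otimes> t \<ominus> l \<otimes> t)) \<longlonglongrightarrow> 0" "(\<lambda>n. cnorm A (t \<otimes> X n \<ominus> t \<otimes> l)) \<longlonglongrightarrow> 0"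
proof -
 have lim': "(\<lambda>n. cnorm A (X n \<ominus> l) * cnorm A t) \<longlonglongrightarrow> 0" "(\<lambda>n. cnorm A t * cnorm A (X n \<ominus> l)) \<longlonglongrightarrow> 0"
  using lim unfolding norm_tendsto_def by (auto intro: tendsto_mult_left_zero tendsto_mult_right_zero)
 have "cnorm A (X n \<otimes> t \<ominus> l \<otimes> t) \<le> cnorm A (X n \<ominus> l) * cnorm A t" for n
  using p_mult[of "X n \<ominus> l" t] X l t by (simp add: mult_minus_left)
 then show "(\<lambda>n. cnorm A (X n \<otimes> t \<ominus> l \<otimes> t)) \<longlonglongrightarrow> 0"
  using X l t by (intro tendsto_sandwich[OF _ _ tendsto_const lim'(1)]) (auto intro!:)
 have "cnorm A (t \<otimes> X n \<ominus> t \<otimes> l) \<le> cnorm A t * cnorm A (X n \<ominus> l)" for n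
  using p_mult[of t "X n \<ominus> l"] X l t by (simp add: mult_minus_right)
 then show "(\<lambda>n. cnorm A (t \<otimes> X n \<ominus> t \<otimes> l)) \<longlonglongrightarrow> 0"
  using X l t by (intro tendsto_sandwich[OF _ _ tendsto_const lim'(2)]) (auto intro!:)
qed

lemma commutant:
 assumes e: "e \<in> \<A>" and X: "X \<subseteq> \<A>"
 shows "norm_closed A (cnorm A) (commutant e X)" "\<zero> \<in> commutant e X"
  "\<lbrakk>x \<in> commutant e X; y \<in> commutant e X\<rbrakk> \<Longrightarrow> x \<oplus> y \<in> commutant e X"
  "x \<in> commutant e X \<Longrightarrow> c \<odot> x \<in> commutant e X"
  "\<lbrakk>x \<in> commutant e X; y \<in> commutant e X\<rbrakk> \<Longrightarrow> x \<otimes> y \<in> commutant e X"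
  "\<lbrakk>x \<in> commutant e X; y \<in> commutant e X\<rbrakk> \<Longrightarrow> x \<ominus> y \<in> commutant e X"
  "commutant e X \<subseteq> \<A>"
proof -
 have Xc: "t \<in> \<A>" if "t \<in> X" for t using X that by blast
 show "norm_closed A (cnorm A) (commutant e X)"
  unfolding norm_closed_def
 proof (intro conjI allI impI)
  show "commutant e X \<subseteq> \<A>" by (auto simp: commutant_def)
  fix Y l assume "(\<forall>n. Y n \<in> commutant e X) \<and> l \<in> \<A> \<and> norm_tendsto A (cnorm A) Y l"
  then have Y: "\<And>n. Y n \<in> \<A>" "\<And>n. e \<otimes> Y n = Y n" "\<And>n. Y n \<otimes> e = Y n"
    "\<And>n t. t \<in> X \<Longrightarrow> Y n \<otimes> t = t \<otimes> Y n"
   and l: "l \<in> \<A>" and lim: "norm_tendsto A (cnorm A) Y l" by (auto simp: commutant_def)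
  note m = norm_tendsto_mult[OF Y(1) l _ lim]
  have lim': "(\<lambda>n. cnorm A (Y n \<ominus> l)) \<longlonglongrightarrow> 0" using lim by (simp add: norm_tendsto_def)
  have "e \<otimes> l = l"
   by (rule norm_limit_unique[OF Y(1) _ l _ lim']) (use m(2)[OF e] Y(2) e l in auto)
  moreover have "l \<otimes> e = l"
   by (rule norm_limit_unique[OF Y(1) _ l _ lim']) (use m(1)[OF e] Y(3) e l in auto)
  moreover have "l \<otimes> t = t \<otimes> l" if t: "t \<in> X" for t
   by (rule norm_limit_unique) (use m(1)[OF Xc[OF t]] m(2) Y(4)[OF t] Y(1) Xc[OF t] l in auto)
  ultimately show "l \<in> commutant e X" using l by (simp add: commutant_def)
 qed
 show "\<zero> \<in> commutant e X" "\<lbrakk>x \<in> commutant e X; y \<in> commutant e X\<rbrakk> \<Longrightarrow> x \<oplus> y \<in> commutant e X"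
  "x \<in> commutant e X \<Longrightarrow> c \<odot> x \<in> commutant e X"
  "\<lbrakk>x \<in> commutant e X; y \<in> commutant e X\<rbrakk> \<Longrightarrow> x \<ominus> y \<in> commutant e X"
  using e Xc by (auto simp: commutant_def mult_l_distr mult_r_distr smult_mult_left smult_mult_right
    mult_minus_left mult_minus_right)
 show "x \<otimes> y \<in> commutant e X" if "x \<in> commutant e X" "y \<in> commutant e X"
 proof -
  have x: "x \<in> \<A>" "e \<otimes> x = x" "\<And>t. t \<in> X \<Longrightarrow> x \<otimes> t = t \<otimes> x"
   and y: "y \<in> \<A>" "y \<otimes> e = y" "\<And>t. t \<in> X \<Longrightarrow> y \<otimes> t = t \<otimes> y" using that by (auto simp: commutant_def)
  have "e \<otimes> (x \<otimes> y) = x \<otimes> y" using mult_assoc[OF e x(1) y(1)] x by simp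
  moreover have "(x \<otimes> y) \<otimes> e = x \<otimes> y" using mult_assoc[OF x(1) y(1) e] y by simp
  moreover have "(x \<otimes> y) \<otimes> t = t \<otimes> (x \<otimes> y)" if t: "t \<in> X" for t
   by (metis mult_assoc x y Xc t)
  ultimately show ?thesis using x y by (simp add: commutant_def)
 qed
 show "commutant e X \<subseteq> \<A>" by (auto simp: commutant_def)
qed

lemma corner_root:
 assumes e: "e \<in> commutant e X" "star A e = e" and X: "X \<subseteq> \<A>"
  and b: "b \<in> commutant e X" "star A b = b" "cnorm A b \<le> 1"
 obtains c where "c \<in> commutant e X" "star A c = c" "cnorm A c \<le> 1"
  "(e \<ominus> c) \<otimes> (e \<ominus> c) = e \<ominus> b" "e \<ominus> c \<in> commutant e X" "star A (e \<ominus> c) = e \<ominus> c"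
proof -
 have ec: "e \<in> \<A>" using e by (simp add: commutant_def)
 note K = commutant[OF ec X]
 have bc: "b \<in> \<A>" using b(1) K(7) by blast
 obtain c where c: "c \<in> commutant e X" "c \<in> \<A>" "star A c = c" "cnorm A c \<le> 1" "2 \<odot> c = b \<oplus> c \<otimes> c"
  by (rule half_root[OF bc b(2,3) K(1,2) b(1) K(3,4,5)])
 have unit: "e \<otimes> c = c" "c \<otimes> e = c" "e \<otimes> e = e" using c(1) e(1) by (auto simp: commutant_def)
 have two: "2 \<odot> c = c \<oplus> c" using complex_smult_distr(2)[of c 1 1] complex_smult_distr(4) c(2) by simp
 have cc: "c \<otimes> c \<in> \<A>" using c by simp
 have "b = (b \<oplus> c \<otimes> c) \<ominus> c \<otimes> c" using bc cc by (simp add: M.minus_eq M.a_assoc M.r_neg)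
 then have "b = (c \<oplus> c) \<ominus> c \<otimes> c" using c(5) two by simp
 then have "e \<ominus> b = (e \<ominus> c) \<ominus> (c \<ominus> c \<otimes> c)"
  using c(2) ec by (simp add: M.minus_eq M.minus_add M.a_ac)
 moreover have "(e \<ominus> c) \<otimes> (e \<ominus> c) = (e \<ominus> c) \<ominus> (c \<ominus> c \<otimes> c)"
  using c(2) ec unit by (simp add: mult_minus_left mult_minus_right)
 ultimately show thesis using that K(6) ec c e by (simp add: star_minus)
qed

text \<open>The absolute value \<open>a\<close> of \<open>z\<close> is obtained by two square roots inside the commutant of \<open>z\<close>: first
\<open>q = \<surd>(e - z\<^sup>2)\<close>, which is a contraction because \<open>q\<^sup>2 + z\<^sup>2 = e\<close>, and then \<open>a = \<surd>(e - q\<^sup>2)\<close>. As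
\<open>(a - z) (a + z) = 0\<close> and there are no zero divisors, \<open>z = a\<close> or \<open>z = - a\<close>. The root \<open>a\<close> has the form \<open>e - c\<close>
with a contraction \<open>c\<close>, which expresses positivity.\<close>

lemma absolute_value_dichotomy:
 assumes e: "e \<in> commutant e X" "star A e = e" and X: "X \<subseteq> \<A>"
  and nzd: "\<And>x y. \<lbrakk>x \<in> commutant e X; y \<in> commutant e X; x \<otimes> y = \<zero>\<rbrakk> \<Longrightarrow> x = \<zero> \<or> y = \<zero>"
  and pos: "\<And>x y. \<lbrakk>x \<in> \<A>; y \<in> \<A>\<rbrakk> \<Longrightarrow> (cnorm A x)\<^sup>2 \<le> cnorm A (star A x \<otimes> x \<oplus> star A y \<otimes> y)"
  and z: "z \<in> commutant e X" "star A z = z" "cnorm A z \<le> 1"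
 obtains c where "c \<in> commutant e X" "cnorm A c \<le> 1" "z = e \<ominus> c \<or> z = (-1) \<odot> (e \<ominus> c)"
proof -
 let ?X = "insert z X"
 have ec: "e \<in> \<A>" and zc: "z \<in> \<A>" using e z by (auto simp: commutant_def)
 have X': "?X \<subseteq> \<A>" using X zc by blast
 note K = commutant[OF ec X] and K' = commutant[OF ec X']
 have sub: "y \<in> commutant e X" if "y \<in> commutant e ?X" for y using that by (simp add: commutant_def)
 have e': "e \<in> commutant e ?X" and z': "z \<in> commutant e ?X" using e z by (auto simp: commutant_def)
 have sq: "star A (y \<otimes> y) = y \<otimes> y" "cnorm A (y \<otimes> y) = (cnorm A y)\<^sup>2" if "y \<in> \<A>" "star A y = y" for y
  using that star_mult p_star_mult[of y] by auto
 have zz: "z \<otimes> z \<in> commutant e ?X" by (rule K'(5)[OF z' z'])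
 obtain c where c: "(e \<ominus> c) \<otimes> (e \<ominus> c) = e \<ominus> z \<otimes> z" "e \<ominus> c \<in> commutant e ?X" "star A (e \<ominus> c) = e \<ominus> c"
  by (rule corner_root[OF e' e(2) X' zz]) (use sq zc z in \<open>auto simp: power_le_one\<close>)
 define q where "q = e \<ominus> c"
 note q = c[folded q_def]
 have qc: "q \<in> \<A>" using q(2) K'(7) by blast
 have "q \<otimes> q \<oplus> z \<otimes> z = e" unfolding q(1) using zc ec by (simp add: M.minus_eq M.a_assoc M.l_neg)
 then have "cnorm A (q \<otimes> q) \<le> cnorm A e" using pos[OF qc zc] q(3) z(2) sq(2)[OF qc q(3)] by simp
 also have "cnorm A e = (cnorm A e)\<^sup>2" using p_star_mult[OF ec] e by (simp add: commutant_def)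
 then have "cnorm A e \<le> 1" by (metis le_less mult_cancel_right1 power2_eq_square zero_le_one)
 finally have qq: "cnorm A (q \<otimes> q) \<le> 1" .
 have qK: "q \<otimes> q \<in> commutant e ?X" by (rule K'(5)[OF q(2) q(2)])
 obtain b where b: "b \<in> commutant e ?X" "cnorm A b \<le> 1" "(e \<ominus> b) \<otimes> (e \<ominus> b) = e \<ominus> q \<otimes> q" "e \<ominus> b \<in> commutant e ?X"
  by (rule corner_root[OF e' e(2) X' qK sq(1)[OF qc q(3)] qq])
 define a where "a = e \<ominus> b"
 note a = b(3,4)[folded a_def]
 have ac: "a \<in> \<A>" using a(2) K'(7) by blast
 have az: "a \<otimes> z = z \<otimes> a" using a(2) by (simp add: commutant_def)
 have "a \<otimes> a = z \<otimes> z"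
  unfolding a(1) q(1) using ec zc by (simp add: M.minus_eq M.minus_add M.a_assoc[symmetric] M.r_neg)
 moreover have "(a \<ominus> z) \<otimes> (a \<oplus> z) = (a \<otimes> a \<ominus> z \<otimes> a) \<oplus> (a \<otimes> z \<ominus> z \<otimes> z)"
  using ac zc by (simp only: mult_r_distr M.minus_closed mult_minus_left)
 moreover have "(x \<ominus> y) \<oplus> (y \<ominus> x) = \<zero>" if "x \<in> \<A>" "y \<in> \<A>" for x y
  using that by (simp add: M.minus_eq M.a_assoc M.r_neg1 M.r_neg)
 ultimately have "(a \<ominus> z) \<otimes> (a \<oplus> z) = \<zero>" using ac zc by (simp add: az)
 then have "a \<ominus> z = \<zero> \<or> a \<oplus> z = \<zero>"
  using nzd[OF K(6)[OF sub[OF a(2)] z(1)] K(3)[OF sub[OF a(2)] z(1)]] by blast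
 then have "z = a \<or> z = (-1) \<odot> a"
  using minus_eq_zero_iff M.minus_equality[of z a] minus_conv ac zc by (auto simp: M.a_comm)
 then show thesis using that[OF sub[OF b(1)] b(2)] by (simp add: a_def)
qed

end

section \<open>The support of an irreducible representation\<close>

context kgraph_rep
begin

text \<open>Identities between matrix coefficients need to be checked for \<open>s\<^sub>\<alpha> s\<^sub>\<beta>\<^sup>*\<close> only.\<close>

lemma coefficient_eqI:
 assumes t: "\<And>\<alpha> \<beta>. \<lbrakk>\<alpha> \<in> M; \<beta> \<in> M; s \<alpha> = s \<beta>\<rbrakk> \<Longrightarrow>
   ip (S' \<beta> h1) (S' \<alpha> k1) = ip (S' \<beta> h2) (S' \<alpha> k2)"
  and h: "h1 \<in> \<H>" "k1 \<in> \<H>" "h2 \<in> \<H>" "k2 \<in> \<H>" and a: "a \<in> \<A>"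
 shows "ip (\<pi> a h1) k1 = ip (\<pi> a h2) k2"
proof -
 define K where "K = nrm h1 * nrm k1 + nrm h2 * nrm k2"
 have K: "K \<ge> 0" using hnorm_nonneg h by (simp add: K_def)
 let ?t = "cmod (ip (\<pi> a h1) k1 - ip (\<pi> a h2) k2)"
 have "?t \<le> 0 + e" if e: "e > 0" for e
 proof -
  have e': "e / (K + 1) > 0" using e K by simp
  obtain b L where b: "represents b L" "cnorm A (b \<ominus>\<^bsub>A\<^esub> a) < e / (K + 1)"
   using represented_dense[OF a e'] by blast
  note L = representsD[OF b(1)]
  have "form L h1 k1 = form L h2 k2"
   unfolding form_def
  proof (intro arg_cong[where f = sum_list] map_cong refl)
   fix x assume x: "x \<in> set L"
   obtain c \<alpha> \<beta> where xx: "x = (c, \<alpha>, \<beta>)" by (cases x)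
   have "\<alpha> \<in> M" "\<beta> \<in> M" "s \<alpha> = s \<beta>" using L(2) x xx by (auto simp: valid_terms_def)
   then show "(case x of (c, \<alpha>, \<beta>) \<Rightarrow> c * ip (S' \<beta> h1) (S' \<alpha> k1)) =
     (case x of (c, \<alpha>, \<beta>) \<Rightarrow> c * ip (S' \<beta> h2) (S' \<alpha> k2))"
    using t xx by simp
  qed
  then have eq: "ip (\<pi> b h1) k1 = ip (\<pi> b h2) k2" using L(3) h by simp
  have "?t \<le> cmod (ip (\<pi> b h1) k1 - ip (\<pi> a h1) k1) + cmod (ip (\<pi> b h2) k2 - ip (\<pi> a h2) k2)"
   using norm_triangle_ineq4[of "ip (\<pi> b h2) k2 - ip (\<pi> a h2) k2" "ip (\<pi> b h1) k1 - ip (\<pi> a h1) k1"] unfolding eq by simp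
  also have "\<dots> \<le> cnorm A (b \<ominus>\<^bsub>A\<^esub> a) * K"
   using rep_diff_le[OF a L(1) h(1,2)] rep_diff_le[OF a L(1) h(3,4)] by (simp add: K_def distrib_left)
  also have "\<dots> \<le> e / (K + 1) * K" using b(2) K by (intro mult_right_mono) auto
  also have "\<dots> = e * (K / (K + 1))" by simp
  also have "\<dots> \<le> e * 1" using e K by (intro mult_left_mono) auto
  finally show ?thesis by simp
 qed
 then have "?t \<le> 0" by (rule field_le_epsilon)
 then show ?thesis by simp
qed

end

context irreducible_kgraph_rep
begin

definition rep_tail :: "'a set" where
 "rep_tail = {v \<in> V. \<exists>h\<in>\<H>. S v h \<noteq> \<zero>}"

lemma S'_outside: "\<lbrakk>\<kappa> \<in> M; s \<kappa> \<notin> rep_tail; y \<in> \<H>\<rbrakk> \<Longrightarrow> S' \<kappa> y = \<zero>"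
proof -
 assume k: "\<kappa> \<in> M" "s \<kappa> \<notin> rep_tail" and y: "y \<in> \<H>"
 have "S (s \<kappa>) (S' \<kappa> y) = \<zero>"
  using k(2) src_verts[OF k(1)] S'_closed[OF k(1) y] unfolding rep_tail_def by blast
 then show ?thesis using S'_rng(2)[OF k(1) y] by simp
qed

text \<open>Two vertices of the support have a common successor in the support because otherwise
\<open>\<pi> (s\<^sub>v b s\<^sub>w) = 0\<close> for all \<open>b\<close>, which contradicts primeness. The other two properties are the
Cuntz--Krieger relation and the fact that \<open>s\<^sub>\<kappa>\<close> is a partial isometry.\<close>

theorem rep_tail_maximal: "rep_tail \<in> maximal_tails \<Lambda>"
proof -
 have ne: "rep_tail \<noteq> {}"
 proof
  assume e: "rep_tail = {}"
  obtain a h where ah: "a \<in> \<A>" "h \<in> \<H>" "\<pi> a h \<noteq> \<zero>" using irreducible by (auto simp: irreducible_rep_def)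
  have "\<pi> a h = \<zero>"
  proof (rule hinner_eqI)
   fix k assume k: "k \<in> \<H>"
   have "ip (\<pi> a h) k = ip (\<pi> a \<zero>) k"
    by (rule coefficient_eqI[OF _ ah(2) k _ k ah(1)]) (use S'_outside e ah in \<open>simp_all add: S'_closed hinner_zero_left\<close>)
   then show "ip (\<pi> a h) k = ip \<zero> k" using rep_zero_vec[OF ah(1)] by simp
  qed (use rep_closed ah in auto)
  then show False using ah by simp
 qed
 have up: "v \<in> rep_tail" if w: "w \<in> rep_tail" and v: "v \<in> V" "connected_to \<Lambda> v w" for v w
 proof -
  obtain \<kappa> where k: "\<kappa> \<in> M" "r \<kappa> = v" "s \<kappa> = w" using v(2) by (auto simp: connected_to_def)
  obtain h where h: "h \<in> \<H>" "S w h \<noteq> \<zero>" using w by (auto simp: rep_tail_def)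
  have c: "S \<kappa> h \<in> \<H>" "S w h \<in> \<H>" using S_closed k h src_closed by auto
  have "S \<kappa> h \<noteq> \<zero>"
   by (metis S_norm k h hnorm_eq_0 c)
  then have "S v (S \<kappa> h) \<noteq> \<zero>" using S_src(2)[OF k(1) h(1)] k(2) by simp
  then show ?thesis using c(1) v(1) unfolding rep_tail_def by blast
 qed
 have down: "\<exists>\<kappa>\<in>M. r \<kappa> = v \<and> d \<kappa> = n \<and> s \<kappa> \<in> rep_tail" if v: "v \<in> rep_tail" for v n
 proof (rule ccontr)
  assume no: "\<not> ?thesis"
  obtain h where h: "h \<in> \<H>" "S v h \<noteq> \<zero>" and vv: "v \<in> V" using v by (auto simp: rep_tail_def)
  have c: "S v h \<in> \<H>" using S_closed vertsD(1)[OF vv] h by blast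
  have "ip (S v h) (S v h) = (\<Sum>\<kappa>\<in>outp v n. ip (S' \<kappa> h) (S' \<kappa> (S v h)))"
   by (rule CK[OF vv h(1) c])
  also have "\<dots> = 0"
   using no outp_def S'_outside h hinner_zero_left c by simp
  finally show False using h(2) hinner_eq_0[OF c] by simp
 qed
 have dir: "\<exists>w\<in>rep_tail. connected_to \<Lambda> v1 w \<and> connected_to \<Lambda> v2 w" if v1: "v1 \<in> rep_tail" and v2: "v2 \<in> rep_tail" for v1 v2
 proof (rule ccontr)
  assume no: "\<not> ?thesis"
  obtain h1 h2 where h1: "h1 \<in> \<H>" "S v1 h1 \<noteq> \<zero>" and h2: "h2 \<in> \<H>" "S v2 h2 \<noteq> \<zero>"
   and v: "v1 \<in> V" "v2 \<in> V" using v1 v2 by (auto simp: rep_tail_def)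
  let ?h = "S v2 h2"
  have c: "?h \<in> \<H>" using S_closed vertsD(1)[OF v(2)] h2 by blast
  obtain b where b: "b \<in> \<A>" "S v1 (\<pi> b ?h) \<noteq> \<zero>"
   using prime[OF gen_closed[OF vertsD(1)[OF v(1)]] h1 c h2(2)] by blast
  have bh: "\<pi> b ?h \<in> \<H>" by (rule rep_closed[OF b(1) c])
  have "S v1 (\<pi> b ?h) = \<zero>"
  proof (rule hinner_eqI)
   fix k assume k: "k \<in> \<H>"
   have k1: "S v1 k \<in> \<H>" using S_closed vertsD(1)[OF v(1)] k by blast
   have "ip (S v1 (\<pi> b ?h)) k = ip (\<pi> b ?h) (S v1 k)"
    using S_adj[OF vertsD(1)[OF v(1)] bh k] S_vert[OF v(1) k] by simp
   also have "\<dots> = ip (\<pi> b \<zero>) (S v1 k)"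
   proof (rule coefficient_eqI[OF _ c k1 _ k1 b(1)])
    fix \<alpha> \<beta> assume ab: "\<alpha> \<in> M" "\<beta> \<in> M" "s \<alpha> = s \<beta>"
    have "connected_to \<Lambda> v1 (s \<alpha>)" if "r \<alpha> = v1" using ab that by (auto simp: connected_to_def)
    moreover have "connected_to \<Lambda> v2 (s \<alpha>)" if "r \<beta> = v2" using ab that by (auto simp: connected_to_def)
    ultimately have "r \<alpha> \<noteq> v1 \<or> r \<beta> \<noteq> v2 \<or> s \<alpha> \<notin> rep_tail" using no by blast
    then have "S' \<beta> ?h = \<zero> \<or> S' \<alpha> (S v1 k) = \<zero>"
     using S'_vert[OF ab(2) v(2) h2(1)] S'_vert[OF ab(1) v(1) k] S'_outside[OF ab(1) _ k1] by auto
    then show "ip (S' \<beta> ?h) (S' \<alpha> (S v1 k)) =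
      ip (S' \<beta> \<zero>) (S' \<alpha> (S v1 k))"
     using S_zero(2)[OF ab(2)] S'_closed[OF ab(2) c] by (auto simp: hinner_zero_right)
   qed simp
   also have "\<dots> = ip \<zero> k" using rep_zero_vec[OF b(1)] hinner_zero_left k k1 by simp
   finally show "ip (S v1 (\<pi> b ?h)) k = ip \<zero> k" .
  qed (use S_closed vertsD(1)[OF v(1)] bh in auto)
  then show False using b(2) by simp
 qed
 have "rep_tail \<subseteq> V" by (auto simp: rep_tail_def)
 then show ?thesis
  unfolding maximal_tails_def using ne up down dir by blast
qed

text \<open>Schur's lemma for a corner. The commutant of the corner has no zero divisors by cyclicity. Subtract from
\<open>z\<close> the multiple of the projection that makes its expectation at a vector \<open>h0\<close> of the corner vanish. Up
to sign and scaling the result is \<open>e - c\<close> with a contraction \<open>c\<close>, so \<open>\<langle>c h0, h0\<rangle> = \<parallel>h0\<parallel>\<^sup>2\<close>. This forces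
\<open>c h0 = h0\<close>, and an element of the commutant that kills \<open>h0\<close> is zero.\<close>

lemma corner_scalar:
 assumes w: "w \<in> rep_tail" and z: "adjoint_pair H z z"
  and cut: "\<And>h. h \<in> \<H> \<Longrightarrow> z (S w h) = z h" "\<And>h. h \<in> \<H> \<Longrightarrow> S w (z h) = z h"
  and comm: "\<And>a h. \<lbrakk>a \<in> \<A>; h \<in> \<H>\<rbrakk> \<Longrightarrow> z (S w (\<pi> a (S w h))) = S w (\<pi> a (S w (z h)))"
 obtains t :: complex where "\<And>h. h \<in> \<H> \<Longrightarrow> z h = t \<odot> S w h"
proof -
 interpret Bo: cstar_algebra B by (rule cstar_algebra_B)
 have wv: "w \<in> V" using w by (simp add: rep_tail_def)
 note wM = vertsD(1)[OF wv]
 have wc: "S w h \<in> \<H>" if "h \<in> \<H>" for h by (rule S_closed[OF wM that])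
 have ww: "S w (S w h) = S w h" if "h \<in> \<H>" for h by (rule S_vert_idem[OF wv that])
 have wadj: "ip (S w h) k = ip h (S w k)" if "h \<in> \<H>" "k \<in> \<H>" for h k
  using S_adj[OF wM that] S_vert[OF wv that(2)] by simp
 define e where "e = restrict (S w) \<H>"
 have ee: "adjoint_pair H e e" unfolding e_def
  by (rule adjoint_pairI[where C = 1 and C' = 1]) (use wc wadj S_vert_norm_le[OF wv] in auto)
 have ea: "e h = S w h" if "h \<in> \<H>" for h using that by (simp add: e_def)
 have eB: "e \<in> \<B>" and es: "star B e = e" using ee B_carrier star_B_eq by auto
 have contr: "nrm (\<pi> a h) \<le> cnorm A a * nrm h" if "a \<in> \<A>" "h \<in> \<H>" for a h
  using rep_contractive that .
 have RB: "restrict (\<pi> a) \<H> \<in> \<B>" if a: "a \<in> \<A>" for a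
 proof -
  have "adjoint_pair H (restrict (\<pi> a) \<H>) (restrict (\<pi> (star A a)) \<H>)"
   by (rule adjoint_pairI) (use a rep_closed rep_adj contr contr[of "star A a"] in auto)
  then show ?thesis using B_carrier by blast
 qed
 define cop where "cop a = e \<otimes>\<^bsub>B\<^esub> (restrict (\<pi> a) \<H> \<otimes>\<^bsub>B\<^esub> e)" for a
 have copB: "cop a \<in> \<B>" if "a \<in> \<A>" for a using RB[OF that] eB by (simp add: cop_def)
 have cop: "cop a h = S w (\<pi> a (S w h))" if "a \<in> \<A>" "h \<in> \<H>" for a h
  using that wc rep_closed by (simp add: cop_def B_simps ea)
 let ?X = "cop ` \<A>"
 have X: "?X \<subseteq> \<B>" using copB by blast
 let ?E = "Bo.commutant e ?X"
 note K = Bo.commutant[OF eB X]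
 have mem: "y \<in> ?E \<longleftrightarrow> y \<in> \<B> \<and> (\<forall>h\<in>\<H>. y (S w h) = y h \<and> S w (y h) = y h \<and>
   (\<forall>a\<in>\<A>. y (S w (\<pi> a (S w h))) = S w (\<pi> a (S w (y h)))))" for y
 proof (cases "y \<in> \<B>")
  case True
  note y = B_apply(2)[OF True]
  have eqs: "x1 = x2 \<longleftrightarrow> (\<forall>h\<in>\<H>. x1 h = x2 h)" if "x1 \<in> \<B>" "x2 \<in> \<B>" for x1 x2
   using B_eqI[OF that] by blast
  have "e \<otimes>\<^bsub>B\<^esub> y = y \<longleftrightarrow> (\<forall>h\<in>\<H>. S w (y h) = y h)"
   using eqs B_closed(2)[OF eB True] True y by (simp add: B_simps ea)
  moreover have "y \<otimes>\<^bsub>B\<^esub> e = y \<longleftrightarrow> (\<forall>h\<in>\<H>. y (S w h) = y h)"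
   using eqs B_closed(2)[OF True eB] True by (simp add: B_simps ea)
  moreover have "y \<otimes>\<^bsub>B\<^esub> cop a = cop a \<otimes>\<^bsub>B\<^esub> y \<longleftrightarrow> (\<forall>h\<in>\<H>. y (S w (\<pi> a (S w h))) = S w (\<pi> a (S w (y h))))"
   if a: "a \<in> \<A>" for a
   using eqs B_closed(2)[OF True copB[OF a]] B_closed(2)[OF copB[OF a] True] y a by (simp add: B_simps cop)
  ultimately show ?thesis unfolding Bo.commutant_def by blast
 qed (simp add: Bo.commutant_def)
 have annih: "y = \<zero>\<^bsub>B\<^esub>" if y: "y \<in> ?E" and h: "h \<in> \<H>" "h \<noteq> \<zero>" "S w h = h" "y h = \<zero>" for y h
 proof -
  have yB: "y \<in> \<B>" using y mem by blast
  note adj = B_adjoint[OF yB]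
  have "y (\<pi> a h) = \<zero>" if a: "a \<in> \<A>" for a
   by (metis y mem rep_closed a h rep_zero_vec)
  then have "star B y k = \<zero>" if k: "k \<in> \<H>" for k
  proof (intro cyclic[OF h(1,2)])
   have sk: "star B y k \<in> \<H>" using B_apply(2)[OF B_closed(4)[OF yB] k] .
   show "star B y k \<in> \<H>" by (rule sk)
   fix a assume a: "a \<in> \<A>"
   have "ip (\<pi> a h) (star B y k) = ip (y (\<pi> a h)) k" using adjoint_pairD[OF adj] rep_closed[OF a h(1)] k by metis
   also have "\<dots> = 0" using \<open>\<And>a. a \<in> \<A> \<Longrightarrow> y (\<pi> a h) = \<zero>\<close>[OF a] hinner_zero_left[OF k] by simp
   finally show "ip (star B y k) (\<pi> a h) = 0" using hinner_cnj[OF rep_closed[OF a h(1)] sk] by simp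
  qed
  note sz = this
  show ?thesis
   using B_eqI yB B_zero_closed adjoint_pairD adj sz hinner_zero_right hinner_eq_0 B_simps by simp
 qed
 have nzd: "x = \<zero>\<^bsub>B\<^esub> \<or> y = \<zero>\<^bsub>B\<^esub>" if x: "x \<in> ?E" and y: "y \<in> ?E" and xy: "x \<otimes>\<^bsub>B\<^esub> y = \<zero>\<^bsub>B\<^esub>" for x y
 proof (rule disjCI)
  assume ny: "y \<noteq> \<zero>\<^bsub>B\<^esub>"
  have yB: "y \<in> \<B>" using y mem by blast
  obtain h where h: "h \<in> \<H>" "y h \<noteq> \<zero>"
   using B_eqI[OF yB B_zero_closed] ny by (auto simp: B_simps)
  have yh: "y h \<in> \<H>" "S w (y h) = y h" using B_apply(2) y mem h(1) by auto
  have "x (y h) = \<zero>" using fun_cong[OF xy, of h] h(1) by (simp add: B_simps)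
  then show "x = \<zero>\<^bsub>B\<^esub>" using annih[OF x yh(1) h(2) yh(2)] by simp
 qed
 have eE: "e \<in> ?E"
  unfolding mem using eB ea wc ww rep_closed by simp
 have zB: "z \<in> \<B>" and zs: "star B z = z" using z B_carrier star_B_eq by auto
 note zc = B_apply(2)[OF zB]
 have zE: "z \<in> ?E" unfolding mem using zB cut comm by blast
 obtain h0 where h0: "h0 \<in> \<H>" "h0 \<noteq> \<zero>" "S w h0 = h0"
  using w ww wc unfolding rep_tail_def by blast
 have n0: "ip h0 h0 \<noteq> 0" using hinner_eq_0[OF h0(1)] h0(2) by blast
 define t where "t = ip (z h0) h0 / ip h0 h0"
 have "cnj (ip (z h0) h0) = ip (z h0) h0"
  using hinner_cnj adjoint_pairD[OF z] h0(1) by metis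
 moreover have "cnj (ip h0 h0) = ip h0 h0" using hinner_cnj[OF h0(1) h0(1)] by simp
 ultimately have tr: "cnj t = t" by (simp add: t_def)
 define y where "y = z \<ominus>\<^bsub>B\<^esub> t \<odot>\<^bsub>B\<^esub> e"
 have yE: "y \<in> ?E" unfolding y_def by (intro K(6) zE K(4) eE)
 have yB: "y \<in> \<B>" using yE mem by blast
 have ys: "star B y = y" unfolding y_def using zB eB zs es tr by (simp add: Bo.star_minus Bo.star_smult)
 have yh: "y h = z h \<ominus> t \<odot> S w h" if "h \<in> \<H>" for h
  unfolding y_def using B_minus_apply[OF zB B_closed(3)[OF eB] that, of t] that by (simp add: B_simps ea)
 \<comment> \<open>Scaling makes the element a contraction.\<close>
 define u where "u = complex_of_real (1 / (1 + cnorm B y))"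
 have un: "u \<noteq> 0" using Bo.p_nonneg[OF yB] unfolding u_def of_real_eq_0_iff by simp
 let ?y = "u \<odot>\<^bsub>B\<^esub> y"
 have yE': "?y \<in> ?E" by (rule K(4)[OF yE])
 have ys': "star B ?y = ?y" using ys yB by (simp add: Bo.star_smult u_def)
 have yn: "cnorm B ?y \<le> 1"
 proof -
  have "cnorm B ?y = \<bar>1 / (1 + cnorm B y)\<bar> * cnorm B y" using Bo.p_smult[OF yB, of u] unfolding u_def norm_of_real .
  also have "\<dots> = cnorm B y / (1 + cnorm B y)" using Bo.p_nonneg[OF yB] by simp
  also have "\<dots> \<le> 1" using Bo.p_nonneg[OF yB] by simp
  finally show ?thesis .
 qed
 have pos: "(cnorm B P)\<^sup>2 \<le> cnorm B (star B P \<otimes>\<^bsub>B\<^esub> P \<oplus>\<^bsub>B\<^esub> star B Q \<otimes>\<^bsub>B\<^esub> Q)"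
  if P: "P \<in> \<B>" and Q: "Q \<in> \<B>" for P Q
 proof -
  let ?R = "star B P \<otimes>\<^bsub>B\<^esub> P \<oplus>\<^bsub>B\<^esub> star B Q \<otimes>\<^bsub>B\<^esub> Q"
  have R: "?R \<in> \<B>" using P Q by simp
  note pc = B_apply(2)[OF P] B_apply(2)[OF Q] B_apply(2)[OF B_closed(4)[OF P]] B_apply(2)[OF B_closed(4)[OF Q]] B_apply(2)[OF R]
  have "(nrm (P h))\<^sup>2 \<le> Re (ip h (?R h))" if h: "h \<in> \<H>" for h
   using hinner_nonneg[OF pc(2)[OF h]] h pc B_apply(5)[OF P] B_apply(5)[OF Q]
   by (simp add: B_simps hinner_add_right hnorm_power2)
  then show ?thesis unfolding B_simps(5) by (rule operator_norm_square_le[OF P R])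
 qed
 obtain c where c: "c \<in> ?E" "cnorm B c \<le> 1" "?y = e \<ominus>\<^bsub>B\<^esub> c \<or> ?y = (-1) \<odot>\<^bsub>B\<^esub> (e \<ominus>\<^bsub>B\<^esub> c)"
  by (rule Bo.absolute_value_dichotomy[OF eE es X nzd pos yE' ys' yn])
 have cB: "c \<in> \<B>" using c(1) mem by blast
 note ch = B_apply(2)[OF cB h0(1)]
 let ?k = "h0 \<ominus> c h0"
 have kc: "?k \<in> \<H>" using ch h0 by simp
 have "(e \<ominus>\<^bsub>B\<^esub> c) h0 = ?k" using B_minus_apply[OF eB cB h0(1)] h0 ea by simp
 moreover from this have "((-1) \<odot>\<^bsub>B\<^esub> (e \<ominus>\<^bsub>B\<^esub> c)) h0 = (-1) \<odot> ?k" using h0(1) by (simp add: B_simps(4))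
 ultimately have yk: "?y h0 = ?k \<or> ?y h0 = (-1) \<odot> ?k" using c(3) by metis
 have "ip (?y h0) h0 = 0"
  using yh h0 zc n0 by (simp add: B_simps hinner_minus_left hinner_smult_left t_def)
 then have k0: "ip ?k h0 = 0" using yk kc h0(1) by (auto simp: hinner_smult_left)
 then have "ip (c h0) h0 = ip h0 h0" using ch h0(1) by (simp add: hinner_minus_left)
 then have "ip h0 (c h0) = ip h0 h0" using hinner_cnj[OF ch h0(1)] hinner_cnj[OF h0(1) h0(1)] by simp
 then have "(nrm ?k)\<^sup>2 = (nrm (c h0))\<^sup>2 - (nrm h0)\<^sup>2"
  using k0 ch h0(1) by (simp add: hinner_minus_left hinner_minus_right hnorm_power2)
 also have "\<dots> \<le> 0"
  using order_trans[OF operator_norm(2)[OF cB h0(1)] mult_right_mono[OF c(2)[unfolded B_simps(5)] hnorm_nonneg[OF h0(1)]]] hnorm_nonneg[OF ch] by simp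
 finally have "?k = \<zero>" using hnorm_eq_0[OF kc] by simp
 then have "?y h0 = \<zero>" using yk by auto
 then have y_zero: "?y = \<zero>\<^bsub>B\<^esub>" using annih[OF yE' h0] by blast
 have "y h = \<zero>" if h: "h \<in> \<H>" for h
 proof -
  have "u \<odot> y h = \<zero>" using fun_cong[OF y_zero, of h] h by (simp add: B_simps)
  then have "(1 / u) \<odot> (u \<odot> y h) = \<zero>" by simp
  then show ?thesis using un B_apply(2)[OF yB h] complex_smult_distr(3)[of "y h" "1 / u" u] by (simp add: complex_smult_distr(4))
 qed
 then have "z h = t \<odot> S w h" if "h \<in> \<H>" for h
  using yh minus_eq_zero_iff[of "z h" "t \<odot> S w h"] zc wc that by simp
 then show thesis using that by blast
qed

end

section \<open>The character of an irreducible representation\<close>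

context ck_ops
begin

lemma swap_bij:
 assumes v: "v \<in> V" and sw: "swap_at v p q" "swap_at v q p"
 obtains \<sigma> where "bij_betw \<sigma> (outp v p) (outp v q)" "\<And>\<tau>. \<tau> \<in> outp v p \<Longrightarrow> feq \<tau> (\<sigma> \<tau>)"
proof -
 obtain \<sigma> where s: "\<And>\<tau>. \<tau> \<in> outp v p \<Longrightarrow> \<sigma> \<tau> \<in> outp v q \<and> feq \<tau> (\<sigma> \<tau>)"
  using sw(1) unfolding swap_at_def by metis
 obtain \<rho> where r: "\<And>\<tau>. \<tau> \<in> outp v q \<Longrightarrow> \<rho> \<tau> \<in> outp v p \<and> feq \<tau> (\<rho> \<tau>)"
  using sw(2) unfolding swap_at_def by metis
 have "\<rho> (\<sigma> \<tau>) = \<tau>" if t: "\<tau> \<in> outp v p" for \<tau>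
 proof -
  have "feq \<tau> (\<rho> (\<sigma> \<tau>))" using feq_trans s[OF t] r by blast
  then show ?thesis using feq_same_deg[of \<tau> "\<rho> (\<sigma> \<tau>)"] t s[OF t] r[of "\<sigma> \<tau>"] by (simp add: outp_def)
 qed
 moreover have "\<sigma> (\<rho> \<tau>) = \<tau>" if t: "\<tau> \<in> outp v q" for \<tau>
 proof -
  have "feq \<tau> (\<sigma> (\<rho> \<tau>))" using feq_trans r[OF t] s by blast
  then show ?thesis using feq_same_deg[of \<tau> "\<sigma> (\<rho> \<tau>)"] t r[OF t] s[of "\<rho> \<tau>"] by (simp add: outp_def)
 qed
 ultimately have "bij_betw \<sigma> (outp v p) (outp v q)"
  using s r by (intro bij_betw_byWitness[where f' = \<rho>]) auto
 then show thesis using that s by blast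
qed

lemma feq_swap_eq:
 assumes f: "feq \<mu> \<nu>" and b: "\<beta> \<in> M" "r \<beta> = s \<mu>" and t: "feq \<tau> \<rho>" "r \<tau> = s \<beta>" "d \<tau> = d \<nu>" "d \<rho> = d \<mu>"
 shows "\<mu> \<cdot> (\<beta> \<cdot> \<tau>) = \<nu> \<cdot> (\<beta> \<cdot> \<rho>)"
  by (smt (verit) feq_same_deg feqD f t feq_rng b rng_cmp deg_cmp feq_cmp_left _ feq_trans feq_cmp_right add_ac)

lemma S'_strip:
 assumes "\<mu> \<in> M" "\<kappa> \<in> M" "r \<kappa> = s \<mu>" "h \<in> \<H>"
 shows "S' (\<mu> \<cdot> \<kappa>) (S \<mu> h) = S' \<kappa> h"
 using S'_cmp[OF assms(1,2) _ S_closed[OF assms(1,4)]] S_iso[OF assms(1,4)] S'_rng(1)[OF assms(2,4)] assms(3) by simp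

text \<open>The operator \<open>s\<^sub>\<nu>\<^sup>* s\<^sub>\<mu>\<close> commutes with \<open>s\<^sub>\<alpha> s\<^sub>\<beta>\<^sup>*\<close>. Expand the two sides at the degrees \<open>d \<mu>\<close> and \<open>d \<nu>\<close>. A bijection
\<open>\<sigma>\<close> between the paths of degree \<open>d \<nu>\<close> and those of degree \<open>d \<mu>\<close>, with \<open>\<tau> \<sim> \<sigma> \<tau>\<close>, matches the terms because
\<open>\<mu> \<beta> \<tau> = \<nu> \<beta> (\<sigma> \<tau>)\<close>.\<close>

lemma swap_commute:
 assumes f: "feq \<mu> \<nu>" and ab: "\<alpha> \<in> M" "\<beta> \<in> M" "r \<alpha> = s \<mu>" "r \<beta> = s \<mu>" "s \<alpha> = s \<beta>"
  and h: "h \<in> \<H>" and k: "k \<in> \<H>"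
 shows "ip (S' \<beta> (S' \<nu> (S \<mu> h))) (S' \<alpha> k) = ip (S' \<beta> h) (S' \<alpha> (S' \<mu> (S \<nu> k)))"
proof -
 note m = feqD(1-3)[OF f]
 let ?v = "s \<beta>" and ?p = "d \<nu>" and ?q = "d \<mu>"
 have v: "?v \<in> V" using src_verts ab by blast
 have "swap_at (s \<mu>) ?p ?q" "swap_at (s \<mu>) ?q ?p"
  using swap_at_source[OF f, of ?p ?q] swap_at_source[OF feq_sym[OF f], of ?q ?p] m(3) by auto
 then have "swap_at ?v ?p ?q" "swap_at ?v ?q ?p" using swap_at_hereditary[OF _ ab(2,4)] by auto
 then obtain \<sigma> where sg: "bij_betw \<sigma> (outp ?v ?p) (outp ?v ?q)" "\<And>\<tau>. \<tau> \<in> outp ?v ?p \<Longrightarrow> feq \<tau> (\<sigma> \<tau>)"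
  using swap_bij[OF v] by metis
 have sg': "\<sigma> \<tau> \<in> M" "r (\<sigma> \<tau>) = ?v" "d (\<sigma> \<tau>) = ?q" if "\<tau> \<in> outp ?v ?p" for \<tau>
  using bij_betw_apply[OF sg(1) that] by (auto simp: outp_def)
 have tt: "\<tau> \<in> M" "r \<tau> = ?v" "d \<tau> = ?p" if "\<tau> \<in> outp ?v ?p" for \<tau> using that by (auto simp: outp_def)
 have rb: "s \<nu> = r \<beta>" "s \<mu> = r \<alpha>" using m(3) ab by auto
 have y: "S \<mu> h \<in> \<H>" "S \<nu> k \<in> \<H>" using S_closed m h k by auto
 have "ip (S' \<beta> (S' \<nu> (S \<mu> h))) (S' \<alpha> k) = ip (S' (\<nu> \<cdot> \<beta>) (S \<mu> h)) (S' \<alpha> k)"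
  using S'_cmp[OF m(2) ab(2) rb(1) y(1)] by simp
 also have "\<dots> = (\<Sum>\<rho>\<in>outp (s (\<nu> \<cdot> \<beta>)) ?q. ip (S' (\<nu> \<cdot> \<beta> \<cdot> \<rho>) (S \<mu> h)) (S' (\<alpha> \<cdot> \<rho>) k))"
  by (rule expand) (use cmp_closed[OF m(2) ab(2) rb(1)] src_cmp[OF m(2) ab(2) rb(1)] ab y k in auto)
 also have "\<dots> = (\<Sum>\<rho>\<in>outp ?v ?q. ip (S' (\<nu> \<cdot> \<beta> \<cdot> \<rho>) (S \<mu> h)) (S' (\<alpha> \<cdot> \<rho>) k))"
  using src_cmp[OF m(2) ab(2) rb(1)] by simp
 also have "\<dots> = (\<Sum>\<tau>\<in>outp ?v ?p. ip (S' (\<nu> \<cdot> \<beta> \<cdot> \<sigma> \<tau>) (S \<mu> h)) (S' (\<alpha> \<cdot> \<sigma> \<tau>) k))"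
  by (rule sum.reindex_bij_betw[OF sg(1), symmetric])
 also have "\<dots> = (\<Sum>\<tau>\<in>outp ?v ?p. ip (S' (\<beta> \<cdot> \<tau>) h) (S' (\<alpha> \<cdot> \<sigma> \<tau>) k))"
 proof (rule sum.cong[OF refl])
  fix \<tau> assume t: "\<tau> \<in> outp ?v ?p"
  note t1 = tt[OF t] and t2 = sg'[OF t]
  have "\<nu> \<cdot> \<beta> \<cdot> \<sigma> \<tau> = \<nu> \<cdot> (\<beta> \<cdot> \<sigma> \<tau>)" using cmp_assoc[OF m(2) ab(2) t2(1) rb(1)] t2(2) by simp
  also have "\<dots> = \<mu> \<cdot> (\<beta> \<cdot> \<tau>)" using feq_swap_eq[OF f ab(2,4) sg(2)[OF t] t1(2,3) t2(3)] by simp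
  finally have "S' (\<nu> \<cdot> \<beta> \<cdot> \<sigma> \<tau>) (S \<mu> h) = S' (\<beta> \<cdot> \<tau>) h"
   using S'_strip[OF m(1) cmp_closed[OF ab(2) t1(1)] _ h] rng_cmp[OF ab(2) t1(1)] t1(2) ab(4) by simp
  then show "ip (S' (\<nu> \<cdot> \<beta> \<cdot> \<sigma> \<tau>) (S \<mu> h)) (S' (\<alpha> \<cdot> \<sigma> \<tau>) k) = ip (S' (\<beta> \<cdot> \<tau>) h) (S' (\<alpha> \<cdot> \<sigma> \<tau>) k)" by simp
 qed
 also have "\<dots> = (\<Sum>\<tau>\<in>outp ?v ?p. ip (S' (\<beta> \<cdot> \<tau>) h) (S' (\<mu> \<cdot> \<alpha> \<cdot> \<tau>) (S \<nu> k)))"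
 proof (rule sum.cong[OF refl])
  fix \<tau> assume t: "\<tau> \<in> outp ?v ?p"
  note t1 = tt[OF t] and t2 = sg'[OF t]
  have t1': "r \<tau> = s \<alpha>" and t2': "r (\<sigma> \<tau>) = s \<alpha>" using t1 t2 ab(5) by auto
  have "\<mu> \<cdot> \<alpha> \<cdot> \<tau> = \<mu> \<cdot> (\<alpha> \<cdot> \<tau>)" using cmp_assoc[OF m(1) ab(1) t1(1) rb(2)] t1' by simp
  also have "\<dots> = \<nu> \<cdot> (\<alpha> \<cdot> \<sigma> \<tau>)" using feq_swap_eq[OF f ab(1,3) sg(2)[OF t] t1' t1(3) t2(3)] by simp
  finally have "S' (\<mu> \<cdot> \<alpha> \<cdot> \<tau>) (S \<nu> k) = S' (\<alpha> \<cdot> \<sigma> \<tau>) k"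
   using S'_strip[OF m(2) cmp_closed[OF ab(1) t2(1)] _ k] rng_cmp[OF ab(1) t2(1)] t2' ab(3) m(3) by simp
  then show "ip (S' (\<beta> \<cdot> \<tau>) h) (S' (\<alpha> \<cdot> \<sigma> \<tau>) k) = ip (S' (\<beta> \<cdot> \<tau>) h) (S' (\<mu> \<cdot> \<alpha> \<cdot> \<tau>) (S \<nu> k))" by simp
 qed
 also have "\<dots> = ip (S' \<beta> h) (S' (\<mu> \<cdot> \<alpha>) (S \<nu> k))"
  by (rule expand[symmetric]) (use cmp_closed[OF m(1) ab(1) rb(2)] src_cmp[OF m(1) ab(1) rb(2)] ab y h in auto)
 also have "\<dots> = ip (S' \<beta> h) (S' \<alpha> (S' \<mu> (S \<nu> k)))" using S'_cmp[OF m(1) ab(1) rb(2) y(2)] by simp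
 finally show ?thesis .
qed

text \<open>The range of \<open>s\<^sub>\<mu>\<close> is contained in the range of \<open>s\<^sub>\<nu>\<close>; the same exchange of paths shows it.\<close>

lemma feq_range:
 assumes f: "feq \<mu> \<nu>" and h: "h \<in> \<H>"
 shows "S \<nu> (S' \<nu> (S \<mu> h)) = S \<mu> h"
proof (rule hinner_eqI)
 note m = feqD(1-3)[OF f]
 let ?v = "s \<mu>" and ?p = "d \<nu>" and ?q = "d \<mu>"
 have v: "?v \<in> V" using src_verts m by blast
 note vM = vertsD(1)[OF v]
 have vs: "s ?v = ?v" "r ?v = ?v" using v by (auto simp: vertsD)
 have y: "S \<mu> h \<in> \<H>" using S_closed m h by auto
 show "S \<nu> (S' \<nu> (S \<mu> h)) \<in> \<H>" "S \<mu> h \<in> \<H>" using S_closed S'_closed m y by auto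
 fix k assume k: "k \<in> \<H>"
 have "swap_at ?v ?p ?q" "swap_at ?v ?q ?p"
  using swap_at_source[OF f, of ?p ?q] swap_at_source[OF feq_sym[OF f], of ?q ?p] m(3) by auto
 then obtain \<sigma> where sg: "bij_betw \<sigma> (outp ?v ?p) (outp ?v ?q)" "\<And>\<tau>. \<tau> \<in> outp ?v ?p \<Longrightarrow> feq \<tau> (\<sigma> \<tau>)"
  using swap_bij[OF v] by metis
 have "ip (S \<nu> (S' \<nu> (S \<mu> h))) k = ip (S' \<nu> (S \<mu> h)) (S' \<nu> k)"
  by (rule S_adj[OF m(2) S'_closed[OF m(2) y] k])
 also have "\<dots> = (\<Sum>\<rho>\<in>outp (s \<nu>) ?q. ip (S' (\<nu> \<cdot> \<rho>) (S \<mu> h)) (S' (\<nu> \<cdot> \<rho>) k))"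
  by (rule expand[OF m(2,2) refl y k])
 also have "\<dots> = (\<Sum>\<tau>\<in>outp ?v ?p. ip (S' (\<nu> \<cdot> \<sigma> \<tau>) (S \<mu> h)) (S' (\<nu> \<cdot> \<sigma> \<tau>) k))"
  unfolding m(3)[symmetric] by (rule sum.reindex_bij_betw[OF sg(1), symmetric])
 also have "\<dots> = (\<Sum>\<tau>\<in>outp ?v ?p. ip (S' (?v \<cdot> \<tau>) h) (S' (\<mu> \<cdot> \<tau>) k))"
 proof (rule sum.cong[OF refl])
  fix \<tau> assume t: "\<tau> \<in> outp ?v ?p"
  have t1: "\<tau> \<in> M" "r \<tau> = ?v" "d \<tau> = ?p" using t by (auto simp: outp_def)
  have t2: "\<sigma> \<tau> \<in> M" "r (\<sigma> \<tau>) = ?v" "d (\<sigma> \<tau>) = ?q" using bij_betw_apply[OF sg(1) t] by (auto simp: outp_def)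
  have u: "?v \<cdot> \<tau> = \<tau>" "?v \<cdot> \<sigma> \<tau> = \<sigma> \<tau>" using cmp_rng_left[OF t1(1)] cmp_rng_left[OF t2(1)] t1(2) t2(2) by auto
  have "\<mu> \<cdot> \<tau> = \<nu> \<cdot> \<sigma> \<tau>" using feq_swap_eq[OF f vM vs(2) sg(2)[OF t] _ t1(3) t2(3)] vs t1 u by simp
  moreover have "S' (\<mu> \<cdot> \<tau>) (S \<mu> h) = S' \<tau> h" by (rule S'_strip[OF m(1) t1(1,2) h])
  ultimately show "ip (S' (\<nu> \<cdot> \<sigma> \<tau>) (S \<mu> h)) (S' (\<nu> \<cdot> \<sigma> \<tau>) k) = ip (S' (?v \<cdot> \<tau>) h) (S' (\<mu> \<cdot> \<tau>) k)" using u by simp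
 qed
 also have "\<dots> = ip (S' ?v h) (S' \<mu> k)"
  using expand[OF vM m(1) vs(1) h k, of ?p] vs(1) by simp
 also have "\<dots> = ip (S \<mu> h) k"
  using S_adj[OF m(1) S_closed[OF vM h] k] S_src(1)[OF m(1) h] S_vert[OF v h] by simp
 finally show "ip (S \<nu> (S' \<nu> (S \<mu> h))) k = ip (S \<mu> h) k" .
qed

lemma S'_S_norm_le:
 assumes "\<mu> \<in> M" "\<nu> \<in> M" "h \<in> \<H>"
 shows "nrm (S' \<nu> (S \<mu> h)) \<le> 1 * nrm h"
proof -
 let ?y = "S \<mu> h"
 have y: "?y \<in> \<H>" using assms S_closed by blast
 have "(nrm (S' \<nu> ?y))\<^sup>2 \<le> (\<Sum>\<kappa>\<in>outp (r \<nu>) (d \<nu>). (nrm (S' \<kappa> ?y))\<^sup>2)"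
  by (rule member_le_sum) (use outp(1)[OF rng_verts[OF assms(2)]] assms in \<open>auto simp: outp_def\<close>)
 also have "\<dots> = (nrm (S (r \<nu>) ?y))\<^sup>2" by (rule CK_norm_sum[OF rng_verts[OF assms(2)] y])
 finally have "nrm (S' \<nu> ?y) \<le> nrm (S (r \<nu>) ?y)"
  using hnorm_nonneg S_closed rng_closed[OF assms(2)] y by (meson power2_le_imp_le)
 also have "\<dots> \<le> nrm ?y" by (rule S_vert_norm_le[OF rng_verts[OF assms(2)] y])
 also have "\<dots> \<le> nrm h" using S_norm[OF assms(1,3)] S_vert_norm_le[OF src_verts[OF assms(1)] assms(3)] by simp
 finally show ?thesis by simp
qed

end

context irreducible_kgraph_rep
begin

abbreviation "\<Theta> \<equiv> sub rep_tail"

lemma directed_rep_tail: "directed_kgraph \<Theta>"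
 by (rule directed_kgraph_tail[OF rep_tail_maximal])

lemma ck_ops_rep_tail: "ck_ops \<Theta> H S S'"
 by (rule ck_ops_tail[OF rep_tail_maximal]) (auto simp: rep_tail_def)

text \<open>The commutation relation extends from the graph of the tail to the whole algebra since the other
terms vanish.\<close>

lemma swap_intertwines:
 assumes f: "kgraph.feq \<Theta> \<mu> \<nu>"
 defines "X \<equiv> \<lambda>h\<in>\<H>. S' \<nu> (S \<mu> h)" and "w \<equiv> s \<mu>"
 shows "h \<in> \<H> \<Longrightarrow> X (S w h) = X h" "h \<in> \<H> \<Longrightarrow> S w (X h) = X h"
  "\<lbrakk>a \<in> \<A>; h \<in> \<H>\<rbrakk> \<Longrightarrow> X (S w (\<pi> a (S w h))) = S w (\<pi> a (S w (X h)))"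
  "adjoint_pair H X (\<lambda>h\<in>\<H>. S' \<mu> (S \<nu> h))"
proof -
 interpret G: directed_kgraph \<Theta> by (rule directed_rep_tail)
 interpret Q: ck_ops \<Theta> H S S' by (rule ck_ops_rep_tail)
 let ?Y = "\<lambda>h\<in>\<H>. S' \<mu> (S \<nu> h)"
 note m = G.feqD(1-3)[OF f, simplified]
 have mM: "\<mu> \<in> M" and nM: "\<nu> \<in> M" and sn: "s \<nu> = w" using m by (auto simp: w_def)
 have wv: "w \<in> V" using src_verts mM by (simp add: w_def)
 note wM = vertsD(1)[OF wv]
 have wc: "S w h \<in> \<H>" if "h \<in> \<H>" for h by (rule S_closed[OF wM that])
 have Xh: "X h = S' \<nu> (S \<mu> h)" "X h \<in> \<H>" if "h \<in> \<H>" for h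
  using that S_closed[OF mM] S'_closed[OF nM] by (auto simp: X_def)
 have Yh: "?Y h = S' \<mu> (S \<nu> h)" "?Y h \<in> \<H>" if "h \<in> \<H>" for h
  using that S_closed[OF nM] S'_closed[OF mM] by auto
 show Xw: "X (S w h) = X h" if h: "h \<in> \<H>" for h
  using S_src(1)[OF mM h] Xh(1)[OF h] Xh(1)[OF wc[OF h]] by (simp add: w_def)
 show wX: "S w (X h) = X h" if h: "h \<in> \<H>" for h
  using S'_rng(2)[OF nM S_closed[OF mM h]] sn Xh(1)[OF h] by simp
 have wY: "S w (?Y h) = ?Y h" if h: "h \<in> \<H>" for h
  using S'_rng(2)[OF mM S_closed[OF nM h]] Yh(1)[OF h] by (simp add: w_def)
 show adj: "adjoint_pair H X ?Y"
  unfolding X_def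
  by (rule adjoint_pairI[where C = 1 and C' = 1])
   (use S_closed S'_closed mM nM S_adj S'_adj S'_S_norm_le[OF mM nM] S'_S_norm_le[OF nM mM] in auto)
 assume a: "a \<in> \<A>" and h: "h \<in> \<H>"
 have c1: "S w (\<pi> a (S w h)) \<in> \<H>" using wc rep_closed[OF a] h by blast
 have c2: "\<pi> a (S w h) \<in> \<H>" "\<pi> a (S w (X h)) \<in> \<H>" using wc rep_closed[OF a] h Xh(2) by auto
 have wadj: "ip (S w h) k = ip h (S w k)" if "h \<in> \<H>" "k \<in> \<H>" for h k
  using S_adj[OF wM that] S_vert[OF wv that(2)] by simp
 show "X (S w (\<pi> a (S w h))) = S w (\<pi> a (S w (X h)))"
 proof (rule hinner_eqI)
  show "X (S w (\<pi> a (S w h))) \<in> \<H>" "S w (\<pi> a (S w (X h))) \<in> \<H>"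
   using Xh(2)[OF c1] wc[OF c2(2)] by auto
  fix k assume k: "k \<in> \<H>"
  have "ip (X (S w (\<pi> a (S w h)))) k = ip (S w (\<pi> a (S w h))) (?Y k)"
   by (rule adjoint_pairD(5)[OF adj c1 k])
  also have "\<dots> = ip (\<pi> a (S w h)) (?Y k)" using wadj[OF c2(1) Yh(2)[OF k]] wY[OF k] by simp
  also have "\<dots> = ip (\<pi> a (X h)) (S w k)"
  proof (rule coefficient_eqI[OF _ wc[OF h] Yh(2)[OF k] Xh(2)[OF h] wc[OF k] a])
   fix \<alpha> \<beta> assume ab: "\<alpha> \<in> M" "\<beta> \<in> M" "s \<alpha> = s \<beta>"
   have cl: "S' \<kappa> y \<in> \<H>" if "\<kappa> \<in> M" "y \<in> \<H>" for \<kappa> y by (rule S'_closed[OF that])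
   note cs = cl[OF ab(2) wc[OF h]] cl[OF ab(1) Yh(2)[OF k]] cl[OF ab(2) Xh(2)[OF h]] cl[OF ab(1) wc[OF k]]
   show "ip (S' \<beta> (S w h)) (S' \<alpha> (?Y k)) =
     ip (S' \<beta> (X h)) (S' \<alpha> (S w k))"
   proof (cases "r \<alpha> = w \<and> r \<beta> = w \<and> s \<alpha> \<in> rep_tail")
    case True
    then have "\<alpha> \<in> mor \<Theta>" "\<beta> \<in> mor \<Theta>" using ab by auto
    then have "ip (S' \<beta> (X h)) (S' \<alpha> k) = ip (S' \<beta> h) (S' \<alpha> (?Y k))"
     using Q.swap_commute[OF f _ _ _ _ _ h k, of \<alpha> \<beta>] True ab Xh(1)[OF h] Yh(1)[OF k] by (simp add: w_def)
    then show ?thesis using S'_vert[OF ab(2) wv h] S'_vert[OF ab(1) wv k] True by simp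
   next
    case False
    have "S' \<alpha> (?Y k) = \<zero> \<and> S' \<alpha> (S w k) = \<zero>" if "r \<alpha> \<noteq> w"
     using S'_vert[OF ab(1) wv Yh(2)[OF k]] wY[OF k] S'_vert[OF ab(1) wv k] that by simp
    moreover have "S' \<beta> (X h) = \<zero> \<and> S' \<beta> (S w h) = \<zero>" if "r \<beta> \<noteq> w"
     using S'_vert[OF ab(2) wv Xh(2)[OF h]] wX[OF h] S'_vert[OF ab(2) wv h] that by simp
    moreover have "S' \<alpha> (?Y k) = \<zero> \<and> S' \<alpha> (S w k) = \<zero>" if "s \<alpha> \<notin> rep_tail"
     using S'_outside[OF ab(1) that] Yh(2)[OF k] wc[OF k] by blast
    ultimately have "(S' \<alpha> (?Y k) = \<zero> \<and> S' \<alpha> (S w k) = \<zero>) \<or>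
      (S' \<beta> (X h) = \<zero> \<and> S' \<beta> (S w h) = \<zero>)" using False by argo
    then show ?thesis
     by (metis hinner_zero_right cs refl hinner_zero_left)
   qed
  qed
  also have "\<dots> = ip (S w (\<pi> a (S w (X h)))) k"
   using wadj[OF c2(2) k] wX[OF h] by simp
  finally show "ip (X (S w (\<pi> a (S w h)))) k = ip (S w (\<pi> a (S w (X h)))) k" .
 qed
qed

text \<open>Apply Schur's lemma to the real and imaginary parts of \<open>s\<^sub>\<nu>\<^sup>* s\<^sub>\<mu>\<close>.\<close>

lemma swap_scalar:
 assumes f: "kgraph.feq \<Theta> \<mu> \<nu>"
 obtains c where "\<And>h. h \<in> \<H> \<Longrightarrow> S \<mu> h = c \<odot> S \<nu> h"
proof -
 interpret G: directed_kgraph \<Theta> by (rule directed_rep_tail)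
 interpret Q: ck_ops \<Theta> H S S' by (rule ck_ops_rep_tail)
 note m = G.feqD(1-3)[OF f, simplified]
 let ?w = "s \<mu>"
 have sn: "s \<nu> = ?w" using m(3) by simp
 have wT: "?w \<in> rep_tail" using m by simp
 have mM: "\<mu> \<in> M" and nM: "\<nu> \<in> M" using m by auto
 have wM: "?w \<in> M" using src_closed mM by blast
 define X where "X = (\<lambda>h\<in>\<H>. S' \<nu> (S \<mu> h))"
 define Y where "Y = (\<lambda>h\<in>\<H>. S' \<mu> (S \<nu> h))"
 note x = swap_intertwines[OF f, folded X_def Y_def]
 note y = swap_intertwines[OF G.feq_sym[OF f], folded X_def Y_def, unfolded sn]
 have cl: "X h \<in> \<H>" "Y h \<in> \<H>" if "h \<in> \<H>" for h using adjoint_pairD(3,4)[OF x(4) that] .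
 note wc = S_closed[OF wM]
 note lin = rep_linear[OF gen_closed[OF wM]]
 \<comment> \<open>Schur applies to the selfadjoint combinations of \<open>X\<close> and its adjoint \<open>Y\<close>.\<close>
 have comb: "\<exists>t. \<forall>h\<in>\<H>. p \<odot> X h \<oplus> q \<odot> Y h = t \<odot> S ?w h" if pq: "q = cnj p" for p q
 proof -
  let ?z = "p \<odot>\<^bsub>B\<^esub> X \<oplus>\<^bsub>B\<^esub> q \<odot>\<^bsub>B\<^esub> Y"
  have zh: "?z h = p \<odot> X h \<oplus> q \<odot> Y h" if "h \<in> \<H>" for h using that by (simp add: B_simps)
  have "adjoint_pair H ?z (q \<odot>\<^bsub>B\<^esub> Y \<oplus>\<^bsub>B\<^esub> p \<odot>\<^bsub>B\<^esub> X)"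
   using adjoint_pair_ops(1)[OF adjoint_pair_ops(2)[OF x(4) x(4), of p] adjoint_pair_ops(2)[OF y(4) y(4), of q]] pq by simp
  moreover have "q \<odot>\<^bsub>B\<^esub> Y \<oplus>\<^bsub>B\<^esub> p \<odot>\<^bsub>B\<^esub> X = ?z"
   by (rule) (simp add: B_simps M.a_comm cl)
  ultimately have z: "adjoint_pair H ?z ?z" by simp
  have "\<exists>t. \<forall>h\<in>\<H>. ?z h = t \<odot> S ?w h"
  proof (rule corner_scalar[OF wT z])
   fix h assume h: "h \<in> \<H>"
   show "?z (S ?w h) = ?z h" using zh h wc[OF h] x(1)[OF h] y(1)[OF h] by simp
   show "S ?w (?z h) = ?z h" using zh[OF h] x(2)[OF h] y(2)[OF h] lin cl[OF h] by simp
   show "?z (S ?w (\<pi> a (S ?w h))) = S ?w (\<pi> a (S ?w (?z h)))" if a: "a \<in> \<A>" for a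
    using zh[OF h] zh[OF wc[OF rep_closed[OF a wc[OF h]]]] x(3)[OF a h] y(3)[OF a h] rep_linear[OF a] lin cl[OF h] wc rep_closed[OF a]
    by simp
  next
   fix t assume "\<And>h. h \<in> \<H> \<Longrightarrow> ?z h = t \<odot> S ?w h"
   then show "\<exists>t. \<forall>h\<in>\<H>. ?z h = t \<odot> S ?w h" by blast
  qed
  then show ?thesis using zh by simp
 qed
 obtain t1 where t1: "\<And>h. h \<in> \<H> \<Longrightarrow> 1 \<odot> X h \<oplus> 1 \<odot> Y h = t1 \<odot> S ?w h" using comb[of 1 1] by auto
 obtain t2 where t2: "\<And>h. h \<in> \<H> \<Longrightarrow> \<i> \<odot> X h \<oplus> (- \<i>) \<odot> Y h = t2 \<odot> S ?w h" using comb[of "- \<i>" \<i>] by auto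
 define c where "c = (t1 - \<i> * t2) / 2"
 have X: "X h = c \<odot> S ?w h" if h: "h \<in> \<H>" for h
 proof (rule hinner_eqI)
  note ch = cl[OF h] wc[OF h]
  fix k assume k: "k \<in> \<H>"
  have 1: "ip (X h) k + ip (Y h) k = t1 * ip (S ?w h) k"
   using arg_cong[OF t1[OF h], of "\<lambda>v. ip v k"] ch k by (simp add: hinner_add_left hinner_smult_left)
  have 2: "\<i> * ip (X h) k - \<i> * ip (Y h) k = t2 * ip (S ?w h) k"
   using arg_cong[OF t2[OF h], of "\<lambda>v. ip v k"] ch k by (simp add: hinner_add_left hinner_smult_left)
  have "2 * ip (X h) k = (ip (X h) k + ip (Y h) k) - \<i> * (\<i> * ip (X h) k - \<i> * ip (Y h) k)"
   by (simp add: algebra_simps)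
  also have "\<dots> = 2 * (c * ip (S ?w h) k)" unfolding 1 2 c_def by (simp add: algebra_simps)
  finally show "ip (X h) k = ip (c \<odot> S ?w h) k" using ch k by (simp add: hinner_smult_left)
 qed (use cl[OF h] wc[OF h] in auto)
 have "S \<mu> h = c \<odot> S \<nu> h" if h: "h \<in> \<H>" for h
 proof -
  have "S \<mu> h = S \<nu> (X h)" using Q.feq_range[OF f h] h by (simp add: X_def)
  also have "\<dots> = c \<odot> S \<nu> (S (s \<nu>) h)" unfolding X[OF h] sn using rep_linear[OF gen_closed[OF nM]] wc[OF h] by simp
  also have "\<dots> = c \<odot> S \<nu> h" using S_src(1)[OF nM h] by simp
  finally show ?thesis .
 qed
 then show thesis using that by blast
qed

definition scales :: "complex \<Rightarrow> 'a \<Rightarrow> 'a \<Rightarrow> bool" where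
 "scales c \<mu> \<nu> \<longleftrightarrow> (\<forall>h\<in>\<H>. S \<mu> h = c \<odot> S \<nu> h)"

lemma nonzero_on_tail:
 assumes "\<tau> \<in> mor \<Theta>"
 obtains h where "h \<in> \<H>" "S \<tau> h \<noteq> \<zero>"
proof -
 have t: "\<tau> \<in> M" "s \<tau> \<in> rep_tail" using assms by auto
 obtain h where h: "h \<in> \<H>" "S (s \<tau>) h \<noteq> \<zero>" using t by (auto simp: rep_tail_def)
 have c: "S (s \<tau>) h \<in> \<H>" using S_closed src_closed t(1) h(1) by blast
 have "S \<tau> h \<noteq> \<zero>" using S_norm[OF t(1) h(1)] hnorm_eq_0[OF c] h(2) by auto
 then show thesis using that h by blast
qed

lemma scales_unique:
 assumes "\<nu> \<in> mor \<Theta>" "scales c \<mu> \<nu>" "scales c' \<mu> \<nu>"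
 shows "c = c'"
proof -
 obtain h where h: "h \<in> \<H>" "S \<nu> h \<noteq> \<zero>" by (rule nonzero_on_tail[OF assms(1)])
 have n: "S \<nu> h \<in> \<H>" using S_closed assms(1) h by simp
 have "c \<odot> S \<nu> h = c' \<odot> S \<nu> h" using assms(2,3) h by (simp add: scales_def)
 then have "c * ip (S \<nu> h) (S \<nu> h) = c' * ip (S \<nu> h) (S \<nu> h)"
  using n by (metis hinner_smult_left)
 then show ?thesis using hinner_eq_0[OF n] h(2) by auto
qed

lemma scales_unimodular:
 assumes "kgraph.feq \<Theta> \<mu> \<nu>" "scales c \<mu> \<nu>"
 shows "cmod c = 1"
proof -
 interpret G: directed_kgraph \<Theta> by (rule directed_rep_tail)
 note m = G.feqD(1-3)[OF assms(1), simplified]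
 obtain h where h: "h \<in> \<H>" "S \<nu> h \<noteq> \<zero>" by (rule nonzero_on_tail[OF G.feqD(2)[OF assms(1)]])
 have n: "S \<nu> h \<in> \<H>" using S_closed m h by simp
 have "nrm (S \<mu> h) = nrm (S \<nu> h)" using S_norm[of \<mu> h] S_norm[of \<nu> h] m h by simp
 then have "cmod c * nrm (S \<nu> h) = nrm (S \<nu> h)" using assms(2) h(1) hnorm_smult[OF n, of c] by (simp add: scales_def)
 then show ?thesis using hnorm_eq_0[OF n] h(2) by simp
qed

lemma scales_shift:
 assumes f: "kgraph.feq \<Theta> \<mu> \<nu>" and c: "scales c \<mu> \<nu>" and t: "\<tau> \<in> mor \<Theta>" "r \<tau> = s \<mu>"
  and rho: "kgraph.feq \<Theta> \<rho> \<tau>" "d \<nu> + d \<rho> = d \<mu> + d \<tau>"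
 shows "scales c \<rho> \<tau>"
proof -
 interpret G: directed_kgraph \<Theta> by (rule directed_rep_tail)
 note m = G.feqD(1-3)[OF f, simplified] and rm = G.feqD(1,2)[OF rho(1), simplified]
 have le: "d \<nu> \<le> d \<mu> + d \<tau>" using rho(2) by (metis vec_le_add(1))
 obtain \<rho>0 where r0: "\<rho>0 \<in> mor \<Theta>" "r \<rho>0 = s \<nu>" "\<mu> \<cdot> \<tau> = \<nu> \<cdot> \<rho>0" "G.feq \<rho>0 \<tau>" "d \<nu> + d \<rho>0 = d \<mu> + d \<tau>"
  by (rule G.feq_shift[OF f t(1), unfolded tail_subgraph_simps(2-), OF t(2) le])
 have "d \<rho>0 = d \<rho>" using r0(5) rho(2) by (metis add_left_imp_eq)
 then have "\<rho>0 = \<rho>" using G.feq_same_deg[OF G.feq_trans[OF r0(4) G.feq_sym[OF rho(1)]]] by simp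
 note r0 = r0[unfolded this]
 have M: "\<mu> \<in> M" "\<nu> \<in> M" "\<tau> \<in> M" "\<rho> \<in> M" using m t r0 by auto
 show ?thesis
  by (smt (verit) scales_def S_closed M S_mult _ r0 t c rep_linear A.star_closed gen_closed S_iso S_src m)
qed

lemma scales_cmp:
 assumes "\<mu> \<in> M" "\<nu> \<in> M" "s \<mu> = s \<nu>" "\<alpha> \<in> M" "r \<alpha> = s \<mu>" "scales c \<mu> \<nu>"
 shows "scales c (\<mu> \<cdot> \<alpha>) (\<nu> \<cdot> \<alpha>)"
 using assms S_mult[OF assms(1,4)] S_mult[OF assms(2,4)] S_closed[OF assms(4)] unfolding scales_def by (metis)

text \<open>The scalar is the same for a pair and for the pair moved to the source along any path. Two pairs with
the same difference of degrees have a common source after extension, and moved along a common long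
path they become equal.\<close>

lemma scales_degree:
 assumes f: "kgraph.feq \<Theta> \<mu> \<nu>" "kgraph.feq \<Theta> \<mu>' \<nu>'" and eq: "vdiff (d \<mu>) (d \<nu>) = vdiff (d \<mu>') (d \<nu>')"
  and c: "scales c \<mu> \<nu>" "scales c' \<mu>' \<nu>'"
 shows "c = c'"
proof -
 interpret G: directed_kgraph \<Theta> by (rule directed_rep_tail)
 have same: "c = c'" if f: "G.feq \<mu> \<nu>" "G.feq \<mu>' \<nu>'" and eq: "vdiff (d \<mu>) (d \<nu>) = vdiff (d \<mu>') (d \<nu>')"
  and c: "scales c \<mu> \<nu>" "scales c' \<mu>' \<nu>'" and u: "s \<mu> = s \<mu>'" for \<mu> \<nu> \<mu>' \<nu>'
 proof -
  note m = G.feqD(1-3)[OF f(1), simplified] and m' = G.feqD(1-3)[OF f(2), simplified]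
  have "s \<mu> \<in> verts \<Theta>" using G.src_verts[OF G.feqD(1)[OF f(1)]] by simp
  then obtain \<tau> where t: "\<tau> \<in> mor \<Theta>" "r \<tau> = s \<mu>" "d \<tau> = d \<nu> + d \<nu>'"
   using G.outpE[of "s \<mu>" "d \<nu> + d \<nu>'"] by auto
  have le: "d \<nu> \<le> d \<mu> + d \<tau>" "d \<nu>' \<le> d \<mu>' + d \<tau>" unfolding t(3) less_eq_vec_def by auto
  obtain \<rho> where r: "G.feq \<rho> \<tau>" "d \<nu> + d \<rho> = d \<mu> + d \<tau>"
   by (rule G.feq_shift[OF f(1) t(1), unfolded tail_subgraph_simps(2-), OF t(2) le(1)])
  obtain \<rho>' where r': "G.feq \<rho>' \<tau>" "d \<nu>' + d \<rho>' = d \<mu>' + d \<tau>"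
   by (rule G.feq_shift[OF f(2) t(1), unfolded tail_subgraph_simps(2-), OF t(2)[unfolded u] le(2)])
  have e: "d \<mu> + d \<nu>' = d \<mu>' + d \<nu>" using eq by (simp add: vdiff_eq_iff)
  have "d \<rho> $ i = d \<rho>' $ i" for i
   using arg_cong[OF r(2), of "\<lambda>v. v $ i"] arg_cong[OF r'(2), of "\<lambda>v. v $ i"] arg_cong[OF e, of "\<lambda>v. v $ i"] by simp
  then have "d \<rho> = d \<rho>'" by (simp add: vec_eq_iff)
  then have rr: "\<rho> = \<rho>'" using G.feq_same_deg[OF G.feq_trans[OF r(1) G.feq_sym[OF r'(1)]]] by simp
  have t': "r \<tau> = s \<mu>'" using t(2) u by simp
  show ?thesis
   using scales_unique[OF t(1) scales_shift[OF f(1) c(1) t(1,2) r]] scales_shift[OF f(2) c(2) t(1) t' r'] rr by blast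
 qed
 obtain \<alpha> \<beta> where ab: "\<alpha> \<in> mor \<Theta>" "\<beta> \<in> mor \<Theta>" "r \<alpha> = s \<mu>" "r \<beta> = s \<mu>'" "G.feq (\<mu> \<cdot> \<alpha>) (\<nu> \<cdot> \<alpha>)" "G.feq (\<mu>' \<cdot> \<beta>) (\<nu>' \<cdot> \<beta>)"
  "s (\<mu> \<cdot> \<alpha>) = s (\<mu>' \<cdot> \<beta>)"
  "vdiff (d (\<mu> \<cdot> \<alpha>)) (d (\<nu> \<cdot> \<alpha>)) = vdiff (d \<mu>) (d \<nu>)" "vdiff (d (\<mu>' \<cdot> \<beta>)) (d (\<nu>' \<cdot> \<beta>)) = vdiff (d \<mu>') (d \<nu>')"
  by (rule G.feq_common_source[OF f, unfolded tail_subgraph_simps(2-)])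
 note m = G.feqD(1-3)[OF f(1), simplified] and m' = G.feqD(1-3)[OF f(2), simplified]
 have "scales c (\<mu> \<cdot> \<alpha>) (\<nu> \<cdot> \<alpha>)" by (rule scales_cmp) (use m ab c in auto)
 moreover have "scales c' (\<mu>' \<cdot> \<beta>) (\<nu>' \<cdot> \<beta>)" by (rule scales_cmp) (use m' ab c in auto)
 ultimately show ?thesis using same[OF ab(5,6) _ _ _ ab(7)] ab(8,9) eq by simp
qed

text \<open>Multiplicativity is read off from three equivalent paths at a periodic vertex.\<close>

theorem tail_rep_exists: "\<exists>T \<gamma>. tail_rep \<Lambda> H \<pi> T \<gamma>"
proof -
 interpret G: directed_kgraph \<Theta> by (rule directed_rep_tail)
 define \<gamma> where "\<gamma> p = (if p \<in> G.perset then (SOME c. \<exists>\<mu> \<nu>. G.feq \<mu> \<nu> \<and> vdiff (d \<mu>) (d \<nu>) = p \<and> scales c \<mu> \<nu>) else undefined)" for p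
 have sc: "scales (\<gamma> (vdiff (d \<mu>) (d \<nu>))) \<mu> \<nu>" if f: "G.feq \<mu> \<nu>" for \<mu> \<nu>
 proof -
  let ?p = "vdiff (d \<mu>) (d \<nu>)"
  have p: "?p \<in> G.perset" unfolding G.perset_def using f by auto
  obtain c where c: "scales c \<mu> \<nu>" using swap_scalar[OF f] unfolding scales_def by metis
  have "\<exists>c. \<exists>\<mu> \<nu>. G.feq \<mu> \<nu> \<and> vdiff (d \<mu>) (d \<nu>) = ?p \<and> scales c \<mu> \<nu>" using f c by blast
  from someI_ex[OF this] obtain \<mu>' \<nu>' where m: "G.feq \<mu>' \<nu>'" "vdiff (d \<mu>') (d \<nu>') = ?p" "scales (\<gamma> ?p) \<mu>' \<nu>'"
   unfolding \<gamma>_def using p by auto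
  have "c = \<gamma> ?p" by (rule scales_degree[OF f m(1) m(2)[symmetric] c m(3)])
  then show ?thesis using c by simp
 qed
 have uni: "cmod (\<gamma> p) = 1" if p: "p \<in> G.perset" for p
  using p G.perset_def scales_unimodular sc by auto
 have mult: "\<gamma> (x + y) = \<gamma> x * \<gamma> y" if x: "x \<in> G.perset" and y: "y \<in> G.perset" for x y
 proof -
  obtain p q where pq: "x = vdiff p q" using x unfolding G.perset_def by auto
  obtain p' q' where pq': "y = vdiff p' q'" using y unfolding G.perset_def by auto
  obtain w where w: "w \<in> G.periodic_verts" using G.periodic_verts_nonempty by blast
  have "w \<in> verts \<Theta>" using w by (simp add: G.periodic_verts_def)
  then obtain t0 where t0: "t0 \<in> mor \<Theta>" "r t0 = w" "d t0 = q + q'" using G.outpE[of w "q + q'"] by auto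
  have 1: "vdiff (d t0) (p + q') \<in> G.perset" using x G.perset_vdiff_commute unfolding t0(3) pq vdiff_simps by blast
  obtain t1 where t1: "t1 \<in> mor \<Theta>" "r t1 = w" "d t1 = p + q'" "G.feq t0 t1"
   using G.periodic_verts_swap[OF w t0(1), simplified, OF t0(2) 1] by auto
  have 2: "vdiff (d t1) (p + p') \<in> G.perset" using y G.perset_vdiff_commute unfolding t1(3) pq' vdiff_simps by blast
  obtain t2 where t2: "d t2 = p + p'" "G.feq t1 t2"
   using G.periodic_verts_swap[OF w t1(1), simplified, OF t1(2) 2] by auto
  have f: "G.feq t1 t0" "G.feq t2 t1" "G.feq t2 t0"
   using G.feq_sym t1(4) t2(2) G.feq_trans by blast+
  have "vdiff (d t1) (d t0) = x" "vdiff (d t2) (d t1) = y" "vdiff (d t2) (d t0) = x + y"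
   unfolding t0(3) t1(3) t2(1) pq pq' vdiff_add by simp_all
  then have s: "scales (\<gamma> x) t1 t0" "scales (\<gamma> y) t2 t1" "scales (\<gamma> (x + y)) t2 t0" using sc f by metis+
  have "scales (\<gamma> x * \<gamma> y) t2 t0"
   unfolding scales_def
  proof
   fix h assume h: "h \<in> \<H>"
   have "S t0 h \<in> \<H>" using S_closed t0(1) h by simp
   then show "S t2 h = (\<gamma> x * \<gamma> y) \<odot> S t0 h"
    using s(1,2) h complex_smult_distr(3)[of "S t0 h" "\<gamma> y" "\<gamma> x"] by (simp add: scales_def mult.commute)
  qed
  then show ?thesis using scales_unique[OF t0(1) s(3)] by blast
 qed
 have "\<gamma> \<in> characters (Per \<Theta>)"
  unfolding characters_def G.Per_eq_perset
 proof (intro CollectI conjI ballI)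
  show "\<gamma> \<in> G.perset \<rightarrow>\<^sub>E {z. cmod z = 1}"
   by (intro PiE_I CollectI uni) (simp_all add: \<gamma>_def)
 qed (rule mult)
 moreover have "S \<mu> h = \<gamma> (vdiff (d \<mu>) (d \<nu>)) \<odot> S \<nu> h"
  if "\<mu> \<in> mor \<Theta>" "\<nu> \<in> mor \<Theta>" "path_equiv \<Theta> \<mu> \<nu>" "h \<in> \<H>" for \<mu> \<nu> h
  using sc[OF iffD1[OF G.path_equiv_iff_feq[OF that(1,2)] that(3)]] that(4) unfolding scales_def by blast
 moreover have "v \<in> rep_tail \<longleftrightarrow> (\<exists>h\<in>\<H>. S v h \<noteq> \<zero>)" if "v \<in> V" for v
  using that by (simp add: rep_tail_def)
 ultimately have "tail_rep \<Lambda> H \<pi> rep_tail \<gamma>"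
  by (intro tail_rep.intro kgraph_rep_axioms tail_rep_axioms.intro rep_tail_maximal) assumption+
 then show ?thesis by blast
qed

end

section \<open>Path representations\<close>

lemma ell2_pullback:
 assumes f: "f \<in> carrier (ell2 X)" and b: "b ` V \<subseteq> X" "inj_on b V" and V: "V \<subseteq> X" and c: "cmod c = 1"
 defines "P \<equiv> \<lambda>y. if y \<in> V then c * f (b y) else 0"
 shows "P \<in> carrier (ell2 X)" "hnorm (ell2 X) P \<le> hnorm (ell2 X) f"
proof -
 have sf: "(\<lambda>i. (cmod (f i))\<^sup>2) summable_on X" using f by simp
 have sU: "(\<lambda>i. (cmod (f i))\<^sup>2) summable_on (b ` V)" by (rule summable_on_subset_banach[OF sf b(1)])
 have "(\<lambda>y. (cmod (f (b y)))\<^sup>2) summable_on V"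
  using summable_on_reindex[OF b(2), of "\<lambda>i. (cmod (f i))\<^sup>2"] sU by (simp add: o_def)
 then have sX: "(\<lambda>y. (cmod (P y))\<^sup>2) summable_on X"
  by (rule summable_on_cong_neutral[THEN iffD1, rotated -1]) (use V c in \<open>auto simp: P_def norm_mult\<close>)
 then show P: "P \<in> carrier (ell2 X)" using V by (auto simp: P_def)
 have "(\<Sum>\<^sub>\<infinity>y\<in>X. (cmod (P y))\<^sup>2) = (\<Sum>\<^sub>\<infinity>y\<in>V. (cmod (f (b y)))\<^sup>2)"
  by (rule infsum_cong_neutral) (use V c in \<open>auto simp: P_def norm_mult\<close>)
 also have "\<dots> = (\<Sum>\<^sub>\<infinity>y\<in>b ` V. (cmod (f y))\<^sup>2)"
  using infsum_reindex[OF b(2), of "\<lambda>i. (cmod (f i))\<^sup>2"] by (simp add: o_def)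
 also have "\<dots> \<le> (\<Sum>\<^sub>\<infinity>y\<in>X. (cmod (f y))\<^sup>2)"
  by (rule infsum_mono_neutral[OF sU sf]) (use b in auto)
 finally show "hnorm (ell2 X) P \<le> hnorm (ell2 X) f" unfolding ell2_norm[OF P] ell2_norm[OF f] by simp
qed

lemma ell2_pullback_adjoint:
 assumes V: "V \<subseteq> X" "U \<subseteq> X" and b: "bij_betw b V U" "\<And>y. y \<in> V \<Longrightarrow> b' (b y) = y"
 shows "hinner (ell2 X) (\<lambda>y. if y \<in> U then c * f (b' y) else 0) g
  = hinner (ell2 X) f (\<lambda>y. if y \<in> V then cnj c * g (b y) else 0)"
proof -
 have "hinner (ell2 X) (\<lambda>y. if y \<in> U then c * f (b' y) else 0) g = (\<Sum>\<^sub>\<infinity>y\<in>U. c * f (b' y) * cnj (g y))"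
  unfolding ell2_sel by (rule infsum_cong_neutral) (use V in auto)
 also have "\<dots> = (\<Sum>\<^sub>\<infinity>y\<in>V. c * f (b' (b y)) * cnj (g (b y)))"
  by (rule infsum_reindex_bij_betw[OF b(1), symmetric])
 also have "\<dots> = (\<Sum>\<^sub>\<infinity>y\<in>X. f y * cnj (if y \<in> V then cnj c * g (b y) else 0))"
  by (rule infsum_cong_neutral) (use V b in auto)
 finally show ?thesis by simp
qed

locale path_space = rf_kgraph \<Lambda> for \<Lambda> :: "('e, 'k::finite) kgraph" +
 fixes x :: "('e, 'k) inf_path" and z :: "complex ^ 'k"
 assumes x: "x \<in> inf_paths \<Lambda>" and z: "cmod (z $ i) = 1"
begin

abbreviation "X \<equiv> orbit x"
abbreviation "H \<equiv> ell2 X"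
abbreviation "\<H> \<equiv> carrier H"
abbreviation "ip \<equiv> hinner H"
abbreviation "nrm \<equiv> hnorm H"

definition zp :: "nat ^ 'k \<Rightarrow> complex" where
 "zp n = (\<Prod>i\<in>UNIV. (z $ i) ^ (n $ i))"

lemma zp: "cmod (zp n) = 1" "zp (m + n) = zp m * zp n" "zp 0 = 1" "zp n * cnj (zp n) = 1" "cnj (zp n) * zp n = 1"
proof -
 show 1: "cmod (zp n) = 1" by (simp add: zp_def norm_power z flip: prod_norm)
 show "zp (m + n) = zp m * zp n" "zp 0 = 1" by (simp_all add: zp_def power_add prod.distrib)
 show "zp n * cnj (zp n) = 1" using 1 complex_norm_square[of "zp n"] by simp
 then show "cnj (zp n) * zp n = 1" by (simp add: mult.commute)
qed

lemmas X_path = shift_tail_class(2)[OF x]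
lemmas X_shift = shift_tail_class(3)[OF x]
lemmas X_prepend = shift_tail_class(4)[OF x]

lemma X_split:
 assumes "y \<in> X"
 shows "y (0, n) \<in> M" "d (y (0, n)) = n" "r (y (0, n)) = y (0, 0)" "s (y (0, n)) = shift n y (0, 0)"
  "pre (y (0, n)) (shift n y) = y"
 using inf_pathsD[OF X_path[OF assms], of 0 n] prepend_shift[OF X_path[OF assms], of n] by (auto simp: shift_apply)

lemma X_append:
 assumes "y \<in> X" "\<kappa> \<in> M" "y (0, 0) = s \<kappa>"
 shows "pre \<kappa> y \<in> X" "pre \<kappa> y (0, d \<kappa>) = \<kappa>" "shift (d \<kappa>) (pre \<kappa> y) = y"
 using X_prepend[OF assms(1,2)] prepend(2,3)[OF assms(2) X_path[OF assms(1)] assms(3)] assms(3) by auto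

definition starting :: "'e \<Rightarrow> ('e, 'k) inf_path set" where
 "starting \<kappa> = {y \<in> X. y (0, d \<kappa>) = \<kappa>}"

lemma starting_vert: "v \<in> V \<Longrightarrow> starting v = {y \<in> X. y (0, 0) = v}"
 by (simp add: starting_def deg_vert)

lemma prepend_bij:
 assumes k: "\<kappa> \<in> M"
 shows "bij_betw (pre \<kappa>) (starting (s \<kappa>)) (starting \<kappa>)" "bij_betw (shift (d \<kappa>)) (starting \<kappa>) (starting (s \<kappa>))"
  "y \<in> starting (s \<kappa>) \<Longrightarrow> shift (d \<kappa>) (pre \<kappa> y) = y"
  "y \<in> starting \<kappa> \<Longrightarrow> pre \<kappa> (shift (d \<kappa>) y) = y"
proof -
 note sv = starting_vert[OF src_verts[OF k]]
 have a: "pre \<kappa> y \<in> starting \<kappa> \<and> shift (d \<kappa>) (pre \<kappa> y) = y" if "y \<in> starting (s \<kappa>)" for y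
  using X_append that k sv unfolding starting_def by simp
 have b: "shift (d \<kappa>) y \<in> starting (s \<kappa>) \<and> pre \<kappa> (shift (d \<kappa>) y) = y" if "y \<in> starting \<kappa>" for y
  using X_split[of y "d \<kappa>"] X_shift that unfolding sv starting_def[of \<kappa>] by simp
 show "bij_betw (pre \<kappa>) (starting (s \<kappa>)) (starting \<kappa>)"
  by (rule bij_betw_byWitness[where f' = "shift (d \<kappa>)"]) (use a b in auto)
 show "bij_betw (shift (d \<kappa>)) (starting \<kappa>) (starting (s \<kappa>))"
  by (rule bij_betw_byWitness[where f' = "pre \<kappa>"]) (use a b in auto)
 show "y \<in> starting (s \<kappa>) \<Longrightarrow> shift (d \<kappa>) (pre \<kappa> y) = y"
  "y \<in> starting \<kappa> \<Longrightarrow> pre \<kappa> (shift (d \<kappa>) y) = y" using a b by auto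
qed

lemma starting_X: "starting \<kappa> \<subseteq> X"
 by (auto simp: starting_def)

definition creation :: "'e \<Rightarrow> (('e, 'k) inf_path \<Rightarrow> complex) \<Rightarrow> (('e, 'k) inf_path \<Rightarrow> complex)" where
 "creation \<kappa> f = (\<lambda>y. if y \<in> starting \<kappa> then zp (d \<kappa>) * f (shift (d \<kappa>) y) else 0)"

definition annihilation :: "'e \<Rightarrow> (('e, 'k) inf_path \<Rightarrow> complex) \<Rightarrow> (('e, 'k) inf_path \<Rightarrow> complex)" where
 "annihilation \<kappa> f = (\<lambda>y. if y \<in> starting (s \<kappa>) then cnj (zp (d \<kappa>)) * f (pre \<kappa> y) else 0)"

sublocale E: hilbert_space H
 by (rule hilbert_space_ell2)

lemma creation:
 assumes k: "\<kappa> \<in> M" and f: "f \<in> \<H>"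
 shows "creation \<kappa> f \<in> \<H>" "nrm (creation \<kappa> f) \<le> nrm f"
  "annihilation \<kappa> f \<in> \<H>" "nrm (annihilation \<kappa> f) \<le> nrm f"
  "ip (creation \<kappa> f) g = ip f (annihilation \<kappa> g)"
proof -
 note b = prepend_bij[OF k]
 have i: "shift (d \<kappa>) ` starting \<kappa> \<subseteq> X" "inj_on (shift (d \<kappa>)) (starting \<kappa>)"
  "pre \<kappa> ` starting (s \<kappa>) \<subseteq> X" "inj_on (pre \<kappa>) (starting (s \<kappa>))"
  using b(1,2) starting_X unfolding bij_betw_def by auto
 show "creation \<kappa> f \<in> \<H>" "nrm (creation \<kappa> f) \<le> nrm f"
  unfolding creation_def by (rule ell2_pullback[OF f i(1,2) starting_X zp(1)])+
 have c: "cmod (cnj (zp (d \<kappa>))) = 1" using zp(1) by simp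
 show "annihilation \<kappa> f \<in> \<H>" "nrm (annihilation \<kappa> f) \<le> nrm f"
  unfolding annihilation_def by (rule ell2_pullback[OF f i(3,4) starting_X c])+
 show "ip (creation \<kappa> f) g = ip f (annihilation \<kappa> g)"
  unfolding creation_def annihilation_def by (rule ell2_pullback_adjoint[OF starting_X starting_X b(1,3)])
qed

definition path_op :: "'e \<Rightarrow> (('e, 'k) inf_path \<Rightarrow> complex) \<Rightarrow> (('e, 'k) inf_path \<Rightarrow> complex)" where
 "path_op \<kappa> = restrict (creation \<kappa>) \<H>"

lemma path_op_adjoint:
 assumes k: "\<kappa> \<in> M"
 shows "adjoint_pair H (path_op \<kappa>) (restrict (annihilation \<kappa>) \<H>)"
 unfolding path_op_def
proof (rule E.adjoint_pairI[where C = 1 and C' = 1])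
 fix v w assume v: "v \<in> \<H>" and w: "w \<in> \<H>"
 show "ip (restrict (creation \<kappa>) \<H> v) w =
   ip v (restrict (annihilation \<kappa>) \<H> w)"
  unfolding restrict_apply'[OF v] restrict_apply'[OF w] by (rule creation(5)[OF k v])
next
 fix v assume v: "v \<in> \<H>"
 note c = creation[OF k v]
 show "restrict (creation \<kappa>) \<H> v \<in> \<H>" "restrict (annihilation \<kappa>) \<H> v \<in> \<H>"
  "nrm (restrict (creation \<kappa>) \<H> v) \<le> 1 * nrm v"
  "nrm (restrict (annihilation \<kappa>) \<H> v) \<le> 1 * nrm v"
  unfolding restrict_apply'[OF v] mult_1 by (rule c(1), rule c(3), rule c(2), rule c(4))
qed simp_all

text \<open>The operator \<open>s\<^sub>\<kappa>\<close> moves \<open>\<xi>\<^sub>y\<close> to a multiple of the basis vector of \<open>\<kappa> y\<close>. On functions this is a pullback along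
the shift \<open>\<kappa> y \<mapsto> y\<close>, and the relations are verified pointwise.\<close>

lemma path_op_CK: "CK_family \<Lambda> (bounded_operators H) path_op"
proof -
 let ?B = "bounded_operators H"
 have tB: "path_op \<kappa> \<in> carrier ?B" if "\<kappa> \<in> M" for \<kappa> using path_op_adjoint[OF that] E.B_carrier by blast
 have st: "star ?B (path_op \<kappa>) = restrict (annihilation \<kappa>) \<H>" if "\<kappa> \<in> M" for \<kappa>
  by (rule E.star_B_eq[OF path_op_adjoint[OF that]])
 have t: "path_op \<kappa> f = creation \<kappa> f" if "f \<in> \<H>" for \<kappa> f by (simp only: path_op_def restrict_apply'[OF that])
 have m: "(P \<otimes>\<^bsub>?B\<^esub> Q) f = P (Q f)" if "f \<in> \<H>" for P Q f unfolding E.B_simps restrict_apply'[OF that] ..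
 have vcr: "creation v f = (\<lambda>y. if y \<in> starting v then f y else 0)" if v: "v \<in> V" for v f
  by (rule) (use v in \<open>auto simp: creation_def deg_vert zp shift_0 starting_def X_path\<close>)
 have van: "annihilation v f = (\<lambda>y. if y \<in> starting v then f y else 0)" if v: "v \<in> V" for v f
 proof (rule ext)
  fix y
  have "pre v y = y" if "y \<in> starting v"
   using that prepend_bij(4)[OF vertsD(1)[OF v], of y] deg_vert[OF v] shift_0 X_path starting_X by (simp add: subset_iff)
  then show "annihilation v f y = (if y \<in> starting v then f y else 0)"
   using v vertsD(2) by (auto simp: annihilation_def deg_vert zp)
 qed
 have "CK_relations \<Lambda> ?B (=) path_op"
  unfolding CK_relations_def
 proof (intro conjI ballI impI allI)
  fix v assume v: "v \<in> V"
  note vM = vertsD(1)[OF v]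
  show "star ?B (path_op v) = path_op v" unfolding st[OF vM] unfolding path_op_def
   by (rule restrict_ext) (simp only: vcr[OF v] van[OF v])
  show "path_op v \<otimes>\<^bsub>?B\<^esub> path_op v = path_op v"
  proof (rule E.B_eqI[OF E.B_closed(2)[OF tB[OF vM] tB[OF vM]] tB[OF vM]])
   fix f assume f: "f \<in> \<H>"
   show "(path_op v \<otimes>\<^bsub>?B\<^esub> path_op v) f = path_op v f"
    unfolding m[OF f] t[OF f] t[OF creation(1)[OF vM f]] unfolding vcr[OF v] by auto
  qed
  fix w assume w: "w \<in> V" "v \<noteq> w"
  note wM = vertsD(1)[OF w(1)]
  show "path_op v \<otimes>\<^bsub>?B\<^esub> path_op w = \<zero>\<^bsub>?B\<^esub>"
  proof (rule E.B_eqI[OF E.B_closed(2)[OF tB[OF vM] tB[OF wM]] E.B_zero_closed])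
   fix f assume f: "f \<in> \<H>"
   show "(path_op v \<otimes>\<^bsub>?B\<^esub> path_op w) f = \<zero>\<^bsub>?B\<^esub> f"
    unfolding m[OF f] t[OF f] t[OF creation(1)[OF wM f]] unfolding vcr[OF v] vcr[OF w(1)] E.B_simps restrict_apply'[OF f] using w(2) by (auto simp: starting_vert[OF v] starting_vert[OF w(1)])
  qed
 next
  fix \<mu> \<nu> assume a: "\<mu> \<in> M" "\<nu> \<in> M" "s \<mu> = r \<nu>"
  note c = cmp_closed[OF a] and dc = deg_cmp[OF a]
  show "path_op \<mu> \<otimes>\<^bsub>?B\<^esub> path_op \<nu> = path_op (\<mu> \<cdot> \<nu>)"
  proof (rule E.B_eqI[OF E.B_closed(2)[OF tB[OF a(1)] tB[OF a(2)]] tB[OF c]])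
   fix f assume f: "f \<in> \<H>"
   have mem: "y \<in> starting \<mu> \<and> shift (d \<mu>) y \<in> starting \<nu> \<longleftrightarrow> y \<in> starting (\<mu> \<cdot> \<nu>)" for y
   proof (cases "y \<in> X")
    case True
    note p = X_path[OF True]
    have sp: "shift (d \<mu>) y (0, d \<nu>) = y (d \<mu>, d \<mu> + d \<nu>)" by (simp add: shift_apply add.commute)
    have e: "y (0, d \<mu>) \<cdot> y (d \<mu>, d \<mu> + d \<nu>) = y (0, d \<mu> + d \<nu>)" using inf_pathsD(5)[OF p, of 0 "d \<mu>" "d \<mu> + d \<nu>"] by simp
    have q: "pfx (d \<mu>) (y (0, d \<mu> + d \<nu>)) = y (0, d \<mu>)" "sfx (d \<mu>) (y (0, d \<mu> + d \<nu>)) = y (d \<mu>, d \<mu> + d \<nu>)"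
     using inf_path_pfx[OF p, of "d \<mu>" "d \<mu> + d \<nu>"] by auto
    have "y (0, d \<mu>) = \<mu> \<and> y (d \<mu>, d \<mu> + d \<nu>) = \<nu> \<longleftrightarrow> y (0, d \<mu> + d \<nu>) = \<mu> \<cdot> \<nu>"
     using e q pfx_cmp[OF a] by metis
    then show ?thesis using X_shift[OF True] by (simp add: starting_def dc sp)
   qed (use starting_X in blast)
   have sh: "shift (d \<nu>) (shift (d \<mu>) y) = shift (d (\<mu> \<cdot> \<nu>)) y" if "y \<in> starting \<mu>" for y
    using shift_shift[of y "d \<nu>" "d \<mu>"] X_path starting_X that by (auto simp: dc)
   show "(path_op \<mu> \<otimes>\<^bsub>?B\<^esub> path_op \<nu>) f = path_op (\<mu> \<cdot> \<nu>) f"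
    unfolding m[OF f] t[OF f] t[OF creation(1)[OF a(2) f]]
   proof
    fix y
    show "creation \<mu> (creation \<nu> f) y = creation (\<mu> \<cdot> \<nu>) f y"
     using mem sh creation_def dc zp by auto
   qed
  qed
 next
  fix \<kappa> assume k: "\<kappa> \<in> M"
  note sM = src_closed[OF k] and sv = src_verts[OF k]
  show "star ?B (path_op \<kappa>) \<otimes>\<^bsub>?B\<^esub> path_op \<kappa> = path_op (s \<kappa>)"
  proof (rule E.B_eqI[OF E.B_closed(2)[OF E.B_closed(4)[OF tB[OF k]] tB[OF k]] tB[OF sM]])
   fix f assume f: "f \<in> \<H>"
   show "(star ?B (path_op \<kappa>) \<otimes>\<^bsub>?B\<^esub> path_op \<kappa>) f = path_op (s \<kappa>) f"
    unfolding m[OF f] t[OF f] st[OF k] restrict_apply'[OF creation(1)[OF k f]] vcr[OF sv]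
   proof
    fix y
    show "annihilation \<kappa> (creation \<kappa> f) y = (if y \<in> starting (s \<kappa>) then f y else 0)"
     using bij_betw_apply prepend_bij k zp annihilation_def creation_def by fastforce
   qed
  qed
 next
  fix v n assume v: "v \<in> V"
  note vM = vertsD(1)[OF v]
  let ?J = "{\<kappa> \<in> M. r \<kappa> = v \<and> d \<kappa> = n}"
  let ?q = "\<lambda>\<kappa>. path_op \<kappa> \<otimes>\<^bsub>?B\<^esub> star ?B (path_op \<kappa>)"
  interpret Bo: cstar_algebra ?B by (rule E.cstar_algebra_B)
  have fJ: "finite ?J" using outp(1)[OF v, of n] by (simp add: outp_def)
  have qB: "?q \<kappa> \<in> carrier ?B" if "\<kappa> \<in> ?J" for \<kappa> using that tB by auto
  have sumB: "finsum ?B ?q ?J \<in> carrier ?B" using qB by (auto intro!:)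
  show "path_op v = (\<Oplus>\<^bsub>?B\<^esub>\<kappa>\<in>?J. ?q \<kappa>)"
  proof (rule E.B_eqI[OF tB[OF vM] sumB])
   fix f assume f: "f \<in> \<H>"
   show "path_op v f = finsum ?B ?q ?J f"
   proof
    fix y
    show "path_op v f y = finsum ?B ?q ?J f y"
    proof (cases "y \<in> X")
     case False
     then show ?thesis using E.B_apply(2)[OF tB[OF vM] f] E.B_apply(2)[OF sumB f] by simp
    next
     case True
     have q: "?q \<kappa> f y = (if y (0, n) = \<kappa> then f y else 0)" if kJ: "\<kappa> \<in> ?J" for \<kappa>
     proof -
      have k: "\<kappa> \<in> M" "d \<kappa> = n" using kJ by auto
      have "?q \<kappa> f = creation \<kappa> (annihilation \<kappa> f)"
       unfolding m[OF f] st[OF k(1)] restrict_apply'[OF f] by (rule t[OF creation(3)[OF k(1) f]])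
      moreover have "creation \<kappa> (annihilation \<kappa> f) y = f y" if ys: "y \<in> starting \<kappa>"
       using bij_betw_apply prepend_bij k ys zp annihilation_def creation_def by fastforce
      moreover have "creation \<kappa> (annihilation \<kappa> f) y = 0" if "y \<notin> starting \<kappa>" using that by (simp add: creation_def)
      ultimately show ?thesis using True k(2) by (auto simp: starting_def)
     qed
     have "finsum ?B ?q ?J f y = ip (finsum ?B ?q ?J f) (ket y)" by (rule hinner_ket[OF True, symmetric])
     also have "\<dots> = (\<Sum>\<kappa>\<in>?J. ip (?q \<kappa> f) (ket y))"
      by (rule E.finsum_B_apply[OF fJ qB f ket_closed[OF True]])
     also have "\<dots> = (\<Sum>\<kappa>\<in>?J. if y (0, n) = \<kappa> then f y else 0)"
      by (rule sum.cong[OF refl]) (simp only: hinner_ket[OF True] q)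
     also have "\<dots> = (if y (0, n) \<in> ?J then f y else 0)" using fJ by simp
     also have "\<dots> = path_op v f y"
      unfolding t[OF f] vcr[OF v] starting_vert[OF v] using X_split(1-3) True by simp
     finally show ?thesis by simp
    qed
   qed
  qed
 qed
 then show ?thesis using tB by (auto simp: CK_family_def)
qed

lemma creation_ket:
 assumes k: "\<kappa> \<in> M" and y: "y \<in> X"
 shows "creation \<kappa> (ket y) = (if y (0, 0) = s \<kappa> then zp (d \<kappa>) \<odot>\<^bsub>H\<^esub> ket (pre \<kappa> y) else \<zero>\<^bsub>H\<^esub>)"
proof
 fix u
 have ss: "y \<in> starting (s \<kappa>) \<longleftrightarrow> y (0, 0) = s \<kappa>" using starting_vert[OF src_verts[OF k]] y by simp
 have "u \<in> starting \<kappa> \<and> shift (d \<kappa>) u = y \<longleftrightarrow> y \<in> starting (s \<kappa>) \<and> u = pre \<kappa> y"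
  using prepend_bij(3,4)[OF k] bij_betw_apply[OF prepend_bij(1)[OF k]] bij_betw_apply[OF prepend_bij(2)[OF k]] by metis
 then show "creation \<kappa> (ket y) u = (if y (0, 0) = s \<kappa> then zp (d \<kappa>) \<odot>\<^bsub>H\<^esub> ket (pre \<kappa> y) else \<zero>\<^bsub>H\<^esub>) u"
  unfolding ss by (auto simp: creation_def ket_def)
qed

theorem path_rep_exists: "\<exists>\<pi>. is_path_rep \<Lambda> X z \<pi>"
proof -
 obtain \<phi> where p: "star_hom (kgraph_cstar \<Lambda>) (bounded_operators H) \<phi>"
  "\<forall>\<mu>\<in>M. \<phi> (kgraph_gen \<Lambda> \<mu>) = path_op \<mu>"
  using kgraph_cstar_universal[OF E.cstar_algebra_B path_op_CK] by blast
 interpret A: cstar_algebra "kgraph_cstar \<Lambda>" by (rule cstar_algebra_kgraph)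
 have "hilbert_rep (kgraph_cstar \<Lambda>) H \<phi>" by (rule E.star_hom_hilbert_rep[OF A.star_algebra_axioms p(1)])
 moreover have "\<phi> (kgraph_gen \<Lambda> \<kappa>) (ket y) = (if y (0, 0) = s \<kappa>
   then (\<Prod>i\<in>UNIV. (z $ i) ^ (d \<kappa> $ i)) \<odot>\<^bsub>H\<^esub> ket (pre \<kappa> y) else \<zero>\<^bsub>H\<^esub>)"
  if "\<kappa> \<in> M" "y \<in> X" for \<kappa> y
    using creation_ket[OF that] p(2) that(1) restrict_apply'[OF ket_closed[OF that(2)], of "creation \<kappa>"]
  by (simp only: path_op_def zp_def)
 ultimately show ?thesis unfolding is_path_rep_def by blast
qed

end

locale path_rep = path_space \<Lambda> x z for \<Lambda> :: "('e, 'k::finite) kgraph" and x z +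
 fixes \<pi>
 assumes is_path_rep: "is_path_rep \<Lambda> X z \<pi>"
begin

sublocale R: kgraph_rep \<Lambda> H \<pi>
 by unfold_locales (use is_path_rep in \<open>simp add: is_path_rep_def\<close>)

abbreviation "g \<equiv> kgraph_gen \<Lambda>"
abbreviation "A \<equiv> kgraph_cstar \<Lambda>"
abbreviation "\<A> \<equiv> carrier A"

lemma gen_ket:
 assumes "\<kappa> \<in> M" "y \<in> X"
 shows "y (0, 0) = s \<kappa> \<Longrightarrow> \<pi> (g \<kappa>) (ket y) = zp (d \<kappa>) \<odot>\<^bsub>H\<^esub> ket (pre \<kappa> y)"
  "y (0, 0) \<noteq> s \<kappa> \<Longrightarrow> \<pi> (g \<kappa>) (ket y) = \<zero>\<^bsub>H\<^esub>"
proof -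
 have "\<forall>\<kappa>\<in>M. \<forall>y\<in>X. \<pi> (g \<kappa>) (ket y) = (if y (0, 0) = s \<kappa>
   then zp (d \<kappa>) \<odot>\<^bsub>H\<^esub> ket (pre \<kappa> y) else \<zero>\<^bsub>H\<^esub>)"
    unfolding zp_def by (rule conjunct2[OF is_path_rep[unfolded is_path_rep_def]])
 then have "\<pi> (g \<kappa>) (ket y) = (if y (0, 0) = s \<kappa>
   then zp (d \<kappa>) \<odot>\<^bsub>H\<^esub> ket (pre \<kappa> y) else \<zero>\<^bsub>H\<^esub>)"
    using assms by blast
 then show "y (0, 0) = s \<kappa> \<Longrightarrow> \<pi> (g \<kappa>) (ket y) = zp (d \<kappa>) \<odot>\<^bsub>H\<^esub> ket (pre \<kappa> y)"
  "y (0, 0) \<noteq> s \<kappa> \<Longrightarrow> \<pi> (g \<kappa>) (ket y) = \<zero>\<^bsub>H\<^esub>"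
  by auto
qed

lemma rep_coordinate:
 assumes "a \<in> \<A>" "h \<in> \<H>" "y \<in> X"
 shows "\<pi> a h y = ip h (\<pi> (star A a) (ket y))"
 using hinner_ket[OF assms(3), of "\<pi> a h"] R.rep_adj[OF assms(1,2) ket_closed[OF assms(3)]] by (rule trans[OF sym])

text \<open>The coefficients of \<open>\<pi> a\<^sup>* w\<close> are inner products of \<open>w\<close> with the vectors \<open>\<pi> a \<xi>\<^sub>y\<close>.\<close>

lemma kill_kets:
 assumes a: "a \<in> \<A>" and k: "\<And>y. y \<in> X \<Longrightarrow> \<pi> a (ket y) = \<zero>\<^bsub>H\<^esub>" and h: "h \<in> \<H>"
 shows "\<pi> a h = \<zero>\<^bsub>H\<^esub>"
proof (rule E.hinner_eqI)
 note sa = R.A.star_closed[OF a]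
 have star: "\<pi> (star A a) w = \<zero>\<^bsub>H\<^esub>" if w: "w \<in> \<H>" for w
 proof
  fix y
  show "\<pi> (star A a) w y = \<zero>\<^bsub>H\<^esub> y"
  proof (cases "y \<in> X")
   case True
   then show ?thesis using rep_coordinate[OF sa w True] k R.A.star_star[OF a] by simp
  next
   case False
   then show ?thesis using R.rep_closed[OF sa w] by simp
  qed
 qed
 fix w assume w: "w \<in> \<H>"
 have "ip (\<pi> a h) w = ip h (\<pi> (star A a) w)" by (rule R.rep_adj[OF a h w])
 then show "ip (\<pi> a h) w = ip \<zero>\<^bsub>H\<^esub> w"
  unfolding star[OF w] E.hinner_zero_right[OF h] E.hinner_zero_left[OF w] .
qed (use R.rep_closed[OF a h] E.M.zero_closed in auto)

lemma ket_inner: "\<lbrakk>u \<in> X; y \<in> X\<rbrakk> \<Longrightarrow> ip (ket u) (ket y) = (if u = y then 1 else 0)"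
 by (subst hinner_ket) (auto simp: ket_def)

lemma star_gen_ket:
 assumes k: "\<kappa> \<in> M" and y: "y \<in> X"
 shows "y \<in> starting \<kappa> \<Longrightarrow> \<pi> (star A (g \<kappa>)) (ket y) = cnj (zp (d \<kappa>)) \<odot>\<^bsub>H\<^esub> ket (shift (d \<kappa>) y)"
  "y \<notin> starting \<kappa> \<Longrightarrow> \<pi> (star A (g \<kappa>)) (ket y) = \<zero>\<^bsub>H\<^esub>"
proof -
 note gA = R.gen_closed[OF k]
 note kc = ket_closed[OF y]
 have *: "\<pi> (star A (g \<kappa>)) (ket y) u = (if u \<in> starting (s \<kappa>) \<and> pre \<kappa> u = y then cnj (zp (d \<kappa>)) else 0)" for u
 proof (cases "u \<in> X")
  case False
  then show ?thesis using R.rep_closed[OF R.A.star_closed[OF gA] kc] starting_X by auto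
 next
  case True
  have "\<pi> (star A (g \<kappa>)) (ket y) u = ip (ket y) (\<pi> (g \<kappa>) (ket u))"
   using rep_coordinate[OF R.A.star_closed[OF gA] kc True] R.A.star_star[OF gA] by simp
  also have "\<dots> = (if u \<in> starting (s \<kappa>) \<and> pre \<kappa> u = y then cnj (zp (d \<kappa>)) else 0)"
  proof (cases "u (0, 0) = s \<kappa>")
   case s: True
   have p: "pre \<kappa> u \<in> X" by (rule X_append(1)[OF True k s])
   have "ip (ket y) (\<pi> (g \<kappa>) (ket u)) = cnj (zp (d \<kappa>)) * ip (ket y) (ket (pre \<kappa> u))"
    unfolding gen_ket(1)[OF k True s] by (rule E.hinner_smult_right[OF kc ket_closed[OF p]])
   then show ?thesis using ket_inner[OF y p] True s starting_vert[OF src_verts[OF k]] by auto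
  next
   case False
   then show ?thesis unfolding gen_ket(2)[OF k True False] using starting_vert[OF src_verts[OF k]] by simp
  qed
  finally show ?thesis .
 qed
 note b = prepend_bij(3,4)[OF k] bij_betw_apply[OF prepend_bij(1)[OF k]] bij_betw_apply[OF prepend_bij(2)[OF k]]
 show "\<pi> (star A (g \<kappa>)) (ket y) = cnj (zp (d \<kappa>)) \<odot>\<^bsub>H\<^esub> ket (shift (d \<kappa>) y)" if ys: "y \<in> starting \<kappa>"
 proof
  fix u
  have "u \<in> starting (s \<kappa>) \<and> pre \<kappa> u = y \<longleftrightarrow> u = shift (d \<kappa>) y" using b ys by metis
  then show "\<pi> (star A (g \<kappa>)) (ket y) u = (cnj (zp (d \<kappa>)) \<odot>\<^bsub>H\<^esub> ket (shift (d \<kappa>) y)) u"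
   unfolding * by (simp add: ket_def)
 qed
 show "\<pi> (star A (g \<kappa>)) (ket y) = \<zero>\<^bsub>H\<^esub>" if ys: "y \<notin> starting \<kappa>"
  using b ys * by fastforce
qed

lemma range_projection:
 assumes k: "\<kappa> \<in> M" and h: "h \<in> \<H>"
 shows "\<pi> (g \<kappa>) (\<pi> (star A (g \<kappa>)) h) = (\<lambda>y. if y \<in> starting \<kappa> then h y else 0)"
proof
 fix y
 note gA = R.gen_closed[OF k] and sA = R.A.star_closed[OF R.gen_closed[OF k]]
 note sh = R.rep_closed[OF sA h]
 show "\<pi> (g \<kappa>) (\<pi> (star A (g \<kappa>)) h) y = (if y \<in> starting \<kappa> then h y else 0)"
 proof (cases "y \<in> X")
  case False
  then show ?thesis using R.rep_closed[OF gA sh] starting_X by auto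
 next
  case True
  have 1: "\<pi> (g \<kappa>) (\<pi> (star A (g \<kappa>)) h) y = ip (\<pi> (star A (g \<kappa>)) h) (\<pi> (star A (g \<kappa>)) (ket y))"
   by (rule rep_coordinate[OF gA sh True])
  show ?thesis
  proof (cases "y \<in> starting \<kappa>")
   case ys: True
   let ?u = "shift (d \<kappa>) y"
   have u: "?u \<in> X" "?u (0, 0) = s \<kappa>" "pre \<kappa> ?u = y"
    using bij_betw_apply[OF prepend_bij(2)[OF k] ys] prepend_bij(4)[OF k ys] starting_vert[OF src_verts[OF k]] by auto
   have "\<pi> (g \<kappa>) (\<pi> (star A (g \<kappa>)) h) y = zp (d \<kappa>) * ip (\<pi> (star A (g \<kappa>)) h) (ket ?u)"
    unfolding 1 star_gen_ket(1)[OF k True ys] E.hinner_smult_right[OF sh ket_closed[OF u(1)]] by simp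
   also have "ip (\<pi> (star A (g \<kappa>)) h) (ket ?u) = ip h (\<pi> (g \<kappa>) (ket ?u))"
    using R.rep_adj[OF sA h ket_closed[OF u(1)]] R.A.star_star[OF gA] by simp
   also have "\<dots> = cnj (zp (d \<kappa>)) * h y"
    unfolding gen_ket(1)[OF k u(1,2)] u(3) E.hinner_smult_right[OF h ket_closed[OF True]] hinner_ket[OF True] ..
   finally show ?thesis using zp(4) ys by simp
  next
   case False
   then show ?thesis unfolding 1 star_gen_ket(2)[OF k True False] by simp
  qed
 qed
qed

lemma tail_equivalent:
 assumes "y \<in> X" "y' \<in> X"
 obtains p q where "shift p y = shift q y'"
proof -
 have *: "\<exists>p m. \<forall>n. shift (p + n) y = shift (m + n) x" if y: "y \<in> X" for y
 proof -
  obtain m \<kappa> where k: "\<kappa> \<in> M" "s \<kappa> = x (m, m)" "y = pre \<kappa> (shift m x)"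
   using y unfolding shift_tail_class_def by blast
  have sx: "shift m x (0, 0) = s \<kappa>" using k(2) by (simp add: shift_apply)
  have "shift (d \<kappa>) y = shift m x" using prepend(3)[OF k(1) shift_closed[OF x] sx] k(3) by simp
  then have "shift (d \<kappa> + n) y = shift (m + n) x" for n
   using shift_shift[OF X_path[OF y], of n "d \<kappa>"] shift_shift[OF x, of n m] by simp
  then show ?thesis by blast
 qed
 obtain p m where pm: "\<And>n. shift (p + n) y = shift (m + n) x" using *[OF assms(1)] by blast
 obtain q l where ql: "\<And>n. shift (q + n) y' = shift (l + n) x" using *[OF assms(2)] by blast
 have "shift (p + l) y = shift (q + m) y'" using pm ql by (simp add: add.commute)
 then show thesis by (rule)
qed

text \<open>Let \<open>w\<close> be a vector of a closed invariant subspace with nonzero coordinate at \<open>y0\<close>. The projections onto the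
paths that begin with longer and longer initial segments of \<open>y0\<close> map \<open>w\<close> to vectors that converge to a
multiple of the basis vector of \<open>y0\<close>. From it all basis vectors are obtained, since any two paths in \<open>X\<close>
have a common tail.\<close>

theorem irreducible_path_rep: "irreducible_rep A H \<pi>"
 unfolding irreducible_rep_def
proof (intro conjI allI impI)
 show "hilbert_rep A H \<pi>" by (rule R.rep)
 note xX = shift_tail_class(1)[OF x]
 have kz: "ket x \<noteq> \<zero>\<^bsub>H\<^esub>" by (auto simp: ket_def fun_eq_iff)
 have v: "x (0, 0) \<in> V" by (rule inf_path_vert[OF x])
 have "\<pi> (g (x (0, 0))) (ket x) = ket x"
  using gen_ket(1)[OF vertsD(1)[OF v] xX] vertsD(2)[OF v] deg_vert[OF v] prepend_shift[OF x, of 0] shift_0[OF x] by (simp add: zp(3))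
 then show "\<exists>a\<in>\<A>. \<exists>v\<in>\<H>. \<pi> a v \<noteq> \<zero>\<^bsub>H\<^esub>"
  using kz R.gen_closed[OF vertsD(1)[OF v]] ket_closed[OF xX] by metis
 fix W assume "submodule W complex_ring H \<and> norm_closed H nrm W \<and> (\<forall>a\<in>\<A>. \<forall>w\<in>W. \<pi> a w \<in> W)"
 then have W: "submodule W complex_ring H" "norm_closed H nrm W" and inv: "\<And>a w. \<lbrakk>a \<in> \<A>; w \<in> W\<rbrakk> \<Longrightarrow> \<pi> a w \<in> W"
  by auto
 note sub = E.submoduleE[OF W(1)]
 have Wc: "W \<subseteq> \<H>" using W(2) by (simp add: norm_closed_def)
 have scal: "u \<in> W" if u: "u \<in> \<H>" "c \<odot>\<^bsub>H\<^esub> u \<in> W" "c \<noteq> 0" for c u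
 proof -
  have "(1 / c) \<odot>\<^bsub>H\<^esub> (c \<odot>\<^bsub>H\<^esub> u) \<in> W" by (rule sub(4)[OF _ u(2)]) simp
  moreover have "(1 / c) \<odot>\<^bsub>H\<^esub> (c \<odot>\<^bsub>H\<^esub> u) = u" using u(3) by simp
  ultimately show ?thesis by simp
 qed
 have zW: "\<zero>\<^bsub>H\<^esub> \<in> W"
 proof -
  obtain w where w: "w \<in> W" using sub(2) by blast
  have "0 \<odot>\<^bsub>H\<^esub> w \<in> W" by (rule sub(4)[OF _ w]) simp
  then show ?thesis by simp
 qed
 show "W = {\<zero>\<^bsub>H\<^esub>} \<or> W = \<H>"
 proof (cases "W = {\<zero>\<^bsub>H\<^esub>}")
  case False
  then obtain w where w: "w \<in> W" "w \<noteq> \<zero>\<^bsub>H\<^esub>" using zW by blast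
  have wc: "w \<in> \<H>" using w Wc by blast
  obtain y0 where wy: "w y0 \<noteq> 0" using w(2) by auto
  then have y0: "y0 \<in> X" using wc by auto
  define N :: "nat \<Rightarrow> nat ^ 'k" where "N j = (\<chi> i. j)" for j
  define P where "P j = \<pi> (g (y0 (0, N j))) (\<pi> (star A (g (y0 (0, N j)))) w)" for j
  have gM: "y0 (0, n) \<in> M" for n by (rule X_split(1)[OF y0])
  have PW: "P j \<in> W" for j unfolding P_def by (intro inv R.gen_closed R.A.star_closed gM w(1))
  have Peq: "P j = (\<lambda>y. if y \<in> starting (y0 (0, N j)) then w y else 0)" for j
   unfolding P_def by (rule range_projection[OF gM wc])
  let ?l = "w y0 \<odot>\<^bsub>H\<^esub> ket y0"
  have lc: "?l \<in> \<H>" by (rule E.smult_closed[OF _ ket_closed[OF y0]]) simp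
  have lim: "norm_tendsto H nrm P ?l"
   unfolding norm_tendsto_def
  proof (rule LIMSEQ_I)
   fix e :: real assume e: "0 < e"
   obtain Fs where Fs: "finite Fs" "Fs \<subseteq> X" "\<And>Y. Fs \<inter> Y = {} \<Longrightarrow> nrm (\<lambda>i. if i \<in> Y then w i else 0) \<le> e / 2"
    using ell2_small_tail[OF wc, of "e / 2"] e by auto
   have "\<exists>j. \<forall>j'\<ge>j. y \<noteq> y0 \<longrightarrow> y (0, N j') \<noteq> y0 (0, N j')" if y: "y \<in> X" for y
   proof (rule ccontr)
    assume no: "\<not> ?thesis"
    have "y = y0"
    proof (rule inf_path_eqI[OF X_path[OF y] X_path[OF y0]])
     fix n :: "nat ^ 'k"
     obtain j where j: "j \<ge> (\<Sum>i\<in>UNIV. n $ i)" "y (0, N j) = y0 (0, N j)" using no by blast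
     have "n \<le> N j" unfolding less_eq_vec_def N_def
      using j(1) member_le_sum[of _ UNIV "\<lambda>i. n $ i"] by (auto intro: order_trans)
     then show "\<exists>n'. n \<le> n' \<and> y (0, n') = y0 (0, n')" using j(2) by blast
    qed
    then show False using no by blast
   qed
   \<comment> \<open>Each of the finitely many paths that matter is eventually distinguished from \<open>y0\<close>.\<close>
   then obtain J where J: "\<And>y j. \<lbrakk>y \<in> X; j \<ge> J y; y \<noteq> y0\<rbrakk> \<Longrightarrow> y (0, N j) \<noteq> y0 (0, N j)" by metis
   define K where "K = Max (insert 0 (J ` Fs))"
   have K: "J y \<le> K" if "y \<in> Fs" for y using that Fs(1) by (auto simp: K_def)
   have "nrm (P j \<ominus>\<^bsub>H\<^esub> ?l) \<le> e / 2" if j: "j \<ge> K" for j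
   proof -
    let ?Y = "starting (y0 (0, N j)) - {y0}"
    have y0s: "y0 \<in> starting (y0 (0, N j))" using y0 X_split(2) by (simp add: starting_def)
    have "P j \<ominus>\<^bsub>H\<^esub> ?l = (\<lambda>i. P j i - ?l i)" by (rule ell2_minus[OF subsetD[OF Wc PW] lc])
    also have "\<dots> = (\<lambda>i. if i \<in> ?Y then w i else 0)" unfolding Peq by (rule) (use y0s in \<open>simp add: ket_def\<close>)
    finally have eq: "P j \<ominus>\<^bsub>H\<^esub> ?l = (\<lambda>i. if i \<in> ?Y then w i else 0)" .
    have "Fs \<inter> ?Y = {}"
    proof -
     have "y \<notin> ?Y" if y: "y \<in> Fs" for y
     proof
      assume a: "y \<in> ?Y"
      then have "y (0, N j) = y0 (0, N j)" using X_split(2)[OF y0, of "N j"] by (simp add: starting_def)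
      then show False using J a K[OF y] j Fs(2) y by auto
     qed
     then show ?thesis by blast
    qed
    then show ?thesis unfolding eq by (rule Fs(3))
   qed
   moreover have "0 \<le> nrm (P j \<ominus>\<^bsub>H\<^esub> ?l)" for j
    by (intro E.hnorm_nonneg E.M.minus_closed lc subsetD[OF Wc PW])
   moreover have "\<bar>t\<bar> < e" if "t \<le> e / 2" "0 \<le> t" for t :: real using that e by linarith
   ultimately have "\<bar>nrm (P j \<ominus>\<^bsub>H\<^esub> ?l)\<bar> < e" if "j \<ge> K" for j
    using that by blast
   then show "\<exists>no. \<forall>j\<ge>no. norm (nrm (P j \<ominus>\<^bsub>H\<^esub> ?l) - 0) < e"
    by auto
  qed
  have "?l \<in> W"
   by (rule mp[OF spec[OF spec[OF conjunct2[OF W(2)[unfolded norm_closed_def]]]] conjI[OF allI[OF PW] conjI[OF lc lim]]])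
  then have k0: "ket y0 \<in> W" by (rule scal[OF ket_closed[OF y0] _ wy])
  have "ket y \<in> W" if y: "y \<in> X" for y
  proof -
   obtain p q where pq: "shift p y0 = shift q y" by (rule tail_equivalent[OF y0 y])
   let ?a = "y0 (0, p)" and ?b = "y (0, q)"
   note a = X_split[OF y0, of p] and b = X_split[OF y, of q]
   let ?u = "shift p y0"
   have u: "?u \<in> X" by (rule X_shift[OF y0])
   have "y0 \<in> starting ?a" using y0 a(2) by (simp add: starting_def)
   then have 1: "\<pi> (star A (g ?a)) (ket y0) = cnj (zp p) \<odot>\<^bsub>H\<^esub> ket ?u" using star_gen_ket(1)[OF a(1) y0] a(2) by simp
   have 2: "\<pi> (g ?b) (ket ?u) = zp q \<odot>\<^bsub>H\<^esub> ket y" using gen_ket(1)[OF b(1) u] b(2,4,5) pq by simp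
   have "cnj (zp p) \<odot>\<^bsub>H\<^esub> ket ?u \<in> W" using inv[OF R.A.star_closed[OF R.gen_closed[OF a(1)]] k0] 1 by simp
   then have "ket ?u \<in> W" by (rule scal[OF ket_closed[OF u]]) (use zp(1)[of p] in auto)
   then have "\<pi> (g ?b) (ket ?u) \<in> W" by (rule inv[OF R.gen_closed[OF b(1)]])
   then have "zp q \<odot>\<^bsub>H\<^esub> ket y \<in> W" by (simp only: 2)
   then show ?thesis by (rule scal[OF ket_closed[OF y]]) (use zp(1)[of q] in auto)
  qed
  then have "W = \<H>" by (rule ell2_closed_subspace_kets[OF W])
  then show ?thesis ..
 qed simp
qed

text \<open>The support is \<open>T\<close> because the path is cofinal, and the character is \<open>\<gamma>\<close> because \<open>\<mu> y = \<nu> y\<close> for all paths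
\<open>y\<close> in the tail if \<open>\<mu> \<sim> \<nu>\<close>.\<close>

theorem tail_rep_path:
 assumes T: "T \<in> maximal_tails \<Lambda>" and xT: "x \<in> inf_paths (sub T)" and cof: "cofinal_in \<Lambda> T x"
  and \<gamma>: "\<gamma> \<in> characters (Per (sub T))"
  and ext: "\<And>p. p \<in> Per (sub T) \<Longrightarrow> (\<Prod>i\<in>UNIV. (z $ i) powi (p $ i)) = \<gamma> p"
 shows "tail_rep \<Lambda> H \<pi> T \<gamma>"
proof (intro tail_rep.intro tail_rep_axioms.intro R.kgraph_rep_axioms T \<gamma>)
 let ?\<Sigma> = "sub T"
 have XT: "y \<in> inf_paths ?\<Sigma>" if "y \<in> X" for y by (rule shift_tail_class_tail[OF T xT that])
 note tail = inf_paths_tail[OF T]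
 fix v assume v: "v \<in> V"
 note vM = vertsD(1)[OF v]
 show "v \<in> T \<longleftrightarrow> (\<exists>h\<in>\<H>. \<pi> (g v) h \<noteq> \<zero>\<^bsub>H\<^esub>)"
 proof
  assume "v \<in> T"
  then obtain n \<kappa> where k: "\<kappa> \<in> M" "r \<kappa> = v" "s \<kappa> = x (n, n)"
   using cof unfolding cofinal_in_def connected_to_def by blast
  have sx: "shift n x \<in> X" "shift n x (0, 0) = s \<kappa>" using X_shift[OF shift_tail_class(1)[OF x]] k(3) by (auto simp: shift_apply)
  let ?y = "pre \<kappa> (shift n x)"
  have y: "?y \<in> X" "?y (0, 0) = v" using X_append(1)[OF sx(1) k(1) sx(2)] prepend_rng[OF k(1) X_path[OF sx(1)] sx(2)] k(2) by auto
  have "\<pi> (g v) (ket ?y) = zp (d v) \<odot>\<^bsub>H\<^esub> ket (pre v ?y)" using gen_ket(1)[OF vM y(1)] y(2) vertsD(2)[OF v] by simp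
  then have "\<pi> (g v) (ket ?y) (pre v ?y) \<noteq> 0" using zp(1)[of "d v"] by (auto simp: ket_def)
  then have "\<pi> (g v) (ket ?y) \<noteq> \<zero>\<^bsub>H\<^esub>" by auto
  then show "\<exists>h\<in>\<H>. \<pi> (g v) h \<noteq> \<zero>\<^bsub>H\<^esub>" using ket_closed[OF y(1)] by blast
 next
  assume "\<exists>h\<in>\<H>. \<pi> (g v) h \<noteq> \<zero>\<^bsub>H\<^esub>"
  then obtain y where y: "y \<in> X" "\<pi> (g v) (ket y) \<noteq> \<zero>\<^bsub>H\<^esub>" using kill_kets[OF R.gen_closed[OF vM]] by blast
  then have "y (0, 0) = v" using gen_ket(2)[OF vM y(1)] vertsD(2)[OF v] by auto
  then show "v \<in> T" using XT[OF y(1)] tail by auto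
 qed
next
 let ?\<Sigma> = "sub T"
 interpret G: directed_kgraph ?\<Sigma> by (rule directed_kgraph_tail[OF T])
 fix \<mu> \<nu> h assume m: "\<mu> \<in> mor ?\<Sigma>" "\<nu> \<in> mor ?\<Sigma>" and eq: "path_equiv ?\<Sigma> \<mu> \<nu>" and h: "h \<in> \<H>"
 have mM: "\<mu> \<in> M" "\<nu> \<in> M" and sn: "s \<mu> = s \<nu>" using m eq by (auto simp: path_equiv_def)
 note gA = R.gen_closed[OF mM(1)] R.gen_closed[OF mM(2)]
 let ?p = "vdiff (d \<mu>) (d \<nu>)"
 have "?p \<in> Per ?\<Sigma>" unfolding Per_def vdiff_def using m eq by auto
 then have "\<gamma> ?p = (\<Prod>i\<in>UNIV. (z $ i) powi (?p $ i))" using ext by simp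
 also have "\<dots> = (\<Prod>i\<in>UNIV. (z $ i) ^ (d \<mu> $ i) / (z $ i) ^ (d \<nu> $ i))"
 proof (rule prod.cong[OF refl])
  fix i
  have "z $ i \<noteq> 0" using z[of i] by auto
  then show "(z $ i) powi (?p $ i) = (z $ i) ^ (d \<mu> $ i) / (z $ i) ^ (d \<nu> $ i)"
   by (simp add: vdiff_def power_int_diff)
 qed
 also have "\<dots> = zp (d \<mu>) / zp (d \<nu>)" by (simp add: zp_def prod_dividef)
 finally have gz: "zp (d \<mu>) = \<gamma> ?p * zp (d \<nu>)" using zp(1)[of "d \<nu>"] by auto
 let ?a = "g \<mu> \<oplus>\<^bsub>A\<^esub> (- \<gamma> ?p) \<odot>\<^bsub>A\<^esub> g \<nu>"
 have aA: "?a \<in> \<A>" using gA by simp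
 have ah: "\<pi> ?a w = \<pi> (g \<mu>) w \<oplus>\<^bsub>H\<^esub> (- \<gamma> ?p) \<odot>\<^bsub>H\<^esub> \<pi> (g \<nu>) w" if w: "w \<in> \<H>" for w
  using R.rep_add[OF gA(1) _ w, of "(- \<gamma> ?p) \<odot>\<^bsub>A\<^esub> g \<nu>"] R.rep_smult[OF gA(2) w] gA by simp
 have eq0: "\<pi> ?a h = \<zero>\<^bsub>H\<^esub>"
 proof (rule kill_kets[OF aA _ h])
  fix y assume y: "y \<in> X"
  show "\<pi> ?a (ket y) = \<zero>\<^bsub>H\<^esub>"
  proof (cases "y (0, 0) = s \<mu>")
   case True
   have yT: "y \<in> inf_paths ?\<Sigma>" by (rule shift_tail_class_tail[OF T xT y])
   have "prepend ?\<Sigma> \<mu> y = prepend ?\<Sigma> \<nu> y" using eq yT True by (simp add: path_equiv_def)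
   then have "pre \<mu> y = pre \<nu> y"
    using prepend_tail[OF T m(1) yT] prepend_tail[OF T m(2) yT] True sn by simp
   then show ?thesis
    unfolding ah[OF ket_closed[OF y]] using gen_ket(1)[OF mM(1) y True] gen_ket(1)[OF mM(2) y] True sn gz by simp
  next
   case False
   then show ?thesis
    unfolding ah[OF ket_closed[OF y]] using gen_ket(2)[OF mM(1) y False] gen_ket(2)[OF mM(2) y] sn by simp
  qed
 qed
 show "\<pi> (g \<mu>) h = \<gamma> ?p \<odot>\<^bsub>H\<^esub> \<pi> (g \<nu>) h"
 proof
  fix i show "\<pi> (g \<mu>) h i = (\<gamma> ?p \<odot>\<^bsub>H\<^esub> \<pi> (g \<nu>) h) i"
   using fun_cong[OF eq0[unfolded ah[OF h]], of i] by simp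
 qed
qed

end

section \<open>Extending characters\<close>

lemma unimodular_root:
 assumes "cmod c = 1" "m > 0"
 obtains \<zeta> where "cmod \<zeta> = 1" "\<zeta> ^ m = c"
proof -
 have c: "c = cis (Arg c)" using assms(1) rcis_cmod_Arg[of c] by (simp add: rcis_def)
 have "cis (Arg c / real m) ^ m = cis (real m * (Arg c / real m))" by (rule Complex.DeMoivre)
 also have "\<dots> = c" using assms(2) c by simp
 finally show thesis using that[of "cis (Arg c / real m)"] by simp
qed

definition torus_character :: "complex ^ 'k::finite \<Rightarrow> int ^ 'k \<Rightarrow> complex" where
 "torus_character z p = (\<Prod>i\<in>UNIV. (z $ i) powi (p $ i))"

lemma torus_character:
 assumes z: "\<And>i. cmod (z $ i) = 1"
 shows "torus_character z (p + q) = torus_character z p * torus_character z q"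
  "torus_character z (- p) * torus_character z p = 1" "cmod (torus_character z p) = 1"
proof -
 have nz: "z $ i \<noteq> 0" for i using z[of i] by auto
 show "torus_character z (p + q) = torus_character z p * torus_character z q"
  by (simp add: torus_character_def power_int_add nz prod.distrib)
 show "torus_character z (- p) * torus_character z p = 1"
  by (simp add: torus_character_def prod.distrib[symmetric] power_int_minus nz)
 show "cmod (torus_character z p) = 1"
  by (simp add: torus_character_def prod_norm[symmetric] norm_power_int z)
qed

text \<open>The circle is divisible: one coordinate at a time, choose a value that is correct on an element with the
least positive entry in that coordinate. All other elements are reduced to it by repeated
subtraction.\<close>

lemma character_extends:
 fixes P :: "(int ^ 'k::finite) set"
 assumes \<gamma>: "\<gamma> \<in> characters P" and P: "0 \<in> P" "\<And>p q. \<lbrakk>p \<in> P; q \<in> P\<rbrakk> \<Longrightarrow> p + q \<in> P" "\<And>p. p \<in> P \<Longrightarrow> - p \<in> P"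
 obtains z where "\<And>i. cmod (z $ i) = 1" "\<And>p. p \<in> P \<Longrightarrow> torus_character z p = \<gamma> p"
proof -
 have uni: "cmod (\<gamma> p) = 1" if "p \<in> P" for p using \<gamma> that by (auto simp: characters_def)
 have hom: "\<gamma> (p + q) = \<gamma> p * \<gamma> q" if "p \<in> P" "q \<in> P" for p q using \<gamma> that by (simp add: characters_def)
 have \<gamma>0: "\<gamma> 0 = 1"
  using hom P uni by fastforce
 have neg: "\<gamma> (- p) * \<gamma> p = 1" if "p \<in> P" for p using hom[OF P(3)[OF that] that] \<gamma>0 by simp
 have "\<exists>z. (\<forall>i. cmod (z $ i) = 1) \<and> (\<forall>p\<in>P. (\<forall>i. i \<notin> I \<longrightarrow> p $ i = 0) \<longrightarrow> torus_character z p = \<gamma> p)" for I :: "'k set"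
  using finite[of I]
 proof (induction I rule: finite_induct)
  case empty
  have "torus_character 1 p = \<gamma> p" if "\<forall>i. i \<notin> {} \<longrightarrow> p $ i = 0" for p :: "int ^ 'k"
  proof -
   have "p = 0" using that by (simp add: vec_eq_iff)
   then show ?thesis using \<gamma>0 by (simp add: torus_character_def)
  qed
  then show ?case by (intro exI[of _ 1]) simp
 next
  case (insert j I)
  obtain z where z: "\<And>i. cmod (z $ i) = 1" "\<And>p. \<lbrakk>p \<in> P; \<And>i. i \<notin> I \<Longrightarrow> p $ i = 0\<rbrakk> \<Longrightarrow> torus_character z p = \<gamma> p"
   using insert.IH by blast
  \<comment> \<open>The positive entries at \<open>j\<close> of the elements of \<open>P\<close> that are supported on \<open>insert j I\<close>.\<close>
  define D where "D n \<longleftrightarrow> n > 0 \<and> (\<exists>p\<in>P. (\<forall>i. i \<notin> insert j I \<longrightarrow> p $ i = 0) \<and> p $ j = int n)" for n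
  text \<open>It is enough to treat elements whose coordinate at \<open>j\<close> is nonnegative.\<close>
  have signs: "torus_character y p = \<gamma> p"
   if y: "\<And>i. cmod (y $ i) = 1"
    and pos: "\<And>n p. \<lbrakk>p \<in> P; \<And>i. i \<notin> insert j I \<Longrightarrow> p $ i = 0; p $ j = int n\<rbrakk> \<Longrightarrow> torus_character y p = \<gamma> p"
    and p: "p \<in> P" "\<And>i. i \<notin> insert j I \<Longrightarrow> p $ i = 0" for y p
  proof (cases "p $ j \<ge> 0")
   case True
   then show ?thesis using pos[OF p, of "nat (p $ j)"] by simp
  next
   case False
   have "torus_character y (- p) = \<gamma> (- p)" using pos[OF P(3)[OF p(1)], of "nat (- p $ j)"] p(2) False by simp
   then have "\<gamma> (- p) * torus_character y p = \<gamma> (- p) * \<gamma> p"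
    using torus_character(2)[OF y, of p] neg[OF p(1)] by simp
   moreover have "\<gamma> (- p) \<noteq> 0" using uni[OF P(3)[OF p(1)]] by auto
   ultimately show ?thesis by simp
  qed
  show ?case
  proof (cases "\<exists>n. D n")
   case False
   have "torus_character z p = \<gamma> p" if p: "p \<in> P" "\<And>i. i \<notin> insert j I \<Longrightarrow> p $ i = 0" for p
   proof (rule signs[OF z(1) _ p])
    fix n q assume q: "q \<in> P" "\<And>i. i \<notin> insert j I \<Longrightarrow> q $ i = 0" "q $ j = int n"
    have "\<not> n > 0"
     by (metis D_def q False)
    then have "n = 0" by simp
    with q(2,3) have "q $ i = 0" if "i \<notin> I" for i using that by (cases "i = j") auto
    then show "torus_character z q = \<gamma> q" by (rule z(2)[OF q(1)])
   qed
   then show ?thesis using z(1) by blast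
  next
   case True
   define m where "m = (LEAST n. D n)"
   have Dm: "D m" unfolding m_def using True by (rule LeastI_ex)
   have least: "m \<le> n" if "D n" for n unfolding m_def using that by (rule Least_le)
   obtain p0 where p0: "p0 \<in> P" "\<And>i. i \<notin> insert j I \<Longrightarrow> p0 $ i = 0" "p0 $ j = int m" and m: "m > 0"
    using Dm by (auto simp: D_def)
   \<comment> \<open>The value that the new coordinate has to supply at \<open>p0\<close>.\<close>
   define c where "c = \<gamma> p0 * torus_character z (- (\<chi> i. if i = j then 0 else p0 $ i))"
   have "cmod c = 1" using uni[OF p0(1)] torus_character(3)[OF z(1)] by (simp add: c_def norm_mult)
   then obtain \<zeta> where zeta: "cmod \<zeta> = 1" "\<zeta> ^ m = c" using unimodular_root m by blast
   define y where "y = (\<chi> i. if i = j then \<zeta> else z $ i)"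
   have y: "cmod (y $ i) = 1" for i using z(1) zeta(1) by (simp add: y_def)
   have ysplit: "torus_character y p = \<zeta> powi (p $ j) * torus_character z (\<chi> i. if i = j then 0 else p $ i)" for p
   proof -
    have "torus_character y p = (y $ j) powi (p $ j) * (\<Prod>i\<in>UNIV - {j}. (y $ i) powi (p $ i))"
     unfolding torus_character_def by (rule prod.remove) auto
    moreover have "torus_character z (\<chi> i. if i = j then 0 else p $ i)
      = (z $ j) powi 0 * (\<Prod>i\<in>UNIV - {j}. (z $ i) powi ((\<chi> i. if i = j then 0 else p $ i) $ i))"
     unfolding torus_character_def by (subst prod.remove) auto
    moreover have "(\<Prod>i\<in>UNIV - {j}. (y $ i) powi (p $ i)) = (\<Prod>i\<in>UNIV - {j}. (z $ i) powi ((\<chi> i. if i = j then 0 else p $ i) $ i))"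
     by (rule) (auto simp: y_def)
    ultimately show ?thesis by (simp add: y_def)
   qed
   have y0: "torus_character y p0 = \<gamma> p0"
    using ysplit p0(3) zeta(2) torus_character(2)[OF z(1), of "\<chi> i. if i = j then 0 else p0 $ i"] by (simp add: c_def)
   have pos: "torus_character y q = \<gamma> q" if "q \<in> P" "\<And>i. i \<notin> insert j I \<Longrightarrow> q $ i = 0" "q $ j = int n" for n q
    using that
   proof (induction n arbitrary: q rule: less_induct)
    case (less n)
    show ?case
    proof (cases "n = 0")
     case True
     have "q $ i = 0" if "i \<notin> I" for i using less.prems(2) less.prems(3) True that by (cases "i = j") auto
     then have "torus_character z q = \<gamma> q" by (rule z(2)[OF less.prems(1)])
     moreover have "(\<chi> i. if i = j then 0 else q $ i) = q" using less.prems(3) True by (simp add: vec_eq_iff)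
     ultimately show ?thesis using ysplit less.prems(3) True by simp
    next
     case False
     have "m \<le> n" using least less.prems False by (auto simp: D_def)
     let ?q = "q + - p0"
     have q: "?q \<in> P" "\<And>i. i \<notin> insert j I \<Longrightarrow> ?q $ i = 0" "?q $ j = int (n - m)"
      using P(2)[OF less.prems(1) P(3)[OF p0(1)]] less.prems(2,3) p0(2,3) \<open>m \<le> n\<close> by simp_all
     have "torus_character y ?q = \<gamma> ?q" by (rule less.IH[OF _ q]) (use m False in simp)
     moreover have "q = ?q + p0" by simp
     ultimately show ?thesis using torus_character(1)[OF y, of ?q p0] hom[OF q(1) p0(1)] y0 by metis
    qed
   qed
   have "torus_character y p = \<gamma> p" if p: "p \<in> P" "\<And>i. i \<notin> insert j I \<Longrightarrow> p $ i = 0" for p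
    by (rule signs[OF y pos p])
   then show ?thesis using y by blast
  qed
 qed
 from this[of UNIV] show thesis using that by auto
qed

section \<open>The primitive ideals\<close>

context rf_kgraph
begin

lemma path_rep_of_tail:
 assumes T: "T \<in> maximal_tails \<Lambda>" and \<gamma>: "\<gamma> \<in> characters (Per (sub T))"
 obtains x z \<pi> where "x \<in> inf_paths (sub T)" "cofinal_in \<Lambda> T x" "\<forall>i. cmod (z $ i) = 1"
  "\<forall>p\<in>Per (sub T). (\<Prod>i\<in>UNIV. (z $ i) powi (p $ i)) = \<gamma> p"
  "is_path_rep \<Lambda> (orbit x) z \<pi>"
proof -
 let ?\<Sigma> = "sub T"
 interpret G: directed_kgraph ?\<Sigma> by (rule directed_kgraph_tail[OF T])
 obtain x where xx: "x \<in> inf_paths ?\<Sigma>" "\<And>v. v \<in> verts ?\<Sigma> \<Longrightarrow> \<exists>n. connected_to ?\<Sigma> v (x (n, n))"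
  using G.cofinal_path_exists by blast
 have x\<Lambda>: "x \<in> ipaths" "\<And>n. x (n, n) \<in> T" using xx(1) inf_paths_tail[OF T] by auto
 have cof: "cofinal_in \<Lambda> T x"
  unfolding cofinal_in_def using xx(2) verts_tail[OF T] connected_to_tail[OF T x\<Lambda>(2)] by auto
 obtain z where zz: "\<And>i. cmod (z $ i) = 1" "\<And>p. p \<in> Per ?\<Sigma> \<Longrightarrow> torus_character z p = \<gamma> p"
  using character_extends[OF \<gamma>, unfolded G.Per_eq_perset, OF G.perset_0 G.perset_add G.perset_uminus]
  unfolding G.Per_eq_perset by blast
 interpret path_space \<Lambda> x z by unfold_locales (rule x\<Lambda>(1), rule zz(1))
 obtain \<pi> where "is_path_rep \<Lambda> (orbit x) z \<pi>" using path_rep_exists by blast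
 then show thesis using that[OF xx(1) cof] zz unfolding torus_character_def by blast
qed

lemma path_rep_properties:
 assumes T: "T \<in> maximal_tails \<Lambda>" and \<gamma>: "\<gamma> \<in> characters (Per (sub T))"
  and xx: "x \<in> inf_paths (sub T)" "cofinal_in \<Lambda> T x" and zz: "\<forall>i. cmod (z $ i) = 1"
  "\<forall>p\<in>Per (sub T). (\<Prod>i\<in>UNIV. (z $ i) powi (p $ i)) = \<gamma> p"
  and \<pi>: "is_path_rep \<Lambda> (orbit x) z \<pi>"
 shows "tail_rep \<Lambda> (ell2 (orbit x)) \<pi> T \<gamma>" "irreducible_rep (kgraph_cstar \<Lambda>) (ell2 (orbit x)) \<pi>"
proof -
 interpret path_rep \<Lambda> x z \<pi>
  by unfold_locales (use xx(1) inf_paths_tail[OF T] zz(1) \<pi> in auto)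
 show "tail_rep \<Lambda> (ell2 (orbit x)) \<pi> T \<gamma>"
  by (rule tail_rep_path[OF T xx \<gamma>]) (use zz(2) in blast)
 show "irreducible_rep (kgraph_cstar \<Lambda>) (ell2 (orbit x)) \<pi>"
  by (rule irreducible_path_rep)
qed

lemma tail_rep_kernel_eq:
 assumes "tail_rep \<Lambda> H1 \<pi>1 T \<gamma>" "irreducible_rep (kgraph_cstar \<Lambda>) H1 \<pi>1"
  and "tail_rep \<Lambda> H2 \<pi>2 T \<gamma>" "irreducible_rep (kgraph_cstar \<Lambda>) H2 \<pi>2"
 shows "rep_kernel (kgraph_cstar \<Lambda>) H1 \<pi>1 = rep_kernel (kgraph_cstar \<Lambda>) H2 \<pi>2"
 using tail_rep_kernel_le[OF assms(1,2,3)] tail_rep_kernel_le[OF assms(3,4,1)] by blast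

text \<open>Every choice of a cofinal path and of an extension of the character gives a representation with the data
\<open>(T, \<gamma>)\<close>, so all choices have the same kernel.\<close>

lemma tail_ideal_eq:
 assumes R: "tail_rep \<Lambda> H \<pi> T \<gamma>" and irr: "irreducible_rep (kgraph_cstar \<Lambda>) H \<pi>"
 shows "tail_ideal \<Lambda> T \<gamma> = rep_kernel (kgraph_cstar \<Lambda>) H \<pi>"
 unfolding tail_ideal_def
proof (rule the_equality)
 interpret R: tail_rep \<Lambda> H \<pi> T \<gamma> by (rule R)
 obtain x z \<rho> where p: "x \<in> inf_paths (sub T)" "cofinal_in \<Lambda> T x" "\<forall>i. cmod (z $ i) = 1"
  "\<forall>p\<in>Per (sub T). (\<Prod>i\<in>UNIV. (z $ i) powi (p $ i)) = \<gamma> p"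
  "is_path_rep \<Lambda> (orbit x) z \<rho>"
  by (rule path_rep_of_tail[OF R.tail R.character])
 note q = path_rep_properties[OF R.tail R.character p]
 show "\<exists>x z \<rho>. x \<in> inf_paths (sub T) \<and> cofinal_in \<Lambda> T x \<and> (\<forall>i. cmod (z $ i) = 1) \<and>
   (\<forall>g\<in>Per (sub T). (\<Prod>i\<in>UNIV. (z $ i) powi (g $ i)) = \<gamma> g) \<and>
   is_path_rep \<Lambda> (orbit x) z \<rho> \<and>
   rep_kernel (kgraph_cstar \<Lambda>) H \<pi> = rep_kernel (kgraph_cstar \<Lambda>) (ell2 (orbit x)) \<rho>"
  using p tail_rep_kernel_eq[OF R irr q] by blast
next
 interpret R: tail_rep \<Lambda> H \<pi> T \<gamma> by (rule R)
 fix J assume "\<exists>x z \<rho>. x \<in> inf_paths (sub T) \<and> cofinal_in \<Lambda> T x \<and> (\<forall>i. cmod (z $ i) = 1) \<and>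
   (\<forall>g\<in>Per (sub T). (\<Prod>i\<in>UNIV. (z $ i) powi (g $ i)) = \<gamma> g) \<and>
   is_path_rep \<Lambda> (orbit x) z \<rho> \<and>
   J = rep_kernel (kgraph_cstar \<Lambda>) (ell2 (orbit x)) \<rho>"
 then obtain x z \<rho> where p: "x \<in> inf_paths (sub T)" "cofinal_in \<Lambda> T x" "\<forall>i. cmod (z $ i) = 1"
  "\<forall>p\<in>Per (sub T). (\<Prod>i\<in>UNIV. (z $ i) powi (p $ i)) = \<gamma> p"
  "is_path_rep \<Lambda> (orbit x) z \<rho>" and J: "J = rep_kernel (kgraph_cstar \<Lambda>) (ell2 (orbit x)) \<rho>"
  by blast
 note q = path_rep_properties[OF R.tail R.character p]
 show "J = rep_kernel (kgraph_cstar \<Lambda>) H \<pi>" unfolding J by (rule tail_rep_kernel_eq[OF q R irr])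
qed

text \<open>The kernel contains \<open>s\<^sub>v\<close> if and only if \<open>v\<close> lies outside the tail, and \<open>s\<^sub>\<mu> - c s\<^sub>\<nu>\<close> for \<open>\<mu> \<sim> \<nu>\<close> if and only if
\<open>c\<close> is the value of the character.\<close>

lemma tail_rep_determined:
 assumes R1: "tail_rep \<Lambda> H1 \<pi>1 T1 \<gamma>1" and R2: "tail_rep \<Lambda> H2 \<pi>2 T2 \<gamma>2"
  and eq: "rep_kernel (kgraph_cstar \<Lambda>) H1 \<pi>1 = rep_kernel (kgraph_cstar \<Lambda>) H2 \<pi>2"
 shows "T1 = T2" "\<gamma>1 = \<gamma>2"
proof -
 interpret R1: tail_rep \<Lambda> H1 \<pi>1 T1 \<gamma>1 by (rule R1)
 interpret R2: tail_rep \<Lambda> H2 \<pi>2 T2 \<gamma>2 by (rule R2)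
 let ?A = "kgraph_cstar \<Lambda>" and ?g = "kgraph_gen \<Lambda>"
 have "v \<in> T1 \<longleftrightarrow> v \<in> T2" if v: "v \<in> V" for v
 proof -
  have "v \<in> T1 \<longleftrightarrow> ?g v \<notin> rep_kernel ?A H1 \<pi>1"
   using R1.support[OF v] R1.gen_closed[OF vertsD(1)[OF v]] by (auto simp: rep_kernel_def)
  moreover have "v \<in> T2 \<longleftrightarrow> ?g v \<notin> rep_kernel ?A H2 \<pi>2"
   using R2.support[OF v] R2.gen_closed[OF vertsD(1)[OF v]] by (auto simp: rep_kernel_def)
  ultimately show ?thesis using eq by simp
 qed
 then show T: "T1 = T2" using tail_props(2)[OF R1.tail] tail_props(2)[OF R2.tail] by blast
 let ?\<Sigma> = "sub T1"
 show "\<gamma>1 = \<gamma>2"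
 proof
  fix p
  show "\<gamma>1 p = \<gamma>2 p"
  proof (cases "p \<in> Per ?\<Sigma>")
   case False
   have "\<gamma> p = undefined" if "\<gamma> \<in> characters (Per ?\<Sigma>)" for \<gamma> using that False by (auto simp: characters_def)
   from this[OF R1.character] this[OF R2.character[folded T]] show ?thesis by simp
  next
   case True
   then obtain \<mu> \<nu> where m: "\<mu> \<in> mor ?\<Sigma>" "\<nu> \<in> mor ?\<Sigma>" "path_equiv ?\<Sigma> \<mu> \<nu>" "p = vdiff (d \<mu>) (d \<nu>)"
    unfolding Per_def vdiff_def by auto
   have mM: "\<mu> \<in> M" "\<nu> \<in> M" "s \<nu> \<in> T2" using m T by auto
   note gA = R1.gen_closed[OF mM(1)] R1.gen_closed[OF mM(2)]
   let ?a = "?g \<mu> \<ominus>\<^bsub>?A\<^esub> \<gamma>1 p \<odot>\<^bsub>?A\<^esub> ?g \<nu>"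
   have cA: "\<gamma>1 p \<odot>\<^bsub>?A\<^esub> ?g \<nu> \<in> carrier ?A" using gA by simp
   have aA: "?a \<in> carrier ?A" using gA by simp
   have split: "?g \<mu> = ?a \<oplus>\<^bsub>?A\<^esub> \<gamma>1 p \<odot>\<^bsub>?A\<^esub> ?g \<nu>" using gA by (simp add: R1.A.M.minus_eq R1.A.M.a_assoc R1.A.M.l_neg)
   have "\<pi>1 ?a h = \<zero>\<^bsub>H1\<^esub>" if h: "h \<in> carrier H1" for h
    by (smt (verit) R1.rep_closed aA h gA R1.twist m R1.rep_add cA R1.rep_smult split R1.M.l_zero R1.M.add.right_cancel R1.M.zero_closed)
   then have "?a \<in> rep_kernel ?A H1 \<pi>1" using aA by (simp add: rep_kernel_def)
   then have "?a \<in> rep_kernel ?A H2 \<pi>2" unfolding eq .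
   then have a2: "\<pi>2 ?a h = \<zero>\<^bsub>H2\<^esub>" if "h \<in> carrier H2" for h using that by (simp add: rep_kernel_def)
   have tw: "\<gamma>1 p \<odot>\<^bsub>H2\<^esub> \<pi>2 (?g \<nu>) h = \<gamma>2 p \<odot>\<^bsub>H2\<^esub> \<pi>2 (?g \<nu>) h" if h: "h \<in> carrier H2" for h
   proof -
    have c: "\<pi>2 (?g \<nu>) h \<in> carrier H2" by (rule R2.rep_closed[OF gA(2) h])
    have "\<pi>2 (?g \<mu>) h = \<pi>2 ?a h \<oplus>\<^bsub>H2\<^esub> \<pi>2 (\<gamma>1 p \<odot>\<^bsub>?A\<^esub> ?g \<nu>) h"
     by (subst split) (rule R2.rep_add[OF aA cA h])
    also have "\<dots> = \<gamma>1 p \<odot>\<^bsub>H2\<^esub> \<pi>2 (?g \<nu>) h" using a2[OF h] R2.rep_smult[OF gA(2) h, of "\<gamma>1 p"] c by simp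
    finally show ?thesis using R2.twist[OF m(1-3)[unfolded T] h] m(4) by simp
   qed
   obtain h where h: "h \<in> carrier H2" "\<pi>2 (?g (s \<nu>)) h \<noteq> \<zero>\<^bsub>H2\<^esub>" using R2.support[OF src_verts[OF mM(2)]] mM(3) by blast
   let ?k = "\<pi>2 (?g \<nu>) h"
   have k: "?k \<in> carrier H2" "\<pi>2 (?g (s \<nu>)) h \<in> carrier H2"
    using R2.rep_closed[OF gA(2) h(1)] R2.rep_closed[OF R2.gen_closed[OF src_closed[OF mM(2)]] h(1)] by auto
   have kz: "?k \<noteq> \<zero>\<^bsub>H2\<^esub>"
    using R2.S_norm[OF mM(2) h(1)] R2.hnorm_eq_0[OF k(2)] h(2) by auto
   have "\<gamma>1 p * hinner H2 ?k ?k = \<gamma>2 p * hinner H2 ?k ?k"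
    using arg_cong[OF tw[OF h(1)], of "\<lambda>v. hinner H2 v ?k"] R2.hinner_smult_left[OF k(1) k(1)] by simp
   then show ?thesis using R2.hinner_eq_0[OF k(1)] kz by auto
  qed
 qed
qed

end

theorem corollary5p4:
 fixes \<Lambda> :: "('e, 'k::finite) kgraph"
 assumes "kgraph \<Lambda>"
  and "row_finite_no_sources \<Lambda>"
 shows "bij_betw (\<lambda>(T, \<gamma>). tail_ideal \<Lambda> T \<gamma>)
      (SIGMA T : maximal_tails \<Lambda>. characters (Per (tail_subgraph \<Lambda> T)))
      (primitive_ideals (kgraph_cstar \<Lambda>))"
proof -
 interpret rf_kgraph \<Lambda> by (intro rf_kgraph.intro rf_kgraph_axioms.intro assms)
 interpret A: cstar_algebra "kgraph_cstar \<Lambda>" by (rule cstar_algebra_kgraph)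
 let ?A = "kgraph_cstar \<Lambda>"
 have pts: "\<exists>(H :: (('e, 'k) inf_path \<Rightarrow> complex) hilbert) \<pi>. tail_rep \<Lambda> H \<pi> T \<gamma> \<and> irreducible_rep ?A H \<pi>"
  if T: "T \<in> maximal_tails \<Lambda>" and \<gamma>: "\<gamma> \<in> characters (Per (tail_subgraph \<Lambda> T))" for T \<gamma>
  by (smt (verit) path_rep_of_tail T \<gamma> path_rep_properties)
 show ?thesis
 proof (rule bij_betwI')
  fix a b assume a: "a \<in> (SIGMA T : maximal_tails \<Lambda>. characters (Per (tail_subgraph \<Lambda> T)))"
   and b: "b \<in> (SIGMA T : maximal_tails \<Lambda>. characters (Per (tail_subgraph \<Lambda> T)))"
  obtain T \<gamma> T' \<gamma>' where ab: "a = (T, \<gamma>)" "b = (T', \<gamma>')" by (cases a, cases b)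
  have "T \<in> maximal_tails \<Lambda>" "\<gamma> \<in> characters (Per (tail_subgraph \<Lambda> T))" using a ab by auto
  from pts[OF this] obtain H :: "(('e, 'k) inf_path \<Rightarrow> complex) hilbert" and \<pi>
   where R: "tail_rep \<Lambda> H \<pi> T \<gamma>" "irreducible_rep ?A H \<pi>" by blast
  have "T' \<in> maximal_tails \<Lambda>" "\<gamma>' \<in> characters (Per (tail_subgraph \<Lambda> T'))" using b ab by auto
  from pts[OF this] obtain H' :: "(('e, 'k) inf_path \<Rightarrow> complex) hilbert" and \<pi>'
   where R': "tail_rep \<Lambda> H' \<pi>' T' \<gamma>'" "irreducible_rep ?A H' \<pi>'" by blast
  show "(case a of (T, \<gamma>) \<Rightarrow> tail_ideal \<Lambda> T \<gamma>) = (case b of (T, \<gamma>) \<Rightarrow> tail_ideal \<Lambda> T \<gamma>) \<longleftrightarrow> a = b"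
   unfolding ab using tail_rep_determined[OF R(1) R'(1)] tail_ideal_eq[OF R] tail_ideal_eq[OF R'] by auto
 next
  fix a assume a: "a \<in> (SIGMA T : maximal_tails \<Lambda>. characters (Per (tail_subgraph \<Lambda> T)))"
  obtain T \<gamma> where ab: "a = (T, \<gamma>)" by (cases a)
  have "T \<in> maximal_tails \<Lambda>" "\<gamma> \<in> characters (Per (tail_subgraph \<Lambda> T))" using a ab by auto
  from pts[OF this] obtain H :: "(('e, 'k) inf_path \<Rightarrow> complex) hilbert" and \<pi>
   where R: "tail_rep \<Lambda> H \<pi> T \<gamma>" "irreducible_rep ?A H \<pi>" by blast
  interpret R: tail_rep \<Lambda> H \<pi> T \<gamma> by (rule R)
  show "(case a of (T, \<gamma>) \<Rightarrow> tail_ideal \<Lambda> T \<gamma>) \<in> primitive_ideals ?A"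
   unfolding ab prod.case tail_ideal_eq[OF R]
   by (rule rep_kernel_primitive[OF A.star_algebra_axioms R.hilbert_space_axioms R(2)])
 next
  fix J assume "J \<in> primitive_ideals ?A"
  then obtain H :: "((nat \<Rightarrow> 'e star_word \<Rightarrow>\<^sub>0 complex) set \<Rightarrow> complex) hilbert" and \<pi>
   where H: "hilbert_space H" "irreducible_rep ?A H \<pi>" and J: "J = rep_kernel ?A H \<pi>"
   unfolding primitive_ideals_def by blast
  have rep: "hilbert_rep ?A H \<pi>" using H(2) by (simp add: irreducible_rep_def)
  interpret H: irreducible_kgraph_rep \<Lambda> H \<pi>
   by (intro irreducible_kgraph_rep.intro kgraph_rep.intro kgraph_rep_axioms.intro irreducible_kgraph_rep_axioms.intro
     rf_kgraph_axioms H rep)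
  obtain T \<gamma> where R: "tail_rep \<Lambda> H \<pi> T \<gamma>" using H.tail_rep_exists by blast
  interpret R: tail_rep \<Lambda> H \<pi> T \<gamma> by (rule R)
  show "\<exists>a\<in>(SIGMA T : maximal_tails \<Lambda>. characters (Per (tail_subgraph \<Lambda> T))). J = (case a of (T, \<gamma>) \<Rightarrow> tail_ideal \<Lambda> T \<gamma>)"
   using R.tail R.character J tail_ideal_eq[OF R H(2)] by (intro bexI) auto
 qed
qed

end
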